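(* Let $X$ be a reflexive Banach space such that both $X$ and $X^*$ have finite cotype. Let $T:X\to X$ be an $\mathcal R$-Ritt$_E$ operator of $\mathcal R$-type $r\in(0,1)$ and assume that $T^*$ is $\mathcal R$-Ritt$_E$ as well. If $\alpha,\beta>0$ are such that, for some constant $C>0$, $\|x\|_{T,\alpha}\le C\|x\|$ and $\|y\|_{T^*,\beta}\le C\|y\|$ for all $(x,y)\in X\times X^*$, then for any $s\in(r,1)$, $T$ admits a bounded $H^\infty(E_s)$ functional calculus.
   Context: $X$ is a complex Banach space, $X^*$ its dual, $T^*\in B(X^* )$ the Banach space adjoint (transpose) of $T$, $R(z,T)=(z-T)^{-1}$, $\mathbb D$ the open unit disc, $\mathbb T$ the unit circle, $D(0,2)$ the open disc of radius 2. $E=\{\xi_1,\dots,\xi_N\}\subset\mathbb T$ is a fixed finite set of $N\ge1$ distinct points. $(\varepsilon_k)_{k\ge1}$ are independent Rademacher variables on a probability space $(\Omega,\mathbb P)$ and $\|\sum_k\varepsilon_k\otimes x_k\|_{\mathrm{Rad}(X)}=\big(\int_\Omega\|\sum_k\varepsilon_k(u)x_k\|_X^2\,d\mathbb P(u)\big)^{1/2}$. A set $F\subset B(X)$ is $\mathcal R$-bounded if there is $C>0$ with $\|\sum_{k}\varepsilon_k\otimes T_kx_k\|_{\mathrm{Rad}(X)}\le C\|\sum_{k}\varepsilon_k\otimes x_k\|_{\mathrm{Rad}(X)}$ for all finite sequences $(T_k)$ in $F$, $(x_k)$ in $X$. $T\in B(X)$ is a Ritt$_E$ (resp. $\mathcal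 R$-Ritt$_E$) operator if $\sigma(T)\subset\overline{\mathbb D}$, $\sigma(T)\cap\mathbb T\subset E$ and for every $C>1$ the set $\{\prod_{j=1}^N(1-\overline{\xi_j}z)R(z,T):1<|z|<C\}$ is bounded (resp. $\mathcal R$-bounded). For such $T$ each $I-\overline{\xi_j}T$ is a bounded sectorial operator, and $(I-\overline{\xi_j}T)^\alpha$ ($\alpha>0$) is the usual fractional power, a bounded operator. For $r\in(0,1)$, $E_r$ is the interior of the convex hull of $E\cup r\mathbb D$; $r$ is $E$-large enough if every segment $[\xi_i,\xi_j]$, $i\neq j$, meets $r\mathbb D$. $T$ is of type $r$ (resp. $\mathcal R$-type $r$) if $r$ is $E$-large enough, $\sigma(T)\subset\overline{E_r}$, and for every $s\in(r,1)$ the set $\{R(z,T)\prod_{j=1}^N(\xi_j-z): z\in D(0,2)\setminus\overline{E_s}\}$ is bounded (resp. $\mathcal R$-bounded). $H_0^\infty(E_s)$ is the space of bounded holomorphic $\phi:E_s\to\mathbb C$ such that $|\phi(z)|\le C_1\prod_{j=1}^N|\xi_j-z|^{s_j}$ on $E_s$ for some $C_1,s_1,\dots,s_N>0$; $\|\cdot\|_{\infty,E_s}$ is the sup norm on $E_s$. If $T$ is of type $r<s$ and $\phi\in H_0^\infty(E_s)$, then $\phi(T)=\frac1{2\pi i}\int_{\partial E_u}\phi(z)R(z,T)\,dz$ for any $u\in(r,s)$. $T$ (of type $r<s$) admits a bounded $H^\infty(E_s)$ functional calculus if there is $K\ge1$ with $\|\phi(T)\|\le K\|\phi\|_{\infty,E_s}$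 for all $\phi\in H_0^\infty(E_s)$. For a Ritt$_E$ operator $S$ on a Banach space $Y$, $\alpha>0$ and $y\in Y$, $$\|y\|_{S,\alpha}=\lim_{n\to\infty}\Big\|\sum_{k=1}^nk^{\alpha-1/2}\varepsilon_k\otimes S^{k-1}\prod_{j=1}^N(I-\overline{\xi_j}S)^\alpha y\Big\|_{\mathrm{Rad}(Y)}\in[0,\infty]$$ (nondecreasing limit). *)

theory Defs
  imports "HOL-Probability.Probability"
begin

section \<open>Complex Banach spaces\<close>

class scaleC = scaleR +
  fixes scaleC :: "complex \<Rightarrow> 'a \<Rightarrow> 'a"  (infixr \<open>*\<^sub>C\<close> 75)

class complex_normed_vector = real_normed_vector + scaleC +
  assumes scaleC_add_right: "c *\<^sub>C (x + y) = c *\<^sub>C x + c *\<^sub>C y"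
    and scaleC_add_left: "(c + d) *\<^sub>C x = c *\<^sub>C x + d *\<^sub>C x"
    and scaleC_scaleC: "c *\<^sub>C (d *\<^sub>C x) = (c * d) *\<^sub>C x"
    and scaleR_scaleC: "r *\<^sub>R x = complex_of_real r *\<^sub>C x"
    and norm_scaleC: "norm (c *\<^sub>C x) = norm c * norm x"

class complex_banach = complex_normed_vector + banach

instantiation complex :: complex_banach
begin
definition "c *\<^sub>C (z::complex) = c * z"
instance
  by standard (simp_all add: scaleC_complex_def algebra_simps norm_mult scaleR_conv_of_real)
end

lemma scaleC_scaleR_commute:
  "c *\<^sub>C (r *\<^sub>R x) = r *\<^sub>R (c *\<^sub>C (x::'a::complex_normed_vector))"
  by (simp add: scaleR_scaleC scaleC_scaleC mult.commute)

lemma bounded_linear_scaleC: "bounded_linear (\<lambda>x::'a::complex_normed_vector. c *\<^sub>C x)"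
  by (rule bounded_linear_intro[where K = "norm c"])
    (simp_all add: scaleC_add_right scaleC_scaleR_commute norm_scaleC mult.commute)

lemma scaleC_zero_right: "c *\<^sub>C (0::'a::complex_normed_vector) = 0"
  by (metis add_cancel_right_right scaleC_add_right add.right_neutral)

lemma scaleC_minus_right: "c *\<^sub>C (- x) = - (c *\<^sub>C (x::'a::complex_normed_vector))"
  by (metis add.right_inverse add_eq_0_iff scaleC_add_right scaleC_zero_right)

lemma scaleC_diff_right:
  "c *\<^sub>C (x - y) = c *\<^sub>C x - c *\<^sub>C (y::'a::complex_normed_vector)"
  by (simp only: diff_conv_add_uminus scaleC_add_right scaleC_minus_right)


section \<open>Bounded complex-linear operators and the dual space\<close>

typedef (overloaded) ('a, 'b) cblinfun
  = "{f :: 'a::complex_normed_vector \<Rightarrow>\<^sub>L 'b::complex_normed_vector. \<forall>c x. f (c *\<^sub>C x) = c *\<^sub>C f x}"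
  by (rule exI[of _ 0]) (simp add: scaleC_zero_right)

type_notation cblinfun (\<open>(_ \<Rightarrow>\<^sub>C\<^sub>L /_)\<close> [22, 21] 21)

setup_lifting type_definition_cblinfun

lift_definition cblinfun_apply :: "('a::complex_normed_vector \<Rightarrow>\<^sub>C\<^sub>L 'b::complex_normed_vector) \<Rightarrow> 'a \<Rightarrow> 'b"
  (infixr \<open>*\<^sub>V\<close> 70) is blinfun_apply .

lemma cblinfun_eqI: "(\<And>x. A *\<^sub>V x = B *\<^sub>V x) \<Longrightarrow> A = B"
  by transfer (rule blinfun_eqI)

instantiation cblinfun :: (complex_normed_vector, complex_normed_vector) complex_normed_vector
begin

lift_definition zero_cblinfun :: "'a \<Rightarrow>\<^sub>C\<^sub>L 'b" is 0
  by (simp add: scaleC_zero_right)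
lift_definition plus_cblinfun :: "'a \<Rightarrow>\<^sub>C\<^sub>L 'b \<Rightarrow> 'a \<Rightarrow>\<^sub>C\<^sub>L 'b \<Rightarrow> 'a \<Rightarrow>\<^sub>C\<^sub>L 'b" is "(+)"
  by (simp add: blinfun.bilinear_simps scaleC_add_right)
lift_definition minus_cblinfun :: "'a \<Rightarrow>\<^sub>C\<^sub>L 'b \<Rightarrow> 'a \<Rightarrow>\<^sub>C\<^sub>L 'b \<Rightarrow> 'a \<Rightarrow>\<^sub>C\<^sub>L 'b" is "(-)"
  by (simp add: blinfun.bilinear_simps scaleC_diff_right)
lift_definition uminus_cblinfun :: "'a \<Rightarrow>\<^sub>C\<^sub>L 'b \<Rightarrow> 'a \<Rightarrow>\<^sub>C\<^sub>L 'b" is uminus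
  by (simp add: blinfun.bilinear_simps scaleC_minus_right)
lift_definition scaleR_cblinfun :: "real \<Rightarrow> 'a \<Rightarrow>\<^sub>C\<^sub>L 'b \<Rightarrow> 'a \<Rightarrow>\<^sub>C\<^sub>L 'b" is scaleR
  by (simp add: blinfun.bilinear_simps scaleC_scaleR_commute)
lift_definition scaleC_cblinfun :: "complex \<Rightarrow> 'a \<Rightarrow>\<^sub>C\<^sub>L 'b \<Rightarrow> 'a \<Rightarrow>\<^sub>C\<^sub>L 'b"
  is "\<lambda>c f. blinfun_compose (Blinfun (\<lambda>x. c *\<^sub>C x)) f"
  by (simp add: bounded_linear_Blinfun_apply[OF bounded_linear_scaleC] scaleC_scaleC mult.commute)
lift_definition norm_cblinfun :: "'a \<Rightarrow>\<^sub>C\<^sub>L 'b \<Rightarrow> real" is norm .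

definition dist_cblinfun :: "'a \<Rightarrow>\<^sub>C\<^sub>L 'b \<Rightarrow> 'a \<Rightarrow>\<^sub>C\<^sub>L 'b \<Rightarrow> real"
  where "dist_cblinfun A B = norm (A - B)"
definition sgn_cblinfun :: "'a \<Rightarrow>\<^sub>C\<^sub>L 'b \<Rightarrow> 'a \<Rightarrow>\<^sub>C\<^sub>L 'b"
  where "sgn_cblinfun A = scaleR (inverse (norm A)) A"
definition [code del]:
  "(uniformity :: (('a \<Rightarrow>\<^sub>C\<^sub>L 'b) \<times> ('a \<Rightarrow>\<^sub>C\<^sub>L 'b)) filter)
    = (INF e\<in>{0<..}. principal {(A, B). dist A B < e})"
definition open_cblinfun :: "('a \<Rightarrow>\<^sub>C\<^sub>L 'b) set \<Rightarrow> bool"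
  where [code del]: "open_cblinfun U
    \<longleftrightarrow> (\<forall>A\<in>U. eventually (\<lambda>(A', B). A' = A \<longrightarrow> B \<in> U) uniformity)"

lemma scaleC_cblinfun_apply: "(c *\<^sub>C A) *\<^sub>V x = c *\<^sub>C (A *\<^sub>V (x::'a))"
  by transfer (simp add: bounded_linear_Blinfun_apply[OF bounded_linear_scaleC])

lemma plus_cblinfun_apply: "(A + B) *\<^sub>V x = A *\<^sub>V x + B *\<^sub>V x"
  by transfer (simp add: blinfun.bilinear_simps)

lemma scaleR_cblinfun_apply: "(r *\<^sub>R A) *\<^sub>V x = r *\<^sub>R (A *\<^sub>V x)"
  by transfer (simp add: blinfun.bilinear_simps)

lemma norm_scaleC_cblinfun_le: "norm (c *\<^sub>C A) \<le> norm c * norm (A :: 'a \<Rightarrow>\<^sub>C\<^sub>L 'b)"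
proof (transfer, rule norm_blinfun_bound)
  fix c and A :: "'a \<Rightarrow>\<^sub>L 'b" and x
  show "norm ((Blinfun ((*\<^sub>C) c) o\<^sub>L A) x) \<le> norm c * norm A * norm x"
    using mult_left_mono[OF norm_blinfun[of A x], of "norm c"]
    by (simp add: bounded_linear_Blinfun_apply[OF bounded_linear_scaleC] norm_scaleC mult.assoc)
qed simp

instance
proof
  fix A B D :: "'a \<Rightarrow>\<^sub>C\<^sub>L 'b" and a b r :: real and c d :: complex
  show "A + B + D = A + (B + D)" "A + B = B + A" "0 + A = A" "- A + A = 0" "A - B = A + - B"
    by (transfer; simp)+
  show "a *\<^sub>R (A + B) = a *\<^sub>R A + a *\<^sub>R B" "(a + b) *\<^sub>R A = a *\<^sub>R A + b *\<^sub>R A"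
    "a *\<^sub>R b *\<^sub>R A = (a * b) *\<^sub>R A" "1 *\<^sub>R A = A"
    by (transfer; simp add: algebra_simps)+
  show "dist A B = norm (A - B)" by (rule dist_cblinfun_def)
  show "sgn A = scaleR (inverse (norm A)) A" by (rule sgn_cblinfun_def)
  show "(uniformity :: (('a \<Rightarrow>\<^sub>C\<^sub>L 'b) \<times> ('a \<Rightarrow>\<^sub>C\<^sub>L 'b)) filter)
    = (INF e\<in>{0<..}. principal {(A, B). dist A B < e})"
    by (rule uniformity_cblinfun_def)
  show "open U \<longleftrightarrow> (\<forall>A\<in>U. eventually (\<lambda>(A', B). A' = A \<longrightarrow> B \<in> U) uniformity)"
    for U :: "('a \<Rightarrow>\<^sub>C\<^sub>L 'b) set"
    by (rule open_cblinfun_def)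
  show "norm A = 0 \<longleftrightarrow> A = 0" "norm (A + B) \<le> norm A + norm B" "norm (a *\<^sub>R A) = \<bar>a\<bar> * norm A"
    by (transfer; simp add: norm_triangle_ineq)+
  show "c *\<^sub>C (A + B) = c *\<^sub>C A + c *\<^sub>C B" "(c + d) *\<^sub>C A = c *\<^sub>C A + d *\<^sub>C A"
    "c *\<^sub>C (d *\<^sub>C A) = (c * d) *\<^sub>C A" "r *\<^sub>R A = complex_of_real r *\<^sub>C A"
    by (rule cblinfun_eqI, simp add: scaleC_cblinfun_apply plus_cblinfun_apply
        scaleR_cblinfun_apply scaleC_add_right scaleC_add_left scaleC_scaleC scaleR_scaleC)+
  show "norm (c *\<^sub>C A) = norm c * norm A"
  proof (cases "c = 0")
    case True
    moreover have "0 \<le> norm (c *\<^sub>C A)"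
      by (simp add: norm_cblinfun.rep_eq)
    ultimately show ?thesis using norm_scaleC_cblinfun_le[of c A] by simp
  next
    case False
    have "inverse c *\<^sub>C (c *\<^sub>C A) = A"
      using False by (intro cblinfun_eqI)
        (simp add: scaleC_cblinfun_apply scaleC_scaleC flip: scaleR_scaleC[of 1, simplified])
    then have "norm A \<le> norm (inverse c) * norm (c *\<^sub>C A)"
      using norm_scaleC_cblinfun_le[of "inverse c" "c *\<^sub>C A"] by simp
    then have "norm c * norm A \<le> norm (c *\<^sub>C A)"
      using False by (simp add: norm_inverse norm_divide field_simps)
    then show ?thesis using norm_scaleC_cblinfun_le[of c A] by simp
  qed
qed

end

instance cblinfun :: (complex_normed_vector, complex_banach) complex_banach
proof
  fix X :: "nat \<Rightarrow> 'a \<Rightarrow>\<^sub>C\<^sub>L 'b"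
  assume X: "Cauchy X"
  define Y where "Y = (\<lambda>n. Rep_cblinfun (X n))"
  have d: "dist A B = dist (Rep_cblinfun A) (Rep_cblinfun B)" for A B :: "'a \<Rightarrow>\<^sub>C\<^sub>L 'b"
    by (simp add: dist_norm norm_cblinfun.rep_eq minus_cblinfun.rep_eq)
  have "Cauchy Y" using X by (simp add: Cauchy_def Y_def d)
  then obtain L where L: "Y \<longlonglongrightarrow> L"
    using Cauchy_convergent convergent_def by blast
  have "L (c *\<^sub>C x) = c *\<^sub>C L x" for c x
  proof (rule LIMSEQ_unique)
    show "(\<lambda>n. Y n (c *\<^sub>C x)) \<longlonglongrightarrow> L (c *\<^sub>C x)"
      by (intro tendsto_intros L)
    have "Y n (c *\<^sub>C x) = c *\<^sub>C Y n x" for n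
      using Rep_cblinfun[of "X n"] by (simp add: Y_def)
    moreover have "(\<lambda>n. c *\<^sub>C Y n x) \<longlonglongrightarrow> c *\<^sub>C L x"
      by (intro bounded_linear.tendsto[OF bounded_linear_scaleC] tendsto_intros L)
    ultimately show "(\<lambda>n. Y n (c *\<^sub>C x)) \<longlonglongrightarrow> c *\<^sub>C L x" by simp
  qed
  then have "Rep_cblinfun (Abs_cblinfun L) = L"
    by (simp add: Abs_cblinfun_inverse)
  then have "X \<longlonglongrightarrow> Abs_cblinfun L"
    using L by (simp add: tendsto_iff d Y_def)
  then show "convergent X" by (auto simp: convergent_def)
qed

lift_definition id_cblinfun :: "'a::complex_normed_vector \<Rightarrow>\<^sub>C\<^sub>L 'a" is id_blinfun
  by simp

lift_definition cblinfun_compose ::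
  "('b::complex_normed_vector \<Rightarrow>\<^sub>C\<^sub>L 'c::complex_normed_vector) \<Rightarrow> ('a::complex_normed_vector \<Rightarrow>\<^sub>C\<^sub>L 'b) \<Rightarrow> 'a \<Rightarrow>\<^sub>C\<^sub>L 'c"
  (infixl \<open>o\<^sub>C\<^sub>L\<close> 67) is blinfun_compose
  by simp

definition op_power :: "('a::complex_normed_vector \<Rightarrow>\<^sub>C\<^sub>L 'a) \<Rightarrow> nat \<Rightarrow> 'a \<Rightarrow>\<^sub>C\<^sub>L 'a"
  where "op_power A n = ((\<lambda>B. A o\<^sub>C\<^sub>L B) ^^ n) id_cblinfun"

text \<open>The Banach space adjoint \<open>T\<^sup>* f = f \<circ> T\<close>; it is complex-linear (no conjugation).\<close>

lemma bounded_linear_compose_right: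
  fixes T :: "'a::complex_normed_vector \<Rightarrow>\<^sub>C\<^sub>L 'b::complex_normed_vector"
  shows "bounded_linear (\<lambda>f :: 'b \<Rightarrow>\<^sub>C\<^sub>L complex. f o\<^sub>C\<^sub>L T)"
proof (rule bounded_linear_intro[where K = "norm T"])
  fix f g :: "'b \<Rightarrow>\<^sub>C\<^sub>L complex" and r
  show "(f + g) o\<^sub>C\<^sub>L T = (f o\<^sub>C\<^sub>L T) + (g o\<^sub>C\<^sub>L T)"
    by (transfer, rule blinfun_eqI) (simp add: blinfun.bilinear_simps)
  show "(r *\<^sub>R f) o\<^sub>C\<^sub>L T = r *\<^sub>R (f o\<^sub>C\<^sub>L T)"
    by (transfer, rule blinfun_eqI) (simp add: blinfun.bilinear_simps)
  show "norm (f o\<^sub>C\<^sub>L T) \<le> norm f * norm T"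
    by transfer (rule norm_blinfun_compose)
qed

lift_definition banach_adjoint ::
  "('a::complex_normed_vector \<Rightarrow>\<^sub>C\<^sub>L 'b::complex_normed_vector) \<Rightarrow> ('b \<Rightarrow>\<^sub>C\<^sub>L complex) \<Rightarrow>\<^sub>C\<^sub>L ('a \<Rightarrow>\<^sub>C\<^sub>L complex)"
  is "\<lambda>T. Blinfun (\<lambda>f. f o\<^sub>C\<^sub>L T)"
  apply (subst bounded_linear_Blinfun_apply[OF bounded_linear_compose_right])+
  apply (intro allI cblinfun_eqI)
  apply (transfer, simp add: bounded_linear_Blinfun_apply[OF bounded_linear_scaleC])
  done

lemma banach_adjoint_apply: "banach_adjoint T *\<^sub>V f = f o\<^sub>C\<^sub>L T"
  by transfer (simp add: bounded_linear_Blinfun_apply[OF bounded_linear_compose_right])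

text \<open>Reflexivity: the canonical embedding into the bidual is onto.\<close>

definition reflexive_space :: "'a::complex_banach itself \<Rightarrow> bool"
  where "reflexive_space _ \<longleftrightarrow>
    (\<forall>\<Phi> :: ('a \<Rightarrow>\<^sub>C\<^sub>L complex) \<Rightarrow>\<^sub>C\<^sub>L complex. \<exists>x::'a. \<forall>f. \<Phi> *\<^sub>V f = f *\<^sub>V x)"


section \<open>Spectrum, resolvent, fractional powers\<close>

definition op_is_inverse :: "('a::complex_normed_vector \<Rightarrow>\<^sub>C\<^sub>L 'a) \<Rightarrow> ('a \<Rightarrow>\<^sub>C\<^sub>L 'a) \<Rightarrow> bool"
  where "op_is_inverse A B \<longleftrightarrow> A o\<^sub>C\<^sub>L B = id_cblinfun \<and> B o\<^sub>C\<^sub>L A = id_cblinfun"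

definition op_inverse :: "('a::complex_normed_vector \<Rightarrow>\<^sub>C\<^sub>L 'a) \<Rightarrow> 'a \<Rightarrow>\<^sub>C\<^sub>L 'a"
  where "op_inverse A = (SOME B. op_is_inverse A B)"

definition op_spectrum :: "('a::complex_normed_vector \<Rightarrow>\<^sub>C\<^sub>L 'a) \<Rightarrow> complex set"
  where "op_spectrum T = {z. \<not> (\<exists>B. op_is_inverse (z *\<^sub>C id_cblinfun - T) B)}"

definition resolvent :: "complex \<Rightarrow> ('a::complex_normed_vector \<Rightarrow>\<^sub>C\<^sub>L 'a) \<Rightarrow> 'a \<Rightarrow>\<^sub>C\<^sub>L 'a"
  where "resolvent z T = op_inverse (z *\<^sub>C id_cblinfun - T)"

text \<open>
  Fractional power of a bounded sectorial operator (not necessarily injective) for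
  \<open>\<alpha> > 0\<close>: \<open>A\<^sup>\<alpha> = A\<^sup>n A\<^sup>\<theta>\<close> with \<open>n = \<lfloor>\<alpha>\<rfloor>\<close> and
  \<open>\<theta> = \<alpha> - n \<in> [0,1)\<close>, where for \<open>0 < \<theta> < 1\<close> the Balakrishnan formula gives
  \<open>A\<^sup>\<theta> = sin(\<pi>\<theta>)/\<pi> \<integral>\<^sub>0\<^sup>\<infinity> t\<^sup>\<theta>\<^sup>-\<^sup>1 (t + A)\<^sup>-\<^sup>1 A dt\<close>.
  The integral is absolutely convergent in operator norm.
\<close>

definition frac_power :: "('a::complex_banach \<Rightarrow>\<^sub>C\<^sub>L 'a) \<Rightarrow> real \<Rightarrow> 'a \<Rightarrow>\<^sub>C\<^sub>L 'a"
  where "frac_power A \<alpha> =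
    (let n = nat \<lfloor>\<alpha>\<rfloor>; \<theta> = \<alpha> - real n in
      op_power A n o\<^sub>C\<^sub>L
        (if \<theta> = 0 then id_cblinfun
         else (sin (pi * \<theta>) / pi) *\<^sub>R
           integral {0<..} (\<lambda>t. t powr (\<theta> - 1) *\<^sub>R (op_inverse (t *\<^sub>R id_cblinfun + A) o\<^sub>C\<^sub>L A))))"


section \<open>Rademacher averages, cotype, R-boundedness\<close>

definition rademacher_seq :: "'w measure \<Rightarrow> (nat \<Rightarrow> 'w \<Rightarrow> real) \<Rightarrow> bool"
  where "rademacher_seq M \<epsilon> \<longleftrightarrow>
    prob_space M \<and> prob_space.indep_vars M (\<lambda>_. borel) \<epsilon> {1..} \<and>
    (\<forall>k\<ge>1. measure M {u \<in> space M. \<epsilon> k u = 1} = 1/2 \<and>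
           measure M {u \<in> space M. \<epsilon> k u = - 1} = 1/2)"

definition rad_norm ::
  "'w measure \<Rightarrow> (nat \<Rightarrow> 'w \<Rightarrow> real) \<Rightarrow> nat \<Rightarrow> (nat \<Rightarrow> 'a::real_normed_vector) \<Rightarrow> real"
  where "rad_norm M \<epsilon> n x = sqrt (LINT u|M. (norm (\<Sum>k=1..n. \<epsilon> k u *\<^sub>R x k))\<^sup>2)"

definition finite_cotype ::
  "'w measure \<Rightarrow> (nat \<Rightarrow> 'w \<Rightarrow> real) \<Rightarrow> 'a::real_normed_vector itself \<Rightarrow> bool"
  where "finite_cotype M \<epsilon> _ \<longleftrightarrow>
    (\<exists>q\<ge>2. \<exists>C>0. \<forall>n (x :: nat \<Rightarrow> 'a).
      (\<Sum>k=1..n. norm (x k) powr q) powr (1/q) \<le> C * rad_norm M \<epsilon> n x)"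

definition R_bounded ::
  "'w measure \<Rightarrow> (nat \<Rightarrow> 'w \<Rightarrow> real) \<Rightarrow> ('a::complex_normed_vector \<Rightarrow>\<^sub>C\<^sub>L 'a) set \<Rightarrow> bool"
  where "R_bounded M \<epsilon> F \<longleftrightarrow>
    (\<exists>C>0. \<forall>n (T :: nat \<Rightarrow> 'a \<Rightarrow>\<^sub>C\<^sub>L 'a) x. (\<forall>k\<in>{1..n}. T k \<in> F) \<longrightarrow>
      rad_norm M \<epsilon> n (\<lambda>k. T k *\<^sub>V x k) \<le> C * rad_norm M \<epsilon> n x)"


section \<open>R-Ritt operators with peripheral spectrum in a finite set\<close>

text \<open>
  Throughout, \<open>\<xi>\<close> is a list enumerating \<open>E = set \<xi>\<close> without repetition. The order matters
  only syntactically, to write the product of the (commuting) operators \<open>(I - cnj \<xi>\<^sub>j S)\<^sup>\<alpha>\<close>.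
\<close>

definition R_Ritt ::
  "'w measure \<Rightarrow> (nat \<Rightarrow> 'w \<Rightarrow> real) \<Rightarrow> complex set \<Rightarrow> ('a::complex_banach \<Rightarrow>\<^sub>C\<^sub>L 'a) \<Rightarrow> bool"
  where "R_Ritt M \<epsilon> E T \<longleftrightarrow>
    op_spectrum T \<subseteq> cball 0 1 \<and> op_spectrum T \<inter> sphere 0 1 \<subseteq> E \<and>
    (\<forall>C>1. R_bounded M \<epsilon>
      {(\<Prod>\<zeta>\<in>E. 1 - cnj \<zeta> * z) *\<^sub>C resolvent z T | z. 1 < norm z \<and> norm z < C})"

definition polygonal :: "complex set \<Rightarrow> real \<Rightarrow> complex set"
  where "polygonal E r = interior (convex hull (E \<union> ball 0 r))"

definition large_enough :: "complex set \<Rightarrow> real \<Rightarrow> bool"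
  where "large_enough E r \<longleftrightarrow>
    (\<forall>\<zeta>\<in>E. \<forall>\<eta>\<in>E. \<zeta> \<noteq> \<eta> \<longrightarrow> closed_segment \<zeta> \<eta> \<inter> ball 0 r \<noteq> {})"

definition R_type ::
  "'w measure \<Rightarrow> (nat \<Rightarrow> 'w \<Rightarrow> real) \<Rightarrow> complex set \<Rightarrow> real \<Rightarrow> ('a::complex_banach \<Rightarrow>\<^sub>C\<^sub>L 'a) \<Rightarrow> bool"
  where "R_type M \<epsilon> E r T \<longleftrightarrow>
    large_enough E r \<and> op_spectrum T \<subseteq> closure (polygonal E r) \<and>
    (\<forall>s\<in>{r<..<1}. R_bounded M \<epsilon>
      {(\<Prod>\<zeta>\<in>E. \<zeta> - z) *\<^sub>C resolvent z T | z. z \<in> ball 0 2 - closure (polygonal E s)})"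


section \<open>Functional calculus\<close>

definition H0_inf :: "complex set \<Rightarrow> real \<Rightarrow> (complex \<Rightarrow> complex) set"
  where "H0_inf E s = {\<phi>. \<phi> holomorphic_on polygonal E s \<and> bounded (\<phi> ` polygonal E s) \<and>
    (\<exists>C>0. \<exists>e :: complex \<Rightarrow> real. (\<forall>\<zeta>\<in>E. e \<zeta> > 0) \<and>
      (\<forall>z\<in>polygonal E s. norm (\<phi> z) \<le> C * (\<Prod>\<zeta>\<in>E. norm (\<zeta> - z) powr e \<zeta>)))}"

definition sup_norm_on :: "complex set \<Rightarrow> (complex \<Rightarrow> complex) \<Rightarrow> real"
  where "sup_norm_on U \<phi> = (SUP z\<in>U. norm (\<phi> z))"

text \<open>
  Counterclockwise parametrization on \<open>{0..1}\<close> of the boundary of \<open>polygonal E u\<close>. This set is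
  bounded, convex, open and contains \<open>0\<close> (for \<open>u > 0\<close>), so each ray from \<open>0\<close> meets its boundary
  in exactly one point. The path is piecewise smooth (arcs and segments).
\<close>

definition boundary_path :: "complex set \<Rightarrow> real \<Rightarrow> real \<Rightarrow> complex"
  where "boundary_path E u t =
    complex_of_real (Sup {\<rho>. 0 \<le> \<rho> \<and> complex_of_real \<rho> * cis (2 * pi * t) \<in> polygonal E u})
      * cis (2 * pi * t)"

text \<open>
  Banach-space-valued version of the contour integral of \<open>HOL-Complex_Analysis\<close>.
\<close>

definition op_contour_integral ::
  "(real \<Rightarrow> complex) \<Rightarrow> (complex \<Rightarrow> 'b::complex_banach) \<Rightarrow> 'b"
  where "op_contour_integral g f =
    integral {0..1} (\<lambda>t. vector_derivative g (at t within {0..1}) *\<^sub>C f (g t))"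

text \<open>
  \<open>\<phi>(T)\<close> computed on the boundary of \<open>polygonal E u\<close>. That boundary lies in the domain
  \<open>polygonal E s\<close> of \<open>\<phi>\<close> except for the finitely many points of \<open>E\<close>, where the
  value of the integrand is irrelevant.
\<close>

definition fun_calc ::
  "complex set \<Rightarrow> real \<Rightarrow> (complex \<Rightarrow> complex) \<Rightarrow> ('a::complex_banach \<Rightarrow>\<^sub>C\<^sub>L 'a) \<Rightarrow> 'a \<Rightarrow>\<^sub>C\<^sub>L 'a"
  where "fun_calc E u \<phi> T =
    (1 / (2 * pi * \<i>)) *\<^sub>C op_contour_integral (boundary_path E u) (\<lambda>z. \<phi> z *\<^sub>C resolvent z T)"

text \<open>
  For \<open>T\<close> of type \<open>r < s\<close>, \<open>fun_calc E u \<phi> T\<close> does not depend on \<open>u \<in> (r,s)\<close>; the estimate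
  is required for each admissible \<open>u\<close>.
\<close>

definition bounded_Hinf_calculus ::
  "complex set \<Rightarrow> real \<Rightarrow> real \<Rightarrow> ('a::complex_banach \<Rightarrow>\<^sub>C\<^sub>L 'a) \<Rightarrow> bool"
  where "bounded_Hinf_calculus E r s T \<longleftrightarrow>
    (\<exists>K\<ge>1. \<forall>\<phi>\<in>H0_inf E s. \<forall>u\<in>{r<..<s}.
      norm (fun_calc E u \<phi> T) \<le> K * sup_norm_on (polygonal E s) \<phi>)"


section \<open>Square functions\<close>

definition frac_product ::
  "complex list \<Rightarrow> real \<Rightarrow> ('a::complex_banach \<Rightarrow>\<^sub>C\<^sub>L 'a) \<Rightarrow> 'a \<Rightarrow>\<^sub>C\<^sub>L 'a"
  where "frac_product \<xi> \<alpha> S =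
    foldr (\<lambda>\<zeta> B. frac_power (id_cblinfun - cnj \<zeta> *\<^sub>C S) \<alpha> o\<^sub>C\<^sub>L B) \<xi> id_cblinfun"

definition square_fun ::
  "'w measure \<Rightarrow> (nat \<Rightarrow> 'w \<Rightarrow> real) \<Rightarrow> complex list \<Rightarrow>
    ('a::complex_banach \<Rightarrow>\<^sub>C\<^sub>L 'a) \<Rightarrow> real \<Rightarrow> 'a \<Rightarrow> ennreal"
  where "square_fun M \<epsilon> \<xi> S \<alpha> y =
    lim (\<lambda>n. ennreal (rad_norm M \<epsilon> n
      (\<lambda>k. real k powr (\<alpha> - 1/2) *\<^sub>R ((op_power S (k - 1) o\<^sub>C\<^sub>L frac_product \<xi> \<alpha> S) *\<^sub>V y))))"

end

theory Submission
  imports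
    Defs
    "HOL-Complex_Analysis.Complex_Analysis"
    "HOL-Computational_Algebra.Computational_Algebra"
    "HOL-Computational_Algebra.Field_as_Ring"
begin

text \<open>
  Let \<open>P(z) = \<Prod>\<^sub>j (1 - cnj \<xi>\<^sub>j z)\<close>. Expanding \<open>(1 - cnj \<xi>\<^sub>j z)\<^sup>-\<^sup>m\<close> into its binomial series and using a
  Bezout identity between the powers \<open>(1 - cnj \<xi>\<^sub>j z)\<^sup>m\<close> writes
  \<open>1 = \<Sum>\<^sub>j \<Sum>\<^sub>k b\<^sub>k (cnj \<xi>\<^sub>j)\<^sup>k z\<^sup>k h\<^sub>j(z) P(z)\<^sup>m\<close> with \<open>b\<^sub>k = O(k\<^sup>m\<^sup>-\<^sup>1)\<close>. For \<open>k \<approx> 3a\<close>, one factor \<open>z\<^sup>a P\<^sup>\<alpha>\<close> of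
  \<open>z\<^sup>k P\<^sup>m \<phi>\<close> is moved to \<open>x\<close> and one factor \<open>z\<^sup>a P\<^sup>\<beta>\<close> to \<open>y\<close> in \<open>\<langle>y, (z\<^sup>k P\<^sup>m \<phi>)(T) x\<rangle>\<close>; these produce the
  terms of the two square functions. The remaining function is
  \<open>O(|z|\<^sup>a |P|\<^sup>m\<^sup>-\<^sup>\<alpha>\<^sup>-\<^sup>\<beta>)\<close>, so the weight \<open>|P| \<parallel>R(z,T)\<parallel>\<close> leaves a contour integral of size
  \<open>a\<^sup>-\<^sup>(\<^sup>m\<^sup>-\<^sup>\<alpha>\<^sup>-\<^sup>\<beta>\<^sup>)\<close> times a supremum over \<open>z\<close> of \<open>|\<langle>y\<^sub>a, P(z) R(z,T) x\<^sub>a\<rangle>|\<close>. The powers of \<open>a\<close> cancel, and the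
  sum over \<open>a\<close> of these suprema is controlled by R-boundedness and the duality between the Rademacher
  norms of \<open>X\<close> and of its dual.
\<close>


section \<open>Bounded complex-linear operators\<close>

text \<open>A function in \<open>H0_inf\<close> may vanish at \<open>E\<close> to an arbitrarily
  small order, so the termwise estimate is made for the truncations
  \<open>approx_one * \<phi>\<close>. These stay bounded on the contours because the contours
  approach \<open>E\<close> nontangentially: there \<open>|P| \<le> C (1 - |z|)\<close>, while the
  binomial partial sums are at most \<open>(1 - |z|)^(-m)\<close>. Dominated convergence then passes
  to \<open>\<phi>\<close>. The exponent \<open>m \<ge> \<alpha> + \<beta> + 1\<close> leaves a full
  factor \<open>P\<close> to absorb the resolvent. Contour integrals are handled through the scalar
  pairings \<open>cpair\<close>, which puts Cauchy's theorem, Fubini and dominated convergence in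
  the setting of complex-valued functions; Hahn-Banach recovers the operator norm. The scalar
  counterpart of \<open>frac_power\<close> is defined by the same Balakrishnan integral, so an
  exchange of integrals shows that the operator acts as multiplication by \<open>scalar_pow\<close>;
  the estimates use its holomorphy and its comparability with \<open>|a|^\<alpha>\<close>. The
  square function estimate is made on one fixed contour, and Cauchy's theorem carries its constant
  to every admissible \<open>u\<close>.\<close>

lemma scaleC_zero_left [simp]: "0 *\<^sub>C (x::'a::complex_normed_vector) = 0"
  using scaleR_scaleC[of 0 x] by simp

lemma scaleC_one [simp]: "1 *\<^sub>C (x::'a::complex_normed_vector) = x"
  using scaleR_scaleC[of 1 x] by simp

lemma scaleC_minus_left: "(- c) *\<^sub>C (x::'a::complex_normed_vector) = - (c *\<^sub>C x)"
proof -
  have "(- c) *\<^sub>C x + c *\<^sub>C x = 0" by (simp flip: scaleC_add_left)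
  then show ?thesis by (simp add: eq_neg_iff_add_eq_0)
qed

lemma scaleC_diff_left: "(c - d) *\<^sub>C (x::'a::complex_normed_vector) = c *\<^sub>C x - d *\<^sub>C x"
  using scaleC_add_left[of c "- d" x] by (simp add: scaleC_minus_left)

lemmas scaleC_algebra = scaleC_add_left scaleC_add_right scaleC_diff_left scaleC_diff_right
  scaleC_minus_left scaleC_minus_right scaleC_scaleC

lemma scaleC_complex [simp]: "c *\<^sub>C (z::complex) = c * z"
  by (simp add: scaleC_complex_def)

lemma minus_cblinfun_apply: "(A - B) *\<^sub>V x = A *\<^sub>V x - B *\<^sub>V x"
  by transfer (simp add: blinfun.bilinear_simps)

lemma uminus_cblinfun_apply: "(- A) *\<^sub>V x = - (A *\<^sub>V x)"
  by transfer (simp add: blinfun.bilinear_simps)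

lemma zero_cblinfun_apply [simp]: "0 *\<^sub>V x = 0"
  by transfer simp

lemma id_cblinfun_apply [simp]: "id_cblinfun *\<^sub>V x = x"
  by transfer simp

lemma cblinfun_compose_apply [simp]: "(A o\<^sub>C\<^sub>L B) *\<^sub>V x = A *\<^sub>V (B *\<^sub>V x)"
  by transfer simp

lemma cblinfun_apply_add: "A *\<^sub>V (x + y) = A *\<^sub>V x + A *\<^sub>V y"
  by transfer (simp add: blinfun.bilinear_simps)

lemma cblinfun_apply_diff: "A *\<^sub>V (x - y) = A *\<^sub>V x - A *\<^sub>V y"
  by transfer (simp add: blinfun.bilinear_simps)

lemma cblinfun_apply_minus: "A *\<^sub>V (- x) = - (A *\<^sub>V x)"
  by transfer (simp add: blinfun.bilinear_simps)

lemma cblinfun_apply_zero [simp]: "A *\<^sub>V 0 = 0"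
  by transfer (simp add: blinfun.bilinear_simps)

lemma cblinfun_apply_scaleR: "A *\<^sub>V (r *\<^sub>R x) = r *\<^sub>R (A *\<^sub>V x)"
  by transfer (simp add: blinfun.bilinear_simps)

lemma cblinfun_apply_scaleC: "A *\<^sub>V (c *\<^sub>C x) = c *\<^sub>C (A *\<^sub>V x)"
  by transfer simp

lemma cblinfun_apply_sum: "A *\<^sub>V (\<Sum>i\<in>I. f i) = (\<Sum>i\<in>I. A *\<^sub>V f i)"
  by (induction I rule: infinite_finite_induct) (simp_all add: cblinfun_apply_add)

lemmas cblinfun_simps = plus_cblinfun_apply minus_cblinfun_apply uminus_cblinfun_apply
  scaleC_cblinfun_apply scaleR_cblinfun_apply cblinfun_apply_add cblinfun_apply_diff
  cblinfun_apply_minus cblinfun_apply_scaleR cblinfun_apply_scaleC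

lemma norm_cblinfun: "norm (A *\<^sub>V x) \<le> norm A * norm x"
  by transfer (rule norm_blinfun)

lemma norm_cblinfun_bound:
  assumes "0 \<le> b" "\<And>x. norm (A *\<^sub>V x) \<le> b * norm x"
  shows "norm A \<le> b"
  using assms by transfer (rule norm_blinfun_bound)

lemma norm_cblinfun_compose: "norm (A o\<^sub>C\<^sub>L B) \<le> norm A * norm B"
  by transfer (rule norm_blinfun_compose)

lemma norm_id_cblinfun_le: "norm (id_cblinfun :: 'a::complex_normed_vector \<Rightarrow>\<^sub>C\<^sub>L 'a) \<le> 1"
  by (rule norm_cblinfun_bound) simp_all

lemma bounded_linear_cblinfun_apply: "bounded_linear (\<lambda>x. A *\<^sub>V x)"
  by (rule bounded_linear_intro[where K = "norm A"])
    (simp_all add: cblinfun_simps norm_cblinfun[THEN order.trans] mult.commute)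

lemma bounded_linear_cblinfun_apply_left: "bounded_linear (\<lambda>A. A *\<^sub>V x)"
  by (rule bounded_linear_intro[where K = "norm x"])
    (simp_all add: cblinfun_simps norm_cblinfun)

lemma cblinfun_compose_assoc: "(A o\<^sub>C\<^sub>L B) o\<^sub>C\<^sub>L D = A o\<^sub>C\<^sub>L (B o\<^sub>C\<^sub>L D)"
  by (rule cblinfun_eqI) simp

lemma cblinfun_compose_id [simp]: "A o\<^sub>C\<^sub>L id_cblinfun = A" "id_cblinfun o\<^sub>C\<^sub>L A = A"
  by (rule cblinfun_eqI; simp)+

lemma op_power_0 [simp]: "op_power A 0 = id_cblinfun"
  and op_power_Suc [simp]: "op_power A (Suc n) = A o\<^sub>C\<^sub>L op_power A n"
  by (simp_all add: op_power_def)

lemma banach_adjoint_apply_apply [simp]: "(banach_adjoint A *\<^sub>V f) *\<^sub>V x = f *\<^sub>V (A *\<^sub>V x)"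
  by (simp add: banach_adjoint_apply)

lemma banach_adjoint_id: "banach_adjoint id_cblinfun = id_cblinfun"
  by (intro cblinfun_eqI) simp

lemma banach_adjoint_compose:
  "banach_adjoint (A o\<^sub>C\<^sub>L B) = banach_adjoint B o\<^sub>C\<^sub>L banach_adjoint A"
  by (intro cblinfun_eqI) simp

lemma banach_adjoint_diff: "banach_adjoint (A - B) = banach_adjoint A - banach_adjoint B"
  by (intro cblinfun_eqI) (simp add: cblinfun_simps)

lemma banach_adjoint_scaleC: "banach_adjoint (c *\<^sub>C A) = c *\<^sub>C banach_adjoint A"
  by (intro cblinfun_eqI) (simp add: cblinfun_simps)

lemma norm_banach_adjoint_le: "norm (banach_adjoint A) \<le> norm A"
proof (rule norm_cblinfun_bound)
  fix f show "norm (banach_adjoint A *\<^sub>V f) \<le> norm A * norm f"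
    using norm_cblinfun_compose[of f A] by (simp add: banach_adjoint_apply mult.commute)
qed simp

text \<open>The canonical image of \<open>x\<close> in the bidual. With it the pairing of
  \<open>T\<close> at \<open>(x, y)\<close> becomes a pairing of \<open>banach_adjoint T\<close> at
  \<open>(y, eval_functional x)\<close>.\<close>

lift_definition eval_functional ::
  "'a::complex_normed_vector \<Rightarrow> ('a \<Rightarrow>\<^sub>C\<^sub>L complex) \<Rightarrow>\<^sub>C\<^sub>L complex"
  is "\<lambda>x. Blinfun (\<lambda>f. f *\<^sub>V x)"
  by (simp add: bounded_linear_Blinfun_apply[OF bounded_linear_cblinfun_apply_left] cblinfun_simps)

lemma eval_functional_apply [simp]: "eval_functional x *\<^sub>V f = f *\<^sub>V x"
  by transfer (simp add: bounded_linear_Blinfun_apply[OF bounded_linear_cblinfun_apply_left])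

section \<open>Inverses, resolvents and their adjoints\<close>

lemma op_is_inverse_unique:
  assumes "op_is_inverse A B" "op_is_inverse A B'"
  shows "B = B'"
proof -
  have "B o\<^sub>C\<^sub>L (A o\<^sub>C\<^sub>L B') = (B o\<^sub>C\<^sub>L A) o\<^sub>C\<^sub>L B'"
    by (simp add: cblinfun_compose_assoc)
  then show ?thesis using assms by (simp add: op_is_inverse_def)
qed

lemma op_inverse_eq: "op_is_inverse A B \<Longrightarrow> op_inverse A = B"
  unfolding op_inverse_def by (rule some_equality) (auto dest: op_is_inverse_unique)

lemma op_is_inverse_op_inverse: "op_is_inverse A B \<Longrightarrow> op_is_inverse A (op_inverse A)"
  by (simp add: op_inverse_eq)

lemma op_is_inverse_resolvent:
  "z \<notin> op_spectrum A \<Longrightarrow> op_is_inverse (z *\<^sub>C id_cblinfun - A) (resolvent z A)"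
  unfolding op_spectrum_def resolvent_def by (auto intro: op_is_inverse_op_inverse)

lemma op_is_inverse_adjoint:
  "op_is_inverse A B \<Longrightarrow> op_is_inverse (banach_adjoint A) (banach_adjoint B)"
  by (metis banach_adjoint_compose banach_adjoint_id op_is_inverse_def)

lemma resolvent_adjoint:
  assumes "z \<notin> op_spectrum A"
  shows "z \<notin> op_spectrum (banach_adjoint A)"
    "resolvent z (banach_adjoint A) = banach_adjoint (resolvent z A)"
proof -
  have "op_is_inverse (z *\<^sub>C id_cblinfun - banach_adjoint A) (banach_adjoint (resolvent z A))"
    using op_is_inverse_adjoint[OF op_is_inverse_resolvent[OF assms]]
    by (simp add: banach_adjoint_diff banach_adjoint_scaleC banach_adjoint_id)
  then show "z \<notin> op_spectrum (banach_adjoint A)"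
    "resolvent z (banach_adjoint A) = banach_adjoint (resolvent z A)"
    by (auto simp: op_spectrum_def resolvent_def op_inverse_eq)
qed

lemma resolvent_apply:
  assumes "z \<notin> op_spectrum A"
  shows "z *\<^sub>C (resolvent z A *\<^sub>V x) = x + resolvent z A *\<^sub>V (A *\<^sub>V x)"
    "z *\<^sub>C (resolvent z A *\<^sub>V x) = x + A *\<^sub>V (resolvent z A *\<^sub>V x)"
proof -
  have "(resolvent z A o\<^sub>C\<^sub>L (z *\<^sub>C id_cblinfun - A)) *\<^sub>V x = x"
    "((z *\<^sub>C id_cblinfun - A) o\<^sub>C\<^sub>L resolvent z A) *\<^sub>V x = x"
    using op_is_inverse_resolvent[OF assms] by (simp_all add: op_is_inverse_def)
  then show "z *\<^sub>C (resolvent z A *\<^sub>V x) = x + resolvent z A *\<^sub>V (A *\<^sub>V x)"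
    "z *\<^sub>C (resolvent z A *\<^sub>V x) = x + A *\<^sub>V (resolvent z A *\<^sub>V x)"
    by (simp_all add: cblinfun_simps algebra_simps)
qed

lemma resolvent_identity:
  assumes "z \<notin> op_spectrum A" "w \<notin> op_spectrum A"
  shows "resolvent w A *\<^sub>V x - resolvent z A *\<^sub>V x
    = (z - w) *\<^sub>C (resolvent z A *\<^sub>V (resolvent w A *\<^sub>V x))"
proof -
  let ?Rw = "resolvent w A *\<^sub>V x"
  have "resolvent z A *\<^sub>V x = resolvent z A *\<^sub>V (w *\<^sub>C ?Rw - A *\<^sub>V ?Rw)"
    using resolvent_apply(2)[OF assms(2), of x] by simp
  also have "\<dots> = w *\<^sub>C (resolvent z A *\<^sub>V ?Rw) - (z *\<^sub>C (resolvent z A *\<^sub>V ?Rw) - ?Rw)"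
    using resolvent_apply(1)[OF assms(1), of ?Rw] by (simp add: cblinfun_simps)
  finally show ?thesis by (simp add: scaleC_algebra)
qed

text \<open>The resolvent identity turns a local bound of the resolvent into local Lipschitz
  continuity, and then into the derivative \<open>- y (R(z) R(z) x)\<close>. The local bound is a
  hypothesis because the intended use supplies it from the weighted resolvent estimate.\<close>

lemma resolvent_holomorphic:
  fixes A :: "'a::complex_banach \<Rightarrow>\<^sub>C\<^sub>L 'a"
  assumes S: "open S" "S \<inter> op_spectrum A = {}"
    and bd: "\<And>z. z \<in> S \<Longrightarrow> \<exists>d>0. \<exists>B. \<forall>w\<in>ball z d \<inter> S. norm (resolvent w A) \<le> B"
  shows "(\<lambda>z. y *\<^sub>V (resolvent z A *\<^sub>V x)) holomorphic_on S"
proof -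
  have lip: "\<exists>d>0. \<exists>B\<ge>0. \<forall>w\<in>ball z d \<inter> S. norm (resolvent w A) \<le> B
      \<and> (\<forall>v. norm (resolvent w A *\<^sub>V v - resolvent z A *\<^sub>V v) \<le> B * B * norm v * norm (w - z))"
    if "z \<in> S" for z
  proof -
    obtain d B where d: "d > 0" "\<And>w. w \<in> ball z d \<inter> S \<Longrightarrow> norm (resolvent w A) \<le> B"
      using bd[OF \<open>z \<in> S\<close>] by blast
    have zB: "norm (resolvent z A) \<le> B" using d \<open>z \<in> S\<close> by simp
    then have B0: "0 \<le> B" using norm_ge_zero order.trans by blast
    have "norm (resolvent w A *\<^sub>V v - resolvent z A *\<^sub>V v) \<le> B * B * norm v * norm (w - z)"
      if w: "w \<in> ball z d \<inter> S" for w v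
    proof -
      have "norm (resolvent w A *\<^sub>V v - resolvent z A *\<^sub>V v)
        = norm (z - w) * norm (resolvent z A *\<^sub>V (resolvent w A *\<^sub>V v))"
        using S \<open>z \<in> S\<close> w by (subst resolvent_identity) (auto simp: norm_scaleC)
      also have "norm (resolvent z A *\<^sub>V (resolvent w A *\<^sub>V v)) \<le> B * (B * norm v)"
        by (intro order.trans[OF norm_cblinfun] mult_mono zB d(2)[OF w] order.refl B0 mult_nonneg_nonneg norm_ge_zero)
      finally have "norm (resolvent w A *\<^sub>V v - resolvent z A *\<^sub>V v) \<le> norm (z - w) * (B * (B * norm v))"
        by (simp add: mult_left_mono)
      then show ?thesis by (simp add: norm_minus_commute mult_ac)
    qed
    then show ?thesis using d B0 by blast
  qed
  have cont: "((\<lambda>w. resolvent w A *\<^sub>V v) \<longlongrightarrow> resolvent z A *\<^sub>V v) (at z)" if z: "z \<in> S" for z v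
  proof -
    obtain d B where d: "d > 0" "B \<ge> 0"
      "\<And>w. w \<in> ball z d \<inter> S \<Longrightarrow> norm (resolvent w A *\<^sub>V v - resolvent z A *\<^sub>V v) \<le> B * B * norm v * norm (w - z)"
      using lip[OF z] by blast
    have "\<forall>\<^sub>F w in at z. w \<in> ball z d \<inter> S"
      using S d z by (intro eventually_at_in_open') auto
    then have "\<forall>\<^sub>F w in at z. norm (resolvent w A *\<^sub>V v - resolvent z A *\<^sub>V v) \<le> B * B * norm v * norm (w - z)"
      by (rule eventually_mono) (use d in auto)
    moreover have "((\<lambda>w. B * B * norm v * norm (w - z)) \<longlongrightarrow> 0) (at z)"
      by (auto intro!: tendsto_eq_intros)
    ultimately have "((\<lambda>w. resolvent w A *\<^sub>V v - resolvent z A *\<^sub>V v) \<longlongrightarrow> 0) (at z)"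
      by (rule Lim_null_comparison)
    then show ?thesis by (simp add: LIM_zero_iff)
  qed
  show ?thesis
  proof (rule holomorphic_onI)
    fix z assume z: "z \<in> S"
    let ?f = "\<lambda>z. y *\<^sub>V (resolvent z A *\<^sub>V x)"
    have "\<forall>\<^sub>F w in at z. w \<in> S"
      using S z by (intro eventually_at_in_open') auto
    then have "\<forall>\<^sub>F w in at z. - (y *\<^sub>V (resolvent w A *\<^sub>V (resolvent z A *\<^sub>V x))) = (?f w - ?f z) / (w - z)"
      using eventually_neq_at_within[of z z UNIV]
    proof eventually_elim
      case (elim w)
      then have "resolvent z A *\<^sub>V x - resolvent w A *\<^sub>V x
        = (w - z) *\<^sub>C (resolvent w A *\<^sub>V (resolvent z A *\<^sub>V x))"
        using S z by (intro resolvent_identity) auto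
      then have "?f z - ?f w = (w - z) * (y *\<^sub>V (resolvent w A *\<^sub>V (resolvent z A *\<^sub>V x)))"
        by (metis cblinfun_apply_diff cblinfun_apply_scaleC scaleC_complex)
      then show ?case using elim by (simp add: field_simps)
    qed
    moreover have "((\<lambda>w. - (y *\<^sub>V (resolvent w A *\<^sub>V (resolvent z A *\<^sub>V x)))) \<longlongrightarrow>
        - (y *\<^sub>V (resolvent z A *\<^sub>V (resolvent z A *\<^sub>V x)))) (at z)"
      by (intro tendsto_minus bounded_linear.tendsto[OF bounded_linear_cblinfun_apply] cont z)
    ultimately have "((\<lambda>w. (?f w - ?f z) / (w - z)) \<longlongrightarrow>
        - (y *\<^sub>V (resolvent z A *\<^sub>V (resolvent z A *\<^sub>V x)))) (at z)"
      by (rule Lim_transform_eventually[rotated])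
    then show "?f field_differentiable at z within S"
      by (auto simp: field_differentiable_def has_field_derivative_iff
          intro: tendsto_within_subset)
  qed
qed

section \<open>Norming functionals\<close>

text \<open>Partial functionals dominated by the norm are ordered by inclusion of their graphs, seen
  as subspaces of the product with the real line; the domination makes such a subspace a graph.\<close>

lemma real_norming_functional:
  fixes x0 :: "'a::real_normed_vector"
  obtains f where "linear f" "\<And>x. f x \<le> norm x" "f x0 = norm x0"
proof -
  define \<A> where "\<A> = {G :: ('a \<times> real) set. subspace G \<and> (\<forall>(x, r)\<in>G. r \<le> norm x) \<and> (x0, norm x0) \<in> G}"
  have "span {(x0, norm x0)} \<in> \<A>"
  proof -
    have "r \<le> norm x" if "(x, r) \<in> span {(x0, norm x0)}" for x r
      using that by (auto simp: span_singleton mult_right_mono)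
    then show ?thesis by (auto simp: \<A>_def subspace_span span_base)
  qed
  then have "\<A> \<noteq> {}" by blast
  moreover have "\<Union>\<C> \<in> \<A>" if "\<C> \<noteq> {}" and ch: "subset.chain \<A> \<C>" for \<C>
  proof -
    have sub: "\<C> \<subseteq> \<A>" using ch by (auto simp: subset.chain_def)
    have "subspace (\<Union>\<C>)"
    proof (rule subspaceI)
      show "0 \<in> \<Union>\<C>" using that sub by (auto simp: \<A>_def dest!: subspace_0)
      show "a + b \<in> \<Union>\<C>" if ab: "a \<in> \<Union>\<C>" "b \<in> \<Union>\<C>" for a b
      proof -
        obtain G H where GH: "G \<in> \<C>" "H \<in> \<C>" "a \<in> G" "b \<in> H" using ab by blast
        then have "G \<subseteq> H \<or> H \<subseteq> G" using ch by (auto simp: subset.chain_def)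
        then obtain K where "K \<in> \<C>" "a \<in> K" "b \<in> K" using GH by blast
        then show ?thesis using sub by (auto simp: \<A>_def intro: subspace_add)
      qed
      show "c *\<^sub>R a \<in> \<Union>\<C>" if "a \<in> \<Union>\<C>" for a c
        using that sub by (auto simp: \<A>_def intro: subspace_scale)
    qed
    then show ?thesis using that sub unfolding \<A>_def by blast
  qed
  ultimately obtain G where G: "G \<in> \<A>" and max: "\<And>H. H \<in> \<A> \<Longrightarrow> G \<subseteq> H \<Longrightarrow> H = G"
    using subset_Zorn_nonempty[of \<A>] by metis
  have Gs: "subspace G" and Gn: "\<And>x r. (x, r) \<in> G \<Longrightarrow> r \<le> norm x" and G0: "(x0, norm x0) \<in> G"
    using G by (auto simp: \<A>_def)
  have sp: "span G = G" using Gs span_eq_iff by blast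
  have dom: "\<exists>c. (x1, c) \<in> G" for x1
  proof -
    \<comment> \<open>A value \<open>c\<close> at \<open>x1\<close> is admissible when it lies
      between the numbers in \<open>L\<close> and all the numbers \<open>norm (y + x1) - s\<close>.
      By \<open>LU\<close> the former never exceed the latter, so \<open>Sup L\<close>
      works.\<close>
    define L where "L = (\<lambda>(x, r). r - norm (x - x1)) ` G"
    have LU: "r - norm (x - x1) \<le> norm (y + x1) - s" if "(x, r) \<in> G" "(y, s) \<in> G" for x r y s
    proof -
      have "(x + y, r + s) \<in> G" using subspace_add[OF Gs that] by simp
      then have "r + s \<le> norm ((x - x1) + (y + x1))" using Gn by simp
      also have "\<dots> \<le> norm (x - x1) + norm (y + x1)" by (rule norm_triangle_ineq)
      finally show ?thesis by simp
    qed
    have 0: "(0, 0) \<in> G" using subspace_0[OF Gs] by (simp add: zero_prod_def)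
    have Lbdd: "bdd_above L" using LU[OF _ 0] by (auto simp: L_def intro!: bdd_aboveI2)
    define c where "c = Sup L"
    have c1: "r - norm (x - x1) \<le> c" if "(x, r) \<in> G" for x r
      unfolding c_def using that by (intro cSup_upper Lbdd) (force simp: L_def)
    have c2: "c \<le> norm (y + x1) - s" if "(y, s) \<in> G" for y s
      unfolding c_def using 0 LU that by (intro cSup_least) (auto simp: L_def)
    \<comment> \<open>Dividing by \<open>|k|\<close> reduces a general multiple of \<open>x1\<close>
      to the two bounds \<open>c1\<close> and \<open>c2\<close>.\<close>
    have key: "r + k * c \<le> norm (x + k *\<^sub>R x1)" if xr: "(x, r) \<in> G" for x r k
    proof (cases k "0::real" rule: linorder_cases)
      case less
      have "((1 / - k) *\<^sub>R x, (1 / - k) * r) \<in> G" using subspace_scale[OF Gs xr, of "1 / - k"] by simp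
      from c1[OF this] have "- k * ((1 / - k) * r - norm ((1 / - k) *\<^sub>R x - x1)) \<le> - k * c"
        using less by (intro mult_left_mono) auto
      moreover have "- k * ((1 / - k) * r - norm ((1 / - k) *\<^sub>R x - x1))
          = r - (- k * norm ((1 / - k) *\<^sub>R x - x1))"
        using less by (simp add: field_simps)
      moreover have "- k *\<^sub>R ((1 / - k) *\<^sub>R x - x1) = x + k *\<^sub>R x1"
        using less by (simp add: scaleR_diff_right)
      then have "- k * norm ((1 / - k) *\<^sub>R x - x1) = norm (x + k *\<^sub>R x1)"
        using less norm_scaleR[of "- k" "(1 / - k) *\<^sub>R x - x1"] by simp
      ultimately show ?thesis by linarith
    next
      case equal then show ?thesis using Gn[OF xr] by simp
    next
      case greater
      have "((1 / k) *\<^sub>R x, (1 / k) * r) \<in> G" using subspace_scale[OF Gs xr, of "1 / k"] by simp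
      from c2[OF this] have "k * c \<le> k * (norm ((1 / k) *\<^sub>R x + x1) - (1 / k) * r)"
        using greater by (intro mult_left_mono) auto
      moreover have "k * (norm ((1 / k) *\<^sub>R x + x1) - (1 / k) * r) = k * norm ((1 / k) *\<^sub>R x + x1) - r"
        using greater by (simp add: field_simps)
      moreover have "k *\<^sub>R ((1 / k) *\<^sub>R x + x1) = x + k *\<^sub>R x1"
        using greater by (simp add: scaleR_add_right)
      then have "k * norm ((1 / k) *\<^sub>R x + x1) = norm (x + k *\<^sub>R x1)"
        using greater norm_scaleR[of k "(1 / k) *\<^sub>R x + x1"] by simp
      ultimately show ?thesis by linarith
    qed
    have "span (insert (x1, c) G) \<in> \<A>"
    proof -
      have "r \<le> norm x" if xr: "(x, r) \<in> span (insert (x1, c) G)" for x r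
      proof -
        obtain k where "(x, r) - k *\<^sub>R (x1, c) \<in> span G" using xr unfolding span_insert by blast
        then have "(x - k *\<^sub>R x1, r - k * c) \<in> G" by (simp add: sp)
        from key[OF this, of k] show ?thesis by simp
      qed
      then show ?thesis using G0 by (auto simp: \<A>_def subspace_span intro: span_base)
    qed
    from max[OF this] have "(x1, c) \<in> G"
      by (metis insert_subset span_superset)
    then show ?thesis by blast
  qed
  define f where "f x = (SOME r. (x, r) \<in> G)" for x
  have fG: "(x, f x) \<in> G" for x unfolding f_def using someI_ex[OF dom] .
  have uniq: "r = s" if "(x, r) \<in> G" "(x, s) \<in> G" for x r s
    using Gn[of 0 "r - s"] Gn[of 0 "s - r"] subspace_diff[OF Gs that] subspace_diff[OF Gs that(2,1)] by simp
  have "linear f"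
  proof (rule linearI)
    show "f (x + y) = f x + f y" for x y
      using subspace_add[OF Gs fG fG, of x y] by (intro uniq[OF fG]) simp
    show "f (c *\<^sub>R x) = c *\<^sub>R f x" for c x
      using subspace_scale[OF Gs fG, of c x] by (intro uniq[OF fG]) simp
  qed
  then show thesis using that Gn[OF fG] uniq[OF fG G0] by blast
qed

text \<open>A real functional \<open>f\<close> is the real part of the complex one
  \<open>x \<mapsto> f x - i f (i x)\<close>. Multiplying \<open>x\<close> by a phase makes the
  value of the latter real, so the bound of \<open>f\<close> passes to its modulus.\<close>

lemma norming_functional:
  fixes x0 :: "'a::complex_normed_vector"
  obtains y :: "'a \<Rightarrow>\<^sub>C\<^sub>L complex" where "norm y \<le> 1" "y *\<^sub>V x0 = complex_of_real (norm x0)"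
proof -
  obtain f where f: "linear f" "\<And>x. f x \<le> norm x" "f x0 = norm x0"
    using real_norming_functional[of x0] by blast
  define g where "g x = Complex (f x) (- f (\<i> *\<^sub>C x))" for x
  have add: "g (x + y) = g x + g y" for x y
    by (simp add: g_def linear_add[OF f(1)] scaleC_add_right complex_eq_iff)
  have sR: "g (r *\<^sub>R x) = r *\<^sub>R g x" for r x
    by (simp add: g_def linear_scale[OF f(1)] scaleC_scaleR_commute complex_eq_iff)
  have gi: "g (\<i> *\<^sub>C x) = \<i> * g x" for x
    using linear_neg[OF f(1), of x] scaleC_minus_left[of 1 x]
    by (simp add: g_def scaleC_scaleC complex_eq_iff)
  have sC: "g (c *\<^sub>C x) = c * g x" for c x
  proof -
    have "c *\<^sub>C x = Re c *\<^sub>R x + Im c *\<^sub>R (\<i> *\<^sub>C x)"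
      by (simp add: scaleR_scaleC scaleC_scaleC flip: scaleC_add_left)
        (metis complex_eq mult.commute)
    then have "g (c *\<^sub>C x) = Re c *\<^sub>R g x + Im c *\<^sub>R (\<i> * g x)"
      by (simp only: add sR gi)
    then show ?thesis by (simp add: complex_eq_iff)
  qed
  have bd: "norm (g x) \<le> norm x" for x
  proof (cases "g x = 0")
    case False
    define c where "c = cnj (g x) / norm (g x)"
    have c: "norm c = 1" "c * g x = norm (g x)"
      using False by (simp_all add: c_def norm_divide complex_norm_square power2_eq_square field_simps
          flip: complex_norm_square)
    then have "norm (g x) = Re (g (c *\<^sub>C x))" by (simp add: sC)
    also have "\<dots> = f (c *\<^sub>C x)" by (simp add: g_def)
    also have "\<dots> \<le> norm x" using f(2)[of "c *\<^sub>C x"] c by (simp add: norm_scaleC)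
    finally show ?thesis .
  qed simp
  have bl: "bounded_linear g" by (rule bounded_linear_intro[where K = 1]) (simp_all add: add sR bd)
  define y where "y = Abs_cblinfun (Blinfun g)"
  have y: "y *\<^sub>V x = g x" for x
    by (simp add: y_def cblinfun_apply.rep_eq Abs_cblinfun_inverse bounded_linear_Blinfun_apply[OF bl] sC)
  \<comment> \<open>A complex number of modulus at most \<open>norm x0\<close> whose real part is
    \<open>norm x0\<close> has no imaginary part.\<close>
  have "Re (g x0) = norm x0" by (simp add: g_def f)
  then have "g x0 = norm x0"
    using bd[of x0] by (smt (verit) Re_complex_of_real cmod_eq_Re complex_eq_iff complex_Re_le_cmod
        Im_complex_of_real cmod_power2 norm_ge_zero power_mono sum_power2_eq_zero_iff zero_eq_power2)
  then show thesis
    by (intro that[of y] norm_cblinfun_bound) (simp_all add: y bd)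
qed

lemma norm_cblinfun_le_pairing:
  fixes A :: "'a::complex_normed_vector \<Rightarrow>\<^sub>C\<^sub>L 'b::complex_normed_vector"
  assumes "0 \<le> K" "\<And>x (y :: 'b \<Rightarrow>\<^sub>C\<^sub>L complex). norm (y *\<^sub>V (A *\<^sub>V x)) \<le> K * norm x * norm y"
  shows "norm A \<le> K"
proof (rule norm_cblinfun_bound[OF assms(1)])
  fix x
  obtain y :: "'b \<Rightarrow>\<^sub>C\<^sub>L complex" where y: "norm y \<le> 1" "y *\<^sub>V (A *\<^sub>V x) = norm (A *\<^sub>V x)"
    using norming_functional[of "A *\<^sub>V x"] .
  have "norm (A *\<^sub>V x) \<le> K * norm x * norm y" using assms(2)[of y x] y(2) by simp
  also have "\<dots> \<le> K * norm x" using y(1) assms(1) by (simp add: mult_left_le)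
  finally show "norm (A *\<^sub>V x) \<le> K * norm x" .
qed

section \<open>Rademacher averages as finite averages over signs\<close>

definition signs :: "nat \<Rightarrow> (nat \<Rightarrow> real) set"
  where "signs n = PiE {1..n} (\<lambda>_. {-1, 1})"

lemma finite_signs [simp]: "finite (signs n)"
  by (simp add: signs_def finite_PiE)

lemma card_signs: "card (signs n) = 2 ^ n"
  by (simp add: signs_def card_PiE numeral_2_eq_2)

lemma signs_values: "s \<in> signs n \<Longrightarrow> k \<in> {1..n} \<Longrightarrow> s k = - 1 \<or> s k = 1"
  by (auto simp: signs_def PiE_def Pi_def)

text \<open>Multiplication by a fixed sign pattern is an involution of the cube of signs. The
  product leaves the extensional functions that make up \<open>signs n\<close>, hence the
  requirement that \<open>F\<close> see only the coordinates in \<open>{1..n}\<close>.\<close>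

lemma sum_signs_multiply:
  assumes "\<And>k. k \<in> {1..n} \<Longrightarrow> \<omega> k = - 1 \<or> \<omega> k = (1::real)"
    and F: "\<And>s s'. (\<And>k. k \<in> {1..n} \<Longrightarrow> s k = s' k) \<Longrightarrow> F s = F s'"
  shows "(\<Sum>s\<in>signs n. F (\<lambda>k. \<omega> k * s k)) = (\<Sum>s\<in>signs n. F s)"
proof -
  let ?f = "\<lambda>s. restrict (\<lambda>k. \<omega> k * s k) {1..n}"
  have f: "?f s \<in> signs n" if "s \<in> signs n" for s
    using that assms(1) by (force simp: signs_def PiE_def Pi_def)
  have ff: "?f (?f s) = s" if "s \<in> signs n" for s
  proof
    fix k show "?f (?f s) k = s k"
      using assms(1)[of k] PiE_arb[OF that[unfolded signs_def], of k]
      by (cases "k \<in> {1..n}") (auto simp: restrict_def)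
  qed
  have "(\<Sum>s\<in>signs n. F s) = (\<Sum>s\<in>signs n. F (?f s))"
    by (rule sum.reindex_bij_witness[of _ ?f ?f]) (simp_all only: f ff)
  also have "\<dots> = (\<Sum>s\<in>signs n. F (\<lambda>k. \<omega> k * s k))"
    by (intro sum.cong refl F) simp
  finally show ?thesis by simp
qed

text \<open>Orthogonality of the signs: flipping the coordinate \<open>k\<close> alone changes the
  sign of the summand when \<open>k \<noteq> l\<close>.\<close>

lemma sum_signs_mult:
  assumes "k \<in> {1..n}" "l \<in> {1..n}"
  shows "(\<Sum>s\<in>signs n. s k * s l) = (if k = l then 2 ^ n else 0)"
proof (cases "k = l")
  case True
  have "s k * s l = 1" if "s \<in> signs n" for s
    using signs_values[OF that assms(1)] True by auto
  then have "(\<Sum>s\<in>signs n. s k * s l) = (\<Sum>s\<in>signs n. 1)"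
    by (intro sum.cong) auto
  then show ?thesis using True by (simp add: card_signs)
next
  case False
  have "(\<Sum>s\<in>signs n. s k * s l)
    = (\<Sum>s\<in>signs n. ((if k = k then - 1 else 1) * s k) * ((if l = k then - 1 else 1) * s l))"
    by (rule sum_signs_multiply[symmetric, where F = "\<lambda>s. s k * s l" and \<omega> = "\<lambda>i. if i = k then - 1 else 1"])
      (use assms in auto)
  then show ?thesis using False by (simp add: sum_negf)
qed

text \<open>By independence every sign pattern has probability \<open>1 / 2 ^ n\<close>. The later
  inequalities for Rademacher norms are read off from this finite average.\<close>

lemma rad_norm_eq:
  assumes "rademacher_seq M \<epsilon>"
  shows "rad_norm M \<epsilon> n x = sqrt ((\<Sum>s\<in>signs n. (norm (\<Sum>k=1..n. s k *\<^sub>R x k))\<^sup>2) / 2 ^ n)"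
proof -
  interpret prob_space M using assms by (simp add: rademacher_seq_def)
  have indep: "indep_vars (\<lambda>_. borel) \<epsilon> {1..}"
    and half: "\<And>k. k \<ge> 1 \<Longrightarrow> prob {u \<in> space M. \<epsilon> k u = 1} = 1/2"
      "\<And>k. k \<ge> 1 \<Longrightarrow> prob {u \<in> space M. \<epsilon> k u = - 1} = 1/2"
    using assms by (auto simp: rademacher_seq_def)
  have meas [measurable]: "\<epsilon> k \<in> borel_measurable M" if "k \<ge> 1" for k
    using indep that by (auto simp: indep_vars_def)
  define F where "F s = (norm (\<Sum>k=1..n. s k *\<^sub>R x k))\<^sup>2" for s :: "nat \<Rightarrow> real"
  have Fcong: "F s = F s'" if "\<And>k. k \<in> {1..n} \<Longrightarrow> s k = s' k" for s s'
    unfolding F_def using that by (intro arg_cong[where f = "\<lambda>v. (norm v)\<^sup>2"] sum.cong) auto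
  define A where "A s = {u \<in> space M. \<forall>k\<in>{1..n}. \<epsilon> k u = s k}" for s
  have A: "A s \<in> events" for s
    unfolding A_def
  proof (rule sets.sets_Collect_finite_All)
    fix k assume k: "k \<in> {1..n}"
    have "{u \<in> space M. \<epsilon> k u = s k} = \<epsilon> k -` {s k} \<inter> space M" by auto
    then show "{u \<in> space M. \<epsilon> k u = s k} \<in> events"
      using k measurable_sets[OF meas, of k "{s k}"] by simp
  qed simp
  have probA: "prob (A s) = 1 / 2 ^ n" if s: "s \<in> signs n" for s
  proof (cases "n = 0")
    case True then show ?thesis by (simp add: A_def prob_space)
  next
    case False
    have "prob (\<Inter>k\<in>{1..n}. \<epsilon> k -` {s k} \<inter> space M) = (\<Prod>k\<in>{1..n}. prob (\<epsilon> k -` {s k} \<inter> space M))"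
      by (rule indep_varsD[OF indep]) (use False in auto)
    also have "\<dots> = (\<Prod>k\<in>{1..n}. 1/2)"
    proof (rule prod.cong)
      fix k assume k: "k \<in> {1..n}"
      have "\<epsilon> k -` {s k} \<inter> space M = {u \<in> space M. \<epsilon> k u = s k}" by auto
      then show "prob (\<epsilon> k -` {s k} \<inter> space M) = 1/2"
        using half[of k] signs_values[OF s k] k by auto
    qed simp
    also have "(\<Inter>k\<in>{1..n}. \<epsilon> k -` {s k} \<inter> space M) = A s" using False by (auto simp: A_def)
    finally show ?thesis by (simp add: power_divide)
  qed
  have ae: "AE u in M. \<forall>k\<in>{1..n}. \<epsilon> k u = - 1 \<or> \<epsilon> k u = 1"
  proof (rule AE_finite_allI, simp)
    fix k assume k: "k \<in> {1..n}"
    have "prob {u \<in> space M. \<epsilon> k u = - 1 \<or> \<epsilon> k u = 1}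
      = prob ({u \<in> space M. \<epsilon> k u = - 1} \<union> {u \<in> space M. \<epsilon> k u = 1})"
      by (rule arg_cong[where f = prob]) auto
    also have "\<dots> = prob {u \<in> space M. \<epsilon> k u = - 1} + prob {u \<in> space M. \<epsilon> k u = 1}"
      using k by (intro finite_measure_Union) auto
    finally have "prob {u \<in> space M. \<epsilon> k u = - 1 \<or> \<epsilon> k u = 1} = 1" using half[of k] k by simp
    then show "AE u in M. \<epsilon> k u = - 1 \<or> \<epsilon> k u = 1"
      using k by (subst (asm) prob_Collect_eq_1) auto
  qed
  \<comment> \<open>The vector space may fail to be separable, so measurability comes from the
    continuity of \<open>F\<close> as a function of the real coordinates. Coordinates outside
    \<open>{1..n}\<close> are set to \<open>0\<close>; nothing is assumed about
    \<open>\<epsilon> 0\<close>.\<close>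
  have mF: "(\<lambda>u. F (\<lambda>k. \<epsilon> k u)) \<in> borel_measurable M"
  proof -
    have "(\<lambda>u k. if k \<in> {1..n} then \<epsilon> k u else 0) \<in> borel_measurable M"
    proof (rule measurable_coordinatewise_then_product)
      show "(\<lambda>u. if i \<in> {1..n} then \<epsilon> i u else 0) \<in> borel_measurable M" for i
        using meas[of i] by (cases "i \<in> {1..n}") auto
    qed
    moreover have "continuous_on UNIV F"
      unfolding F_def by (intro continuous_intros continuous_on_product_coordinates)
    then have "F \<in> borel_measurable borel" by (rule borel_measurable_continuous_onI)
    ultimately have "(\<lambda>u. F (\<lambda>k. if k \<in> {1..n} then \<epsilon> k u else 0)) \<in> borel_measurable M"
      by (rule measurable_compose)
    moreover have "F (\<lambda>k. if k \<in> {1..n} then \<epsilon> k u else 0) = F (\<lambda>k. \<epsilon> k u)" for u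
      by (rule Fcong) simp
    ultimately show ?thesis by simp
  qed
  have "(LINT u|M. F (\<lambda>k. \<epsilon> k u)) = (LINT u|M. (\<Sum>s\<in>signs n. indicator (A s) u * F s))"
  proof (rule integral_cong_AE)
    show "AE u in M. F (\<lambda>k. \<epsilon> k u) = (\<Sum>s\<in>signs n. indicator (A s) u * F s)"
      using ae AE_space
    proof eventually_elim
      case (elim u)
      define s0 where "s0 = restrict (\<lambda>k. \<epsilon> k u) {1..n}"
      have s0: "s0 \<in> signs n" using elim by (auto simp: s0_def signs_def)
      have ind: "indicator (A s) u = (if s = s0 then 1 else 0::real)" if "s \<in> signs n" for s
      proof -
        have "u \<in> A s \<longleftrightarrow> s = s0"
        proof
          assume "u \<in> A s"
          then have "s k = s0 k" for k
            using PiE_arb[OF that[unfolded signs_def], of k]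
            by (cases "k \<in> {1..n}") (simp_all add: s0_def A_def)
          then show "s = s0" by blast
        next
          have "u \<in> A s0" using elim(2) by (simp add: A_def s0_def)
          then show "u \<in> A s" if "s = s0" by (simp only: that)
        qed
        then show ?thesis by (simp add: indicator_def)
      qed
      have "(\<Sum>s\<in>signs n. indicator (A s) u * F s) = (\<Sum>s\<in>signs n. if s = s0 then F s else 0)"
        by (intro sum.cong) (auto simp: ind)
      also have "\<dots> = F s0" using s0 by simp
      also have "\<dots> = F (\<lambda>k. \<epsilon> k u)" by (rule Fcong) (simp add: s0_def)
      finally show ?case by simp
    qed
  qed (intro mF borel_measurable_sum borel_measurable_times borel_measurable_indicator A borel_measurable_const)+
  also have "\<dots> = (\<Sum>s\<in>signs n. prob (A s) * F s)"
  proof (subst Bochner_Integration.integral_sum)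
    show "integrable M (\<lambda>u. indicator (A s) u * F s)" for s
      by (intro integrable_mult_left integrable_real_indicator A) (simp add: emeasure_eq_measure)
    have "(LINT u|M. indicator (A s) u * F s) = prob (A s) * F s" for s
    proof -
      have "A s \<inter> space M = A s" by (auto simp: A_def)
      then show ?thesis by simp
    qed
    then show "(\<Sum>s\<in>signs n. LINT u|M. indicator (A s) u * F s) = (\<Sum>s\<in>signs n. prob (A s) * F s)"
      by (simp only:)
  qed
  also have "\<dots> = (\<Sum>s\<in>signs n. F s) / 2 ^ n"
    by (simp add: probA sum_divide_distrib)
  finally show ?thesis by (simp add: rad_norm_def F_def)
qed

context
  fixes M :: "'w measure" and \<epsilon>
  assumes rad: "rademacher_seq M \<epsilon>"
begin

lemma rad_norm_nonneg: "0 \<le> rad_norm M \<epsilon> n x"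
  by (simp add: rad_norm_eq[OF rad] sum_nonneg)

lemma rad_norm_square: "(rad_norm M \<epsilon> n x)\<^sup>2 * 2 ^ n = (\<Sum>s\<in>signs n. (norm (\<Sum>k=1..n. s k *\<^sub>R x k))\<^sup>2)"
  by (simp add: rad_norm_eq[OF rad] sum_nonneg)

lemma rad_norm_signs:
  assumes "\<And>k. k \<in> {1..n} \<Longrightarrow> \<omega> k = - 1 \<or> \<omega> k = 1"
  shows "rad_norm M \<epsilon> n (\<lambda>k. \<omega> k *\<^sub>R x k) = rad_norm M \<epsilon> n x"
proof -
  have "(\<Sum>s\<in>signs n. (norm (\<Sum>k=1..n. (\<omega> k * s k) *\<^sub>R x k))\<^sup>2)
    = (\<Sum>s\<in>signs n. (norm (\<Sum>k=1..n. s k *\<^sub>R x k))\<^sup>2)"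
    by (rule sum_signs_multiply[OF assms])
      (auto intro!: arg_cong[where f = "\<lambda>v. (norm v)\<^sup>2"] sum.cong)
  then show ?thesis by (simp add: rad_norm_eq[OF rad] mult.commute)
qed

lemma rad_norm_cong: "(\<And>k. k \<in> {1..n} \<Longrightarrow> x k = x' k) \<Longrightarrow> rad_norm M \<epsilon> n x = rad_norm M \<epsilon> n x'"
  unfolding rad_norm_def
  by (intro arg_cong[where f = sqrt] Bochner_Integration.integral_cong refl
      arg_cong[where f = "\<lambda>v. (norm v)\<^sup>2"] sum.cong) auto

lemma rad_norm_1: "rad_norm M \<epsilon> 1 x = norm (x 1)"
proof -
  have "(norm (s 1 *\<^sub>R x 1))\<^sup>2 = (norm (x 1))\<^sup>2" if "s \<in> signs 1" for s
    using signs_values[OF that, of 1] by auto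
  then have "(\<Sum>s\<in>signs 1. (norm (s 1 *\<^sub>R x 1))\<^sup>2) = (\<Sum>s\<in>signs 1. (norm (x 1))\<^sup>2)"
    by (intro sum.cong) auto
  then show ?thesis by (simp add: rad_norm_eq[OF rad] card_signs)
qed

text \<open>Flip the last sign and average: the inequality \<open>par\<close>, valid in every normed
  space, bounds the sum without its last term by the average of the two signed sums.\<close>

lemma rad_norm_Suc_le:
  fixes x :: "nat \<Rightarrow> 'a::real_normed_vector"
  shows "rad_norm M \<epsilon> n x \<le> rad_norm M \<epsilon> (Suc n) x"
proof -
  have "(rad_norm M \<epsilon> n x)\<^sup>2 \<le> (rad_norm M \<epsilon> (Suc n) x)\<^sup>2"
  proof -
    let ?x = "x(Suc n := 0)" and ?\<omega> = "\<lambda>k. if k = Suc n then - 1 else 1 :: real"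
    let ?S = "\<lambda>s. \<Sum>k=1..n. s k *\<^sub>R x k"
    have 0: "rad_norm M \<epsilon> (Suc n) ?x = rad_norm M \<epsilon> n x"
    proof -
      have "(\<Sum>k=1..Suc n. \<epsilon> k u *\<^sub>R ?x k) = (\<Sum>k=1..n. \<epsilon> k u *\<^sub>R x k)" for u
        by simp
      then show ?thesis unfolding rad_norm_def by simp
    qed
    have par: "2 * (norm a)\<^sup>2 \<le> (norm (a + b))\<^sup>2 + (norm (a - b))\<^sup>2" for a b :: 'a
    proof -
      have "2 * norm a = norm ((a + b) + (a - b))" by (simp flip: scaleR_2)
      also have "\<dots> \<le> norm (a + b) + norm (a - b)" by (rule norm_triangle_ineq)
      finally have "(2 * norm a)\<^sup>2 \<le> (norm (a + b) + norm (a - b))\<^sup>2" by (intro power_mono) auto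
      also have "\<dots> \<le> 2 * ((norm (a + b))\<^sup>2 + (norm (a - b))\<^sup>2)"
        using zero_le_power2[of "norm (a + b) - norm (a - b)"]
        by (simp add: power2_eq_square algebra_simps)
      finally show ?thesis by (simp add: power2_eq_square)
    qed
    have "2 * (\<Sum>s\<in>signs (Suc n). (norm (?S s))\<^sup>2)
      \<le> (\<Sum>s\<in>signs (Suc n). (norm (?S s + s (Suc n) *\<^sub>R x (Suc n)))\<^sup>2)
        + (\<Sum>s\<in>signs (Suc n). (norm (?S s - s (Suc n) *\<^sub>R x (Suc n)))\<^sup>2)"
      unfolding sum_distrib_left sum.distrib[symmetric] by (intro sum_mono par)
    then have "2 * ((rad_norm M \<epsilon> (Suc n) ?x)\<^sup>2 * 2 ^ Suc n)
      \<le> (rad_norm M \<epsilon> (Suc n) x)\<^sup>2 * 2 ^ Suc n + (rad_norm M \<epsilon> (Suc n) (\<lambda>k. ?\<omega> k *\<^sub>R x k))\<^sup>2 * 2 ^ Suc n"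
      unfolding rad_norm_square by simp
    then show ?thesis by (subst (asm) rad_norm_signs) (auto simp: 0)
  qed
  then show ?thesis using rad_norm_nonneg power2_le_imp_le by blast
qed

text \<open>By monotonicity in \<open>n\<close> the \<open>lim\<close> in \<open>square_fun\<close>
  is a genuine supremum, so it dominates every partial sum.\<close>

lemma rad_norm_le_square_fun:
  "ennreal (rad_norm M \<epsilon> n
      (\<lambda>k. real k powr (\<alpha> - 1/2) *\<^sub>R ((op_power S (k - 1) o\<^sub>C\<^sub>L frac_product \<xi> \<alpha> S) *\<^sub>V y)))
    \<le> square_fun M \<epsilon> \<xi> S \<alpha> y"
proof -
  let ?r = "\<lambda>n. ennreal (rad_norm M \<epsilon> n
      (\<lambda>k. real k powr (\<alpha> - 1/2) *\<^sub>R ((op_power S (k - 1) o\<^sub>C\<^sub>L frac_product \<xi> \<alpha> S) *\<^sub>V y)))"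
  have "incseq ?r" by (intro incseq_SucI ennreal_leI rad_norm_Suc_le)
  then have "?r \<longlonglongrightarrow> (SUP n. ?r n)" by (rule LIMSEQ_SUP)
  then have "square_fun M \<epsilon> \<xi> S \<alpha> y = (SUP n. ?r n)"
    unfolding square_fun_def by (rule limI)
  then show ?thesis by (simp only:) (rule SUP_upper, rule UNIV_I)
qed

lemma R_bounded_imp_bounded:
  assumes "R_bounded M \<epsilon> F"
  shows "\<exists>C>0. \<forall>A\<in>F. norm A \<le> C"
proof -
  obtain C where C: "C > 0" "\<And>n T x. (\<forall>k\<in>{1..n}. T k \<in> F) \<Longrightarrow>
      rad_norm M \<epsilon> n (\<lambda>k. T k *\<^sub>V x k) \<le> C * rad_norm M \<epsilon> n x"
    using assms by (auto simp: R_bounded_def)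
  have "norm A \<le> C" if "A \<in> F" for A
  proof (rule norm_cblinfun_bound)
    fix x show "norm (A *\<^sub>V x) \<le> C * norm x"
      using C(2)[of 1 "\<lambda>_. A" "\<lambda>_. x"] that by (simp add: rad_norm_1[unfolded One_nat_def])
  qed (use C in simp)
  then show ?thesis using C by blast
qed

text \<open>The signs are orthonormal on average, so the sum of the diagonal pairings is the average
  of the pairings of the two signed sums; Cauchy-Schwarz on the cube of signs does the rest.\<close>

lemma norm_sum_pairing_le:
  fixes x :: "nat \<Rightarrow> 'a::complex_normed_vector" and y :: "nat \<Rightarrow> 'a \<Rightarrow>\<^sub>C\<^sub>L complex"
  shows "norm (\<Sum>k=1..n. y k *\<^sub>V x k) \<le> rad_norm M \<epsilon> n x * rad_norm M \<epsilon> n y"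
proof -
  let ?X = "\<lambda>s. \<Sum>k=1..n. s k *\<^sub>R x k" and ?Y = "\<lambda>s. \<Sum>k=1..n. s k *\<^sub>R y k"
  have app: "(\<Sum>k\<in>I. g k) *\<^sub>V v = (\<Sum>k\<in>I. g k *\<^sub>V v)" for g :: "nat \<Rightarrow> 'a \<Rightarrow>\<^sub>C\<^sub>L complex" and I v
    by (rule linear_sum[OF bounded_linear.linear[OF bounded_linear_cblinfun_apply_left]])
  have "?Y s *\<^sub>V ?X s = (\<Sum>k=1..n. \<Sum>l=1..n. of_real (s k * s l) * (y k *\<^sub>V x l))" for s
  proof -
    have "?Y s *\<^sub>V ?X s = (\<Sum>l=1..n. \<Sum>k=1..n. (s k *\<^sub>R y k) *\<^sub>V (s l *\<^sub>R x l))"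
      unfolding cblinfun_apply_sum app ..
    also have "\<dots> = (\<Sum>k=1..n. \<Sum>l=1..n. (s k *\<^sub>R y k) *\<^sub>V (s l *\<^sub>R x l))"
      by (rule sum.swap)
    finally show ?thesis by (simp add: cblinfun_simps scaleR_conv_of_real mult_ac)
  qed
  then have "(\<Sum>s\<in>signs n. ?Y s *\<^sub>V ?X s)
    = (\<Sum>s\<in>signs n. \<Sum>k=1..n. \<Sum>l=1..n. of_real (s k * s l) * (y k *\<^sub>V x l))"
    by (rule sum.cong[OF refl])
  also have "\<dots> = (\<Sum>k=1..n. \<Sum>l=1..n. \<Sum>s\<in>signs n. of_real (s k * s l) * (y k *\<^sub>V x l))"
    by (subst sum.swap, rule sum.cong[OF refl], rule sum.swap)
  also have "\<dots> = (\<Sum>k=1..n. \<Sum>l=1..n. of_real (\<Sum>s\<in>signs n. s k * s l) * (y k *\<^sub>V x l))"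
    by (simp only: of_real_sum sum_distrib_right)
  also have "\<dots> = (\<Sum>k=1..n. \<Sum>l=1..n. if k = l then 2 ^ n * (y k *\<^sub>V x l) else 0)"
    by (intro sum.cong refl) (auto simp: sum_signs_mult)
  also have "\<dots> = 2 ^ n * (\<Sum>k=1..n. y k *\<^sub>V x k)"
    by (simp add: sum_distrib_left)
  finally have eq: "(\<Sum>s\<in>signs n. ?Y s *\<^sub>V ?X s) = 2 ^ n * (\<Sum>k=1..n. y k *\<^sub>V x k)" .
  have "2 ^ n * norm (\<Sum>k=1..n. y k *\<^sub>V x k) = norm (\<Sum>s\<in>signs n. ?Y s *\<^sub>V ?X s)"
    unfolding eq by (simp only: norm_mult norm_power norm_numeral)
  also have "\<dots> \<le> (\<Sum>s\<in>signs n. norm (?X s) * norm (?Y s))"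
    by (rule order.trans[OF norm_sum sum_mono]) (subst mult.commute, rule norm_cblinfun)
  also have "\<dots> \<le> L2_set (\<lambda>s. norm (?X s)) (signs n) * L2_set (\<lambda>s. norm (?Y s)) (signs n)"
    using L2_set_mult_ineq[of "\<lambda>s. norm (?X s)" "\<lambda>s. norm (?Y s)" "signs n"] by simp
  also have "\<dots> = 2 ^ n * (rad_norm M \<epsilon> n x * rad_norm M \<epsilon> n y)"
  proof -
    have "L2_set (\<lambda>s. norm (\<Sum>k=1..n. s k *\<^sub>R w k)) (signs n) = rad_norm M \<epsilon> n w * sqrt (2 ^ n)"
      for w :: "nat \<Rightarrow> 'b::real_normed_vector"
    proof -
      have "L2_set (\<lambda>s. norm (\<Sum>k=1..n. s k *\<^sub>R w k)) (signs n) = sqrt ((rad_norm M \<epsilon> n w)\<^sup>2 * 2 ^ n)"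
        by (simp only: L2_set_def rad_norm_square)
      then show ?thesis using rad_norm_nonneg[of n w] by (simp add: real_sqrt_mult)
    qed
    note l2 = this
    show ?thesis using real_sqrt_mult_self[of "2 ^ n"] by (simp only: l2) (simp add: mult_ac)
  qed
  finally show ?thesis by (simp only: mult_le_cancel_left) simp
qed

text \<open>Absolute values of real parts can be removed by signs put on \<open>y\<close>, which
  leave \<open>rad_norm\<close> unchanged. Real and imaginary parts are treated separately, hence
  the factor 2.\<close>

lemma sum_norm_pairing_le:
  fixes x :: "nat \<Rightarrow> 'a::complex_normed_vector" and y :: "nat \<Rightarrow> 'a \<Rightarrow>\<^sub>C\<^sub>L complex"
  shows "(\<Sum>k=1..n. norm (y k *\<^sub>V x k)) \<le> 2 * (rad_norm M \<epsilon> n x * rad_norm M \<epsilon> n y)"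
proof -
  have sg: "(\<Sum>k=1..n. \<bar>p (y k *\<^sub>V x k)\<bar>) \<le> rad_norm M \<epsilon> n x * rad_norm M \<epsilon> n y"
    if p: "linear p" "\<And>z. \<bar>p z\<bar> \<le> norm z" for p :: "complex \<Rightarrow> real"
  proof -
    define \<omega> where "\<omega> k = (if p (y k *\<^sub>V x k) \<ge> 0 then 1 else - 1 :: real)" for k
    have "(\<Sum>k=1..n. \<bar>p (y k *\<^sub>V x k)\<bar>) = (\<Sum>k=1..n. p ((\<omega> k *\<^sub>R y k) *\<^sub>V x k))"
      by (intro sum.cong) (auto simp: \<omega>_def cblinfun_simps linear_neg[OF p(1)])
    also have "\<dots> = p (\<Sum>k=1..n. (\<omega> k *\<^sub>R y k) *\<^sub>V x k)" by (simp add: linear_sum[OF p(1)])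
    also have "\<dots> \<le> norm (\<Sum>k=1..n. (\<omega> k *\<^sub>R y k) *\<^sub>V x k)" using p(2) abs_le_D1 by blast
    also have "\<dots> \<le> rad_norm M \<epsilon> n x * rad_norm M \<epsilon> n (\<lambda>k. \<omega> k *\<^sub>R y k)"
      by (rule norm_sum_pairing_le)
    also have "rad_norm M \<epsilon> n (\<lambda>k. \<omega> k *\<^sub>R y k) = rad_norm M \<epsilon> n y"
      by (rule rad_norm_signs) (simp add: \<omega>_def)
    finally show ?thesis .
  qed
  have "(\<Sum>k=1..n. norm (y k *\<^sub>V x k))
    \<le> (\<Sum>k=1..n. \<bar>Re (y k *\<^sub>V x k)\<bar> + \<bar>Im (y k *\<^sub>V x k)\<bar>)"
    by (intro sum_mono cmod_le)
  also have "\<dots> \<le> 2 * (rad_norm M \<epsilon> n x * rad_norm M \<epsilon> n y)"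
    using sg[of Re] sg[of Im]
    by (simp add: sum.distrib bounded_linear.linear bounded_linear_Re bounded_linear_Im abs_Re_le_cmod abs_Im_le_cmod)
  finally show ?thesis .
qed

end

text \<open>Near-maximisers may be chosen independently for each \<open>i\<close>, so a bound for
  all choices of the points bounds the sum of the suprema. It is made for R-boundedness, which
  admits a different resolvent at each index.\<close>

lemma sum_SUP_le:
  fixes f :: "'i \<Rightarrow> 'b \<Rightarrow> real"
  assumes "finite I" "Z \<noteq> {}" "\<And>i. i \<in> I \<Longrightarrow> bdd_above (f i ` Z)"
    and "\<And>z. (\<And>i. i \<in> I \<Longrightarrow> z i \<in> Z) \<Longrightarrow> (\<Sum>i\<in>I. f i (z i)) \<le> K"
  shows "(\<Sum>i\<in>I. SUP z\<in>Z. f i z) \<le> K"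
proof (rule field_le_epsilon)
  fix e :: real assume e: "e > 0"
  define d where "d = e / (1 + card I)"
  have d: "d > 0" "card I * d \<le> e" using e by (auto simp: d_def field_simps)
  have "\<exists>z\<in>Z. (SUP z\<in>Z. f i z) - d < f i z" if "i \<in> I" for i
    using less_cSUP_iff[OF assms(2) assms(3)[OF that], of "(SUP z\<in>Z. f i z) - d"] d by simp
  then obtain z where z: "\<And>i. i \<in> I \<Longrightarrow> z i \<in> Z \<and> (SUP z\<in>Z. f i z) - d < f i (z i)" by metis
  have "(\<Sum>i\<in>I. SUP z\<in>Z. f i z) \<le> (\<Sum>i\<in>I. f i (z i) + d)"
  proof (rule sum_mono)
    show "(SUP z\<in>Z. f i z) \<le> f i (z i) + d" if "i \<in> I" for i
      using z[OF that] by linarith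
  qed
  also have "\<dots> = (\<Sum>i\<in>I. f i (z i)) + card I * d" by (simp add: sum.distrib)
  also have "\<dots> \<le> K + e" using assms(4)[of z] z d by (intro add_mono) auto
  finally show "(\<Sum>i\<in>I. SUP z\<in>Z. f i z) \<le> K + e" .
qed

section \<open>The boundary of a polygonal domain\<close>

text \<open>The radial function of the domain, that is the reciprocal of its Minkowski gauge in the
  direction \<open>w\<close>; it gives the polar equation of the boundary.\<close>

definition radial :: "complex set \<Rightarrow> real \<Rightarrow> complex \<Rightarrow> real"
  where "radial E u w = Sup {\<rho>. 0 \<le> \<rho> \<and> complex_of_real \<rho> * w \<in> polygonal E u}"

lemma boundary_path_radial: "boundary_path E u t = of_real (radial E u (cis (2 * pi * t))) * cis (2 * pi * t)"
  by (simp add: boundary_path_def radial_def)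

lemma convex_polygonal: "convex (polygonal E u)"
  and open_polygonal: "open (polygonal E u)"
  by (simp_all add: polygonal_def convex_interior)

lemma polygonal_mono: "u \<le> v \<Longrightarrow> polygonal E u \<subseteq> polygonal E v"
  unfolding polygonal_def by (intro interior_mono hull_mono Un_mono subset_ball subset_refl)

lemma polygonal_subset_ball:
  assumes "E \<subseteq> sphere 0 1" "u \<le> 1"
  shows "polygonal E u \<subseteq> ball 0 1"
proof -
  have "convex hull (E \<union> ball 0 u) \<subseteq> cball 0 1"
    using assms by (intro hull_minimal) auto
  then show ?thesis unfolding polygonal_def by (metis interior_cball interior_mono)
qed

lemma ball_subset_polygonal: "ball 0 u \<subseteq> polygonal E u"
  unfolding polygonal_def by (intro interior_maximal open_ball) (meson hull_subset le_sup_iff)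

lemma closure_polygonal:
  assumes "0 < u"
  shows "closure (polygonal E u) = closure (convex hull (E \<union> ball 0 u))"
proof -
  have "0 \<in> polygonal E u" using ball_subset_polygonal[of u E] assms by auto
  then show ?thesis
    unfolding polygonal_def by (intro convex_closure_interior) auto
qed

lemma scaled_mem_polygonal:
  assumes "0 < u" "z \<in> closure (polygonal E u)" "0 \<le> t" "t < 1"
  shows "of_real t * z \<in> polygonal E u"
proof -
  have "0 \<in> polygonal E u" using ball_subset_polygonal[of u E] assms by auto
  then have "z - (1 - t) *\<^sub>R (z - 0) \<in> interior (convex hull (E \<union> ball 0 u))"
    using assms unfolding closure_polygonal[OF assms(1)]
    by (intro mem_interior_closure_convex_shrink) (auto simp: polygonal_def)
  moreover have "z - (1 - t) *\<^sub>R (z - 0) = of_real t * z"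
    by (simp add: scaleR_conv_of_real algebra_simps)
  ultimately show ?thesis by (simp add: polygonal_def)
qed

text \<open>A half-plane tangent to the circle of radius \<open>u\<close> that contains the disc and
  \<open>E\<close> contains their convex hull and its closure.\<close>

lemma polygonal_halfplane:
  assumes "0 < u" "norm n = 1" "\<And>\<eta>. \<eta> \<in> E \<Longrightarrow> Re (cnj n * \<eta>) \<le> u"
    and z: "z \<in> closure (polygonal E u)"
  shows "Re (cnj n * z) \<le> u"
proof -
  have eq: "Re (cnj n * z) = n \<bullet> z" for z by (simp add: inner_complex_def)
  have "E \<union> ball 0 u \<subseteq> {z. n \<bullet> z \<le> u}"
  proof (intro Un_least subsetI; simp)
    fix z :: complex assume "norm z < u"
    then show "n \<bullet> z \<le> u" using norm_cauchy_schwarz[of n z] assms(2) by simp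
  qed (use assms(3) eq in auto)
  then have "convex hull (E \<union> ball 0 u) \<subseteq> {z. n \<bullet> z \<le> u}"
    by (intro hull_minimal convex_halfspace_le)
  then have "closure (convex hull (E \<union> ball 0 u)) \<subseteq> {z. n \<bullet> z \<le> u}"
    by (intro closure_minimal closed_halfspace_le)
  then have "n \<bullet> z \<le> u" using z unfolding closure_polygonal[OF assms(1)] by blast
  then show ?thesis by (simp only: eq)
qed

lemma radial_unique:
  assumes "0 < q" "\<And>\<rho>. 0 \<le> \<rho> \<Longrightarrow> \<rho> < q \<Longrightarrow> of_real \<rho> * w \<in> polygonal E u"
    and "\<And>\<rho>. of_real \<rho> * w \<in> closure (polygonal E u) \<Longrightarrow> \<rho> \<le> q"
  shows "radial E u w = q"
  unfolding radial_def
proof (rule cSup_eq_non_empty)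
  show "{\<rho>. 0 \<le> \<rho> \<and> complex_of_real \<rho> * w \<in> polygonal E u} \<noteq> {}"
    using assms(1) assms(2)[of 0] by auto
  show "x \<le> q" if "x \<in> {\<rho>. 0 \<le> \<rho> \<and> complex_of_real \<rho> * w \<in> polygonal E u}" for x
    using that assms(3) closure_subset by blast
  show "q \<le> y" if "\<And>x. x \<in> {\<rho>. 0 \<le> \<rho> \<and> complex_of_real \<rho> * w \<in> polygonal E u} \<Longrightarrow> x \<le> y" for y
  proof (rule ccontr)
    assume "\<not> q \<le> y"
    moreover have "0 \<le> y" using that[of 0] assms(1) assms(2)[of 0] by simp
    ultimately show False using that[of "(y + q) / 2"] assms(2)[of "(y + q) / 2"] by simp
  qed
qed

text \<open>The condition says that the angle between two distinct points of \<open>E\<close> exceeds twice the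
  opening angle \<open>arccos u\<close> of the tangents drawn from them to the circle of radius \<open>u\<close>.\<close>

lemma large_enough_separated:
  assumes "large_enough E u" "0 < u" "E \<subseteq> sphere 0 1" "\<zeta> \<in> E" "\<eta> \<in> E" "\<zeta> \<noteq> \<eta>"
  shows "Re (cnj \<zeta> * \<eta>) < 2 * u\<^sup>2 - 1"
proof -
  obtain z where z: "z \<in> closed_segment \<zeta> \<eta>" "norm z < u"
    using assms by (fastforce simp: large_enough_def)
  then obtain l where l: "0 \<le> l" "l \<le> 1" "z = (1 - l) *\<^sub>R \<zeta> + l *\<^sub>R \<eta>"
    by (auto simp: in_segment)
  let ?c = "\<zeta> \<bullet> \<eta>"
  have n1: "\<zeta> \<bullet> \<zeta> = 1" "\<eta> \<bullet> \<eta> = 1"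
    using assms by (auto simp: dot_square_norm)
  have "norm \<zeta> = 1" "norm \<eta> = 1" using assms by auto
  then have c1: "?c \<le> 1" using norm_cauchy_schwarz[of \<zeta> \<eta>] by simp
  have "(norm z)\<^sup>2 = (1 - l)\<^sup>2 + l\<^sup>2 + 2 * l * (1 - l) * ?c"
    unfolding dot_square_norm[symmetric] l(3)
    by (simp add: inner_simps n1 inner_commute[of \<eta> \<zeta>] power2_eq_square algebra_simps)
  \<comment> \<open>Completing the square: the minimum over \<open>l\<close> is attained at the
    midpoint of the segment and equals the squared cosine of half the angle between
    \<open>\<zeta>\<close> and \<open>\<eta>\<close>.\<close>
  also have "\<dots> = (1 + ?c) / 2 + (1 - ?c) * ((2 * l - 1)\<^sup>2 / 2)"
    by (simp add: power2_eq_square field_simps)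
  also have "\<dots> \<ge> (1 + ?c) / 2" using c1 by simp
  finally have "(1 + ?c) / 2 \<le> (norm z)\<^sup>2" .
  moreover have "(norm z)\<^sup>2 < u\<^sup>2" using z by (intro power_strict_mono) auto
  ultimately show ?thesis by (simp add: inner_complex_def)
qed

lemma Re_Im_unit: "norm \<zeta> = 1 \<Longrightarrow> norm w = 1 \<Longrightarrow> (Re (cnj \<zeta> * w))\<^sup>2 + (Im (cnj \<zeta> * w))\<^sup>2 = 1"
  using cmod_power2[of "cnj \<zeta> * w"] by (simp add: norm_mult)

text \<open>For unit \<open>\<zeta>\<close> and \<open>k = sqrt (1 - u * u)\<close> this is the unit
  normal of the tangent from \<open>\<zeta>\<close> to the circle of radius \<open>u\<close> on the
  side of \<open>w\<close>; \<open>u\<close> times it is the point of contact.\<close>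

definition tangent_normal :: "real \<Rightarrow> real \<Rightarrow> complex \<Rightarrow> complex \<Rightarrow> complex"
  where "tangent_normal u k \<zeta> w
    = \<zeta> * Complex u (if 0 \<le> Im (cnj \<zeta> * w) then k else - k)"

lemma Re_tangent_normal:
  "Re (cnj (tangent_normal u k \<zeta> w) * w)
    = u * Re (cnj \<zeta> * w) + k * \<bar>Im (cnj \<zeta> * w)\<bar>"
  by (simp add: tangent_normal_def algebra_simps)

locale polygonal_boundary =
  fixes E :: "complex set" and u :: real
  assumes finite_E: "finite E" and E_nonempty: "E \<noteq> {}" and E_sphere: "E \<subseteq> sphere 0 1"
    and u: "0 < u" "u < 1" and large: "large_enough E u"
begin

lemma norm_E: "\<zeta> \<in> E \<Longrightarrow> norm \<zeta> = 1"
  using E_sphere by auto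

definition \<kappa> :: real where "\<kappa> = sqrt (1 - u\<^sup>2)"

lemma kappa: "0 < \<kappa>" "\<kappa>\<^sup>2 = 1 - u\<^sup>2"
proof -
  have "u\<^sup>2 < 1" using u by (simp add: power_less_one_iff)
  then show "0 < \<kappa>" "\<kappa>\<^sup>2 = 1 - u\<^sup>2" by (auto simp: \<kappa>_def)
qed

text \<open>Polar equation of the two tangent segments from \<open>\<zeta>\<close> to the circle of radius \<open>u\<close>.\<close>

definition cap :: "complex \<Rightarrow> complex \<Rightarrow> real"
  where "cap \<zeta> w = u / (u * Re (cnj \<zeta> * w) + \<kappa> * \<bar>Im (cnj \<zeta> * w)\<bar>)"

text \<open>Put \<open>u = cos \<psi>\<close>, \<open>\<kappa> = sin \<psi>\<close>,
  \<open>a = cos \<theta>\<close>, \<open>b = sin \<theta>\<close> with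
  \<open>0 \<le> \<theta> < \<psi> < pi / 2\<close>. The claims are then trigonometric; in
  particular \<open>u * a + \<kappa> * b = cos (\<psi> - \<theta>)\<close> lies between
  \<open>cos \<psi>\<close> and \<open>1\<close>.\<close>

lemma in_cap:
  assumes "\<zeta> \<in> E" "norm w = 1" "u < Re (cnj \<zeta> * w)"
  defines "a \<equiv> Re (cnj \<zeta> * w)" and "b \<equiv> \<bar>Im (cnj \<zeta> * w)\<bar>"
  shows "u * b \<le> \<kappa> * a" "u \<le> u * a + \<kappa> * b" "b \<le> \<kappa>" "a \<le> 1" "u * a + \<kappa> * b \<le> 1"
proof -
  have ab: "a\<^sup>2 + b\<^sup>2 = 1" "0 \<le> b"
    using Re_Im_unit[OF norm_E[OF assms(1)] assms(2)] by (simp_all add: a_def b_def)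
  have au: "u < a" using assms by simp
  have "u\<^sup>2 \<le> a\<^sup>2" using au u by (intro power_mono) auto
  then have "b\<^sup>2 \<le> \<kappa>\<^sup>2" using ab kappa by simp
  then show bk: "b \<le> \<kappa>" using power2_le_imp_le kappa(1) less_imp_le by blast
  show "u * b \<le> \<kappa> * a" using bk au u ab kappa by (smt (verit) mult.commute mult_mono)
  have "a\<^sup>2 \<le> 1" using ab by (smt (verit) zero_le_power2)
  then show a1: "a \<le> 1" by (simp add: power_le_one_iff abs_square_le_1)
  have "b\<^sup>2 = (1 - a) * (1 + a)" using ab by (simp add: power2_eq_square algebra_simps)
  then have "u * (1 - a) * (1 + a) = u * b\<^sup>2" by simp
  also have "\<dots> = (u * b) * b" by (simp add: power2_eq_square)
  also have "\<dots> \<le> (\<kappa> * b) * (1 + a)"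
  proof -
    have "u * b \<le> \<kappa> * a" by fact
    then have "(u * b) * b \<le> \<kappa> * a * b" using ab by (intro mult_right_mono) auto
    also have "\<dots> \<le> (\<kappa> * b) * (1 + a)" using kappa ab by (simp add: algebra_simps)
    finally show ?thesis .
  qed
  finally have "u * (1 - a) \<le> \<kappa> * b"
    using au u by (simp only: mult_le_cancel_right)
  then show "u \<le> u * a + \<kappa> * b" by (simp add: algebra_simps)
  have "(u * a + \<kappa> * b)\<^sup>2 + (u * b - \<kappa> * a)\<^sup>2 = (u\<^sup>2 + \<kappa>\<^sup>2) * (a\<^sup>2 + b\<^sup>2)"
    by (simp add: power2_eq_square algebra_simps)
  also have "\<dots> = 1" using ab kappa by simp
  finally have "(u * a + \<kappa> * b)\<^sup>2 \<le> 1" by (smt (verit) zero_le_power2)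
  then show "u * a + \<kappa> * b \<le> 1" using abs_square_le_1[of "u * a + \<kappa> * b"] by linarith
qed

text \<open>For the upper bound, the tangent half-plane on the side of \<open>w\<close> contains the
  whole closed domain, because the other points of \<open>E\<close> are far enough from
  \<open>\<zeta>\<close>. For membership, the point is a convex combination of
  \<open>\<zeta>\<close> and the point of contact of the tangent.\<close>

lemma radial_cap_aux:
  assumes "\<zeta> \<in> E" "norm w = 1" "u < Re (cnj \<zeta> * w)"
  shows "0 < cap \<zeta> w" "of_real (cap \<zeta> w) * w \<in> closure (polygonal E u)"
    "\<And>\<rho>. of_real \<rho> * w \<in> closure (polygonal E u) \<Longrightarrow> \<rho> \<le> cap \<zeta> w"
proof -
  define a b where "a = Re (cnj \<zeta> * w)" and "b = \<bar>Im (cnj \<zeta> * w)\<bar>"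
  define D where "D = u * a + \<kappa> * b"
  note ic = in_cap[OF assms, folded a_def b_def]
  have ab: "a\<^sup>2 + b\<^sup>2 = 1" "0 \<le> b" "u < a"
    using Re_Im_unit[OF norm_E[OF assms(1)] assms(2)] assms by (simp_all add: a_def b_def)
  have D: "0 < D" "u \<le> D" using ic u by (simp_all add: D_def)
  have cap: "cap \<zeta> w = u / D" by (simp add: cap_def D_def a_def b_def)
  show "0 < cap \<zeta> w" using D u by (simp add: cap)
  define n where "n = tangent_normal u \<kappa> \<zeta> w"
  have nn: "norm n = 1"
  proof -
    have "norm (Complex u v) = 1" if "v\<^sup>2 = \<kappa>\<^sup>2" for v
      unfolding cmod_def using that kappa(2) by simp
    then show ?thesis
      using norm_E[OF assms(1)] by (simp add: n_def tangent_normal_def norm_mult)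
  qed
  have n\<zeta>: "Re (cnj n * \<eta>) = u * Re (cnj \<zeta> * \<eta>)
      + (if 0 \<le> Im (cnj \<zeta> * w) then \<kappa> else - \<kappa>) * Im (cnj \<zeta> * \<eta>)" for \<eta>
    by (simp add: n_def tangent_normal_def algebra_simps)
  have nE: "Re (cnj n * \<eta>) \<le> u" if "\<eta> \<in> E" for \<eta>
  proof (cases "\<eta> = \<zeta>")
    case True
    have "cnj \<zeta> * \<zeta> = 1" using norm_E[OF assms(1)] complex_norm_square[of \<zeta>] by (simp add: mult.commute)
    then show ?thesis unfolding True n\<zeta> by simp
  next
    case False
    define c d where "c = Re (cnj \<zeta> * \<eta>)" and "d = \<bar>Im (cnj \<zeta> * \<eta>)\<bar>"
    have cd: "c\<^sup>2 + d\<^sup>2 = 1" "0 \<le> d"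
      using Re_Im_unit[OF norm_E[OF assms(1)] norm_E[OF that]] by (simp_all add: c_def d_def)
    have c: "c < 2 * u\<^sup>2 - 1"
      unfolding c_def using False by (intro large_enough_separated[OF large u(1) E_sphere assms(1) that]) auto
    have "d\<^sup>2 \<le> 1" "c\<^sup>2 \<le> 1" using cd by (smt (verit) zero_le_power2)+
    then have c1: "c \<le> 1" by (simp add: abs_square_le_1)
    \<comment> \<open>After squaring and removing one factor \<open>1 - c\<close>, the inequality
      \<open>(1 - u * u) * (1 + c) \<le> u * u * (1 - c)\<close> is a form of the separation
      \<open>c < 2 * u * u - 1\<close>.\<close>
    have "(\<kappa> * d)\<^sup>2 \<le> (u * (1 - c))\<^sup>2"
    proof -
      have "(\<kappa> * d)\<^sup>2 = (1 - u\<^sup>2) * (1 + c) * (1 - c)"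
        using cd kappa by (simp add: power_mult_distrib) (simp add: power2_eq_square algebra_simps)
      also have "\<dots> \<le> u\<^sup>2 * (1 - c) * (1 - c)"
        using c c1 by (intro mult_right_mono) (auto simp: algebra_simps)
      finally show ?thesis by (simp add: power2_eq_square algebra_simps)
    qed
    then have "\<kappa> * d \<le> u * (1 - c)" by (rule power2_le_imp_le) (use u c1 in auto)
    moreover have "Re (cnj n * \<eta>) \<le> u * c + \<kappa> * d"
    proof -
      have "(if P then \<kappa> else - \<kappa>) * x \<le> \<kappa> * \<bar>x\<bar>" for P and x :: real
        using mult_left_mono[of x "\<bar>x\<bar>" \<kappa>] mult_left_mono[of "- x" "\<bar>x\<bar>" \<kappa>] kappa(1)
        by (cases P) simp_all
      then show ?thesis unfolding n\<zeta> c_def d_def by (intro add_left_mono)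
    qed
    ultimately show ?thesis by (simp add: algebra_simps)
  qed
  show "\<rho> \<le> cap \<zeta> w" if "of_real \<rho> * w \<in> closure (polygonal E u)" for \<rho>
  proof -
    have "Re (cnj n * (of_real \<rho> * w)) \<le> u" by (rule polygonal_halfplane[OF u(1) nn nE that])
    moreover have "Re (cnj n * (of_real \<rho> * w)) = \<rho> * D"
    proof -
      have "Re (cnj n * w) = D" unfolding n_def D_def a_def b_def by (rule Re_tangent_normal)
      moreover have "Re (cnj n * (of_real \<rho> * w)) = \<rho> * Re (cnj n * w)" by (simp add: algebra_simps)
      ultimately show ?thesis by (simp only:)
    qed
    ultimately show ?thesis using D by (simp add: cap field_simps)
  qed
  \<comment> \<open>The coefficient is read off from the component orthogonal to
    \<open>\<zeta>\<close>, where \<open>l * u * \<kappa> = (u / D) * b\<close> has to hold.\<close>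
  define l where "l = b / (\<kappa> * D)"
  have "b * u\<^sup>2 \<le> \<kappa> * u * a" using ic(1) u by (simp add: power2_eq_square mult_ac)
  moreover have "\<kappa> * D = \<kappa> * u * a + \<kappa>\<^sup>2 * b" by (simp add: D_def power2_eq_square algebra_simps)
  then have "\<kappa> * D = \<kappa> * u * a + b - b * u\<^sup>2" unfolding kappa(2) by (simp add: algebra_simps)
  ultimately have "b \<le> \<kappa> * D" by linarith
  then have l: "0 \<le> l" "l \<le> 1" using kappa D ab by (auto simp: l_def divide_simps)
  have "of_real u * n \<in> closure (polygonal E u)"
  proof -
    have "of_real u * n \<in> cball 0 u" using u nn by (simp add: norm_mult)
    then have "of_real u * n \<in> closure (ball 0 u)" using u by simp
    then show ?thesis using closure_mono[OF ball_subset_polygonal] by blast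
  qed
  moreover have "\<zeta> \<in> closure (polygonal E u)"
    unfolding closure_polygonal[OF u(1)] using assms(1)
    by (meson UnI1 closure_subset hull_inc subsetD)
  ultimately have "(1 - l) *\<^sub>R \<zeta> + l *\<^sub>R (of_real u * n) \<in> closure (polygonal E u)"
    using l by (intro convexD_alt convex_closure convex_polygonal) auto
  moreover have "(1 - l) *\<^sub>R \<zeta> + l *\<^sub>R (of_real u * n) = of_real (cap \<zeta> w) * w"
  proof -
    define \<sigma> :: real where "\<sigma> = (if 0 \<le> Im (cnj \<zeta> * w) then 1 else - 1)"
    have "cnj \<zeta> * w = Complex a (\<sigma> * b)"
      by (auto simp: a_def b_def \<sigma>_def complex_eq_iff)
    moreover have "\<zeta> * cnj \<zeta> = 1" using norm_E[OF assms(1)] complex_norm_square[of \<zeta>] by simp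
    ultimately have w: "w = \<zeta> * Complex a (\<sigma> * b)" by (metis mult.assoc mult_1)
    have n: "n = \<zeta> * Complex u (\<sigma> * \<kappa>)" by (simp add: n_def tangent_normal_def \<sigma>_def)
    have 1: "1 - l + l * u\<^sup>2 = u / D * a"
    proof -
      have "1 - l + l * u\<^sup>2 = 1 - l * \<kappa>\<^sup>2" unfolding kappa(2) by (simp add: algebra_simps)
      also have "l * \<kappa>\<^sup>2 = \<kappa> * b / D" using kappa(1) D by (simp add: l_def power2_eq_square)
      also have "1 - \<kappa> * b / D = (D - \<kappa> * b) / D" using D by (simp add: diff_divide_distrib)
      also have "\<dots> = u / D * a" by (simp add: D_def)
      finally show ?thesis .
    qed
    have 2: "l * u * \<kappa> = u / D * b" using kappa(1) D by (simp add: l_def)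
    have "(1 - l) *\<^sub>R \<zeta> + l *\<^sub>R (of_real u * n)
        = \<zeta> * Complex (1 - l + l * u\<^sup>2) (\<sigma> * (l * u * \<kappa>))"
      by (simp add: n complex_eq_iff power2_eq_square algebra_simps)
    also have "\<dots> = of_real (cap \<zeta> w) * (\<zeta> * Complex a (\<sigma> * b))"
      unfolding 1 2 cap by (simp add: complex_eq_iff algebra_simps add_divide_distrib diff_divide_distrib)
    finally show ?thesis using w by simp
  qed
  ultimately show "of_real (cap \<zeta> w) * w \<in> closure (polygonal E u)" by simp
qed

lemma radial_cap:
  assumes "\<zeta> \<in> E" "norm w = 1" "u < Re (cnj \<zeta> * w)"
  shows "radial E u w = cap \<zeta> w"
proof (rule radial_unique[OF radial_cap_aux(1)[OF assms] _ radial_cap_aux(3)[OF assms]])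
  fix \<rho> :: real assume "0 \<le> \<rho>" "\<rho> < cap \<zeta> w"
  then have "of_real (\<rho> / cap \<zeta> w) * (of_real (cap \<zeta> w) * w) \<in> polygonal E u"
    using radial_cap_aux[OF assms] by (intro scaled_mem_polygonal u) (auto simp: field_simps)
  then show "of_real \<rho> * w \<in> polygonal E u" using radial_cap_aux(1)[OF assms] by simp
qed

text \<open>Here the supporting half-plane has the normal \<open>w\<close> itself.\<close>

lemma radial_arc_aux:
  assumes "norm w = 1" "\<And>\<zeta>. \<zeta> \<in> E \<Longrightarrow> Re (cnj \<zeta> * w) \<le> u"
  shows "of_real u * w \<in> closure (polygonal E u)"
    "\<And>\<rho>. of_real \<rho> * w \<in> closure (polygonal E u) \<Longrightarrow> \<rho> \<le> u"
proof -
  have "of_real u * w \<in> closure (ball 0 u)" using u assms by (simp add: norm_mult)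
  then show "of_real u * w \<in> closure (polygonal E u)"
    using closure_mono[OF ball_subset_polygonal] by blast
  fix \<rho> assume "of_real \<rho> * w \<in> closure (polygonal E u)"
  moreover have "Re (cnj w * \<zeta>) \<le> u" if "\<zeta> \<in> E" for \<zeta>
    using assms(2)[OF that] by (simp add: algebra_simps)
  ultimately have "Re (cnj w * (of_real \<rho> * w)) \<le> u"
    using polygonal_halfplane[OF u(1) assms(1)] by blast
  moreover have "cnj w * (of_real \<rho> * w) = of_real \<rho>"
    using assms(1) complex_norm_square[of w] by (simp add: mult_ac)
  ultimately show "\<rho> \<le> u" by simp
qed

lemma radial_arc:
  assumes "norm w = 1" "\<And>\<zeta>. \<zeta> \<in> E \<Longrightarrow> Re (cnj \<zeta> * w) \<le> u"
  shows "radial E u w = u"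
proof (rule radial_unique[OF u(1) _ radial_arc_aux(2)[OF assms]])
  fix \<rho> :: real assume "0 \<le> \<rho>" "\<rho> < u"
  then show "of_real \<rho> * w \<in> polygonal E u"
    using ball_subset_polygonal[of u E] assms(1) by (auto simp: norm_mult)
qed

lemma radial_cases:
  assumes "norm w = 1"
  obtains (cap) \<zeta> where "\<zeta> \<in> E" "u < Re (cnj \<zeta> * w)" "radial E u w = cap \<zeta> w"
  | (arc) "\<And>\<zeta>. \<zeta> \<in> E \<Longrightarrow> Re (cnj \<zeta> * w) \<le> u" "radial E u w = u"
proof (cases "\<exists>\<zeta>\<in>E. u < Re (cnj \<zeta> * w)")
  case True
  then show ?thesis using radial_cap[OF _ assms] cap by blast
next
  case False
  then have le: "\<And>\<zeta>. \<zeta> \<in> E \<Longrightarrow> Re (cnj \<zeta> * w) \<le> u" by (auto simp: not_less)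
  show ?thesis by (rule arc[OF le radial_arc[OF assms le]])
qed

lemma radial_in_closure:
  assumes "norm w = 1"
  shows "of_real (radial E u w) * w \<in> closure (polygonal E u)"
proof (rule radial_cases[OF assms])
  fix \<zeta> assume "\<zeta> \<in> E" "u < Re (cnj \<zeta> * w)" "radial E u w = cap \<zeta> w"
  then show ?thesis using radial_cap_aux(2)[OF _ assms] by simp
next
  assume "\<And>\<zeta>. \<zeta> \<in> E \<Longrightarrow> Re (cnj \<zeta> * w) \<le> u" and eq: "radial E u w = u"
  from radial_arc_aux(1)[OF assms this(1)] show ?thesis by (simp only: eq)
qed

lemma radial_max:
  assumes "norm w = 1" "of_real \<rho> * w \<in> closure (polygonal E u)"
  shows "\<rho> \<le> radial E u w"
proof (rule radial_cases[OF assms(1)])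
  fix \<zeta> assume "\<zeta> \<in> E" "u < Re (cnj \<zeta> * w)" "radial E u w = cap \<zeta> w"
  then show ?thesis using radial_cap_aux(3)[OF _ assms(1) _ assms(2)] by simp
next
  assume "\<And>\<zeta>. \<zeta> \<in> E \<Longrightarrow> Re (cnj \<zeta> * w) \<le> u" and eq: "radial E u w = u"
  from radial_arc_aux(2)[OF assms(1) this(1) assms(2)] show ?thesis by (simp only: eq)
qed

lemma radial_bounds: "norm w = 1 \<Longrightarrow> u \<le> radial E u w" "norm w = 1 \<Longrightarrow> radial E u w \<le> 1"
proof -
  assume w: "norm w = 1"
  have "of_real u * w \<in> closure (ball 0 u)" using u w by (simp add: norm_mult)
  then have "of_real u * w \<in> closure (polygonal E u)"
    using closure_mono[OF ball_subset_polygonal] by blast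
  then show ge: "u \<le> radial E u w" by (rule radial_max[OF w])
  have "closure (polygonal E u) \<subseteq> cball 0 1"
    using polygonal_subset_ball[OF E_sphere, of u] u by (intro closure_minimal) auto
  then show "radial E u w \<le> 1" using radial_in_closure[OF w] ge u w by (auto simp: norm_mult)
qed

lemma mem_polygonal:
  "norm w = 1 \<Longrightarrow> 0 \<le> \<rho> \<Longrightarrow> \<rho> < radial E u w \<Longrightarrow> of_real \<rho> * w \<in> polygonal E u"
  using scaled_mem_polygonal[OF u(1) radial_in_closure, of w "\<rho> / radial E u w"] u
    radial_bounds(1)[of w] by auto

lemma radial_at: "\<zeta> \<in> E \<Longrightarrow> radial E u \<zeta> = 1"
proof -
  assume z: "\<zeta> \<in> E"
  have "cnj \<zeta> * \<zeta> = 1" using norm_E[OF z] complex_norm_square[of \<zeta>] by (simp add: mult.commute)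
  then show ?thesis using radial_cap[OF z norm_E[OF z]] u by (simp add: cap_def)
qed

lemma dist_unit: "norm \<zeta> = 1 \<Longrightarrow> norm w = 1 \<Longrightarrow> (norm (\<zeta> - w))\<^sup>2 = 2 * (1 - Re (cnj \<zeta> * w))"
proof -
  assume "norm \<zeta> = 1" "norm w = 1"
  then have "(norm \<zeta>)\<^sup>2 = 1" "(norm w)\<^sup>2 = 1" by simp_all
  then show ?thesis unfolding cmod_power2 by (simp add: power2_eq_square algebra_simps)
qed

text \<open>Mixing the boundary point in direction \<open>w\<close> with a point of the closed disc
  of radius \<open>u\<close> gives a point on the ray of \<open>w'\<close>. Convexity then bounds
  \<open>radial\<close> at \<open>w'\<close> from below.\<close>

lemma radial_lipschitz_aux:
  assumes "norm w = 1" "norm w' = 1"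
  shows "radial E u w - radial E u w' \<le> norm (w - w') / u"
proof -
  define d where "d = norm (w - w')"
  define R where "R = radial E u w"
  have d: "0 \<le> d" and R: "u \<le> R" "R \<le> 1"
    using radial_bounds[OF assms(1)] by (simp_all add: d_def R_def)
  \<comment> \<open>With this \<open>t\<close> the \<open>w\<close>-components of the two points
    cancel, and \<open>(1 - t) * R\<close> times \<open>w'\<close> remains.\<close>
  define t where "t = d / (u + d)"
  have t: "0 \<le> t" "t \<le> 1" "1 - t = u / (u + d)" using d u by (simp_all add: t_def field_simps)
  show ?thesis
  proof (cases "d = 0")
    case True then show ?thesis by (simp add: d_def)
  next
    case False
    then have d0: "0 < d" "0 < t" using d u by (simp_all add: t_def)
    define v where "v = of_real (R / d) * (w' - w)"
    have "norm (w' - w) = d" by (simp add: d_def norm_minus_commute)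
    then have "norm v = \<bar>R / d\<bar> * d" unfolding v_def by (simp only: norm_mult norm_of_real)
    then have "norm v \<le> 1" using R u d0 by simp
    then have "of_real u * v \<in> closure (ball 0 u)" using u by (simp add: norm_mult mult_left_le)
    then have "of_real u * v \<in> closure (polygonal E u)"
      using closure_mono[OF ball_subset_polygonal] by blast
    then have mem: "(1 - t) *\<^sub>R (of_real R * w) + t *\<^sub>R (of_real u * v) \<in> closure (polygonal E u)"
      unfolding R_def using t radial_in_closure[OF assms(1)]
      by (intro convexD_alt convex_closure convex_polygonal) auto
    have "t * (u * (R / d)) = (1 - t) * R" using d0 by (simp add: t(3)) (simp add: t_def)
    moreover have "t *\<^sub>R (of_real u * v) = of_real (t * (u * (R / d))) * (w' - w)"
      by (simp only: v_def scaleR_conv_of_real of_real_mult mult.assoc)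
    ultimately have "t *\<^sub>R (of_real u * v) = of_real ((1 - t) * R) * (w' - w)"
      by (simp only:)
    then have eq: "(1 - t) *\<^sub>R (of_real R * w) + t *\<^sub>R (of_real u * v) = of_real ((1 - t) * R) * w'"
      by (simp add: scaleR_conv_of_real algebra_simps)
    have "(1 - t) * R \<le> radial E u w'" using radial_max[OF assms(2)] mem unfolding eq by blast
    then have "R - radial E u w' \<le> t * R" by (simp add: algebra_simps)
    also have "\<dots> \<le> t" using R t by (simp add: mult_left_le)
    also have "\<dots> \<le> d / u" using d u by (simp add: t_def frac_le)
    finally show ?thesis by (simp add: R_def d_def)
  qed
qed

lemma radial_lipschitz:
  "norm w = 1 \<Longrightarrow> norm w' = 1 \<Longrightarrow> \<bar>radial E u w - radial E u w'\<bar> \<le> norm (w - w') / u"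
  using radial_lipschitz_aux[of w w'] radial_lipschitz_aux[of w' w] by (simp add: norm_minus_commute abs_le_iff)

text \<open>On a cap the boundary is a segment that leaves the unit circle at a positive angle, so
  the gap to the circle is at least linear in the distance to \<open>E\<close>; on an arc the gap is
  the constant \<open>1 - u\<close>.\<close>

lemma one_minus_radial_ge:
  "\<exists>k>0. \<forall>w. norm w = 1 \<longrightarrow> k * infdist w E \<le> 1 - radial E u w"
proof -
  \<comment> \<open>The two terms serve the two cases: on a cap
    \<open>infdist w E \<le> 2 * b\<close> and the gap is at least
    \<open>\<kappa> * b / (1 + u)\<close>, on an arc \<open>infdist w E \<le> 2\<close> and the gap
    is \<open>1 - u\<close>.\<close>
  define k where "k = min (\<kappa> / 2 / (1 + u)) ((1 - u) / 2)"
  have k0: "0 < k" "k \<le> \<kappa> / 2 / (1 + u)" "k \<le> (1 - u) / 2"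
    using u kappa(1) by (simp_all only: k_def min.cobounded1 min.cobounded2) simp
  have "k * infdist w E \<le> 1 - radial E u w" if w: "norm w = 1" for w
  proof (cases "\<exists>\<zeta>\<in>E. u < Re (cnj \<zeta> * w)")
    case True
    then obtain \<zeta> where z: "\<zeta> \<in> E" "u < Re (cnj \<zeta> * w)" by blast
    define a b where "a = Re (cnj \<zeta> * w)" and "b = \<bar>Im (cnj \<zeta> * w)\<bar>"
    note ic = in_cap[OF z(1) w z(2), folded a_def b_def]
    have ab: "a\<^sup>2 + b\<^sup>2 = 1" "0 \<le> b" "u < a"
      using Re_Im_unit[OF norm_E[OF z(1)] w] z by (simp_all add: a_def b_def)
    have D: "0 < u * a + \<kappa> * b" using ic u by auto
    have "norm (\<zeta> - w) \<le> 2 * b"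
    proof -
      have "(norm (\<zeta> - w))\<^sup>2 = 2 * (1 - a)" using dist_unit[OF norm_E[OF z(1)] w] by (simp add: a_def)
      also have "\<dots> \<le> (2 * b)\<^sup>2"
      proof -
        have "b\<^sup>2 = (1 - a) * (1 + a)" using ab by (simp add: power2_eq_square algebra_simps)
        moreover have "(1 - a) * 1 \<le> (1 - a) * (1 + a)" using ic ab u by (intro mult_left_mono) auto
        ultimately show ?thesis using ic by (simp add: power_mult_distrib)
      qed
      finally show ?thesis by (rule power2_le_imp_le) (use ab in auto)
    qed
    then have "infdist w E \<le> 2 * b"
      using infdist_le[OF z(1), of w] by (simp add: dist_norm norm_minus_commute)
    then have "k * infdist w E \<le> (\<kappa> / 2 / (1 + u)) * (2 * b)"
      using k0 ab by (intro mult_mono) (auto simp: infdist_nonneg)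
    also have "\<dots> = \<kappa> * b / (1 + u)" using u by (simp add: field_simps)
    also have "\<dots> \<le> u * a + \<kappa> * b - u"
    proof -
      have "(1 - a) * (1 + u) \<le> (1 - a) * (1 + a)" using ic ab by (intro mult_left_mono) auto
      also have "\<dots> = b\<^sup>2" using ab by (simp add: power2_eq_square algebra_simps)
      also have "\<dots> \<le> \<kappa> * b" using ic ab by (simp add: power2_eq_square mult_right_mono)
      finally have "u * ((1 - a) * (1 + u)) \<le> u * (\<kappa> * b)" using u by (intro mult_left_mono) auto
      then have "\<kappa> * b \<le> (u * a + \<kappa> * b - u) * (1 + u)" by (simp add: algebra_simps)
      then show ?thesis using u by (simp add: pos_divide_le_eq)
    qed
    also have "\<dots> \<le> (u * a + \<kappa> * b - u) / (u * a + \<kappa> * b)"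
      using ic D by (simp add: le_divide_eq mult_left_le)
    also have "\<dots> = 1 - radial E u w"
      using radial_cap[OF z(1) w z(2)] D by (simp add: cap_def a_def b_def field_simps)
    finally show ?thesis .
  next
    case False
    then have "radial E u w = u" using w by (intro radial_arc) (auto simp: not_less)
    moreover have "infdist w E \<le> 2"
    proof -
      obtain \<zeta> where "\<zeta> \<in> E" using E_nonempty by blast
      then show ?thesis using infdist_le[of \<zeta> E w] norm_triangle_ineq4[of w \<zeta>] w norm_E
        by (simp add: dist_norm)
    qed
    then have "k * infdist w E \<le> (1 - u) / 2 * 2"
      using k0 u by (intro mult_mono) (auto simp: infdist_nonneg)
    ultimately show ?thesis by simp
  qed
  then show ?thesis using k0 by blast
qed

end

text \<open>Away from \<open>E\<close> the boundaries for different parameters do not touch, so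
  every ray has an open piece between them. On a cap with \<open>u = cos \<psi>\<close> the radius
  is \<open>1 / (a + b * tan \<psi>)\<close>, and \<open>tan \<psi>\<close> decreases as
  \<open>u\<close> grows.\<close>

lemma radial_strict_mono:
  assumes "polygonal_boundary E u" "polygonal_boundary E v" "u < v" "norm w = 1" "w \<notin> E"
  shows "radial E u w < radial E v w"
proof -
  interpret U: polygonal_boundary E u by fact
  interpret V: polygonal_boundary E v by fact
  show ?thesis
  proof (rule U.radial_cases[OF assms(4)])
    fix \<zeta> assume z: "\<zeta> \<in> E" "u < Re (cnj \<zeta> * w)" and Ru: "radial E u w = U.cap \<zeta> w"
    define a b where "a = Re (cnj \<zeta> * w)" and "b = \<bar>Im (cnj \<zeta> * w)\<bar>"
    have ab: "a\<^sup>2 + b\<^sup>2 = 1" "0 \<le> b" "u < a"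
      using Re_Im_unit[OF U.norm_E[OF z(1)] assms(4)] z by (simp_all add: a_def b_def)
    have a0: "0 < a" using ab U.u by simp
    have b0: "b > 0"
    proof (rule ccontr)
      assume "\<not> b > 0"
      then have b: "b = 0" using ab by simp
      then have "a\<^sup>2 = 1\<^sup>2" using ab by simp
      then have "a = 1" using a0 by (simp only: power2_eq_iff) auto
      then have "cnj \<zeta> * w = 1" using b by (simp add: a_def b_def complex_eq_iff)
      then have "\<zeta> * (cnj \<zeta> * w) = \<zeta>" by simp
      moreover have "\<zeta> * cnj \<zeta> = 1"
        using U.norm_E[OF z(1)] complex_norm_square[of \<zeta>] by simp
      ultimately have "w = \<zeta>" by (simp flip: mult.assoc)
      then show False using z assms(5) by simp
    qed
    define p q where "p = U.\<kappa> / u" and "q = V.\<kappa> / v"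
    have "u\<^sup>2 < v\<^sup>2" using assms(3) U.u by (intro power_strict_mono) auto
    then have "V.\<kappa> < U.\<kappa>" by (simp add: U.\<kappa>_def V.\<kappa>_def)
    then have pq: "q < p" "0 < q" using assms(3) U.u V.kappa(1) by (auto simp: p_def q_def intro!: frac_less)
    have "radial E u w = u / (u * a + U.\<kappa> * b)" unfolding Ru U.cap_def a_def b_def ..
    also have "u * a + U.\<kappa> * b = u * (a + p * b)" using U.u by (simp add: p_def algebra_simps)
    finally have Rp: "radial E u w = 1 / (a + p * b)" using U.u by simp
    have pb: "q * b < p * b" "0 < q * b" using pq b0 by auto
    show "radial E u w < radial E v w"
    proof (cases "v < a")
      case True
      then have "radial E v w = v / (v * a + V.\<kappa> * b)"
        using V.radial_cap[OF z(1) assms(4)] unfolding V.cap_def a_def b_def by blast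
      also have "v * a + V.\<kappa> * b = v * (a + q * b)" using V.u by (simp add: q_def algebra_simps)
      finally have "radial E v w = 1 / (a + q * b)" using V.u by simp
      then show ?thesis using pb a0 unfolding Rp by (auto intro!: divide_strict_left_mono mult_pos_pos)
    next
      case False
      \<comment> \<open>Now \<open>a \<le> v\<close>, and \<open>v\<close> bounds the radius for
        \<open>v\<close> from below. It remains to see that the cap radius for \<open>u\<close> is
        less than \<open>a\<close>, by comparing \<open>a + p * b\<close> with
        \<open>1 / a = a + b / a * b\<close>.\<close>
      have "b < U.\<kappa>"
      proof (rule power2_less_imp_less)
        have "u\<^sup>2 < a\<^sup>2" using ab U.u by (intro power_strict_mono) auto
        then show "b\<^sup>2 < U.\<kappa>\<^sup>2" using ab U.kappa by simp
      qed (use U.kappa in simp)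
      then have "u * b < a * U.\<kappa>" using ab U.u b0 by (intro mult_strict_mono) auto
      then have "b / a < p" using a0 U.u by (simp add: p_def field_simps)
      then have "b / a * b < p * b" using b0 by (rule mult_strict_right_mono)
      moreover have "a + b / a * b = 1 / a" using ab a0 by (simp add: field_simps power2_eq_square)
      ultimately have "1 / a < a + p * b" by linarith
      then have "1 / (a + p * b) < a" using a0 pb by (simp add: field_simps)
      then show ?thesis using V.radial_bounds[OF assms(4)] False Rp by linarith
    qed
  next
    assume "radial E u w = u"
    then show ?thesis using V.radial_bounds[OF assms(4)] assms(3) by simp
  qed
qed

lemma finite_cis_fibre: "finite W \<Longrightarrow> finite {t\<in>{0..1}. cis (2 * pi * t) \<in> W}"
proof -
  have "finite {t\<in>{0..1}. cis (2 * pi * t) = w}" for w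
  proof (cases "\<exists>t0\<in>{0..1}. cis (2 * pi * t0) = w")
    case True
    then obtain t0 where t0: "t0 \<in> {0..1}" "cis (2 * pi * t0) = w" by blast
    have "{t\<in>{0..1}. cis (2 * pi * t) = w} \<subseteq> {t0 - 1, t0, t0 + 1}"
    proof
      fix t assume t: "t \<in> {t\<in>{0..1}. cis (2 * pi * t) = w}"
      then have "sin (2 * pi * t) = sin (2 * pi * t0) \<and> cos (2 * pi * t) = cos (2 * pi * t0)"
        using t0 by (auto simp: complex_eq_iff)
      then obtain n :: int where "2 * pi * t = 2 * pi * t0 + 2 * pi * n"
        by (auto simp: sin_cos_eq_iff)
      then have "2 * pi * t = 2 * pi * (t0 + n)" by (simp add: algebra_simps)
      then have n: "t = t0 + n" by simp
      then have "- 1 \<le> n" "n \<le> 1" using t t0 by auto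
      then have "n = - 1 \<or> n = 0 \<or> n = 1" by auto
      then show "t \<in> {t0 - 1, t0, t0 + 1}" using n by auto
    qed
    then show ?thesis by (rule finite_subset) simp
  next
    case False
    then have "{t\<in>{0..1}. cis (2 * pi * t) = w} = {}" by blast
    then show ?thesis by (simp only: finite.emptyI)
  qed
  moreover assume "finite W"
  moreover have "{t\<in>{0..1}. cis (2 * pi * t) \<in> W} = (\<Union>w\<in>W. {t\<in>{0..1}. cis (2 * pi * t) = w})"
    by auto
  ultimately show ?thesis by simp
qed

section \<open>Smoothness of the boundary path\<close>

lemma has_vector_derivative_cis:
  "((\<lambda>t. cis (2 * pi * t)) has_vector_derivative (2 * pi * \<i> * cis (2 * pi * t))) (at t within A)"
proof -
  have "((\<lambda>t. cis (2 * pi * t)) has_derivative (\<lambda>x. (2 * pi * x) *\<^sub>R (\<i> * cis (2 * pi * t)))) (at t within A)"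
    by (rule has_derivative_cis) (auto intro!: derivative_eq_intros)
  then show ?thesis
    by (simp add: has_vector_derivative_def scaleR_conv_of_real mult_ac)
qed

context polygonal_boundary
begin

text \<open>The parameters where the path may fail to be differentiable: the corners at
  \<open>E\<close>, the points of contact of the tangents, and the ends of the parameter
  interval.\<close>

definition breaks :: "real set"
  where "breaks = {t\<in>{0..1}. t = 0 \<or> t = 1 \<or> cis (2 * pi * t) \<in> E
    \<or> (\<exists>\<zeta>\<in>E. Re (cnj \<zeta> * cis (2 * pi * t)) = u)}"

lemma finite_breaks: "finite breaks"
proof -
  let ?W = "E \<union> (\<Union>\<zeta>\<in>E. {\<zeta> * Complex u \<kappa>, \<zeta> * Complex u (- \<kappa>)})"
  have "breaks \<subseteq> {0, 1} \<union> {t\<in>{0..1}. cis (2 * pi * t) \<in> ?W}"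
  proof
    fix t assume t: "t \<in> breaks"
    have "cis (2 * pi * t) \<in> ?W" if z: "\<zeta> \<in> E" "Re (cnj \<zeta> * cis (2 * pi * t)) = u" for \<zeta>
    proof -
      let ?x = "cnj \<zeta> * cis (2 * pi * t)"
      have "(Im ?x)\<^sup>2 = \<kappa>\<^sup>2"
        using Re_Im_unit[OF norm_E[OF z(1)], of "cis (2 * pi * t)"] unfolding z(2) kappa by simp
      then have "Im ?x = \<kappa> \<or> Im ?x = - \<kappa>" by (simp only: power2_eq_iff)
      then have "?x = Complex u \<kappa> \<or> ?x = Complex u (- \<kappa>)"
        using z(2) by (metis complex_surj)
      then have "\<zeta> * ?x = \<zeta> * Complex u \<kappa> \<or> \<zeta> * ?x = \<zeta> * Complex u (- \<kappa>)"
        by (elim disjE) (simp_all only:, simp_all)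
      moreover have "\<zeta> * ?x = cis (2 * pi * t)"
        using norm_E[OF z(1)] complex_norm_square[of \<zeta>] by (simp flip: mult.assoc)
      ultimately have "cis (2 * pi * t) \<in> {\<zeta> * Complex u \<kappa>, \<zeta> * Complex u (- \<kappa>)}"
        by (simp only: insert_iff empty_iff simp_thms)
      then show ?thesis using z(1) by blast
    qed
    then show "t \<in> {0, 1} \<union> {t\<in>{0..1}. cis (2 * pi * t) \<in> ?W}"
      using t unfolding breaks_def by blast
  qed
  moreover have "finite ({0, 1} \<union> {t\<in>{0..1}. cis (2 * pi * t) \<in> ?W})"
    using finite_cis_fibre[of ?W] finite_E by simp
  ultimately show ?thesis by (rule finite_subset)
qed

text \<open>Near such a parameter one and the same polar formula stays valid. The bound is dictated
  by the caps, where rotation and radial motion contribute at most \<open>2 * pi\<close> and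
  \<open>2 * pi / u\<close>.\<close>

lemma boundary_path_smooth_near:
  assumes "t0 \<in> {0<..<1} - breaks"
  obtains N h' where "open N" "t0 \<in> N" "continuous_on N h'"
    "\<And>t. t \<in> N \<Longrightarrow> (boundary_path E u has_vector_derivative h' t) (at t)"
    "\<And>t. t \<in> N \<Longrightarrow> norm (h' t :: complex) \<le> 4 * pi / u"
proof -
  let ?c = "\<lambda>t. cis (2 * pi * t)"
  have cc: "continuous_on A ?c" for A by (intro continuous_intros)
  show thesis
  proof (rule radial_cases[of "?c t0"])
    assume le: "\<And>\<zeta>. \<zeta> \<in> E \<Longrightarrow> Re (cnj \<zeta> * ?c t0) \<le> u"
    define N where "N = (\<Inter>\<zeta>\<in>E. {t. Re (cnj \<zeta> * ?c t) < u})"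
    have "open N"
      unfolding N_def using finite_E by (intro open_INT ballI open_Collect_less continuous_intros) auto
    moreover have "t0 \<in> N"
    proof -
      have "Re (cnj \<zeta> * ?c t0) < u" if "\<zeta> \<in> E" for \<zeta>
        using le[OF that] assms that unfolding breaks_def by fastforce
      then show ?thesis by (simp add: N_def)
    qed
    moreover have "continuous_on N (\<lambda>t. u * (2 * pi * \<i> * ?c t))"
      by (intro continuous_intros cc)
    moreover have "(boundary_path E u has_vector_derivative (u * (2 * pi * \<i> * ?c t))) (at t)" if "t \<in> N" for t
    proof (rule has_vector_derivative_transform_within_open[OF _ \<open>open N\<close> that])
      show "((\<lambda>t. of_real u * ?c t) has_vector_derivative (u * (2 * pi * \<i> * ?c t))) (at t)"
        by (intro has_vector_derivative_mult_right has_vector_derivative_cis)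
      show "of_real u * ?c t = boundary_path E u t" if "t \<in> N" for t
        unfolding boundary_path_radial
        by (subst radial_arc) (use that in \<open>auto simp: N_def less_imp_le\<close>)
    qed
    moreover have "norm (u * (2 * pi * \<i> * ?c t)) \<le> 4 * pi / u" for t
    proof -
      have "u * u \<le> 1 * 1" using u by (intro mult_mono) auto
      then have "u * (2 * pi) * u \<le> 4 * pi" using mult_right_mono[of "u * u" 1 "2 * pi"] by (simp add: mult_ac)
      then show ?thesis using u by (simp add: norm_mult pos_le_divide_eq)
    qed
    ultimately show thesis by (rule that)
  next
    fix \<zeta> assume z: "\<zeta> \<in> E" "u < Re (cnj \<zeta> * ?c t0)"
    define a b where "a t = Re (cnj \<zeta> * ?c t)" and "b t = Im (cnj \<zeta> * ?c t)" for t
    have ab1: "(a t)\<^sup>2 + (b t)\<^sup>2 = 1" for t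
      using Re_Im_unit[OF norm_E[OF z(1)], of "?c t"] by (simp add: a_def b_def)
    have b0: "b t0 \<noteq> 0"
    proof
      assume b: "b t0 = 0"
      then have "(a t0)\<^sup>2 = 1\<^sup>2" using ab1[of t0] by simp
      then have "a t0 = 1" using z u by (simp only: power2_eq_iff) (auto simp: a_def)
      then have "cnj \<zeta> * ?c t0 = 1" using b by (simp add: a_def b_def complex_eq_iff)
      then have "\<zeta> * (cnj \<zeta> * ?c t0) = \<zeta>" by simp
      moreover have "\<zeta> * cnj \<zeta> = 1"
        using norm_E[OF z(1)] complex_norm_square[of \<zeta>] by simp
      ultimately have "?c t0 = \<zeta>" by (simp flip: mult.assoc)
      then show False using z assms unfolding breaks_def by auto
    qed
    \<comment> \<open>Fixing the sign of \<open>b\<close> near \<open>t0\<close> replaces the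
      absolute value in \<open>cap\<close> by a smooth expression.\<close>
    define \<sigma> where "\<sigma> = sgn (b t0)"
    define N where "N = {t. u < a t} \<inter> {t. 0 < \<sigma> * b t}"
    define D D' where "D t = u * a t + \<kappa> * \<sigma> * b t"
      and "D' t = u * Re (cnj \<zeta> * (2 * pi * \<i> * ?c t)) + \<kappa> * \<sigma> * Im (cnj \<zeta> * (2 * pi * \<i> * ?c t))" for t
    have cont: "continuous_on A a" "continuous_on A b" "continuous_on A D" "continuous_on A D'" for A
      unfolding a_def b_def D_def D'_def by (intro continuous_intros cc)+
    have "open N"
      unfolding N_def by (intro open_Int open_Collect_less continuous_intros cont)
    moreover have "t0 \<in> N"
      using z b0 by (auto simp: N_def a_def \<sigma>_def abs_sgn[symmetric] mult.commute[of "sgn _"])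
    moreover have DN: "D t = u * a t + \<kappa> * \<bar>b t\<bar>" "u \<le> D t" if "t \<in> N" for t
    proof -
      have "\<sigma> * b t = \<bar>b t\<bar>" using that by (auto simp: N_def \<sigma>_def sgn_if abs_if split: if_splits)
      then show D: "D t = u * a t + \<kappa> * \<bar>b t\<bar>" by (simp add: D_def mult.assoc)
      show "u \<le> D t" unfolding D a_def b_def
        using in_cap(2)[OF z(1), of "?c t"] that by (simp add: N_def a_def)
    qed
    define h' where "h' t = of_real (u / D t) * (2 * pi * \<i> * ?c t)
      + of_real (- (u * D' t) / (D t * D t)) * ?c t" for t
    have "D t \<noteq> 0" if "t \<in> N" for t using DN(2)[OF that] u by auto
    then have "continuous_on N h'" unfolding h'_def by (intro continuous_intros cc cont) auto
    moreover have "(boundary_path E u has_vector_derivative h' t) (at t)" if t: "t \<in> N" for t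
    proof (rule has_vector_derivative_transform_within_open[OF _ \<open>open N\<close> t])
      have "((\<lambda>t. cnj \<zeta> * ?c t) has_vector_derivative (cnj \<zeta> * (2 * pi * \<i> * ?c t))) (at t)"
        by (intro has_vector_derivative_mult_right has_vector_derivative_cis)
      note cd = this
      have da: "(a has_real_derivative Re (cnj \<zeta> * (2 * pi * \<i> * ?c t))) (at t)"
        unfolding a_def has_real_derivative_iff_has_vector_derivative
        by (rule bounded_linear.has_vector_derivative[OF bounded_linear_Re cd])
      have db: "(b has_real_derivative Im (cnj \<zeta> * (2 * pi * \<i> * ?c t))) (at t)"
        unfolding b_def has_real_derivative_iff_has_vector_derivative
        by (rule bounded_linear.has_vector_derivative[OF bounded_linear_Im cd])
      have "(D has_real_derivative D' t) (at t)"
        unfolding D_def D'_def by (intro DERIV_add DERIV_cmult da db)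
      moreover have "D t \<noteq> 0" using DN(2)[OF t] u by simp
      ultimately have "((\<lambda>t. u / D t) has_real_derivative ((0 * D t - u * D' t) / (D t * D t))) (at t)"
        by (intro DERIV_divide DERIV_const)
      then have "((\<lambda>t. u / D t) has_real_derivative (- (u * D' t) / (D t * D t))) (at t)"
        by simp
      then have "((\<lambda>t. complex_of_real (u / D t)) has_vector_derivative of_real (- (u * D' t) / (D t * D t))) (at t)"
        unfolding has_real_derivative_iff_has_vector_derivative
        by (rule bounded_linear.has_vector_derivative[OF bounded_linear_of_real])
      then show "((\<lambda>t. complex_of_real (u / D t) * ?c t) has_vector_derivative h' t) (at t)"
        unfolding h'_def by (rule has_vector_derivative_mult[OF _ has_vector_derivative_cis])
      show "complex_of_real (u / D t) * ?c t = boundary_path E u t" if "t \<in> N" for t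
        unfolding boundary_path_radial
        by (subst radial_cap[OF z(1)]) (use that DN(1)[OF that] in \<open>auto simp: N_def a_def b_def cap_def\<close>)
    qed
    moreover have "norm (h' t) \<le> 4 * pi / u" if t: "t \<in> N" for t
    proof -
      have "\<bar>D' t\<bar> \<le> 2 * pi"
      proof -
        define x y where "x = Re (cnj \<zeta> * (2 * pi * \<i> * ?c t))" and "y = Im (cnj \<zeta> * (2 * pi * \<i> * ?c t))"
        have xy: "x = - (2 * pi * b t)" "y = 2 * pi * a t"
          by (simp_all add: x_def y_def a_def b_def algebra_simps)
        have "D' t = u * x + \<kappa> * \<sigma> * y" by (simp only: D'_def x_def y_def)
        then have "D' t = 2 * pi * (\<kappa> * \<sigma> * a t - u * b t)"
          unfolding xy by (simp add: algebra_simps)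
        \<comment> \<open>Together with \<open>u * a t + \<kappa> * \<sigma> * b t\<close> this is a
          unit vector, namely \<open>(a t, b t)\<close> rotated, and possibly reflected, by means of
          the unit vector \<open>(u, \<kappa> * \<sigma>)\<close>.\<close>
        moreover have "\<bar>\<kappa> * \<sigma> * a t - u * b t\<bar> \<le> 1"
        proof -
          have "\<sigma>\<^sup>2 = 1" using b0 by (simp add: \<sigma>_def sgn_if)
          have "(\<kappa> * \<sigma> * a t - u * b t)\<^sup>2 + (u * a t + \<kappa> * \<sigma> * b t)\<^sup>2 = (u\<^sup>2 + \<kappa>\<^sup>2 * \<sigma>\<^sup>2) * ((a t)\<^sup>2 + (b t)\<^sup>2)"
            by (simp add: power2_eq_square algebra_simps)
          also have "\<dots> = (u\<^sup>2 + \<kappa>\<^sup>2) * ((a t)\<^sup>2 + (b t)\<^sup>2)" using \<open>\<sigma>\<^sup>2 = 1\<close> by simp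
          also have "\<dots> = 1" using ab1 kappa by simp
          finally have "(\<kappa> * \<sigma> * a t - u * b t)\<^sup>2 \<le> 1" by (smt (verit) zero_le_power2)
          then show ?thesis by (simp only: abs_square_le_1)
        qed
        ultimately show ?thesis by (simp add: abs_mult mult_left_le)
      qed
      have "norm (h' t) \<le> norm (of_real (u / D t) * (2 * pi * \<i> * ?c t))
        + norm (of_real (- (u * D' t) / (D t * D t)) * ?c t)"
        unfolding h'_def by (rule norm_triangle_ineq)
      also have "\<dots> = u / D t * (2 * pi) + u * \<bar>D' t\<bar> / (D t * D t)"
        using u DN(2)[OF t] by (simp add: norm_mult norm_divide abs_mult)
      also have "\<dots> \<le> 1 * (2 * pi) + u * (2 * pi) / (u * u)"
        using u DN(2)[OF t] \<open>\<bar>D' t\<bar> \<le> 2 * pi\<close>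
        by (intro add_mono mult_right_mono frac_le mult_left_mono mult_mono) auto
      also have "\<dots> \<le> 4 * pi / u" using u by (simp add: field_simps)
      finally show ?thesis .
    qed
    ultimately show thesis by (rule that)
  qed simp
qed

text \<open>The value \<open>0\<close> at the exceptional parameters keeps this factor bounded
  everywhere and cancels whatever value the integrand has at points of \<open>E\<close>.\<close>

definition path_deriv :: "real \<Rightarrow> complex"
  where "path_deriv t = (if t \<in> {0<..<1} - breaks then vector_derivative (boundary_path E u) (at t) else 0)"

lemma boundary_path_deriv:
  assumes "t \<in> {0<..<1} - breaks"
  shows "(boundary_path E u has_vector_derivative path_deriv t) (at t)"
proof (rule boundary_path_smooth_near[OF assms])
  fix N h' assume "t \<in> N" "\<And>t. t \<in> N \<Longrightarrow> (boundary_path E u has_vector_derivative h' t) (at t)"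
  then have d: "(boundary_path E u has_vector_derivative h' t) (at t)" by blast
  have "path_deriv t = vector_derivative (boundary_path E u) (at t)"
    unfolding path_deriv_def using assms by (rule if_P)
  then show ?thesis using d vector_derivative_at[OF d] by simp
qed

lemma norm_path_deriv: "norm (path_deriv t) \<le> 4 * pi / u"
proof (cases "t \<in> {0<..<1} - breaks")
  case True
  obtain N h' where N: "open N" "t \<in> N" "continuous_on N h'"
    "\<And>t. t \<in> N \<Longrightarrow> (boundary_path E u has_vector_derivative h' t) (at t)"
    "\<And>t. t \<in> N \<Longrightarrow> norm (h' t :: complex) \<le> 4 * pi / u"
    by (rule boundary_path_smooth_near[OF True], rule that)
  have "path_deriv t = h' t"
    by (rule vector_derivative_unique_at[OF boundary_path_deriv[OF True] N(4)[OF N(2)]])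
  then show ?thesis using N(5)[OF N(2)] by simp
next
  case False
  have "path_deriv t = 0" unfolding path_deriv_def using False by (rule if_not_P)
  then show ?thesis using u by simp
qed

lemma open_minus_breaks: "open ({0<..<1} - breaks)"
  by (intro open_Diff open_greaterThanLessThan finite_imp_closed finite_breaks)

lemma continuous_path_deriv: "continuous_on ({0<..<1} - breaks) path_deriv"
proof (rule continuous_at_imp_continuous_on, rule ballI)
  fix t assume t: "t \<in> {0<..<1} - breaks"
  obtain N h' where N: "open N" "t \<in> N" "continuous_on N h'"
    "\<And>t. t \<in> N \<Longrightarrow> (boundary_path E u has_vector_derivative h' t) (at t)"
    "\<And>t. t \<in> N \<Longrightarrow> norm (h' t :: complex) \<le> 4 * pi / u"
    by (rule boundary_path_smooth_near[OF t], rule that)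
  have "isCont h' t" using N(1,2,3) continuous_on_eq_continuous_at by blast
  moreover have "\<forall>\<^sub>F x in nhds t. path_deriv x = h' x"
  proof (rule eventually_nhds_in_open[THEN eventually_mono])
    show "open (N \<inter> ({0<..<1} - breaks))" using N open_minus_breaks by blast
    show "t \<in> N \<inter> ({0<..<1} - breaks)" using N t by blast
    show "path_deriv x = h' x" if "x \<in> N \<inter> ({0<..<1} - breaks)" for x
      using that vector_derivative_unique_at[OF boundary_path_deriv[of x] N(4)[of x]] by blast
  qed
  ultimately show "isCont path_deriv t" by (simp add: isCont_cong)
qed

lemma continuous_boundary_path: "continuous_on A (boundary_path E u)"
proof -
  have "continuous_on (sphere 0 1) (radial E u)"
  proof (rule lipschitz_on_continuous_on[of "1 / u"], rule lipschitz_onI)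
    show "dist (radial E u x) (radial E u y) \<le> 1 / u * dist x y" if "x \<in> sphere 0 1" "y \<in> sphere 0 1" for x y
      using radial_lipschitz[of x y] that by (simp add: dist_norm)
  qed (use u in simp)
  then have "continuous_on A (\<lambda>t. radial E u (cis (2 * pi * t)))"
    by (rule continuous_on_compose2) (auto intro!: continuous_intros)
  then show ?thesis unfolding boundary_path_radial by (intro continuous_intros)
qed

end

section \<open>Integral estimates along the boundary\<close>

text \<open>The exponent \<open>- \<gamma> - 1\<close> is chosen so that the primitive is
  elementary. For \<open>c = 0\<close> the derivative is the plain power
  \<open>y powr (\<gamma> - 1)\<close>.\<close>

lemma DERIV_bump:
  assumes "0 < \<gamma>" "0 \<le> c" "0 < (y::real)"
  shows "((\<lambda>y. (y / (1 + c * y)) powr \<gamma> / \<gamma>) has_real_derivative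
    y powr (\<gamma> - 1) * (1 + c * y) powr (- \<gamma> - 1)) (at y)"
proof -
  have p: "0 < 1 + c * y" using assms by (simp add: add_pos_nonneg)
  have 1: "((\<lambda>y. y / (1 + c * y)) has_real_derivative ((1 * (1 + c * y) - y * (c * 1)) / ((1 + c * y) * (1 + c * y)))) (at y)"
    using p by (auto intro!: derivative_eq_intros)
  have "((\<lambda>y. (y / (1 + c * y)) powr \<gamma>) has_real_derivative
     (\<gamma> * (y / (1 + c * y)) powr (\<gamma> - 1) * ((1 * (1 + c * y) - y * (c * 1)) / ((1 + c * y) * (1 + c * y))))) (at y)"
    using DERIV_fun_powr[OF 1, of \<gamma>] assms p by simp
  then have "((\<lambda>y. (y / (1 + c * y)) powr \<gamma> / \<gamma>) has_real_derivative
     (\<gamma> * (y / (1 + c * y)) powr (\<gamma> - 1) * ((1 * (1 + c * y) - y * (c * 1)) / ((1 + c * y) * (1 + c * y)))) / \<gamma>) (at y)"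
    by (rule DERIV_cdivide)
  moreover have "(\<gamma> * (y / (1 + c * y)) powr (\<gamma> - 1) * ((1 * (1 + c * y) - y * (c * 1)) / ((1 + c * y) * (1 + c * y)))) / \<gamma>
    = y powr (\<gamma> - 1) * (1 + c * y) powr (- \<gamma> - 1)"
  proof -
    define q where "q = 1 + c * y"
    have q: "0 < q" using p by (simp add: q_def)
    have "(y / q) powr a = y powr a * q powr (- a)" for a
      using q assms by (simp add: powr_divide powr_minus_divide)
    moreover have "1 / (q * q) = q powr (- 2)"
      using q by (simp add: powr_minus_divide powr_numeral power2_eq_square)
    ultimately have "(y / q) powr (\<gamma> - 1) * (1 / (q * q)) = y powr (\<gamma> - 1) * (q powr - (\<gamma> - 1) * q powr (- 2))"
      by (simp only: mult.assoc)
    also have "q powr - (\<gamma> - 1) * q powr (- 2) = q powr (- \<gamma> - 1)"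
      unfolding powr_add[symmetric] by (rule arg_cong[where f = "\<lambda>x. q powr x"]) simp
    finally show ?thesis using assms by (simp add: q_def)
  qed
  ultimately show ?thesis by (simp only:)
qed

text \<open>\<open>H\<close> is the odd continuation about \<open>s\<close> of the primitive. It is
  continuous at \<open>s\<close>, so the possible singularity there counts as a single exceptional
  point for the fundamental theorem.\<close>

lemma bump_has_integral:
  fixes s :: real
  assumes "0 < \<gamma>" "0 \<le> c"
  defines "G \<equiv> \<lambda>y. (y / (1 + c * y)) powr \<gamma> / \<gamma>"
  defines "H \<equiv> \<lambda>x. if x \<le> s then - G (s - x) else G (x - s)"
  shows "((\<lambda>x. \<bar>x - s\<bar> powr (\<gamma> - 1) * (1 + c * \<bar>x - s\<bar>) powr (- \<gamma> - 1)) has_integral (H 1 - H 0)) {0..1}"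
proof (rule fundamental_theorem_of_calculus_interior_strong[where S = "{s}"])
  have contG: "continuous_on {0..} G"
    unfolding G_def using assms(1,2)
    by (intro continuous_intros continuous_on_powr' ballI)
      (auto intro!: continuous_intros simp: add_pos_nonneg less_imp_neq[symmetric] add_nonneg_eq_0_iff)
  show "continuous_on {0..1} H"
    unfolding H_def
  proof (rule continuous_on_cases_le)
    show "continuous_on {t \<in> {0..1}. t \<le> s} (\<lambda>x. - G (s - x))"
      by (intro continuous_on_minus continuous_on_compose2[OF contG]) (auto intro!: continuous_intros)
    show "continuous_on {t \<in> {0..1}. s \<le> t} (\<lambda>x. G (x - s))"
      by (intro continuous_on_compose2[OF contG]) (auto intro!: continuous_intros)
    show "- G (s - t) = G (t - s)" if "t = s" for t
      using assms(1) that by (simp add: G_def)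
  qed (intro continuous_intros)
  fix x assume x: "x \<in> {0<..<1} - {s}"
  have G: "(G has_real_derivative y powr (\<gamma> - 1) * (1 + c * y) powr (- \<gamma> - 1)) (at y)" if "0 < y" for y
    unfolding G_def by (rule DERIV_bump[OF assms(1,2) that])
  show "(H has_vector_derivative \<bar>x - s\<bar> powr (\<gamma> - 1) * (1 + c * \<bar>x - s\<bar>) powr (- \<gamma> - 1)) (at x)"
    unfolding has_real_derivative_iff_has_vector_derivative[symmetric]
  proof (cases "x < s")
    case True
    have "((\<lambda>x. s - x) has_real_derivative - 1) (at x)"
      by (auto intro!: derivative_eq_intros)
    from DERIV_chain2[OF G this] True
    have "((\<lambda>x. G (s - x)) has_real_derivative (s - x) powr (\<gamma> - 1) * (1 + c * (s - x)) powr (- \<gamma> - 1) * - 1) (at x)"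
      by simp
    from DERIV_minus[OF this]
    have d: "((\<lambda>x. - G (s - x)) has_real_derivative \<bar>x - s\<bar> powr (\<gamma> - 1) * (1 + c * \<bar>x - s\<bar>) powr (- \<gamma> - 1)) (at x)"
      using True by simp
    show "(H has_real_derivative \<bar>x - s\<bar> powr (\<gamma> - 1) * (1 + c * \<bar>x - s\<bar>) powr (- \<gamma> - 1)) (at x)"
      by (rule has_field_derivative_transform_within_open[OF d open_lessThan[of s]])
        (use True in \<open>auto simp: H_def\<close>)
  next
    case False
    then have xs: "s < x" using x by simp
    have "((\<lambda>x. x - s) has_real_derivative 1) (at x)"
      by (auto intro!: derivative_eq_intros)
    from DERIV_chain2[OF G this] xs
    have "((\<lambda>x. G (x - s)) has_real_derivative (x - s) powr (\<gamma> - 1) * (1 + c * (x - s)) powr (- \<gamma> - 1) * 1) (at x)"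
      by simp
    then have d: "((\<lambda>x. G (x - s)) has_real_derivative \<bar>x - s\<bar> powr (\<gamma> - 1) * (1 + c * \<bar>x - s\<bar>) powr (- \<gamma> - 1)) (at x)"
      using xs by simp
    show "(H has_real_derivative \<bar>x - s\<bar> powr (\<gamma> - 1) * (1 + c * \<bar>x - s\<bar>) powr (- \<gamma> - 1)) (at x)"
      by (rule has_field_derivative_transform_within_open[OF d open_greaterThan[of s]])
        (use xs in \<open>auto simp: H_def\<close>)
  qed
qed simp_all

lemma bump_integrable:
  fixes s :: real
  assumes "0 < \<gamma>" "0 \<le> c"
  shows "(\<lambda>x. \<bar>x - s\<bar> powr (\<gamma> - 1) * (1 + c * \<bar>x - s\<bar>) powr (- \<gamma> - 1)) integrable_on {0..1}"
  using bump_has_integral[OF assms] by blast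

text \<open>Each half of the primitive stays below its limit
  \<open>c powr - \<gamma> / \<gamma>\<close> at infinity; the two sides of \<open>s\<close> give
  the factor 2.\<close>

lemma bump_integral_le:
  fixes s :: real
  assumes "0 < \<gamma>" "0 < c"
  shows "integral {0..1} (\<lambda>x. \<bar>x - s\<bar> powr (\<gamma> - 1) * (1 + c * \<bar>x - s\<bar>) powr (- \<gamma> - 1))
    \<le> 2 / \<gamma> * c powr - \<gamma>"
proof -
  define G where "G y = (y / (1 + c * y)) powr \<gamma> / \<gamma>" for y
  define H where "H x = (if x \<le> s then - G (s - x) else G (x - s))" for x
  have G: "\<bar>G y\<bar> \<le> c powr - \<gamma> / \<gamma>" if "0 \<le> y" for y
  proof -
    have "y / (1 + c * y) \<le> 1 / c" using assms that by (simp add: field_simps add_pos_nonneg)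
    then have "(y / (1 + c * y)) powr \<gamma> \<le> (1 / c) powr \<gamma>"
      using assms that by (intro powr_mono2) auto
    also have "\<dots> = c powr - \<gamma>" using assms by (simp add: powr_divide powr_minus_divide)
    finally show ?thesis using assms by (simp add: G_def divide_right_mono)
  qed
  have "\<bar>H x\<bar> \<le> c powr - \<gamma> / \<gamma>" for x using G[of "s - x"] G[of "x - s"] by (simp add: H_def)
  from this[of 0] this[of 1] have "H 1 - H 0 \<le> 2 / \<gamma> * c powr - \<gamma>" by simp
  moreover have "integral {0..1} (\<lambda>x. \<bar>x - s\<bar> powr (\<gamma> - 1) * (1 + c * \<bar>x - s\<bar>) powr (- \<gamma> - 1)) = H 1 - H 0"
    unfolding H_def G_def using assms by (intro integral_unique bump_has_integral) auto
  ultimately show ?thesis by simp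
qed

text \<open>Distance on the circle is distance of \<open>t\<close> to the nearest translate of
  \<open>s\<close>. As \<open>|s| \<le> 1/2\<close> and \<open>t\<close> lies in
  \<open>{0..1}\<close>, shifts by \<open>-1\<close>, \<open>0\<close>, \<open>1\<close> suffice.
  The constants come from \<open>y / 3 \<le> sin y \<le> y\<close> on \<open>{0..pi/2}\<close> and
  \<open>3 < pi\<close>.\<close>

lemma dist_cis_bounds:
  assumes "norm (\<zeta>::complex) = 1"
  obtains s where "\<And>t. t \<in> {0..1} \<Longrightarrow> \<exists>i\<in>{-1,0,1}.
      2 * \<bar>t - (s + i)\<bar> \<le> norm (\<zeta> - cis (2 * pi * t)) \<and> norm (\<zeta> - cis (2 * pi * t)) \<le> 2 * pi * \<bar>t - (s + i)\<bar>"
proof -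
  have "\<zeta> \<noteq> 0" using assms by auto
  define s where "s = Arg \<zeta> / (2 * pi)"
  have z: "\<zeta> = cis (2 * pi * s)"
    using cis_Arg[OF \<open>\<zeta> \<noteq> 0\<close>] assms by (simp add: s_def sgn_eq)
  have s: "- 1 / 2 \<le> s" "s \<le> 1 / 2"
    using Arg_bounded[of \<zeta>] pi_gt_zero unfolding s_def by (simp_all add: field_simps)
  have sin: "\<bar>y\<bar> / 3 \<le> \<bar>sin y\<bar>" if "\<bar>y\<bar> \<le> pi / 2" for y :: real
  proof -
    have "\<bar>y\<bar> \<le> 2" using that pi_less_4 by simp
    then have y2: "y\<^sup>2 \<le> 4" using abs_le_square_iff[of y 2] by simp
    have "\<bar>sin y - (\<Sum>m<3. (sin_coeff m) * y ^ m)\<bar> \<le> inverse (fact 3) * \<bar>y\<bar> ^ 3"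
      by (rule Maclaurin_sin_bound)
    then have "\<bar>sin y - y\<bar> \<le> \<bar>y\<bar> * (y\<^sup>2 / 6)"
      by (simp add: eval_nat_numeral sin_coeff_def fact_numeral power2_eq_square mult_ac abs_mult)
    also have "\<dots> \<le> \<bar>y\<bar> * (4 / 6)" using y2 by (intro mult_left_mono) auto
    finally show ?thesis by linarith
  qed
  have dist: "norm (\<zeta> - cis (2 * pi * t)) = 2 * \<bar>sin (pi * (t - s - n))\<bar>" for t and n :: int
  proof -
    have "(norm (\<zeta> - cis (2 * pi * t)))\<^sup>2 = (cos (2 * pi * s) - cos (2 * pi * t))\<^sup>2 + (sin (2 * pi * s) - sin (2 * pi * t))\<^sup>2"
      unfolding z by (simp add: cmod_power2)
    also have "\<dots> = 2 - 2 * cos (2 * pi * t - 2 * pi * s)"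
      using sin_cos_squared_add[of "2 * pi * s"] sin_cos_squared_add[of "2 * pi * t"]
      by (simp add: cos_diff power2_eq_square algebra_simps)
    also have "2 * pi * t - 2 * pi * s = 2 * (pi * (t - s - n)) + 2 * pi * n" by (simp add: algebra_simps)
    also have "cos \<dots> = cos (2 * (pi * (t - s - n)))"
      using cos.plus_of_int[of "2 * (pi * (t - s - n))" n] by (simp add: mult_ac)
    also have "2 - 2 * \<dots> = (2 * \<bar>sin (pi * (t - s - n))\<bar>)\<^sup>2"
      by (simp only: cos_double_sin power_mult_distrib power2_abs) simp
    finally show ?thesis by (rule power2_eq_imp_eq) simp_all
  qed
  show thesis
  proof (rule that)
    fix t :: real assume t: "t \<in> {0..1}"
    have "\<exists>i\<in>{-1,0,1::int}. \<bar>t - s - i\<bar> \<le> 1 / 2"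
    proof (cases "t - s \<le> 1 / 2")
      case True
      then have "\<bar>t - s - of_int 0\<bar> \<le> 1 / 2" using s t unfolding abs_le_iff by auto
      then show ?thesis by blast
    next
      case False
      then have "\<bar>t - s - of_int 1\<bar> \<le> 1 / 2" using s t unfolding abs_le_iff by auto
      then show ?thesis by blast
    qed
    then obtain i :: int where i: "i \<in> {-1,0,1}" "\<bar>t - s - i\<bar> \<le> 1 / 2" by blast
    define y where "y = pi * (t - s - i)"
    have ay: "\<bar>y\<bar> = pi * \<bar>t - (s + i)\<bar>" by (simp add: y_def abs_mult diff_diff_eq)
    have "\<bar>y\<bar> \<le> pi / 2" using i mult_left_mono[OF i(2), of pi] by (simp add: y_def abs_mult)
    then have "\<bar>y\<bar> / 3 \<le> \<bar>sin y\<bar>" by (rule sin)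
    moreover have "3 * \<bar>t - (s + i)\<bar> \<le> \<bar>y\<bar>" unfolding ay using pi_gt3 by (intro mult_right_mono) auto
    moreover have "\<bar>sin y\<bar> \<le> \<bar>y\<bar>" by (rule abs_sin_x_le_abs_x)
    ultimately show "\<exists>i\<in>{-1,0,1}.
      2 * \<bar>t - (s + i)\<bar> \<le> norm (\<zeta> - cis (2 * pi * t)) \<and> norm (\<zeta> - cis (2 * pi * t)) \<le> 2 * pi * \<bar>t - (s + i)\<bar>"
      using i(1) unfolding dist[of t i] y_def[symmetric] unfolding ay by (intro bexI[of _ "real_of_int i"]) auto
  qed
qed

section \<open>Distances to \<open>E\<close> and integrable weights on the boundary\<close>

definition dist_prod :: "complex set \<Rightarrow> complex \<Rightarrow> real"
  where "dist_prod E z = (\<Prod>\<zeta>\<in>E. norm (\<zeta> - z))"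

lemma dist_prod_nonneg: "0 \<le> dist_prod E z"
  by (simp add: dist_prod_def prod_nonneg)

lemma dist_prod_pos: "finite E \<Longrightarrow> z \<notin> E \<Longrightarrow> 0 < dist_prod E z"
  by (auto simp: dist_prod_def intro!: prod_pos)

lemma dist_prod_le:
  assumes "finite E" "E \<subseteq> sphere 0 1" "norm z \<le> 1" "\<zeta> \<in> E"
  shows "dist_prod E z \<le> 2 ^ card E * norm (\<zeta> - z)"
proof -
  have le2: "norm (\<eta> - z) \<le> 2" if "\<eta> \<in> E" for \<eta>
    using norm_triangle_ineq4[of \<eta> z] assms that by auto
  have "(\<Prod>\<eta>\<in>E - {\<zeta>}. norm (\<eta> - z)) \<le> (\<Prod>\<eta>\<in>E - {\<zeta>}. 2)"
    using le2 by (intro prod_mono) auto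
  also have "\<dots> \<le> 2 ^ card E" using assms by (simp add: card_Diff_singleton)
  finally have "(\<Prod>\<eta>\<in>E - {\<zeta>}. norm (\<eta> - z)) * norm (\<zeta> - z) \<le> 2 ^ card E * norm (\<zeta> - z)"
    by (rule mult_right_mono) simp
  moreover have "dist_prod E z = (\<Prod>\<eta>\<in>E - {\<zeta>}. norm (\<eta> - z)) * norm (\<zeta> - z)"
    unfolding dist_prod_def using assms(1,4) by (simp only: prod.remove[of E \<zeta>] mult.commute)
  ultimately show ?thesis by (simp only:)
qed

text \<open>If \<open>\<zeta>\<close> is nearest to \<open>z\<close>, any other
  \<open>\<eta>\<close> in \<open>E\<close> is at distance at least
  \<open>norm (\<zeta> - \<eta>) / 2\<close> from \<open>z\<close>, so the other factors are bounded
  below.\<close>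

lemma dist_prod_ge_nearest:
  assumes "finite E"
  obtains c where "0 < c" "\<And>z \<zeta>. \<zeta> \<in> E \<Longrightarrow> (\<And>\<eta>. \<eta> \<in> E \<Longrightarrow> norm (\<zeta> - z) \<le> norm (\<eta> - z))
    \<Longrightarrow> c * norm (\<zeta> - z) \<le> dist_prod E z"
proof -
  \<comment> \<open>The extra element \<open>1\<close> keeps the set nonempty and gives
    \<open>d \<le> 1\<close>, which allows the exponent to be raised from
    \<open>card (E - {\<zeta>})\<close> to \<open>card E\<close>.\<close>
  define D where "D = insert 1 ((\<lambda>(\<zeta>, \<eta>). norm (\<zeta> - \<eta>) / 2) ` {(\<zeta>, \<eta>) \<in> E \<times> E. \<zeta> \<noteq> \<eta>})"
  have "finite {(\<zeta>, \<eta>) \<in> E \<times> E. \<zeta> \<noteq> \<eta>}"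
    by (rule finite_subset[of _ "E \<times> E"]) (use assms in auto)
  then have fD: "finite D" unfolding D_def by (intro finite.insertI finite_imageI)
  define d where "d = Min D"
  have d0: "0 < d" unfolding d_def using fD by (subst Min_gr_iff) (auto simp: D_def)
  have dle: "d \<le> norm (\<zeta> - \<eta>) / 2" if "\<zeta> \<in> E" "\<eta> \<in> E" "\<zeta> \<noteq> \<eta>" for \<zeta> \<eta>
    unfolding d_def using fD that by (intro Min_le) (auto simp: D_def)
  have d1: "d \<le> 1" unfolding d_def using fD by (intro Min_le) (auto simp: D_def)
  show thesis
  proof (rule that[of "d ^ card E"])
    fix z \<zeta> assume z: "\<zeta> \<in> E" "\<And>\<eta>. \<eta> \<in> E \<Longrightarrow> norm (\<zeta> - z) \<le> norm (\<eta> - z)"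
    have "d ^ card E \<le> d ^ card (E - {\<zeta>})"
      using d0 d1 assms by (intro power_decreasing card_mono) auto
    also have "\<dots> = (\<Prod>\<eta>\<in>E - {\<zeta>}. d)" by simp
    also have "\<dots> \<le> (\<Prod>\<eta>\<in>E - {\<zeta>}. norm (\<eta> - z))"
    proof (rule prod_mono)
      fix \<eta> assume "\<eta> \<in> E - {\<zeta>}"
      then have e: "\<eta> \<in> E" "\<zeta> \<noteq> \<eta>" by auto
      have "norm (\<zeta> - \<eta>) \<le> norm (\<zeta> - z) + norm (\<eta> - z)"
        using norm_triangle_ineq4[of "\<zeta> - z" "\<eta> - z"] by simp
      then show "0 \<le> d \<and> d \<le> norm (\<eta> - z)" using dle[OF z(1) e] z(2)[OF e(1)] d0 by simp
    qed
    finally have "d ^ card E * norm (\<zeta> - z) \<le> (\<Prod>\<eta>\<in>E - {\<zeta>}. norm (\<eta> - z)) * norm (\<zeta> - z)"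
      by (rule mult_right_mono) simp
    also have "\<dots> = dist_prod E z"
      unfolding dist_prod_def using assms z(1) by (simp only: prod.remove[of E \<zeta>] mult.commute)
    finally show "d ^ card E * norm (\<zeta> - z) \<le> dist_prod E z" .
  qed (use d0 in simp)
qed

context polygonal_boundary
begin

lemma norm_boundary_path: "norm (boundary_path E u t) = radial E u (cis (2 * pi * t))"
  using radial_bounds(1)[of "cis (2 * pi * t)"] u by (simp add: boundary_path_radial norm_mult)

lemma norm_boundary_path_le: "norm (boundary_path E u t) \<le> 1"
  and norm_boundary_path_ge: "u \<le> norm (boundary_path E u t)"
  using radial_bounds[of "cis (2 * pi * t)"] by (simp_all add: norm_boundary_path)

text \<open>Radial projection to the unit circle moves the boundary point \<open>z\<close> by
  \<open>1 - norm z\<close>, which is at most its distance to \<open>\<zeta>\<close>.\<close>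

lemma dist_boundary_path_ge:
  assumes "\<zeta> \<in> E"
  shows "norm (\<zeta> - cis (2 * pi * t)) \<le> 2 * norm (\<zeta> - boundary_path E u t)"
proof -
  let ?w = "cis (2 * pi * t)" and ?z = "boundary_path E u t"
  have "norm (?w - ?z) = 1 - norm ?z"
  proof -
    have "?w - ?z = of_real (1 - radial E u ?w) * ?w" by (simp add: boundary_path_radial algebra_simps)
    then have "norm (?w - ?z) = \<bar>1 - radial E u ?w\<bar>" by (simp only: norm_mult norm_of_real) simp
    then show ?thesis using radial_bounds(2)[of ?w] by (simp add: norm_boundary_path)
  qed
  also have "\<dots> \<le> norm (\<zeta> - ?z)" using norm_triangle_ineq2[of \<zeta> ?z] norm_E[OF assms] by simp
  finally show ?thesis using norm_triangle_ineq4[of "\<zeta> - ?z" "?w - ?z"] by simp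
qed

lemma dist_boundary_path_le:
  assumes "\<zeta> \<in> E"
  shows "norm (\<zeta> - boundary_path E u t) \<le> (1 + 1 / u) * norm (\<zeta> - cis (2 * pi * t))"
proof -
  let ?w = "cis (2 * pi * t)" and ?z = "boundary_path E u t"
  have "?w - ?z = of_real (1 - radial E u ?w) * ?w" by (simp add: boundary_path_radial algebra_simps)
  then have "norm (?w - ?z) = \<bar>1 - radial E u ?w\<bar>" by (simp only: norm_mult norm_of_real) simp
  also have "\<dots> = \<bar>radial E u \<zeta> - radial E u ?w\<bar>" by (simp add: radial_at[OF assms])
  also have "\<dots> \<le> norm (\<zeta> - ?w) / u" using radial_lipschitz[of \<zeta> ?w] norm_E[OF assms] by simp
  finally show ?thesis
    using norm_triangle_ineq[of "\<zeta> - ?w" "?w - ?z"] by (simp add: algebra_simps)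
qed

lemma nearest_point:
  obtains \<zeta> where "\<zeta> \<in> E" "\<And>\<eta>. \<eta> \<in> E \<Longrightarrow> norm (\<zeta> - z) \<le> norm (\<eta> - z)"
    "infdist z E = norm (\<zeta> - z)"
proof -
  obtain \<zeta> where z: "\<zeta> \<in> E" "infdist z E = dist z \<zeta>"
    using infdist_attains_inf[of E z] E_nonempty finite_E by (auto intro: finite_imp_closed)
  then have "norm (\<zeta> - z) \<le> norm (\<eta> - z)" if "\<eta> \<in> E" for \<eta>
    using infdist_le[OF that, of z] by (simp add: dist_norm norm_minus_commute)
  then show thesis using z that by (simp add: dist_norm norm_minus_commute)
qed

text \<open>An integrable majorant for the singular weight that remains when a function vanishes at
  \<open>E\<close> to a small order \<open>\<gamma>\<close> and the resolvent costs one power. It is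
  the case \<open>c = 0\<close> of the bump.\<close>

lemma boundary_weight_bound:
  assumes "0 < \<gamma>" "\<gamma> \<le> 1"
  obtains f where "f integrable_on {0..1}" "\<And>t. 0 \<le> f t"
    "\<And>t \<zeta>. t \<in> {0..1} \<Longrightarrow> \<zeta> \<in> E \<Longrightarrow> cis (2 * pi * t) \<noteq> \<zeta>
      \<Longrightarrow> norm (\<zeta> - boundary_path E u t) powr (\<gamma> - 1) \<le> f t"
proof -
  have "\<forall>\<zeta>\<in>E. \<exists>s. \<forall>t\<in>{0..1}. \<exists>i\<in>{-1,0,1}. 2 * \<bar>t - (s + i)\<bar> \<le> norm (\<zeta> - cis (2 * pi * t))
      \<and> norm (\<zeta> - cis (2 * pi * t)) \<le> 2 * pi * \<bar>t - (s + i)\<bar>"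
    by (intro ballI, rule dist_cis_bounds, rule norm_E) blast+
  then obtain s where s: "\<And>\<zeta> t. \<zeta> \<in> E \<Longrightarrow> t \<in> {0..1} \<Longrightarrow> \<exists>i\<in>{-1,0,1}.
      2 * \<bar>t - (s \<zeta> + i)\<bar> \<le> norm (\<zeta> - cis (2 * pi * t))
      \<and> norm (\<zeta> - cis (2 * pi * t)) \<le> 2 * pi * \<bar>t - (s \<zeta> + i)\<bar>"
    by metis
  define f where "f t = (\<Sum>\<zeta>\<in>E. \<Sum>i\<in>{-1,0,1}. \<bar>t - (s \<zeta> + i)\<bar> powr (\<gamma> - 1) * (1 + 0 * \<bar>t - (s \<zeta> + i)\<bar>) powr (- \<gamma> - 1))" for t
  show thesis
  proof (rule that)
    show "f integrable_on {0..1}"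
      unfolding f_def using assms finite_E by (intro integrable_sum bump_integrable) auto
    show "0 \<le> f t" for t unfolding f_def by (intro sum_nonneg) auto
    fix t \<zeta> assume t: "t \<in> {0..1}" "\<zeta> \<in> E" "cis (2 * pi * t) \<noteq> \<zeta>"
    obtain i where i: "i \<in> {-1,0,1}" "2 * \<bar>t - (s \<zeta> + i)\<bar> \<le> norm (\<zeta> - cis (2 * pi * t))"
      "norm (\<zeta> - cis (2 * pi * t)) \<le> 2 * pi * \<bar>t - (s \<zeta> + i)\<bar>"
      using s[OF t(2,1)] by blast
    have pos: "0 < \<bar>t - (s \<zeta> + i)\<bar>"
    proof (rule ccontr)
      assume "\<not> 0 < \<bar>t - (s \<zeta> + i)\<bar>"
      then have "norm (\<zeta> - cis (2 * pi * t)) \<le> 0" using i(3) by simp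
      then show False using t(3) by simp
    qed
    have "norm (\<zeta> - boundary_path E u t) powr (\<gamma> - 1) \<le> \<bar>t - (s \<zeta> + i)\<bar> powr (\<gamma> - 1)"
      using i dist_boundary_path_ge[OF t(2), of t] pos assms by (intro powr_mono2') auto
    also have "\<dots> \<le> (\<Sum>i\<in>{-1,0,1}. \<bar>t - (s \<zeta> + i)\<bar> powr (\<gamma> - 1) * (1 + 0 * \<bar>t - (s \<zeta> + i)\<bar>) powr (- \<gamma> - 1))"
      using i(1) by (intro order.trans[OF _ member_le_sum[of i]]) auto
    also have "\<dots> \<le> f t"
      unfolding f_def using t(2) finite_E
      by (intro member_le_sum[of \<zeta> E "\<lambda>\<zeta>. \<Sum>i\<in>{-1,0,1}. \<bar>t - (s \<zeta> + i)\<bar> powr (\<gamma> - 1) * (1 + 0 * \<bar>t - (s \<zeta> + i)\<bar>) powr (- \<gamma> - 1)"])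
        (auto intro!: sum_nonneg)
    finally show "norm (\<zeta> - boundary_path E u t) powr (\<gamma> - 1) \<le> f t" .
  qed
qed

text \<open>The Stolz type condition \<open>one_minus_radial_ge\<close> makes \<open>norm z ^ n\<close> decay like
  \<open>exp (- c n \<delta>)\<close>, \<open>\<delta>\<close> being the distance of \<open>z / norm z\<close> to \<open>E\<close>; the exponential is replaced by a power
  in order to have an elementary primitive.\<close>

lemma boundary_power_bound:
  assumes "1 \<le> \<gamma>"
  obtains C where "0 < C"
    "\<And>n::nat. \<exists>f. f integrable_on {0..1} \<and> integral {0..1} f \<le> C * (real n + 1) powr - \<gamma> \<and>
      (\<forall>t\<in>{0..1}. norm (boundary_path E u t) ^ n * dist_prod E (boundary_path E u t) powr (\<gamma> - 1) \<le> f t)"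
proof -
  have "\<forall>\<zeta>\<in>E. \<exists>s. \<forall>t\<in>{0..1}. \<exists>i\<in>{-1,0,1}. 2 * \<bar>t - (s + i)\<bar> \<le> norm (\<zeta> - cis (2 * pi * t))
      \<and> norm (\<zeta> - cis (2 * pi * t)) \<le> 2 * pi * \<bar>t - (s + i)\<bar>"
    by (intro ballI, rule dist_cis_bounds, rule norm_E) blast+
  then obtain s where s: "\<And>\<zeta> t. \<zeta> \<in> E \<Longrightarrow> t \<in> {0..1} \<Longrightarrow> \<exists>i\<in>{-1,0,1}.
      2 * \<bar>t - (s \<zeta> + i)\<bar> \<le> norm (\<zeta> - cis (2 * pi * t))
      \<and> norm (\<zeta> - cis (2 * pi * t)) \<le> 2 * pi * \<bar>t - (s \<zeta> + i)\<bar>"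
    by metis
  obtain k where k: "0 < k" "\<And>w. norm w = 1 \<Longrightarrow> k * infdist w E \<le> 1 - radial E u w"
    using one_minus_radial_ge by blast
  define K where "K = (2 ^ card E * (1 + 1 / u) * (2 * pi)) powr (\<gamma> - 1) / u"
  have "0 < 1 + 1 / u" using u by (simp add: add_pos_pos)
  then have "1 + 1 / u \<noteq> 0" by simp
  then have K: "0 < K" using u by (auto simp: K_def intro!: divide_pos_pos)
  \<comment> \<open>With this choice
    \<open>(n + 1) * (2 * k * x) = (\<gamma> + 1) * (c n * x)\<close>, so that
    \<open>exp y \<ge> 1 + y\<close> produces exactly the exponent \<open>- \<gamma> - 1\<close> of
    the bump.\<close>
  define c where "c n = 2 * k * (real n + 1) / (\<gamma> + 1)" for n :: nat
  have c: "0 < c n" for n using k assms by (simp add: c_def)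
  define b where "b n \<zeta> i t = \<bar>t - (s \<zeta> + i)\<bar> powr (\<gamma> - 1) * (1 + c n * \<bar>t - (s \<zeta> + i)\<bar>) powr (- \<gamma> - 1)"
    for n \<zeta> i t
  define f where "f n t = K * (\<Sum>\<zeta>\<in>E. \<Sum>i\<in>{-1,0,1}. b n \<zeta> i t)" for n t
  have bint: "b n \<zeta> i integrable_on {0..1}" for n \<zeta> i
    unfolding b_def using assms c[of n] by (intro bump_integrable) auto
  have ble: "integral {0..1} (b n \<zeta> i) \<le> 2 / \<gamma> * c n powr - \<gamma>" for n \<zeta> i
    unfolding b_def using assms c[of n] by (intro bump_integral_le) auto
  define C where "C = K * (card E * (3 * (2 / \<gamma> * (2 * k / (\<gamma> + 1)) powr - \<gamma>)))"
  show thesis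
  proof (rule that[of C])
    show "0 < C" using K k assms finite_E E_nonempty by (simp add: C_def card_gt_0_iff)
    fix n :: nat
    have "f n integrable_on {0..1}"
      unfolding f_def using finite_E bint by (intro integrable_on_mult_right integrable_sum) auto
    moreover have "integral {0..1} (f n) \<le> C * (real n + 1) powr - \<gamma>"
    proof -
      have "integral {0..1} (f n) = K * (\<Sum>\<zeta>\<in>E. \<Sum>i\<in>{-1,0,1}. integral {0..1} (b n \<zeta> i))"
      proof -
        have inner: "integral {0..1} (\<lambda>t. \<Sum>i\<in>{-1,0,1}. b n \<zeta> i t) = (\<Sum>i\<in>{-1,0,1}. integral {0..1} (b n \<zeta> i))"
          for \<zeta> by (rule integral_sum) (use bint in auto)
        have "integral {0..1} (\<lambda>t. \<Sum>\<zeta>\<in>E. \<Sum>i\<in>{-1,0,1}. b n \<zeta> i t)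
            = (\<Sum>\<zeta>\<in>E. integral {0..1} (\<lambda>t. \<Sum>i\<in>{-1,0,1}. b n \<zeta> i t))"
          by (rule integral_sum[OF finite_E], rule integrable_sum) (use bint in auto)
        then show ?thesis unfolding f_def integral_mult_right inner by (rule arg_cong)
      qed
      also have "\<dots> \<le> K * (\<Sum>\<zeta>\<in>E. \<Sum>i\<in>{-1,0,1::real}. 2 / \<gamma> * c n powr - \<gamma>)"
        using K ble by (intro mult_left_mono sum_mono) auto
      also have "\<dots> = K * (card E * (3 * (2 / \<gamma> * c n powr - \<gamma>)))" by simp
      also have "c n powr - \<gamma> = (2 * k / (\<gamma> + 1)) powr - \<gamma> * (real n + 1) powr - \<gamma>"
        using k assms by (simp add: c_def flip: powr_mult)
      finally show ?thesis by (simp add: C_def mult_ac)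
    qed
    moreover have "norm (boundary_path E u t) ^ n * dist_prod E (boundary_path E u t) powr (\<gamma> - 1) \<le> f n t"
      if t: "t \<in> {0..1}" for t
    proof -
      let ?w = "cis (2 * pi * t)" and ?z = "boundary_path E u t"
      obtain \<zeta> where z: "\<zeta> \<in> E" "infdist ?w E = norm (\<zeta> - ?w)" using nearest_point by metis
      obtain i where i: "i \<in> {-1,0,1}" "2 * \<bar>t - (s \<zeta> + i)\<bar> \<le> norm (\<zeta> - ?w)"
        "norm (\<zeta> - ?w) \<le> 2 * pi * \<bar>t - (s \<zeta> + i)\<bar>"
        using s[OF z(1) t] by blast
      define x where "x = \<bar>t - (s \<zeta> + i)\<bar>"
      have x: "0 \<le> x" by (simp add: x_def)
      have "k * (2 * x) \<le> k * infdist ?w E" using k i z by (intro mult_left_mono) (auto simp: x_def)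
      also have "\<dots> \<le> 1 - norm ?z" using k(2)[of ?w] by (simp add: norm_boundary_path)
      finally have "norm ?z \<le> 1 - 2 * k * x" by simp
      also have "\<dots> \<le> exp (- (2 * k * x))" using exp_ge_add_one_self[of "- (2 * k * x)"] by simp
      \<comment> \<open>The power \<open>Suc n\<close> gives a rate \<open>c n\<close> that is
        positive for \<open>n = 0\<close> too; the surplus factor is removed below at the cost of
        \<open>1 / u\<close>.\<close>
      finally have "norm ?z ^ Suc n \<le> exp (- (2 * k * x)) ^ Suc n" by (intro power_mono) auto
      also have "\<dots> = exp (real (Suc n) * - (2 * k * x))" by (rule exp_of_nat_mult[symmetric])
      also have "real (Suc n) * - (2 * k * x) = (\<gamma> + 1) * - (c n * x)"
        using assms by (simp add: c_def)
      also have "exp \<dots> = exp (- (c n * x)) powr (\<gamma> + 1)" by (simp add: powr_def)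
      also have "\<dots> \<le> (1 / (1 + c n * x)) powr (\<gamma> + 1)"
      proof (rule powr_mono2)
        have "0 < 1 + c n * x" using c[of n] x by (simp add: add_pos_nonneg)
        then show "exp (- (c n * x)) \<le> 1 / (1 + c n * x)"
          using exp_ge_add_one_self[of "c n * x"] by (simp add: exp_minus field_simps)
      qed (use assms in auto)
      also have "\<dots> = (1 + c n * x) powr (- \<gamma> - 1)"
        using c[of n] x by (simp add: powr_divide powr_minus_divide[symmetric] add_pos_nonneg)
      finally have 1: "norm ?z ^ Suc n \<le> (1 + c n * x) powr (- \<gamma> - 1)" .
      have "u * norm ?z ^ n \<le> norm ?z ^ Suc n"
        using norm_boundary_path_ge[of t] by (simp add: mult_right_mono)
      with 1 have 2: "norm ?z ^ n \<le> (1 + c n * x) powr (- \<gamma> - 1) / u"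
        using u by (simp add: pos_le_divide_eq mult.commute)
      have "dist_prod E ?z \<le> 2 ^ card E * norm (\<zeta> - ?z)"
        by (intro dist_prod_le finite_E E_sphere norm_boundary_path_le z)
      also have "\<dots> \<le> 2 ^ card E * ((1 + 1 / u) * (2 * pi * x))"
        using i(3) u dist_boundary_path_le[OF z(1), of t]
        by (intro mult_left_mono order.trans[OF dist_boundary_path_le[OF z(1)]]) (auto simp: x_def)
      finally have "dist_prod E ?z \<le> (2 ^ card E * (1 + 1 / u) * (2 * pi)) * x" by (simp only: mult_ac)
      then have "dist_prod E ?z powr (\<gamma> - 1) \<le> ((2 ^ card E * (1 + 1 / u) * (2 * pi)) * x) powr (\<gamma> - 1)"
        using assms by (intro powr_mono2 dist_prod_nonneg) auto
      also have "\<dots> = (2 ^ card E * (1 + 1 / u) * (2 * pi)) powr (\<gamma> - 1) * x powr (\<gamma> - 1)"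
        using u x by (subst powr_mult) auto
      finally have 3: "dist_prod E ?z powr (\<gamma> - 1) \<le> (K * u) * x powr (\<gamma> - 1)"
        using u by (simp add: K_def)
      have "norm ?z ^ n * dist_prod E ?z powr (\<gamma> - 1)
        \<le> ((1 + c n * x) powr (- \<gamma> - 1) / u) * ((K * u) * x powr (\<gamma> - 1))"
        by (intro mult_mono 2 3) (use u in auto)
      also have "\<dots> = K * b n \<zeta> i t" using u by (simp add: b_def x_def)
      also have "\<dots> \<le> K * (\<Sum>i\<in>{-1,0,1}. b n \<zeta> i t)"
        using i(1) K by (intro mult_left_mono member_le_sum) (auto simp: b_def)
      also have "\<dots> \<le> f n t"
        unfolding f_def using z(1) finite_E K
        by (intro mult_left_mono member_le_sum[of \<zeta> E "\<lambda>\<zeta>. \<Sum>i\<in>{-1,0,1}. b n \<zeta> i t"] sum_nonneg)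
          (auto simp: b_def)
      finally show ?thesis .
    qed
    ultimately show "\<exists>f. f integrable_on {0..1} \<and> integral {0..1} f \<le> C * (real n + 1) powr - \<gamma> \<and>
      (\<forall>t\<in>{0..1}. norm (boundary_path E u t) ^ n * dist_prod E (boundary_path E u t) powr (\<gamma> - 1) \<le> f t)"
      by blast
  qed
qed

end

section \<open>Contour integrals over the boundary\<close>

text \<open>The zone between the boundaries for \<open>q\<close> and \<open>s\<close> is where the
  function is holomorphic and the resolvent is controlled. Every contour with
  \<open>q < u < s\<close> runs inside it except at \<open>E\<close>, where all these boundaries
  meet.\<close>

locale nested_polygonal =
  fixes E :: "complex set" and q s :: real
  assumes finite_E: "finite E" and E_nonempty: "E \<noteq> {}" and E_sphere: "E \<subseteq> sphere 0 1"
    and q: "0 < q" "q < s" "s < 1" and large: "large_enough E q"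
begin

lemma polygonal_boundary: "q \<le> u \<Longrightarrow> u \<le> s \<Longrightarrow> polygonal_boundary E u"
proof
  assume u: "q \<le> u" "u \<le> s"
  show "0 < u" "u < 1" using u q by auto
  show "large_enough E u"
    using large subset_ball[OF u(1), of 0] unfolding large_enough_def by blast
qed (rule finite_E E_nonempty E_sphere)+

sublocale Q: polygonal_boundary E q by (rule polygonal_boundary) (use q in auto)
sublocale S: polygonal_boundary E s by (rule polygonal_boundary) (use q in auto)

abbreviation "\<gamma> \<equiv> boundary_path E"
abbreviation "\<gamma>' \<equiv> polygonal_boundary.path_deriv E"
abbreviation "breaks \<equiv> polygonal_boundary.breaks E"

definition annulus :: "complex set"
  where "annulus = polygonal E s - closure (polygonal E q)"

lemma open_annulus: "open annulus"
  by (simp add: annulus_def open_Diff open_polygonal)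

lemma ray_in_annulus:
  assumes "norm w = 1" "w \<notin> E" "radial E q w < \<rho>" "\<rho> < radial E s w"
  shows "of_real \<rho> * w \<in> annulus"
proof -
  have "0 \<le> \<rho>" using Q.radial_bounds(1)[OF assms(1)] assms(3) q by simp
  then show ?thesis
    using S.mem_polygonal[OF assms(1) _ assms(4)] Q.radial_max[OF assms(1), of \<rho>] assms(3)
    by (auto simp: annulus_def)
qed

lemma radial_between:
  assumes "q < u" "u < s" "norm w = 1" "w \<notin> E"
  shows "radial E q w < radial E u w" "radial E u w < radial E s w"
  using radial_strict_mono[OF polygonal_boundary polygonal_boundary, of q u w]
    radial_strict_mono[OF polygonal_boundary polygonal_boundary, of u s w] assms q by auto

lemma boundary_in_annulus:
  assumes "q < u" "u < s" "cis (2 * pi * t) \<notin> E"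
  shows "\<gamma> u t \<in> annulus"
  unfolding boundary_path_radial
  using radial_between[OF assms(1,2) _ assms(3)] by (intro ray_in_annulus assms) auto

lemma boundary_segment_in_annulus:
  assumes "q < u" "u < s" "q < v" "v < s" "cis (2 * pi * t) \<notin> E"
  shows "closed_segment (\<gamma> u t) (\<gamma> v t) \<subseteq> annulus"
proof
  let ?w = "cis (2 * pi * t)"
  fix z assume "z \<in> closed_segment (\<gamma> u t) (\<gamma> v t)"
  then obtain l where l: "0 \<le> l" "l \<le> 1" "z = (1 - l) *\<^sub>R \<gamma> u t + l *\<^sub>R \<gamma> v t"
    by (auto simp: in_segment)
  let ?\<rho> = "(1 - l) * radial E u ?w + l * radial E v ?w"
  have z: "z = of_real ?\<rho> * ?w" by (simp add: l(3) boundary_path_radial scaleR_conv_of_real algebra_simps)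
  note b = radial_between[OF assms(1,2) _ assms(5)] radial_between[OF assms(3,4) _ assms(5)]
  have "radial E q ?w < ?\<rho>"
    using convex_bound_lt[of "- radial E u ?w" "- radial E q ?w" "- radial E v ?w" "1 - l" l] b l by simp
  moreover have "?\<rho> < radial E s ?w"
    using convex_bound_lt[of "radial E u ?w" "radial E s ?w" "radial E v ?w" "1 - l" l] b l by simp
  ultimately show "z \<in> annulus" unfolding z using assms(5) by (intro ray_in_annulus) auto
qed

lemma breaks_cis: "q \<le> u \<Longrightarrow> u \<le> s \<Longrightarrow> t \<in> {0<..<1} - breaks u \<Longrightarrow> cis (2 * pi * t) \<notin> E"
  using polygonal_boundary.breaks_def[OF polygonal_boundary] by auto

definition cint :: "real \<Rightarrow> (complex \<Rightarrow> complex) \<Rightarrow> complex"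
  where "cint u f = integral {0..1} (\<lambda>t. f (\<gamma> u t) * \<gamma>' u t)"

lemma path_deriv_outside: "q \<le> u \<Longrightarrow> u \<le> s \<Longrightarrow> t \<notin> {0<..<1} - breaks u \<Longrightarrow> \<gamma>' u t = 0"
  using polygonal_boundary.path_deriv_def[OF polygonal_boundary] by presburger

text \<open>Measurability comes from continuity on an open set of full measure. The majorant
  \<open>B\<close> may be unbounded, as it is for functions that vanish slowly at
  \<open>E\<close>.\<close>

lemma integrand_integrable:
  assumes u: "q < u" "u < s" and f: "continuous_on annulus f"
    and B: "B integrable_on {0..1}"
    and le: "\<And>t. t \<in> {0..1} \<Longrightarrow> cis (2 * pi * t) \<notin> E \<Longrightarrow> norm (f (\<gamma> u t)) \<le> B t"
  shows "(\<lambda>t. f (\<gamma> u t) * \<gamma>' u t) absolutely_integrable_on {0..1}"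
proof -
  have us: "q \<le> u" "u \<le> s" using u by auto
  interpret U: polygonal_boundary E u by (rule polygonal_boundary[OF us])
  let ?S = "{0<..<1} - breaks u"
  have S: "?S \<subseteq> {0..1}" "open ?S" using U.open_minus_breaks by auto
  have in_ann: "\<gamma> u t \<in> annulus" if "t \<in> ?S" for t
    using boundary_in_annulus[OF u breaks_cis[OF us that]] .
  have "continuous_on ?S (\<lambda>t. f (\<gamma> u t) * \<gamma>' u t)"
    using in_ann by (intro continuous_on_mult U.continuous_path_deriv
      continuous_on_compose2[OF f U.continuous_boundary_path]) auto
  then have "(\<lambda>t. f (\<gamma> u t) * \<gamma>' u t) \<in> borel_measurable (lebesgue_on ?S)"
    using S by (intro continuous_imp_measurable_on_sets_lebesgue) auto
  moreover have neg: "negligible ({0..1} - ?S)"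
  proof -
    have "{0..1} - ?S \<subseteq> insert 0 (insert 1 (breaks u))" by auto
    then have "finite ({0..1} - ?S)" by (rule finite_subset) (use U.finite_breaks in auto)
    then show ?thesis by (rule negligible_finite)
  qed
  have neg': "negligible {x \<in> ?S - {0..1}. h x \<noteq> 0}" "negligible {x \<in> {0..1} - ?S. h x \<noteq> 0}"
    for h :: "real \<Rightarrow> 'b::real_vector"
    using S(1) by (auto intro: negligible_subset[OF neg] simp: Diff_eq_empty_iff[THEN iffD2])
  have "(\<lambda>t. B t * (4 * pi / u)) integrable_on ?S"
    using integrable_on_mult_left[OF B, of "4 * pi / u"] integrable_spike_set[OF _ neg'(2,1)]
    by blast
  moreover have "norm (f (\<gamma> u t) * \<gamma>' u t) \<le> B t * (4 * pi / u)" if t: "t \<in> ?S" for t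
  proof -
    have n: "norm (f (\<gamma> u t)) \<le> B t" using le breaks_cis[OF us t] t by auto
    then have "0 \<le> B t" using norm_ge_zero order.trans by blast
    then show ?thesis unfolding norm_mult by (intro mult_mono n U.norm_path_deriv) auto
  qed
  ultimately have "(\<lambda>t. f (\<gamma> u t) * \<gamma>' u t) absolutely_integrable_on ?S"
    using S by (intro measurable_bounded_by_integrable_imp_absolutely_integrable) auto
  then show ?thesis
    using absolutely_integrable_spike_set_eq[OF neg'(1,2)] by blast
qed

lemma integrand_integrable_bounded:
  assumes u: "q < u" "u < s" and f: "f holomorphic_on annulus" and le: "\<And>z. z \<in> annulus \<Longrightarrow> norm (f z) \<le> B"
  shows "(\<lambda>t. f (\<gamma> u t) * \<gamma>' u t) absolutely_integrable_on {0..1}"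
  by (rule integrand_integrable[OF u holomorphic_on_imp_continuous_on[OF f], where B = "\<lambda>_. B"])
    (use le boundary_in_annulus[OF u] in auto)

text \<open>The boundary meets \<open>E\<close>, where the integrand need not be continuous, so the closed path is
  first shrunk towards the origin.\<close>

lemma cint_holomorphic:
  assumes u: "q < u" "u < s" and \<psi>: "\<psi> holomorphic_on polygonal E s"
    and le: "\<And>z. z \<in> polygonal E s \<Longrightarrow> norm (\<psi> z) \<le> B"
  shows "cint u \<psi> = 0"
proof -
  have us: "q \<le> u" "u \<le> s" using u by auto
  interpret U: polygonal_boundary E u by (rule polygonal_boundary[OF us])
  have 0: "0 \<in> polygonal E s" using ball_subset_polygonal[of s E] q by auto
  then have B0: "0 \<le> B" using le norm_ge_zero order.trans by blast
  obtain \<Psi> where \<Psi>: "\<And>z. z \<in> polygonal E s \<Longrightarrow> (\<Psi> has_field_derivative \<psi> z) (at z)"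
    using holomorphic_convex_primitive'[OF convex_polygonal open_polygonal \<psi>]
    by (metis at_within_open open_polygonal)
  have sub: "closure (polygonal E u) \<subseteq> closure (polygonal E s)"
    using polygonal_mono[OF us(2)] by (rule closure_mono)
  have in_cl: "\<gamma> u t \<in> closure (polygonal E u)" for t
    unfolding boundary_path_radial by (rule U.radial_in_closure) simp
  have shrink: "of_real \<rho> * \<gamma> u t \<in> polygonal E s" if "0 \<le> \<rho>" "\<rho> < 1" for \<rho> t
    using scaled_mem_polygonal[OF S.u(1) _ that] in_cl[of t] sub by blast
  \<comment> \<open>The shrunken curve is closed and lies in the convex open domain, where
    \<open>\<psi>\<close> has a primitive.\<close>
  have zero: "((\<lambda>t. of_real \<rho> * (\<psi> (of_real \<rho> * \<gamma> u t) * \<gamma>' u t)) has_integral 0) {0..1}" if \<rho>: "0 \<le> \<rho>" "\<rho> < 1" for \<rho>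
  proof -
    let ?F = "\<lambda>t. \<Psi> (of_real \<rho> * \<gamma> u t)"
    have "((\<lambda>t. of_real \<rho> * (\<psi> (of_real \<rho> * \<gamma> u t) * \<gamma>' u t)) has_integral (?F 1 - ?F 0)) {0..1}"
    proof (rule fundamental_theorem_of_calculus_interior_strong[OF U.finite_breaks])
      have "continuous_on (polygonal E s) \<Psi>"
        using \<Psi> by (meson DERIV_isCont continuous_at_imp_continuous_on)
      then show "continuous_on {0..1} ?F"
        by (rule continuous_on_compose2) (use shrink[OF \<rho>] in \<open>auto intro!: continuous_intros U.continuous_boundary_path\<close>)
      fix t assume t: "t \<in> {0<..<1} - breaks u"
      have "((\<lambda>t. of_real \<rho> * \<gamma> u t) has_vector_derivative of_real \<rho> * \<gamma>' u t) (at t)"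
        by (intro has_vector_derivative_mult_right U.boundary_path_deriv t)
      from field_vector_diff_chain_at[OF this \<Psi>[OF shrink[OF \<rho>]]]
      show "(?F has_vector_derivative of_real \<rho> * (\<psi> (of_real \<rho> * \<gamma> u t) * \<gamma>' u t)) (at t)"
        by (simp add: o_def mult_ac)
    qed simp
    then show ?thesis by (simp add: boundary_path_radial)
  qed
  define \<rho> where "\<rho> n = 1 - inverse (real (Suc n))" for n
  have \<rho>: "0 \<le> \<rho> n" "\<rho> n < 1" for n by (simp_all add: \<rho>_def inverse_le_1_iff)
  have \<rho>1: "\<rho> \<longlonglongrightarrow> 1" unfolding \<rho>_def
    using tendsto_diff[OF tendsto_const[of 1] LIMSEQ_inverse_real_of_nat] by simp
  have "(\<lambda>n. integral {0..1} (\<lambda>t. of_real (\<rho> n) * (\<psi> (of_real (\<rho> n) * \<gamma> u t) * \<gamma>' u t)))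
    \<longlonglongrightarrow> integral {0..1} (\<lambda>t. \<psi> (\<gamma> u t) * \<gamma>' u t)"
  proof (rule dominated_convergence(2)[where h = "\<lambda>_. B * (4 * pi / u)"])
    show "(\<lambda>t. of_real (\<rho> n) * (\<psi> (of_real (\<rho> n) * \<gamma> u t) * \<gamma>' u t)) integrable_on {0..1}" for n
      using zero[OF \<rho>] by blast
    fix n t
    have "norm (\<psi> (of_real (\<rho> n) * \<gamma> u t) * \<gamma>' u t) \<le> B * (4 * pi / u)"
      unfolding norm_mult by (intro mult_mono le shrink \<rho> U.norm_path_deriv B0) auto
    moreover have "norm (of_real (\<rho> n) * x) \<le> norm x" for x :: complex
      using \<rho>[of n] by (simp add: norm_mult mult_left_le_one_le)
    ultimately show "norm (of_real (\<rho> n) * (\<psi> (of_real (\<rho> n) * \<gamma> u t) * \<gamma>' u t)) \<le> B * (4 * pi / u)"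
      using order.trans by blast
  next
    fix t :: real
    show "(\<lambda>n. of_real (\<rho> n) * (\<psi> (of_real (\<rho> n) * \<gamma> u t) * \<gamma>' u t)) \<longlonglongrightarrow> \<psi> (\<gamma> u t) * \<gamma>' u t"
    proof (cases "t \<in> {0<..<1} - breaks u")
      case True
      have "\<gamma> u t \<in> polygonal E s"
        using boundary_in_annulus[OF u breaks_cis[OF us True]] by (simp add: annulus_def)
      then have "isCont \<psi> (\<gamma> u t)"
        using holomorphic_on_imp_continuous_on[OF \<psi>] open_polygonal continuous_on_eq_continuous_at by blast
      moreover have lim: "(\<lambda>n. of_real (\<rho> n) * \<gamma> u t) \<longlonglongrightarrow> of_real 1 * \<gamma> u t"
        by (intro tendsto_intros \<rho>1)
      ultimately have "(\<lambda>n. \<psi> (of_real (\<rho> n) * \<gamma> u t)) \<longlonglongrightarrow> \<psi> (\<gamma> u t)"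
        using isCont_tendsto_compose by fastforce
      then have "(\<lambda>n. of_real (\<rho> n) * (\<psi> (of_real (\<rho> n) * \<gamma> u t) * \<gamma>' u t)) \<longlonglongrightarrow> of_real 1 * (\<psi> (\<gamma> u t) * \<gamma>' u t)"
        by (intro tendsto_intros \<rho>1)
      then show ?thesis by simp
    next
      case False
      have z0: "\<gamma>' u t = 0" by (rule path_deriv_outside[OF us False])
      show ?thesis by (simp only: z0 mult_zero_right tendsto_const)
    qed
  qed (rule integrable_const_ivl)
  moreover have "integral {0..1} (\<lambda>t. of_real (\<rho> n) * (\<psi> (of_real (\<rho> n) * \<gamma> u t) * \<gamma>' u t)) = 0" for n
    using zero[OF \<rho>] by (rule integral_unique)
  ultimately have "(\<lambda>n::nat. 0) \<longlonglongrightarrow> integral {0..1} (\<lambda>t. \<psi> (\<gamma> u t) * \<gamma>' u t)"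
    by (simp only:)
  then show ?thesis unfolding cint_def using LIMSEQ_unique[OF tendsto_const] by metis
qed

text \<open>A neighbourhood of constant width of a segment is a Minkowski sum of convex sets, hence
  convex, so \<open>f\<close> has a primitive on it.\<close>

lemma local_primitive:
  assumes f: "f holomorphic_on annulus" and ab: "closed_segment a b \<subseteq> annulus"
  obtains V F where "open V" "a \<in> V" "b \<in> V" "V \<subseteq> annulus"
    "\<And>z. z \<in> V \<Longrightarrow> (F has_field_derivative f z) (at z)"
    "\<And>x y. x \<in> V \<Longrightarrow> y \<in> V \<Longrightarrow> contour_integral (linepath x y) f = F y - F x"
proof -
  obtain e where e: "0 < e" "(\<Union>x\<in>closed_segment a b. ball x e) \<subseteq> annulus"
    using compact_subset_open_imp_ball_epsilon_subset[OF compact_segment open_annulus ab] by blast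
  define V where "V = (\<Union>x\<in>closed_segment a b. ball x e)"
  have V: "open V" "V \<subseteq> annulus" using e by (auto simp: V_def)
  have "V = {x + y |x y. x \<in> closed_segment a b \<and> y \<in> ball 0 e}"
  proof (intro set_eqI iffI)
    fix z assume "z \<in> V"
    then obtain x where "x \<in> closed_segment a b" "z \<in> ball x e" by (auto simp: V_def)
    then show "z \<in> {x + y |x y. x \<in> closed_segment a b \<and> y \<in> ball 0 e}"
      by (intro CollectI exI[of _ x] exI[of _ "z - x"]) (auto simp: dist_norm norm_minus_commute)
  next
    fix z assume "z \<in> {x + y |x y. x \<in> closed_segment a b \<and> y \<in> ball 0 e}"
    then obtain x y where "z = x + y" "x \<in> closed_segment a b" "y \<in> ball 0 e" by blast
    then have "x \<in> closed_segment a b" "z \<in> ball x e" by (simp_all add: dist_norm)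
    then show "z \<in> V" unfolding V_def by blast
  qed
  moreover have "{x + y |x y. x \<in> closed_segment a b \<and> y \<in> ball 0 e}
      = (\<Union>x\<in>closed_segment a b. \<Union>y\<in>ball 0 e. {x + y})" by blast
  then have "convex {x + y |x y. x \<in> closed_segment a b \<and> y \<in> ball 0 e}"
    using convex_sums[OF convex_closed_segment convex_ball] by simp
  ultimately have cV: "convex V" by simp
  obtain F where F: "\<And>z. z \<in> V \<Longrightarrow> (F has_field_derivative f z) (at z within V)"
    using holomorphic_convex_primitive'[OF cV V(1) holomorphic_on_subset[OF f V(2)]] by blast
  show thesis
  proof (rule that[OF V(1) _ _ V(2)])
    show "a \<in> V" unfolding V_def by (rule UN_I[of a]) (use e(1) in simp_all)
    show "b \<in> V" unfolding V_def by (rule UN_I[of b]) (use e(1) in simp_all)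
    show "(F has_field_derivative f z) (at z)" if "z \<in> V" for z
      using F[OF that] unfolding at_within_open[OF that V(1)] .
    fix x y assume xy: "x \<in> V" "y \<in> V"
    then have "closed_segment x y \<subseteq> V" using cV by (simp add: closed_segment_subset)
    then have "(f has_contour_integral (F (pathfinish (linepath x y)) - F (pathstart (linepath x y)))) (linepath x y)"
      by (intro contour_integral_primitive[OF F]) auto
    then show "contour_integral (linepath x y) f = F y - F x"
      using contour_integral_unique by fastforce
  qed
qed

text \<open>The annulus is pinched at \<open>E\<close>, so the two curves are not simply deformed
  into each other inside it. Instead \<open>H t\<close> integrates \<open>f\<close> over the radial
  segment between them: its derivative is the difference of the integrands, and it takes equal
  values at \<open>0\<close> and \<open>1\<close>.\<close>

lemma cint_independent:
  assumes u: "q < u" "u < s" and v: "q < v" "v < s"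
    and f: "f holomorphic_on annulus" and le: "\<And>z. z \<in> annulus \<Longrightarrow> norm (f z) \<le> B"
  shows "cint u f = cint v f"
proof -
  have us: "q \<le> u" "u \<le> s" "q \<le> v" "v \<le> s" using u v by auto
  interpret U: polygonal_boundary E u by (rule polygonal_boundary) (use us in auto)
  interpret V: polygonal_boundary E v by (rule polygonal_boundary) (use us in auto)
  \<comment> \<open>Over points of \<open>E\<close> the curves meet. The value \<open>0\<close> is
    the limit of \<open>H\<close> there, because \<open>f\<close> is bounded and the segment shrinks
    to a point.\<close>
  define H where "H t = (if cis (2 * pi * t) \<in> E then 0 else contour_integral (linepath (\<gamma> u t) (\<gamma> v t)) f)" for t
  have B0: "0 \<le> B"
  proof -
    have "infinite ({0<..<1} - breaks u)" using U.finite_breaks by (simp add: Diff_infinite_finite)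
    then have "{0<..<1} - breaks u \<noteq> {}" by fastforce
    then obtain t :: real where "t \<in> {0<..<1} - breaks u" by blast
    then have "\<gamma> u t \<in> annulus" using boundary_in_annulus[OF u breaks_cis[OF us(1,2)]] by blast
    then show ?thesis using le norm_ge_zero order.trans by blast
  qed
  have nE: "open {t. cis (2 * pi * t) \<notin> E}"
  proof -
    have "closed ((\<lambda>t. cis (2 * pi * t)) -` E)"
      by (intro closed_vimage finite_imp_closed finite_E continuous_intros)
    then have "open (- ((\<lambda>t. cis (2 * pi * t)) -` E))" by (rule open_Compl)
    moreover have "{t. cis (2 * pi * t) \<notin> E} = - ((\<lambda>t. cis (2 * pi * t)) -` E)" by auto
    ultimately show ?thesis by (simp only:)
  qed
  have local: "\<exists>N F V. open N \<and> t \<in> N \<and> open V \<and> (\<forall>z\<in>V. (F has_field_derivative f z) (at z))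
      \<and> (\<forall>t\<in>N. \<gamma> u t \<in> V \<and> \<gamma> v t \<in> V \<and> H t = F (\<gamma> v t) - F (\<gamma> u t))"
    if t: "cis (2 * pi * t) \<notin> E" for t
  proof -
    obtain W F where W: "open W" "\<gamma> u t \<in> W" "\<gamma> v t \<in> W" "W \<subseteq> annulus"
      "\<And>z. z \<in> W \<Longrightarrow> (F has_field_derivative f z) (at z)"
      "\<And>x y. x \<in> W \<Longrightarrow> y \<in> W \<Longrightarrow> contour_integral (linepath x y) f = F y - F x"
      by (rule local_primitive[OF f boundary_segment_in_annulus[OF u v t]], rule that)
    define N where "N = {t. cis (2 * pi * t) \<notin> E} \<inter> (\<gamma> u -` W) \<inter> (\<gamma> v -` W)"
    have oN: "open N"
      unfolding N_def
      by (intro open_Int nE open_vimage W U.continuous_boundary_path V.continuous_boundary_path)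
    have tN: "t \<in> N" using t W by (simp add: N_def)
    have HN: "\<forall>t\<in>N. \<gamma> u t \<in> W \<and> \<gamma> v t \<in> W \<and> H t = F (\<gamma> v t) - F (\<gamma> u t)"
      using W(6) by (simp add: N_def H_def)
    have dW: "\<forall>z\<in>W. (F has_field_derivative f z) (at z)" using W(5) by blast
    show ?thesis
      by (rule exI[of _ N], rule exI[of _ F], rule exI[of _ W], intro conjI oN tN W(1) dW HN)
  qed
  have Hle: "norm (H t) \<le> B * norm (\<gamma> v t - \<gamma> u t)" for t
  proof (cases "cis (2 * pi * t) \<in> E")
    case False
    have seg: "closed_segment (\<gamma> u t) (\<gamma> v t) \<subseteq> annulus" by (rule boundary_segment_in_annulus[OF u v False])
    have "f contour_integrable_on linepath (\<gamma> u t) (\<gamma> v t)"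
      by (rule contour_integrable_continuous_linepath)
        (rule continuous_on_subset[OF holomorphic_on_imp_continuous_on[OF f] seg])
    from has_contour_integral_bound_linepath[OF has_contour_integral_integral[OF this] B0]
    show ?thesis using False seg le by (auto simp: H_def)
  qed (simp add: H_def B0)
  have contH: "isCont H t" for t
  proof (cases "cis (2 * pi * t) \<in> E")
    case True
    have "radial E u (cis (2 * pi * t)) = radial E v (cis (2 * pi * t))"
      using U.radial_at[OF True] V.radial_at[OF True] by simp
    then have 0: "\<gamma> v t - \<gamma> u t = 0" by (simp add: boundary_path_radial)
    have "isCont (\<gamma> u) t" "isCont (\<gamma> v) t"
      using U.continuous_boundary_path[of UNIV] V.continuous_boundary_path[of UNIV]
      by (auto simp: continuous_on_eq_continuous_at)
    then have "isCont (\<lambda>t. B * norm (\<gamma> v t - \<gamma> u t)) t" by (intro continuous_intros)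
    then have "((\<lambda>t. B * norm (\<gamma> v t - \<gamma> u t)) \<longlongrightarrow> 0) (at t)"
      unfolding isCont_def 0 by simp
    then have "(H \<longlongrightarrow> 0) (at t)"
      by (rule Lim_null_comparison[rotated]) (simp add: Hle)
    then show ?thesis using True by (simp add: isCont_def H_def)
  next
    case False
    obtain N F W where W: "open N" "t \<in> N" "open W" "\<forall>z\<in>W. (F has_field_derivative f z) (at z)"
      "\<forall>t\<in>N. \<gamma> u t \<in> W \<and> \<gamma> v t \<in> W \<and> H t = F (\<gamma> v t) - F (\<gamma> u t)"
      using local[OF False] by (elim exE conjE) (rule that)
    have cF: "continuous_on W F" using W(4) by (meson DERIV_isCont continuous_at_imp_continuous_on)
    have "continuous_on N (\<lambda>t. F (\<gamma> v t))"
      by (rule continuous_on_compose2[OF cF V.continuous_boundary_path]) (use W(5) in blast)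
    moreover have "continuous_on N (\<lambda>t. F (\<gamma> u t))"
      by (rule continuous_on_compose2[OF cF U.continuous_boundary_path]) (use W(5) in blast)
    ultimately have "continuous_on N (\<lambda>t. F (\<gamma> v t) - F (\<gamma> u t))"
      by (rule continuous_on_diff)
    then have "continuous_on N H" by (rule continuous_on_eq) (use W(5) in simp)
    then show ?thesis using W(1,2) continuous_on_eq_continuous_at by blast
  qed
  have "((\<lambda>t. f (\<gamma> v t) * \<gamma>' v t - f (\<gamma> u t) * \<gamma>' u t) has_integral (H 1 - H 0)) {0..1}"
  proof (rule fundamental_theorem_of_calculus_interior_strong[of "breaks u \<union> breaks v"])
    show "finite (breaks u \<union> breaks v)" using U.finite_breaks V.finite_breaks by simp
    show "continuous_on {0..1} H" using contH by (simp add: continuous_at_imp_continuous_on)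
    fix t assume t: "t \<in> {0<..<1} - (breaks u \<union> breaks v)"
    then have tu: "t \<in> {0<..<1} - breaks u" and tv: "t \<in> {0<..<1} - breaks v" by auto
    obtain N F W where W: "open N" "t \<in> N" "open W" "\<forall>z\<in>W. (F has_field_derivative f z) (at z)"
      "\<forall>t\<in>N. \<gamma> u t \<in> W \<and> \<gamma> v t \<in> W \<and> H t = F (\<gamma> v t) - F (\<gamma> u t)"
      using local[OF breaks_cis[OF us(1,2) tu]] by (elim exE conjE) (rule that)
    have uv: "\<gamma> u t \<in> W" "\<gamma> v t \<in> W" using W(2,5) by auto
    have "((\<lambda>t. F (\<gamma> v t) - F (\<gamma> u t)) has_vector_derivative f (\<gamma> v t) * \<gamma>' v t - f (\<gamma> u t) * \<gamma>' u t) (at t)"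
      using field_vector_diff_chain_at[OF V.boundary_path_deriv[OF tv] W(4)[rule_format, OF uv(2)]]
        field_vector_diff_chain_at[OF U.boundary_path_deriv[OF tu] W(4)[rule_format, OF uv(1)]]
      by (intro has_vector_derivative_diff) (simp_all add: o_def mult.commute)
    then show "(H has_vector_derivative f (\<gamma> v t) * \<gamma>' v t - f (\<gamma> u t) * \<gamma>' u t) (at t)"
      by (rule has_vector_derivative_transform_within_open[OF _ W(1,2)]) (simp add: W(5))
  qed simp
  moreover have "H 1 = H 0" by (simp add: H_def boundary_path_radial)
  ultimately have "integral {0..1} (\<lambda>t. f (\<gamma> v t) * \<gamma>' v t - f (\<gamma> u t) * \<gamma>' u t) = 0"
    by (simp add: integral_unique)
  moreover have "(\<lambda>t. f (\<gamma> w t) * \<gamma>' w t) integrable_on {0..1}" if "q < w" "w < s" for w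
    using integrand_integrable_bounded[OF that f le] by (rule set_lebesgue_integral_eq_integral(1))
  ultimately show ?thesis
    unfolding cint_def using u v by (subst (asm) Henstock_Kurzweil_Integration.integral_diff) auto
qed

end

section \<open>Improper integrals on the positive half-line\<close>

text \<open>Lebesgue dominated convergence is only available for functions with values in a Euclidean
  space; for values in a Banach space, a primitive extended to \<open>0\<close> gives integrability.\<close>

lemma dominated_integrable_on_pos:
  fixes f :: "real \<Rightarrow> 'a::banach"
  assumes f: "continuous_on {0<..} f" and b: "b integrable_on {0<..}"
    and le: "\<And>x. 0 < x \<Longrightarrow> norm (f x) \<le> b x"
  shows "f integrable_on {0<..}"
proof -
  have spike: "(h integrable_on {0<..}) = (h integrable_on {0..})" for h :: "real \<Rightarrow> 'b::banach"
    by (rule integrable_spike_set_eq, rule negligible_subset[of "{0}"]) auto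
  define c where "c x = (if x = 0 then 0 else b x)" for x
  have cint: "c integrable_on {0..}"
    using b unfolding spike[symmetric] by (rule integrable_eq) (simp add: c_def)
  have "0 \<le> b x" if "0 < x" for x using order.trans[OF norm_ge_zero le[OF that]] .
  then have c0: "0 \<le> c x" if "0 \<le> x" for x using that by (auto simp: c_def)
  have cI: "c integrable_on {x..y}" if "0 \<le> x" for x y
    by (rule integrable_on_subinterval[OF cint]) (use that in auto)
  have fI: "f integrable_on {x..y}" if "0 < x" for x y
    by (rule integrable_continuous_real, rule continuous_on_subset[OF f]) (use that in auto)
  define B where "B x = integral {0..x} c" for x
  have Bdiff: "B y - B x = integral {x..y} c" if "0 \<le> x" "x \<le> y" for x y
    using Henstock_Kurzweil_Integration.integral_combine[OF that cI[OF order.refl]] by (simp add: B_def)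
  have Bmono: "B x \<le> B y" if "0 \<le> x" "x \<le> y" for x y
    using Bdiff[OF that] Henstock_Kurzweil_Integration.integral_nonneg[OF cI[OF that(1)], of y] c0 that by simp
  \<comment> \<open>The primitive is based at \<open>1\<close>, since \<open>f\<close> may be
    singular at \<open>0\<close>.\<close>
  define \<Phi> where "\<Phi> y = (if 1 \<le> y then integral {1..y} f else - integral {y..1} f)" for y
  have \<Phi>: "\<Phi> y = integral {d..y} f - integral {d..1} f" if "0 < d" "d \<le> 1" "d \<le> y" for d y
  proof (cases "1 \<le> y")
    case True
    then show ?thesis
      using Henstock_Kurzweil_Integration.integral_combine[OF that(2) True fI[OF that(1)]]
      by (simp add: \<Phi>_def algebra_simps)
  next
    case False
    then have "y \<le> 1" by simp
    from Henstock_Kurzweil_Integration.integral_combine[OF that(3) this fI[OF that(1)]] False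
    show ?thesis by (simp add: \<Phi>_def algebra_simps)
  qed
  have deriv: "(\<Phi> has_vector_derivative f x) (at x)" if x: "0 < x" for x
  proof -
    define d where "d = min x 1 / 2"
    have d: "0 < d" "d \<le> 1" "d < x" using x by (auto simp: d_def)
    have "continuous_on {d..x + 1} f" by (rule continuous_on_subset[OF f]) (use d in auto)
    then have "((\<lambda>u. integral {d..u} f) has_vector_derivative f x) (at x within {d..x + 1})"
      by (rule integral_has_vector_derivative) (use d in auto)
    then have "((\<lambda>u. integral {d..u} f) has_vector_derivative f x) (at x)"
      using d by (simp add: at_within_Icc_at)
    then have "((\<lambda>u. integral {d..u} f - integral {d..1} f) has_vector_derivative f x - 0) (at x)"
      by (rule has_vector_derivative_diff) (rule has_vector_derivative_const)
    then show ?thesis unfolding diff_zero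
      by (rule has_vector_derivative_transform_within_open[OF _ open_greaterThan[of d]])
        (use d \<Phi>[OF d(1,2)] in auto)
  qed
  have \<Phi>diff: "norm (\<Phi> y - \<Phi> x) \<le> B y - B x" if xy: "0 < x" "x \<le> y" for x y
  proof -
    define d where "d = min x 1"
    have d: "0 < d" "d \<le> 1" "d \<le> x" using xy by (auto simp: d_def)
    have "\<Phi> y - \<Phi> x = integral {d..y} f - integral {d..x} f"
      by (simp only: \<Phi>[OF d(1,2,3)] \<Phi>[OF d(1,2) order.trans[OF d(3) xy(2)]]) simp
    also have "\<dots> = integral {x..y} f"
      using Henstock_Kurzweil_Integration.integral_combine[OF d(3) xy(2) fI[OF d(1)]]
      by (metis add_diff_cancel_left')
    also have "norm \<dots> \<le> integral {x..y} c"
      using xy by (intro Henstock_Kurzweil_Integration.integral_norm_bound_integral fI cI) (auto simp: c_def le)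
    finally show ?thesis using Bdiff xy by simp
  qed
  have Bcont: "continuous_on {0..y} B" for y
    unfolding B_def by (rule indefinite_integral_continuous_1[OF cI]) simp
  \<comment> \<open>Increments of \<open>\<Phi>\<close> are dominated by those of \<open>B\<close>,
    which is continuous up to \<open>0\<close>; hence \<open>\<Phi>\<close> extends continuously to
    \<open>0\<close>.\<close>
  have "uniformly_continuous_on {0<..1} \<Phi>"
    unfolding uniformly_continuous_on_def
  proof (intro allI impI)
    fix e :: real assume e: "0 < e"
    have "uniformly_continuous_on {0..1} B"
      by (rule compact_uniformly_continuous[OF Bcont]) simp
    then obtain d where d: "0 < d" "\<And>x y. x \<in> {0..1} \<Longrightarrow> y \<in> {0..1} \<Longrightarrow> dist y x < d \<Longrightarrow> dist (B y) (B x) < e"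
      by (rule uniformly_continuous_onE[OF _ e]) (rule that, assumption, blast)
    have "dist (\<Phi> y) (\<Phi> x) < e" if "x \<in> {0<..1}" "y \<in> {0<..1}" "dist y x < d" for x y
    proof -
      have "dist (\<Phi> y) (\<Phi> x) \<le> dist (B y) (B x)"
        using \<Phi>diff[of x y] \<Phi>diff[of y x] that
        by (cases "x \<le> y") (auto simp: dist_norm norm_minus_commute)
      also have "\<dots> < e" using d(2)[of x y] that by auto
      finally show ?thesis .
    qed
    then show "\<exists>d>0. \<forall>x\<in>{0<..1}. \<forall>y\<in>{0<..1}. dist y x < d \<longrightarrow> dist (\<Phi> y) (\<Phi> x) < e"
      using d(1) by blast
  qed
  then obtain g where g: "uniformly_continuous_on (closure {0<..1}) g" "\<And>x. x \<in> {0<..1} \<Longrightarrow> \<Phi> x = g x"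
    by (rule uniformly_continuous_on_extension_on_closure) blast
  have gc: "continuous_on {0..1} g" using uniformly_continuous_imp_continuous[OF g(1)] by simp
  define \<Psi> where "\<Psi> x = (if x \<le> 1 then g x else \<Phi> x)" for x
  have \<Psi>\<Phi>: "\<Psi> x = \<Phi> x" if "0 < x" for x using g(2) that by (simp add: \<Psi>_def)
  have hasI: "(f has_integral (\<Psi> y - \<Psi> 0)) {0..y}" if y: "0 \<le> y" for y
  proof (rule fundamental_theorem_of_calculus_interior_strong[of "{}"])
    show "continuous_on {0..y} \<Psi>"
      unfolding \<Psi>_def
    proof (rule continuous_on_cases_le)
      show "continuous_on {t \<in> {0..y}. t \<le> 1} g" by (rule continuous_on_subset[OF gc]) auto
      show "continuous_on {t \<in> {0..y}. 1 \<le> t} \<Phi>"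
        by (rule continuous_at_imp_continuous_on, rule ballI, rule has_vector_derivative_continuous[OF deriv]) auto
    qed (use g(2) in \<open>auto intro!: continuous_intros\<close>)
    fix x assume "x \<in> {0<..<y} - {}"
    then have x: "0 < x" by simp
    show "(\<Psi> has_vector_derivative f x) (at x)"
      by (rule has_vector_derivative_transform_within_open[OF deriv[OF x] open_greaterThan[of 0]])
        (use x \<Psi>\<Phi> in auto)
  qed (use y in simp_all)
  have Bbd: "B (real n) \<le> integral {0..} c" for n
    unfolding B_def by (rule integral_subset_le) (use cI cint c0 in auto)
  have "incseq (\<lambda>n. B (real n))" by (intro incseq_SucI Bmono) auto
  then obtain L where L: "(\<lambda>n. B (real n)) \<longlonglongrightarrow> L"
    using incseq_convergent[of "\<lambda>n. B (real n)" "integral {0..} c"] Bbd by metis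
  have \<Psi>diff: "norm (\<Psi> y - \<Psi> x) \<le> B y - B x" if "0 < x" "x \<le> y" for x y
    using \<Phi>diff[OF that] \<Psi>\<Phi> that by simp
  \<comment> \<open>The same domination, now with the convergence of \<open>B\<close> at infinity,
    gives the limit of the primitive there.\<close>
  have "Cauchy (\<lambda>n. \<Psi> (real n))"
    unfolding Cauchy_def
  proof (intro allI impI)
    fix e :: real assume e: "0 < e"
    obtain N where N: "\<And>m n. m \<ge> N \<Longrightarrow> n \<ge> N \<Longrightarrow> dist (B (real m)) (B (real n)) < e"
      using metric_CauchyD[OF LIMSEQ_imp_Cauchy[OF L] e] by metis
    have "dist (\<Psi> (real m)) (\<Psi> (real n)) < e" if "m \<ge> max 1 N" "n \<ge> max 1 N" for m n
    proof -
      have "dist (\<Psi> (real m)) (\<Psi> (real n)) \<le> dist (B (real m)) (B (real n))"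
        using \<Psi>diff[of m n] \<Psi>diff[of n m] that
        by (cases "m \<le> n") (auto simp: dist_norm norm_minus_commute)
      then show ?thesis using N[of m n] that by simp
    qed
    then show "\<exists>M. \<forall>m\<ge>M. \<forall>n\<ge>M. dist (\<Psi> (real m)) (\<Psi> (real n)) < e" by blast
  qed
  then obtain I where I: "(\<lambda>n. \<Psi> (real n)) \<longlonglongrightarrow> I" using Cauchy_convergent convergent_def by blast
  have tail: "norm (I - \<Psi> y) \<le> L - B y" if y: "0 < y" for y
  proof (rule LIMSEQ_le[OF tendsto_norm[OF tendsto_diff[OF I tendsto_const]] tendsto_diff[OF L tendsto_const]])
    obtain N where N: "y \<le> real N" using real_arch_simple by blast
    have "norm (\<Psi> (real n) - \<Psi> y) \<le> B (real n) - B y" if "N \<le> n" for n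
      using N that y by (intro \<Psi>diff) auto
    then show "\<exists>N. \<forall>n\<ge>N. norm (\<Psi> (real n) - \<Psi> y) \<le> B (real n) - B y" by blast
  qed
  have "(f has_integral (I - \<Psi> 0)) {0..}"
    unfolding has_integral_alt'[of f]
  proof (intro conjI allI impI)
    fix a d :: real
    have "f integrable_on {0..} \<inter> cbox a d"
      using integrable_on_subinterval[OF has_integral_integrable[OF hasI[of "max 0 d"]], of "max 0 a" d]
      by (simp add: Int_atLeastAtMostL2 flip: atLeastAtMost_iff)
    then show "(\<lambda>x. if x \<in> {0..} then f x else 0) integrable_on cbox a d"
      by (simp only: integrable_restrict_Int)
  next
    fix e :: real assume e: "0 < e"
    obtain N where N: "N \<ge> 1" "dist (B (real N)) L < e"
      using metric_LIMSEQ_D[OF L e] by (metis max.cobounded1 max.cobounded2)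
    show "\<exists>Bd>0. \<forall>a d. ball 0 Bd \<subseteq> cbox a d \<longrightarrow>
        norm (integral (cbox a d) (\<lambda>x. if x \<in> {0..} then f x else 0) - (I - \<Psi> 0)) < e"
    proof (intro exI[of _ "real N + 1"] conjI allI impI)
      fix a d :: real assume sub: "ball 0 (real N + 1) \<subseteq> cbox a d"
      have "real N \<in> cbox a d" "0 \<in> cbox a d" by (rule subsetD[OF sub], simp)+
      then have ad: "a \<le> 0" "real N \<le> d" by auto
      then have "{0..} \<inter> cbox a d = {0..d}" by auto
      then have "integral (cbox a d) (\<lambda>x. if x \<in> {0..} then f x else 0) = \<Psi> d - \<Psi> 0"
        using integral_unique[OF hasI[of d]] ad by (simp only: integral_restrict_Int)
      then have "norm (integral (cbox a d) (\<lambda>x. if x \<in> {0..} then f x else 0) - (I - \<Psi> 0)) = norm (I - \<Psi> d)"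
        by (simp add: norm_minus_commute)
      also have "\<dots> \<le> L - B d" using N ad by (intro tail) auto
      also have "\<dots> \<le> L - B (real N)" using N ad Bmono by simp
      also have "\<dots> < e" using N(2) by (simp add: dist_real_def)
      finally show "norm (integral (cbox a d) (\<lambda>x. if x \<in> {0..} then f x else 0) - (I - \<Psi> 0)) < e" .
    qed simp
  qed
  then show ?thesis unfolding spike by blast
qed

text \<open>A majorant of the Balakrishnan integrand for scalars of norm at most \<open>r\<close> in
  the right half-plane: the quotient \<open>a / (\<tau> + a)\<close> is bounded by \<open>1\<close>
  and by \<open>r / \<tau>\<close>, and the better of the two changes at
  \<open>\<tau> = r\<close>.\<close>

definition bal_bound :: "real \<Rightarrow> real \<Rightarrow> real \<Rightarrow> real"
  where "bal_bound r \<theta> \<tau> = (if \<tau> \<le> r then \<tau> powr (\<theta> - 1) else r * \<tau> powr (\<theta> - 2))"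

lemma bal_bound_has_integral:
  assumes "0 < \<theta>" "\<theta> < 1" "0 < r"
  shows "(bal_bound r \<theta> has_integral (1 / \<theta> + 1 / (1 - \<theta>)) * r powr \<theta>) {0<..}"
proof -
  have "((\<lambda>\<tau>. \<tau> powr (\<theta> - 1)) has_integral r powr (\<theta> - 1 + 1) / (\<theta> - 1 + 1)) {0..r}"
    using assms by (intro has_integral_powr_from_0) auto
  then have 1: "(bal_bound r \<theta> has_integral r powr (\<theta> - 1 + 1) / (\<theta> - 1 + 1)) {0..r}"
    by (rule has_integral_eq[rotated]) (simp add: bal_bound_def)
  have "((\<lambda>\<tau>. r * \<tau> powr (\<theta> - 2)) has_integral r * (- (r powr (\<theta> - 2 + 1)) / (\<theta> - 2 + 1))) {r..}"
    using assms by (intro has_integral_mult_right has_integral_powr_to_inf) auto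
  then have 2: "(bal_bound r \<theta> has_integral r * (- (r powr (\<theta> - 2 + 1)) / (\<theta> - 2 + 1))) {r..}"
    by (rule has_integral_spike[of "{r}", rotated 2]) (auto simp: bal_bound_def)
  have "{0..r} \<inter> {r..} = {r}" "{0..r} \<union> {r..} = {0..}" using assms by auto
  with has_integral_Un[OF 1 2]
  have "(bal_bound r \<theta> has_integral r powr (\<theta> - 1 + 1) / (\<theta> - 1 + 1) + r * (- (r powr (\<theta> - 2 + 1)) / (\<theta> - 2 + 1))) {0..}"
    by simp
  moreover have "r * (- (r powr (\<theta> - 2 + 1)) / (\<theta> - 2 + 1)) = r powr \<theta> / (1 - \<theta>)"
  proof -
    have "r * r powr (\<theta> - 1) = r powr \<theta>" using assms powr_mult_base[of r "\<theta> - 1"] by simp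
    then show ?thesis using assms by (simp add: minus_divide_divide[symmetric, of _ "\<theta> - 1"] del: minus_divide_divide)
  qed
  moreover have "r powr (\<theta> - 1 + 1) / (\<theta> - 1 + 1) + r powr \<theta> / (1 - \<theta>) = (1 / \<theta> + 1 / (1 - \<theta>)) * r powr \<theta>"
    by (simp add: algebra_simps)
  ultimately have "(bal_bound r \<theta> has_integral (1 / \<theta> + 1 / (1 - \<theta>)) * r powr \<theta>) {0..}" by (simp only:)
  moreover have "((bal_bound r \<theta> has_integral I) {0<..}) = ((bal_bound r \<theta> has_integral I) {0..})" for I
    by (rule has_integral_spike_set_eq; rule negligible_subset[of "{0}"]) auto
  ultimately show ?thesis by simp
qed

lemma bal_bound_integrable:
  "0 < \<theta> \<Longrightarrow> \<theta> < 1 \<Longrightarrow> 0 < r \<Longrightarrow> bal_bound r \<theta> integrable_on {0<..}"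
  using bal_bound_has_integral by blast

section \<open>Scalar fractional powers\<close>

text \<open>The integrand of \<open>frac_power\<close> with the operator replaced by the scalar
  \<open>a\<close>; the factor \<open>sin (pi * \<theta>) / pi\<close> is left out.\<close>

definition bal_kernel :: "real \<Rightarrow> complex \<Rightarrow> real \<Rightarrow> complex"
  where "bal_kernel \<theta> a \<tau> = of_real (\<tau> powr (\<theta> - 1)) * (a / (of_real \<tau> + a))"

lemma norm_add_ge_Re:
  assumes "0 \<le> Re a" "0 \<le> \<tau>"
  shows "norm a \<le> norm (of_real \<tau> + a)" "\<tau> \<le> norm (of_real \<tau> + a)" "norm (of_real \<tau> + a) \<le> \<tau> + norm a"
    "\<tau> + Re a \<le> norm (of_real \<tau> + a)"
proof -
  show "norm a \<le> norm (of_real \<tau> + a)"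
  proof -
    have "(Re a)\<^sup>2 \<le> (\<tau> + Re a)\<^sup>2" by (rule power_mono) (use assms in auto)
    then show ?thesis by (simp add: cmod_def)
  qed
  show le: "\<tau> + Re a \<le> norm (of_real \<tau> + a)" using complex_Re_le_cmod[of "of_real \<tau> + a"] by simp
  then show "\<tau> \<le> norm (of_real \<tau> + a)" using assms by simp
  show "norm (of_real \<tau> + a) \<le> \<tau> + norm a" using norm_triangle_ineq[of "of_real \<tau>" a] assms by simp
qed

lemma norm_bal_kernel:
  assumes "0 \<le> Re a" "norm a \<le> r" "0 < \<tau>"
  shows "norm (bal_kernel \<theta> a \<tau>) \<le> bal_bound r \<theta> \<tau>"
proof -
  note n = norm_add_ge_Re[OF assms(1) less_imp_le[OF assms(3)]]
  have pos: "0 < norm (of_real \<tau> + a)" by (rule less_le_trans[OF assms(3) n(2)])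
  have k: "norm (bal_kernel \<theta> a \<tau>) = \<tau> powr (\<theta> - 1) * (norm a / norm (of_real \<tau> + a))"
    by (simp add: bal_kernel_def norm_mult norm_divide)
  show ?thesis
  proof (cases "\<tau> \<le> r")
    case True
    have "norm a / norm (of_real \<tau> + a) \<le> 1" using n(1) pos by (simp add: divide_le_eq_1)
    from mult_left_mono[OF this, of "\<tau> powr (\<theta> - 1)"]
    show ?thesis using True by (simp add: k bal_bound_def)
  next
    case False
    have "0 \<le> r" using order.trans[OF norm_ge_zero assms(2)] .
    then have "norm a / norm (of_real \<tau> + a) \<le> r / \<tau>" using n(2) assms by (intro frac_le) auto
    then have "\<tau> powr (\<theta> - 1) * (norm a / norm (of_real \<tau> + a)) \<le> \<tau> powr (\<theta> - 1) * (r / \<tau>)"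
      by (intro mult_left_mono) auto
    also have "\<dots> = r * \<tau> powr (\<theta> - 2)"
      using assms(3) powr_diff[of \<tau> "\<theta> - 1" 1] by (simp add: field_simps)
    finally show ?thesis using False by (simp add: k bal_bound_def)
  qed
qed

lemma of_real_add_nonzero: "0 \<le> Re a \<Longrightarrow> 0 < \<tau> \<Longrightarrow> complex_of_real \<tau> + a \<noteq> 0"
  by (auto simp: complex_eq_iff)

lemma continuous_bal_kernel: "0 \<le> Re a \<Longrightarrow> continuous_on {0<..} (bal_kernel \<theta> a)"
  unfolding bal_kernel_def by (intro continuous_intros) (auto simp: of_real_add_nonzero)

definition bal_int :: "real \<Rightarrow> complex \<Rightarrow> complex"
  where "bal_int \<theta> a = integral {0<..} (bal_kernel \<theta> a)"

lemma bal_kernel_integrable: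
  assumes "0 < \<theta>" "\<theta> < 1" "0 \<le> Re a"
  shows "bal_kernel \<theta> a integrable_on {0<..}"
proof (rule dominated_integrable_on_pos)
  show "bal_bound (norm a + 1) \<theta> integrable_on {0<..}"
    using assms by (intro bal_bound_integrable add_nonneg_pos) auto
  show "norm (bal_kernel \<theta> a \<tau>) \<le> bal_bound (norm a + 1) \<theta> \<tau>" if "0 < \<tau>" for \<tau>
    using assms that by (intro norm_bal_kernel) auto
qed (rule continuous_bal_kernel[OF assms(3)])

lemma norm_bal_int_le:
  assumes "0 < \<theta>" "\<theta> < 1" "0 < Re a"
  shows "norm (bal_int \<theta> a) \<le> (1 / \<theta> + 1 / (1 - \<theta>)) * norm a powr \<theta>"
proof -
  have a: "0 < norm a" using assms(3) by auto
  have "norm (bal_int \<theta> a) \<le> integral {0<..} (bal_bound (norm a) \<theta>)"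
    unfolding bal_int_def using assms a
    by (intro Henstock_Kurzweil_Integration.integral_norm_bound_integral bal_kernel_integrable
        bal_bound_integrable norm_bal_kernel) auto
  also have "\<dots> = (1 / \<theta> + 1 / (1 - \<theta>)) * norm a powr \<theta>"
    using assms a by (intro integral_unique bal_bound_has_integral) auto
  finally show ?thesis .
qed

text \<open>There is no cancellation: for \<open>a\<close> in the right half-plane the quotient
  \<open>a / (\<tau> + a)\<close> has nonnegative real part. For \<open>\<tau> \<le> norm a\<close>
  that real part is at least \<open>1/4\<close>, because
  \<open>norm (\<tau> + a) \<le> 2 * norm a\<close>.\<close>

lemma norm_bal_int_ge:
  assumes "0 < \<theta>" "\<theta> < 1" "0 < Re a"
  shows "norm a powr \<theta> / (4 * \<theta>) \<le> norm (bal_int \<theta> a)"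
proof -
  have a: "0 < norm a" using assms(3) by auto
  define l where "l \<tau> = (if \<tau> \<in> {0..norm a} then \<tau> powr (\<theta> - 1) / 4 else 0)" for \<tau>
  have "((\<lambda>\<tau>. \<tau> powr (\<theta> - 1) / 4) has_integral (norm a powr (\<theta> - 1 + 1) / (\<theta> - 1 + 1)) / 4) {0..norm a}"
    using assms by (intro has_integral_divide has_integral_powr_from_0) auto
  then have "(l has_integral (norm a powr (\<theta> - 1 + 1) / (\<theta> - 1 + 1)) / 4) {0..}"
    unfolding l_def by (subst has_integral_restrict) auto
  moreover have "((l has_integral I) {0<..}) = ((l has_integral I) {0..})" for I
    by (rule has_integral_spike_set_eq; rule negligible_subset[of "{0}"]) auto
  ultimately have l: "(l has_integral norm a powr \<theta> / (4 * \<theta>)) {0<..}" by (simp add: mult.commute)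
  have ReI: "((\<lambda>\<tau>. Re (bal_kernel \<theta> a \<tau>)) has_integral Re (bal_int \<theta> a)) {0<..}"
    unfolding bal_int_def using assms
    by (intro has_integral_Re integrable_integral bal_kernel_integrable) auto
  have "l \<tau> \<le> Re (bal_kernel \<theta> a \<tau>)" if \<tau>: "\<tau> \<in> {0<..}" for \<tau>
  proof -
    note n = norm_add_ge_Re[of a \<tau>]
    have pos: "0 < norm (of_real \<tau> + a)" by (rule less_le_trans[OF _ n(2)]) (use \<tau> assms in auto)
    have "a / (of_real \<tau> + a) = a * cnj (of_real \<tau> + a) / of_real ((norm (of_real \<tau> + a))\<^sup>2)"
      by (rule complex_div_cnj)
    then have "Re (a / (of_real \<tau> + a)) = Re (a * cnj (of_real \<tau> + a)) / (norm (of_real \<tau> + a))\<^sup>2"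
      by (simp only: Re_divide_of_real)
    also have "Re (a * cnj (of_real \<tau> + a)) = (norm a)\<^sup>2 + \<tau> * Re a"
      by (simp add: cmod_power2) (simp add: power2_eq_square algebra_simps)
    finally have R: "Re (a / (of_real \<tau> + a)) = ((norm a)\<^sup>2 + \<tau> * Re a) / (norm (of_real \<tau> + a))\<^sup>2" .
    have Rk: "Re (bal_kernel \<theta> a \<tau>) = \<tau> powr (\<theta> - 1) * Re (a / (of_real \<tau> + a))"
    proof -
      have "Re (of_real x * z) = x * Re z" for x z by simp
      then show ?thesis unfolding bal_kernel_def by blast
    qed
    show ?thesis
    proof (cases "\<tau> \<le> norm a")
      case True
      have "(norm (of_real \<tau> + a))\<^sup>2 \<le> (2 * norm a)\<^sup>2"
        using n(3) \<tau> assms True by (intro power_mono) auto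
      then have "(norm a)\<^sup>2 / (2 * norm a)\<^sup>2 \<le> ((norm a)\<^sup>2 + \<tau> * Re a) / (norm (of_real \<tau> + a))\<^sup>2"
        using pos \<tau> assms by (intro frac_le) auto
      then have "1 / 4 \<le> Re (a / (of_real \<tau> + a))" using a by (simp add: R power_mult_distrib)
      then have "\<tau> powr (\<theta> - 1) * (1 / 4) \<le> \<tau> powr (\<theta> - 1) * Re (a / (of_real \<tau> + a))"
        by (intro mult_left_mono) auto
      then show ?thesis using True \<tau> by (simp add: l_def Rk)
    next
      case False
      have "0 \<le> Re (a / (of_real \<tau> + a))" unfolding R using \<tau> assms by (intro divide_nonneg_nonneg add_nonneg_nonneg) auto
      then show ?thesis using False by (simp add: l_def Rk)
    qed
  qed
  then have "norm a powr \<theta> / (4 * \<theta>) \<le> Re (bal_int \<theta> a)"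
    by (rule has_integral_le[OF l ReI])
  then show ?thesis using complex_Re_le_cmod order.trans by blast
qed

text \<open>The difference quotient between \<open>a\<close> and \<open>b\<close> is the integral of
  \<open>G b\<close>, which has one integrable majorant for all \<open>b\<close> with
  \<open>Re b \<ge> Re a / 2\<close>. Dominated convergence then gives the derivative.\<close>

lemma bal_int_holomorphic:
  assumes "0 < \<theta>" "\<theta> < 1"
  shows "bal_int \<theta> holomorphic_on {a. 0 < Re a}"
proof (rule holomorphic_onI)
  fix a :: complex assume "a \<in> {a. 0 < Re a}"
  then have a: "0 < Re a" by simp
  define c where "c = Re a / 2"
  have c: "0 < c" "c \<le> Re a" using a by (simp_all add: c_def)
  define G where "G b \<tau> = of_real (\<tau> powr \<theta>) / ((of_real \<tau> + a) * (of_real \<tau> + b))" for b \<tau>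
  have Gc: "continuous_on {0<..} (G b)" if "0 < Re b" for b
    unfolding G_def using a that by (intro continuous_intros) (auto simp: of_real_add_nonzero)
  have Gle: "norm (G b \<tau>) \<le> bal_bound c \<theta> \<tau> / c" if b: "c \<le> Re b" and \<tau>: "0 < \<tau>" for b \<tau>
  proof -
    have "(\<tau> + c) * (\<tau> + c) \<le> norm (of_real \<tau> + a) * norm (of_real \<tau> + b)"
      using norm_add_ge_Re(4)[of a \<tau>] norm_add_ge_Re(4)[of b \<tau>] b \<tau> c a by (intro mult_mono) auto
    then have "norm (G b \<tau>) \<le> \<tau> powr \<theta> / ((\<tau> + c) * (\<tau> + c))"
      using c \<tau> unfolding G_def norm_divide norm_mult by (intro frac_le) auto
    also have "\<dots> \<le> bal_bound c \<theta> \<tau> / c"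
    proof (cases "\<tau> \<le> c")
      case True
      have "\<tau> powr \<theta> = \<tau> powr (\<theta> - 1) * \<tau>" using \<tau> powr_mult_base[of \<tau> "\<theta> - 1"] by (simp add: mult.commute)
      then have "\<tau> powr \<theta> / ((\<tau> + c) * (\<tau> + c)) = \<tau> powr (\<theta> - 1) * (\<tau> / ((\<tau> + c) * (\<tau> + c)))" by simp
      also have "\<dots> \<le> \<tau> powr (\<theta> - 1) * (1 / c)"
      proof (rule mult_left_mono)
        have "\<tau> * c \<le> (\<tau> + c) * (\<tau> + c)" using \<tau> c by (intro mult_mono) auto
        moreover have "\<tau> / Q \<le> 1 / c" if "\<tau> * c \<le> Q" "0 < Q" for Q using that c by (simp add: field_simps)
        ultimately show "\<tau> / ((\<tau> + c) * (\<tau> + c)) \<le> 1 / c" using \<tau> c by simp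
      qed simp
      finally show ?thesis using True by (simp add: bal_bound_def)
    next
      case False
      have "\<tau> * \<tau> \<le> (\<tau> + c) * (\<tau> + c)" using \<tau> c by (intro mult_mono) auto
      then have "\<tau> powr \<theta> / ((\<tau> + c) * (\<tau> + c)) \<le> \<tau> powr \<theta> / (\<tau> * \<tau>)"
        using \<tau> c by (intro divide_left_mono mult_pos_pos) auto
      also have "\<dots> = \<tau> powr (\<theta> - 2)" using \<tau> by (simp add: powr_diff powr_numeral power2_eq_square)
      finally show ?thesis using False c by (simp add: bal_bound_def)
    qed
    finally show ?thesis .
  qed
  have bI: "(\<lambda>\<tau>. bal_bound c \<theta> \<tau> / c) integrable_on {0<..}"
    using bal_bound_integrable[OF assms c(1)] by (simp add: integrable_on_divide)
  have GI: "G b integrable_on {0<..}" if "c \<le> Re b" for b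
    by (rule dominated_integrable_on_pos[OF Gc bI Gle[OF that]]) (use that c in auto)
  have quot: "(bal_int \<theta> b - bal_int \<theta> a) / (b - a) = integral {0<..} (G b)" if b: "c \<le> Re b" "b \<noteq> a" for b
  proof -
    have "bal_int \<theta> b - bal_int \<theta> a = integral {0<..} (\<lambda>\<tau>. bal_kernel \<theta> b \<tau> - bal_kernel \<theta> a \<tau>)"
      unfolding bal_int_def using assms a b c
      by (intro Henstock_Kurzweil_Integration.integral_diff[symmetric] bal_kernel_integrable) auto
    also have "\<dots> = integral {0<..} (\<lambda>\<tau>. (b - a) * G b \<tau>)"
    proof (rule Henstock_Kurzweil_Integration.integral_cong)
      fix \<tau> :: real assume "\<tau> \<in> {0<..}"
      then have \<tau>: "0 < \<tau>" by simp
      have nz: "of_real \<tau> + a \<noteq> 0" "of_real \<tau> + b \<noteq> 0"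
        by (rule of_real_add_nonzero[OF _ \<tau>], use a b c in simp)+
      have "b / (of_real \<tau> + b) - a / (of_real \<tau> + a) = (b - a) * (of_real \<tau> / ((of_real \<tau> + a) * (of_real \<tau> + b)))"
        using nz by (simp add: field_simps)
      note e1 = this
      have e2: "complex_of_real (\<tau> powr \<theta>) = of_real (\<tau> powr (\<theta> - 1)) * of_real \<tau>"
        using \<tau> powr_mult_base[of \<tau> "\<theta> - 1"] by (simp add: mult.commute flip: of_real_mult)
      have "bal_kernel \<theta> b \<tau> - bal_kernel \<theta> a \<tau>
          = of_real (\<tau> powr (\<theta> - 1)) * (b / (of_real \<tau> + b) - a / (of_real \<tau> + a))"
        by (simp only: bal_kernel_def right_diff_distrib)
      then show "bal_kernel \<theta> b \<tau> - bal_kernel \<theta> a \<tau> = (b - a) * G b \<tau>"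
        unfolding e1 G_def e2 by simp
    qed
    also have "\<dots> = (b - a) * integral {0<..} (G b)" by simp
    finally show ?thesis using b by simp
  qed
  have ev: "\<forall>\<^sub>F b in at a. c \<le> Re b"
  proof -
    have "open {b. c < Re b}" by (intro open_Collect_less continuous_intros)
    moreover have "a \<in> {b. c < Re b}" using a by (simp add: c_def)
    ultimately have "\<forall>\<^sub>F b in at a. b \<in> {b. c < Re b}" by (rule eventually_at_in_open')
    then show ?thesis by (rule eventually_mono) auto
  qed
  have "((\<lambda>b. integral {0<..} (G b)) \<longlongrightarrow> integral {0<..} (G a)) (at a)"
    unfolding tendsto_at_iff_sequentially comp_def
  proof (intro allI impI)
    fix X :: "nat \<Rightarrow> complex" assume X: "\<forall>i. X i \<in> UNIV - {a}" "X \<longlonglongrightarrow> a"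
    \<comment> \<open>The sequence is changed at the finitely many indices where the majorant might
      not apply.\<close>
    define Y where "Y n = (if c \<le> Re (X n) then X n else a)" for n
    have Yc: "c \<le> Re (Y n)" for n using c by (simp add: Y_def)
    have "(\<lambda>n. Re (X n)) \<longlonglongrightarrow> Re a" using X(2) by (rule tendsto_Re)
    moreover have "c < Re a" using a by (simp add: c_def)
    ultimately have "\<forall>\<^sub>F n in sequentially. c < Re (X n)" by (rule order_tendstoD(1))
    then have evY: "\<forall>\<^sub>F n in sequentially. X n = Y n" by (rule eventually_mono) (simp add: Y_def)
    then have Ya: "Y \<longlonglongrightarrow> a" using X(2) tendsto_cong by blast
    have "(\<lambda>n. integral {0<..} (G (Y n))) \<longlonglongrightarrow> integral {0<..} (G a)"
    proof (rule dominated_convergence(2)[OF GI[OF Yc] bI])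
      fix \<tau> :: real assume "\<tau> \<in> {0<..}"
      then have \<tau>: "0 < \<tau>" by simp
      show "norm (G (Y n) \<tau>) \<le> bal_bound c \<theta> \<tau> / c" for n by (rule Gle[OF Yc \<tau>])
      have "of_real \<tau> + a \<noteq> 0" by (rule of_real_add_nonzero[OF _ \<tau>]) (use a in simp)
      then show "(\<lambda>n. G (Y n) \<tau>) \<longlonglongrightarrow> G a \<tau>"
        unfolding G_def by (intro tendsto_intros Ya) auto
    qed
    then show "(\<lambda>n. integral {0<..} (G (X n))) \<longlonglongrightarrow> integral {0<..} (G a)"
      by (rule Lim_transform_eventually) (rule eventually_mono[OF evY], simp)
  qed
  moreover have "\<forall>\<^sub>F b in at a. integral {0<..} (G b) = (bal_int \<theta> b - bal_int \<theta> a) / (b - a)"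
    using ev eventually_neq_at_within[of a a UNIV]
  proof eventually_elim
    case (elim b)
    then show ?case using quot[of b] by simp
  qed
  ultimately have "((\<lambda>b. (bal_int \<theta> b - bal_int \<theta> a) / (b - a)) \<longlongrightarrow> integral {0<..} (G a)) (at a)"
    by (rule Lim_transform_eventually)
  then show "bal_int \<theta> field_differentiable at a within {a. 0 < Re a}"
    unfolding field_differentiable_def has_field_derivative_iff
    using tendsto_within_subset by blast
qed

text \<open>The scalar twin of \<open>frac_power\<close>, with the same splitting of
  \<open>\<alpha>\<close> into integer and fractional part, so that the two can be matched factor by
  factor. On the right half-plane it is the principal power of \<open>a\<close>.\<close>

definition scalar_pow :: "real \<Rightarrow> complex \<Rightarrow> complex"
  where "scalar_pow \<alpha> a = a ^ nat \<lfloor>\<alpha>\<rfloor> *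
    (if \<alpha> - real (nat \<lfloor>\<alpha>\<rfloor>) = 0 then 1
     else of_real (sin (pi * (\<alpha> - real (nat \<lfloor>\<alpha>\<rfloor>))) / pi) * bal_int (\<alpha> - real (nat \<lfloor>\<alpha>\<rfloor>)) a)"

lemma frac_part_bounds:
  assumes "0 < \<alpha>" "\<alpha> - real (nat \<lfloor>\<alpha>\<rfloor>) \<noteq> 0"
  shows "0 < \<alpha> - real (nat \<lfloor>\<alpha>\<rfloor>)" "\<alpha> - real (nat \<lfloor>\<alpha>\<rfloor>) < 1"
proof -
  have "real (nat \<lfloor>\<alpha>\<rfloor>) = of_int \<lfloor>\<alpha>\<rfloor>" using assms(1) by simp
  then show "0 < \<alpha> - real (nat \<lfloor>\<alpha>\<rfloor>)" "\<alpha> - real (nat \<lfloor>\<alpha>\<rfloor>) < 1"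
    using of_int_floor_le[of \<alpha>] floor_correct[of \<alpha>] assms(2) by linarith+
qed

lemma scalar_pow_holomorphic:
  assumes "0 < \<alpha>"
  shows "scalar_pow \<alpha> holomorphic_on {a. 0 < Re a}"
proof -
  have "(\<lambda>a. if \<alpha> - real (nat \<lfloor>\<alpha>\<rfloor>) = 0 then 1
     else of_real (sin (pi * (\<alpha> - real (nat \<lfloor>\<alpha>\<rfloor>))) / pi) * bal_int (\<alpha> - real (nat \<lfloor>\<alpha>\<rfloor>)) a) holomorphic_on {a. 0 < Re a}"
    using bal_int_holomorphic frac_part_bounds[OF assms]
    by (cases "\<alpha> - real (nat \<lfloor>\<alpha>\<rfloor>) = 0") (auto intro!: holomorphic_intros)
  then show ?thesis unfolding scalar_pow_def by (intro holomorphic_intros)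
qed

lemma scalar_pow_bounds:
  assumes "0 < \<alpha>"
  obtains k K where "0 < k" "0 < K"
    "\<And>a. 0 < Re a \<Longrightarrow> k * norm a powr \<alpha> \<le> norm (scalar_pow \<alpha> a)"
    "\<And>a. 0 < Re a \<Longrightarrow> norm (scalar_pow \<alpha> a) \<le> K * norm a powr \<alpha>"
proof -
  define n \<theta> where "n = nat \<lfloor>\<alpha>\<rfloor>" and "\<theta> = \<alpha> - real n"
  have pw: "norm a ^ n * norm a powr \<theta> = norm a powr \<alpha>" if "0 < Re a" for a
    using that by (simp add: \<theta>_def powr_diff powr_realpow complex_eq_iff)
  show thesis
  proof (cases "\<theta> = 0")
    case True
    then have "norm (scalar_pow \<alpha> a) = norm a powr \<alpha>" if "0 < Re a" for a
    proof -
      have "a \<noteq> 0" using that by auto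
      then show ?thesis
        using pw[OF that] True by (simp add: scalar_pow_def n_def[symmetric] \<theta>_def[symmetric] norm_power)
    qed
    then show thesis by (intro that[of 1 1]) auto
  next
    case False
    have \<theta>: "0 < \<theta>" "\<theta> < 1" using frac_part_bounds[OF assms] False by (simp_all add: \<theta>_def n_def)
    define s where "s = sin (pi * \<theta>) / pi"
    have s: "0 < s" using \<theta> by (auto simp: s_def intro!: divide_pos_pos sin_gt_zero)
    have eq: "norm (scalar_pow \<alpha> a) = norm a ^ n * (s * norm (bal_int \<theta> a))" for a
      using False s by (simp add: scalar_pow_def n_def[symmetric] \<theta>_def[symmetric] s_def[symmetric] norm_mult norm_power)
    show thesis
    proof (rule that[of "s / (4 * \<theta>)" "s * (1 / \<theta> + 1 / (1 - \<theta>))"])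
      fix a :: complex assume a: "0 < Re a"
      have "s / (4 * \<theta>) * norm a powr \<alpha> = norm a ^ n * (s * (norm a powr \<theta> / (4 * \<theta>)))"
        by (simp flip: pw[OF a])
      also have "\<dots> \<le> norm a ^ n * (s * norm (bal_int \<theta> a))"
        using s norm_bal_int_ge[OF \<theta> a] by (intro mult_left_mono) auto
      finally show "s / (4 * \<theta>) * norm a powr \<alpha> \<le> norm (scalar_pow \<alpha> a)" by (simp only: eq)
      have "norm a ^ n * (s * norm (bal_int \<theta> a)) \<le> norm a ^ n * (s * ((1 / \<theta> + 1 / (1 - \<theta>)) * norm a powr \<theta>))"
        using s norm_bal_int_le[OF \<theta> a] by (intro mult_left_mono) auto
      also have "\<dots> = s * (1 / \<theta> + 1 / (1 - \<theta>)) * norm a powr \<alpha>"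
        unfolding pw[OF a, symmetric] by (simp only: mult_ac)
      finally show "norm (scalar_pow \<alpha> a) \<le> s * (1 / \<theta> + 1 / (1 - \<theta>)) * norm a powr \<alpha>" by (simp only: eq)
    qed (use s \<theta> in \<open>auto intro!: mult_pos_pos add_pos_pos\<close>)
  qed
qed

text \<open>The double integral converges absolutely, with majorant \<open>bal_bound 2\<close> for
  arguments of norm at most 2. In the application \<open>h\<close> is a contour integrand and
  \<open>m t\<close> is \<open>1 - cnj \<zeta> * z\<close> along the contour.\<close>

lemma bal_fubini:
  fixes h m :: "real \<Rightarrow> complex"
  assumes \<theta>: "0 < \<theta>" "\<theta> < 1"
    and h: "h \<in> borel_measurable borel" "\<And>t. norm (h t) \<le> B" "\<And>t. t \<notin> {0..1} \<Longrightarrow> h t = 0"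
    and m: "continuous_on UNIV m" "\<And>t. 0 \<le> Re (m t)" "\<And>t. norm (m t) \<le> 2"
  shows "integral {0<..} (\<lambda>\<tau>. integral {0..1} (\<lambda>t. h t * bal_kernel \<theta> (m t) \<tau>))
    = integral {0..1} (\<lambda>t. h t * bal_int \<theta> (m t))"
proof -
  have [measurable]: "h \<in> borel_measurable borel" "m \<in> borel_measurable borel"
    using h m borel_measurable_continuous_onI by auto
  \<comment> \<open>The indicators extend both variables to the whole line, where Fubini is applied
    for \<open>lborel\<close>; the majorant \<open>fle\<close> is a product of a function of
    \<open>\<tau>\<close> and a function of \<open>t\<close>.\<close>
  define f where "f \<tau> t = (indicator {0<..} \<tau> * indicator {0..1} t) *\<^sub>R (h t * bal_kernel \<theta> (m t) \<tau>)" for \<tau> t :: real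
  have [measurable]: "case_prod f \<in> borel_measurable (lborel \<Otimes>\<^sub>M lborel)"
    unfolding f_def bal_kernel_def case_prod_beta by measurable
  have B0: "0 \<le> B" using h(2) norm_ge_zero order.trans by blast
  have fle: "norm (f \<tau> t) \<le> (B * (indicator {0<..} \<tau> * bal_bound 2 \<theta> \<tau>)) * indicator {0..1} t" for \<tau> t
  proof -
    have "norm (h t * bal_kernel \<theta> (m t) \<tau>) \<le> B * bal_bound 2 \<theta> \<tau>" if "0 < \<tau>"
      unfolding norm_mult by (intro mult_mono h norm_bal_kernel m that B0) auto
    then show ?thesis by (simp add: f_def indicator_def)
  qed
  have bb: "integrable lborel (\<lambda>\<tau>. B * (indicator {0<..} \<tau> * bal_bound 2 \<theta> \<tau>))"
  proof -
    have "bal_bound 2 \<theta> absolutely_integrable_on {0<..}"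
      using bal_bound_integrable[OF \<theta>, of 2]
      by (intro nonnegative_absolutely_integrable_1) (auto simp: bal_bound_def)
    then have "integrable lebesgue (\<lambda>\<tau>. indicator {0<..} \<tau> * bal_bound 2 \<theta> \<tau>)"
      by (simp add: set_integrable_def)
    moreover have "(\<lambda>\<tau>. indicator {0<..} \<tau> * bal_bound 2 \<theta> \<tau>) \<in> borel_measurable lborel"
      unfolding bal_bound_def by measurable
    ultimately have "integrable lborel (\<lambda>\<tau>. indicator {0<..} \<tau> * bal_bound 2 \<theta> \<tau>)"
      using integrable_completion by blast
    then show ?thesis by (rule integrable_mult_right)
  qed
  have i01: "integrable lborel (\<lambda>t::real. indicator {0..1} t :: real)"
    by (rule integrable_real_indicator) auto
  have ft: "integrable lborel (\<lambda>t. f \<tau> t)" for \<tau>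
    by (rule Bochner_Integration.integrable_bound[OF integrable_mult_right[OF i01], of _ "B * (indicator {0<..} \<tau> * bal_bound 2 \<theta> \<tau>)"])
      (use fle[of \<tau>] in \<open>auto intro!: AE_I2 order.trans[OF fle abs_ge_self]\<close>)
  have f\<tau>: "integrable lborel (\<lambda>\<tau>. f \<tau> t)" for t
  proof (rule Bochner_Integration.integrable_bound[OF bb])
    show "AE \<tau> in lborel. norm (f \<tau> t) \<le> norm (B * (indicator {0<..} \<tau> * bal_bound 2 \<theta> \<tau>))"
    proof (rule AE_I2)
      fix \<tau>
      have "0 \<le> B * (indicator {0<..} \<tau> * bal_bound 2 \<theta> \<tau>)"
        using B0 by (auto simp: bal_bound_def indicator_def)
      then show "norm (f \<tau> t) \<le> norm (B * (indicator {0<..} \<tau> * bal_bound 2 \<theta> \<tau>))"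
        using order.trans[OF fle[of \<tau> t] mult_left_le[of "indicator {0..1} t"]]
        by (simp add: indicator_def)
    qed
  qed simp
  have "integrable (lborel \<Otimes>\<^sub>M lborel) (case_prod f)"
  proof (rule lborel_pair.Fubini_integrable)
    show "integrable lborel (\<lambda>\<tau>. \<integral>t. norm (case (\<tau>, t) of (\<tau>, t) \<Rightarrow> f \<tau> t) \<partial>lborel)"
    proof (rule Bochner_Integration.integrable_bound[OF bb])
      show "AE \<tau> in lborel. norm (\<integral>t. norm (case (\<tau>, t) of (\<tau>, t) \<Rightarrow> f \<tau> t) \<partial>lborel)
        \<le> norm (B * (indicator {0<..} \<tau> * bal_bound 2 \<theta> \<tau>))"
      proof (rule AE_I2)
        fix \<tau>
        have "(\<integral>t. norm (f \<tau> t) \<partial>lborel) \<le> (\<integral>t. (B * (indicator {0<..} \<tau> * bal_bound 2 \<theta> \<tau>)) * indicator {0..1::real} t \<partial>lborel)"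
          by (intro Bochner_Integration.integral_mono integrable_norm ft integrable_mult_right i01 fle)
        also have "\<dots> = B * (indicator {0<..} \<tau> * bal_bound 2 \<theta> \<tau>)" by simp
        finally show "norm (\<integral>t. norm (case (\<tau>, t) of (\<tau>, t) \<Rightarrow> f \<tau> t) \<partial>lborel)
          \<le> norm (B * (indicator {0<..} \<tau> * bal_bound 2 \<theta> \<tau>))" by simp
      qed
    qed measurable
  qed (use ft in auto)
  from lborel_pair.Fubini_integral[OF this]
  have swap: "(\<integral>\<tau>. (\<integral>t. f \<tau> t \<partial>lborel) \<partial>lborel) = (\<integral>t. (\<integral>\<tau>. f \<tau> t \<partial>lborel) \<partial>lborel)" by simp
  have 1: "(\<integral>t. f \<tau> t \<partial>lborel) = indicator {0<..} \<tau> *\<^sub>R integral {0..1} (\<lambda>t. h t * bal_kernel \<theta> (m t) \<tau>)" for \<tau>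
  proof (cases "0 < \<tau>")
    case True
    then have "set_integrable lborel {0..1} (\<lambda>t. h t * bal_kernel \<theta> (m t) \<tau>)"
      using ft[of \<tau>] by (simp add: f_def set_integrable_def)
    from set_borel_integral_eq_integral(2)[OF this] True
    show ?thesis by (simp add: f_def set_lebesgue_integral_def)
  qed (simp add: f_def)
  have 2: "(\<integral>\<tau>. f \<tau> t \<partial>lborel) = indicator {0..1} t *\<^sub>R (h t * bal_int \<theta> (m t))" for t
  proof (cases "t \<in> {0..1}")
    case True
    then have "set_integrable lborel {0<..} (\<lambda>\<tau>. h t * bal_kernel \<theta> (m t) \<tau>)"
      using f\<tau>[of t] by (simp add: f_def set_integrable_def)
    from set_borel_integral_eq_integral(2)[OF this]
    have "(\<integral>\<tau>. f \<tau> t \<partial>lborel) = integral {0<..} (\<lambda>\<tau>. h t * bal_kernel \<theta> (m t) \<tau>)"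
      using True by (simp only: f_def set_lebesgue_integral_def) simp
    also have "\<dots> = h t * bal_int \<theta> (m t)" unfolding bal_int_def by (rule integral_mult_right)
    finally show ?thesis using True by simp
  qed (simp add: f_def)
  have "integrable lborel (\<lambda>\<tau>. \<integral>t. f \<tau> t \<partial>lborel)"
    using lborel_pair.integrable_fst[OF \<open>integrable (lborel \<Otimes>\<^sub>M lborel) (case_prod f)\<close>] by simp
  then have "set_integrable lborel {0<..} (\<lambda>\<tau>. integral {0..1} (\<lambda>t. h t * bal_kernel \<theta> (m t) \<tau>))"
    unfolding 1 by (simp add: set_integrable_def)
  moreover have "integrable lborel (\<lambda>t. \<integral>\<tau>. f \<tau> t \<partial>lborel)"
    using lborel_pair.integrable_snd[OF \<open>integrable (lborel \<Otimes>\<^sub>M lborel) (case_prod f)\<close>] by simp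
  then have "set_integrable lborel {0..1} (\<lambda>t. h t * bal_int \<theta> (m t))"
    unfolding 2 by (simp add: set_integrable_def)
  ultimately show ?thesis
    using swap unfolding 1 2
    by (simp add: set_borel_integral_eq_integral(2)[symmetric] set_lebesgue_integral_def)
qed

section \<open>The functional calculus paired with functionals\<close>

text \<open>The part of sectoriality that the Balakrishnan integral draws on: its resolvents are
  taken on the positive half-line.\<close>

definition sectorial_bound :: "('b::complex_banach \<Rightarrow>\<^sub>C\<^sub>L 'b) \<Rightarrow> real \<Rightarrow> bool"
  where "sectorial_bound A M \<longleftrightarrow>
    (\<forall>\<tau>>0. op_is_inverse (\<tau> *\<^sub>R id_cblinfun + A) (op_inverse (\<tau> *\<^sub>R id_cblinfun + A))
      \<and> \<tau> * norm (op_inverse (\<tau> *\<^sub>R id_cblinfun + A)) \<le> M)"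

lemma op_inverse_apply:
  assumes "op_is_inverse (\<tau> *\<^sub>R id_cblinfun + A) V"
  shows "\<tau> *\<^sub>R (V *\<^sub>V x) + V *\<^sub>V (A *\<^sub>V x) = x" "\<tau> *\<^sub>R (V *\<^sub>V x) + A *\<^sub>V (V *\<^sub>V x) = x"
proof -
  have "(V o\<^sub>C\<^sub>L (\<tau> *\<^sub>R id_cblinfun + A)) *\<^sub>V x = x" "((\<tau> *\<^sub>R id_cblinfun + A) o\<^sub>C\<^sub>L V) *\<^sub>V x = x"
    using assms by (simp_all add: op_is_inverse_def)
  then show "\<tau> *\<^sub>R (V *\<^sub>V x) + V *\<^sub>V (A *\<^sub>V x) = x" "\<tau> *\<^sub>R (V *\<^sub>V x) + A *\<^sub>V (V *\<^sub>V x) = x"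
    by (simp_all add: cblinfun_simps)
qed

text \<open>The product \<open>V \<tau> o\<^sub>C\<^sub>L A\<close> equals
  \<open>1 - \<tau> * V \<tau>\<close>, hence is bounded near \<open>0\<close>, and it is at most
  \<open>M * norm A / \<tau>\<close> at infinity. Convergence has to be proved because
  \<open>integral\<close> takes the value \<open>0\<close> by convention when there is none.\<close>

lemma balakrishnan_integrable:
  assumes A: "sectorial_bound A M" and \<theta>: "0 < \<theta>" "\<theta> < 1"
  shows "(\<lambda>\<tau>. \<tau> powr (\<theta> - 1) *\<^sub>R (op_inverse (\<tau> *\<^sub>R id_cblinfun + A) o\<^sub>C\<^sub>L A)) integrable_on {0<..}"
proof -
  define V where "V \<tau> = op_inverse (\<tau> *\<^sub>R id_cblinfun + A)" for \<tau>
  have V: "op_is_inverse (\<tau> *\<^sub>R id_cblinfun + A) (V \<tau>)" "\<tau> * norm (V \<tau>) \<le> M" if "0 < \<tau>" for \<tau>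
    using A that by (auto simp: sectorial_bound_def V_def)
  have M0: "0 \<le> M" using V(2)[of 1] order.trans[OF norm_ge_zero[of "V 1"], of M] by simp
  have Vle: "norm (V \<tau>) \<le> M / \<tau>" if "0 < \<tau>" for \<tau>
    using V(2)[OF that] that by (simp add: pos_le_divide_eq mult.commute)
  have diff: "V \<tau> *\<^sub>V x - V \<sigma> *\<^sub>V x = (\<sigma> - \<tau>) *\<^sub>R (V \<tau> *\<^sub>V (V \<sigma> *\<^sub>V x))" if "0 < \<tau>" "0 < \<sigma>" for \<tau> \<sigma> x
  proof -
    have "V \<tau> *\<^sub>V x = V \<tau> *\<^sub>V (\<sigma> *\<^sub>R (V \<sigma> *\<^sub>V x) + A *\<^sub>V (V \<sigma> *\<^sub>V x))"
      using op_inverse_apply(2)[OF V(1)[OF that(2)], of x] by simp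
    then have a: "V \<tau> *\<^sub>V x = \<sigma> *\<^sub>R (V \<tau> *\<^sub>V (V \<sigma> *\<^sub>V x)) + V \<tau> *\<^sub>V (A *\<^sub>V (V \<sigma> *\<^sub>V x))"
      by (simp only: cblinfun_apply_add cblinfun_apply_scaleR)
    have b: "V \<sigma> *\<^sub>V x = \<tau> *\<^sub>R (V \<tau> *\<^sub>V (V \<sigma> *\<^sub>V x)) + V \<tau> *\<^sub>V (A *\<^sub>V (V \<sigma> *\<^sub>V x))"
      using op_inverse_apply(1)[OF V(1)[OF that(1)], of "V \<sigma> *\<^sub>V x"] by simp
    have "V \<tau> *\<^sub>V x - V \<sigma> *\<^sub>V x = (\<sigma> *\<^sub>R (V \<tau> *\<^sub>V (V \<sigma> *\<^sub>V x)) + V \<tau> *\<^sub>V (A *\<^sub>V (V \<sigma> *\<^sub>V x)))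
        - (\<tau> *\<^sub>R (V \<tau> *\<^sub>V (V \<sigma> *\<^sub>V x)) + V \<tau> *\<^sub>V (A *\<^sub>V (V \<sigma> *\<^sub>V x)))"
      by (rule arg_cong2[where f = minus, OF a b])
    then show ?thesis by (simp add: scaleR_left_diff_distrib)
  qed
  have dist: "norm (V \<tau> - V \<sigma>) \<le> \<bar>\<sigma> - \<tau>\<bar> * (M / \<tau> * (M / \<sigma>))" if "0 < \<tau>" "0 < \<sigma>" for \<tau> \<sigma>
  proof (rule norm_cblinfun_bound)
    fix x
    have "norm ((V \<tau> - V \<sigma>) *\<^sub>V x) = \<bar>\<sigma> - \<tau>\<bar> * norm (V \<tau> *\<^sub>V (V \<sigma> *\<^sub>V x))"
      by (simp add: minus_cblinfun_apply diff[OF that])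
    also have "\<dots> \<le> \<bar>\<sigma> - \<tau>\<bar> * (M / \<tau> * (M / \<sigma> * norm x))"
      using that M0
      by (intro mult_left_mono order.trans[OF norm_cblinfun] mult_mono Vle mult_right_mono) auto
    finally show "norm ((V \<tau> - V \<sigma>) *\<^sub>V x) \<le> \<bar>\<sigma> - \<tau>\<bar> * (M / \<tau> * (M / \<sigma>)) * norm x" by (simp add: mult.assoc)
  qed (use that M0 in simp)
  have Vc: "isCont V \<sigma>" if s: "0 < \<sigma>" for \<sigma>
  proof -
    have "isCont (\<lambda>\<tau>. \<bar>\<sigma> - \<tau>\<bar> * (M / \<tau> * (M / \<sigma>))) \<sigma>" using s by (intro continuous_intros) auto
    then have "((\<lambda>\<tau>. \<bar>\<sigma> - \<tau>\<bar> * (M / \<tau> * (M / \<sigma>))) \<longlongrightarrow> 0) (at \<sigma>)" by (simp add: isCont_def)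
    moreover have "\<forall>\<^sub>F \<tau> in at \<sigma>. norm (V \<tau> - V \<sigma>) \<le> \<bar>\<sigma> - \<tau>\<bar> * (M / \<tau> * (M / \<sigma>))"
    proof (rule eventually_mono)
      show "\<forall>\<^sub>F \<tau> in at \<sigma>. \<tau> \<in> {0<..}" using s by (intro eventually_at_in_open') auto
    qed (use s in \<open>auto intro!: dist simp del: times_divide_eq_left times_divide_eq_right\<close>)
    ultimately have "((\<lambda>\<tau>. V \<tau> - V \<sigma>) \<longlongrightarrow> 0) (at \<sigma>)" by (rule Lim_null_comparison[rotated])
    then show ?thesis by (simp add: isCont_def LIM_zero_iff)
  qed
  define K where "K = max (1 + M) (M * norm A)"
  have K: "0 \<le> K" "1 + M \<le> K" "M * norm A \<le> K" using M0 by (auto simp: K_def)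
  have "(\<lambda>\<tau>. \<tau> powr (\<theta> - 1) *\<^sub>R (V \<tau> o\<^sub>C\<^sub>L A)) integrable_on {0<..}"
  proof (rule dominated_integrable_on_pos)
    have "continuous_on {0<..} (\<lambda>\<tau>. V \<tau> o\<^sub>C\<^sub>L A)"
    proof (rule continuous_at_imp_continuous_on, rule ballI)
      fix \<tau> :: real assume "\<tau> \<in> {0<..}"
      then have "isCont V \<tau>" using Vc by simp
      moreover have "bounded_linear (\<lambda>B. B o\<^sub>C\<^sub>L A)"
        by (rule bounded_linear_intro[where K = "norm A"])
          (auto intro!: cblinfun_eqI simp: cblinfun_simps norm_cblinfun_compose)
      ultimately show "isCont (\<lambda>\<tau>. V \<tau> o\<^sub>C\<^sub>L A) \<tau>" by (rule bounded_linear.isCont[rotated])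
    qed
    then show "continuous_on {0<..} (\<lambda>\<tau>. \<tau> powr (\<theta> - 1) *\<^sub>R (V \<tau> o\<^sub>C\<^sub>L A))"
      by (intro continuous_intros) auto
    show "(\<lambda>\<tau>. K * bal_bound 1 \<theta> \<tau>) integrable_on {0<..}"
      using bal_bound_integrable[OF \<theta>, of 1] by (intro integrable_on_mult_right) auto
    fix \<tau> :: real assume t: "0 < \<tau>"
    have eq: "V \<tau> o\<^sub>C\<^sub>L A = id_cblinfun - \<tau> *\<^sub>R V \<tau>"
      using op_inverse_apply(1)[OF V(1)[OF t]] by (intro cblinfun_eqI) (simp add: cblinfun_simps algebra_simps)
    have "norm (V \<tau> o\<^sub>C\<^sub>L A) \<le> norm (id_cblinfun :: 'a \<Rightarrow>\<^sub>C\<^sub>L 'a) + norm (\<tau> *\<^sub>R V \<tau>)"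
      unfolding eq by (rule norm_triangle_ineq4)
    also have "\<dots> \<le> 1 + M" using V(2)[OF t] t norm_id_cblinfun_le by (intro add_mono) auto
    also have "\<dots> \<le> K" by (rule K)
    finally have 1: "norm (V \<tau> o\<^sub>C\<^sub>L A) \<le> K" .
    have "norm (V \<tau> o\<^sub>C\<^sub>L A) \<le> M / \<tau> * norm A"
      by (intro order.trans[OF norm_cblinfun_compose] mult_right_mono Vle t) auto
    also have "\<dots> \<le> K / \<tau>" using K t by (simp add: divide_right_mono)
    finally have 2: "norm (V \<tau> o\<^sub>C\<^sub>L A) \<le> K / \<tau>" .
    have "\<tau> powr (\<theta> - 1) * norm (V \<tau> o\<^sub>C\<^sub>L A) \<le> K * bal_bound 1 \<theta> \<tau>"
    proof (cases "\<tau> \<le> 1")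
      case True
      then show ?thesis using mult_left_mono[OF 1, of "\<tau> powr (\<theta> - 1)"] by (simp add: bal_bound_def mult.commute)
    next
      case False
      have "\<tau> powr (\<theta> - 1) * norm (V \<tau> o\<^sub>C\<^sub>L A) \<le> \<tau> powr (\<theta> - 1) * (K / \<tau>)"
        by (intro mult_left_mono 2) auto
      also have "\<dots> = K * \<tau> powr (\<theta> - 2)"
        using t powr_diff[of \<tau> "\<theta> - 1" 1] by (simp add: field_simps)
      finally show ?thesis using False by (simp add: bal_bound_def)
    qed
    then show "norm (\<tau> powr (\<theta> - 1) *\<^sub>R (V \<tau> o\<^sub>C\<^sub>L A)) \<le> K * bal_bound 1 \<theta> \<tau>" by simp
  qed
  then show ?thesis by (simp add: V_def)
qed

section \<open>Admissible functions and the weak functional calculus\<close>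

context nested_polygonal
begin

lemma annulus_subset: "annulus \<subseteq> polygonal E s"
  by (auto simp: annulus_def)

lemma norm_polygonal: "z \<in> polygonal E s \<Longrightarrow> norm z < 1"
  using polygonal_subset_ball[OF E_sphere, of s] q by auto

lemma polygonal_not_E: "z \<in> polygonal E s \<Longrightarrow> z \<notin> E"
  using norm_polygonal[of z] E_sphere by auto

lemma path_in_annulus: "q < u \<Longrightarrow> u < s \<Longrightarrow> t \<in> {0<..<1} - breaks u \<Longrightarrow> \<gamma> u t \<in> annulus"
  using boundary_in_annulus[of u t] breaks_cis[of u t] by simp

lemma cint_cong:
  assumes "q < u" "u < s" "\<And>z. z \<in> annulus \<Longrightarrow> f z = g z"
  shows "cint u f = cint u g"
  unfolding cint_def
proof (rule Henstock_Kurzweil_Integration.integral_cong)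
  fix t :: real
  show "f (\<gamma> u t) * \<gamma>' u t = g (\<gamma> u t) * \<gamma>' u t"
  proof (cases "t \<in> {0<..<1} - breaks u")
    case True
    then show ?thesis using assms(3) path_in_annulus[OF assms(1,2)] by simp
  next
    case False
    have "\<gamma>' u t = 0" by (rule path_deriv_outside[OF _ _ False]) (use assms in auto)
    then show ?thesis by simp
  qed
qed

lemma cint_add:
  assumes u: "q < u" "u < s"
    and f: "f holomorphic_on annulus" "\<And>z. z \<in> annulus \<Longrightarrow> norm (f z) \<le> B"
    and g: "g holomorphic_on annulus" "\<And>z. z \<in> annulus \<Longrightarrow> norm (g z) \<le> B'"
  shows "cint u (\<lambda>z. f z + g z) = cint u f + cint u g"
  unfolding cint_def distrib_right
  using integrand_integrable_bounded[OF u f] integrand_integrable_bounded[OF u g]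
  by (intro Henstock_Kurzweil_Integration.integral_add) (auto intro: set_lebesgue_integral_eq_integral(1))

lemma cint_cmult: "cint u (\<lambda>z. c * f z) = c * cint u f"
  unfolding cint_def mult.assoc by (rule integral_mult_right)

lemma norm_cint_le:
  assumes u: "q < u" "u < s"
    and f: "f holomorphic_on annulus" "\<And>z. z \<in> annulus \<Longrightarrow> norm (f z) \<le> B" and B: "0 \<le> B"
  shows "norm (cint u f) \<le> B * (4 * pi / u)"
proof -
  interpret U: polygonal_boundary E u by (rule polygonal_boundary) (use u in auto)
  have "norm (cint u f) \<le> integral {0..1} (\<lambda>t::real. B * (4 * pi / u))"
    unfolding cint_def
  proof (rule Henstock_Kurzweil_Integration.integral_norm_bound_integral)
    show "(\<lambda>t. f (\<gamma> u t) * \<gamma>' u t) integrable_on {0..1}"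
      using integrand_integrable_bounded[OF u f] by (rule set_lebesgue_integral_eq_integral(1))
    fix t :: real
    show "norm (f (\<gamma> u t) * \<gamma>' u t) \<le> B * (4 * pi / u)"
    proof (cases "t \<in> {0<..<1} - breaks u")
      case True
      then have "\<gamma> u t \<in> annulus" by (rule path_in_annulus[OF u])
      then show ?thesis unfolding norm_mult by (intro mult_mono f U.norm_path_deriv B) auto
    next
      case False
      have "\<gamma>' u t = 0" by (rule path_deriv_outside[OF _ _ False]) (use u in auto)
      then show ?thesis using B u q by simp
    qed
  qed (rule integrable_const_ivl)
  then show ?thesis by simp
qed

text \<open>First order vanishing at \<open>E\<close> compensates the resolvent, which may grow like
  \<open>1 / dist_prod E z\<close>, so contour integrands are bounded. The class is stable under
  multiplication by bounded holomorphic functions.\<close>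

definition admissible :: "(complex \<Rightarrow> complex) \<Rightarrow> bool"
  where "admissible \<psi> \<longleftrightarrow> \<psi> holomorphic_on polygonal E s
    \<and> (\<exists>C\<ge>0. \<forall>z\<in>polygonal E s. norm (\<psi> z) \<le> C * dist_prod E z)"

lemma admissible_mult:
  assumes "admissible \<psi>" "g holomorphic_on polygonal E s" "\<And>z. z \<in> polygonal E s \<Longrightarrow> norm (g z) \<le> B"
  shows "admissible (\<lambda>z. g z * \<psi> z)"
proof -
  obtain C where C: "0 \<le> C" "\<And>z. z \<in> polygonal E s \<Longrightarrow> norm (\<psi> z) \<le> C * dist_prod E z"
    using assms(1) by (auto simp: admissible_def)
  have "0 \<in> polygonal E s" using ball_subset_polygonal[of s E] q by auto
  then have B: "0 \<le> B" using assms(3) norm_ge_zero order.trans by blast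
  have "norm (g z * \<psi> z) \<le> (B * C) * dist_prod E z" if "z \<in> polygonal E s" for z
    unfolding norm_mult mult.assoc by (intro mult_mono assms C that B) auto
  then show ?thesis using assms(1,2) B C(1)
    unfolding admissible_def by (auto intro!: holomorphic_intros exI[of _ "B * C"])
qed

lemma dist_prod_le_2: "z \<in> polygonal E s \<Longrightarrow> dist_prod E z \<le> 2 ^ card E * 2"
proof -
  assume z: "z \<in> polygonal E s"
  obtain \<zeta> where "\<zeta> \<in> E" using E_nonempty by blast
  moreover have "norm (\<zeta> - z) \<le> 2"
    using norm_triangle_ineq4[of \<zeta> z] norm_polygonal[OF z] calculation E_sphere by auto
  ultimately show ?thesis
    using dist_prod_le[OF finite_E E_sphere, of z \<zeta>] norm_polygonal[OF z]
    by (meson less_imp_le mult_left_mono order.trans zero_le_power zero_le_numeral)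
qed

lemma admissible_bounded:
  assumes "admissible \<psi>"
  obtains B where "\<And>z. z \<in> polygonal E s \<Longrightarrow> norm (\<psi> z) \<le> B"
proof -
  obtain C where C: "0 \<le> C" "\<And>z. z \<in> polygonal E s \<Longrightarrow> norm (\<psi> z) \<le> C * dist_prod E z"
    using assms by (auto simp: admissible_def)
  show thesis
    by (rule that[of "C * (2 ^ card E * 2)"])
      (use C dist_prod_le_2 in \<open>meson mult_left_mono order.trans\<close>)
qed

lemma Re_one_minus_pos:
  assumes "\<zeta> \<in> E" "z \<in> polygonal E s"
  shows "0 < Re (1 - cnj \<zeta> * z)" "norm (1 - cnj \<zeta> * z) \<le> 2"
proof -
  have n: "norm (cnj \<zeta> * z) < 1" using assms norm_polygonal E_sphere by (auto simp: norm_mult)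
  then show "0 < Re (1 - cnj \<zeta> * z)" using complex_Re_le_cmod[of "cnj \<zeta> * z"] by (simp del: times_complex.sel)
  show "norm (1 - cnj \<zeta> * z) \<le> 2" using norm_triangle_ineq4[of 1 "cnj \<zeta> * z"] n by simp
qed

end

text \<open>The assumptions concern the annulus alone, so that an operator and its adjoint satisfy
  them with the same \<open>M0\<close>.\<close>

locale op_calculus = nested_polygonal E q s for E q s +
  fixes A :: "'b::complex_banach \<Rightarrow>\<^sub>C\<^sub>L 'b" and M0 :: real
  assumes not_spectrum: "z \<in> annulus \<Longrightarrow> z \<notin> op_spectrum A"
    and resolvent_bound: "z \<in> annulus \<Longrightarrow> dist_prod E z * norm (resolvent z A) \<le> M0"
    and M0: "0 \<le> M0"
begin

lemma resolvent_pairing_holomorphic: "(\<lambda>z. y *\<^sub>V (resolvent z A *\<^sub>V x)) holomorphic_on annulus"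
proof (rule resolvent_holomorphic[OF open_annulus])
  show "annulus \<inter> op_spectrum A = {}" using not_spectrum by blast
  fix z assume z: "z \<in> annulus"
  have pz: "0 < dist_prod E z"
    using dist_prod_pos[OF finite_E] polygonal_not_E annulus_subset z by blast
  have "isCont (dist_prod E) z" unfolding dist_prod_def by (intro continuous_intros)
  then have "\<forall>\<^sub>F w in nhds z. dist_prod E z / 2 < dist_prod E w"
    using order_tendstoD(1)[of "dist_prod E" "dist_prod E z" "nhds z" "dist_prod E z / 2"] pz
    by (simp add: isCont_def tendsto_at_iff_tendsto_nhds)
  then obtain d where d: "0 < d" "\<And>w. dist w z < d \<Longrightarrow> dist_prod E z / 2 < dist_prod E w"
    unfolding eventually_nhds_metric by blast
  have "norm (resolvent w A) \<le> M0 / (dist_prod E z / 2)" if w: "w \<in> ball z d \<inter> annulus" for w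
  proof -
    have "dist_prod E z / 2 * norm (resolvent w A) \<le> dist_prod E w * norm (resolvent w A)"
      using d(2)[of w] w by (intro mult_right_mono) (auto simp: dist_commute less_imp_le)
    also have "\<dots> \<le> M0" using resolvent_bound w by blast
    finally show ?thesis using pz by (simp add: field_simps)
  qed
  then show "\<exists>d>0. \<exists>B. \<forall>w\<in>ball z d \<inter> annulus. norm (resolvent w A) \<le> B" using d(1) by blast
qed

lemma integrand_holomorphic:
  "\<psi> holomorphic_on polygonal E s \<Longrightarrow> (\<lambda>z. \<psi> z * (y *\<^sub>V (resolvent z A *\<^sub>V x))) holomorphic_on annulus"
  by (intro holomorphic_intros resolvent_pairing_holomorphic) (rule holomorphic_on_subset[OF _ annulus_subset])

lemma norm_integrand_le:
  fixes y :: "'b \<Rightarrow>\<^sub>C\<^sub>L complex"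
  assumes "0 \<le> C" "norm (\<psi> z) \<le> C * dist_prod E z" "z \<in> annulus"
  shows "norm (\<psi> z * (y *\<^sub>V (resolvent z A *\<^sub>V x))) \<le> C * M0 * norm y * norm x"
proof -
  have "norm (y *\<^sub>V (resolvent z A *\<^sub>V x)) \<le> norm y * (norm (resolvent z A) * norm x)"
    by (intro order.trans[OF norm_cblinfun] mult_left_mono norm_cblinfun) auto
  then have "norm (\<psi> z * (y *\<^sub>V (resolvent z A *\<^sub>V x)))
    \<le> (C * dist_prod E z) * (norm y * (norm (resolvent z A) * norm x))"
    unfolding norm_mult using assms dist_prod_nonneg[of E z] by (intro mult_mono) auto
  also have "\<dots> = C * (dist_prod E z * norm (resolvent z A)) * norm y * norm x" by (simp only: mult_ac)
  also have "\<dots> \<le> C * M0 * norm y * norm x"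
    using assms resolvent_bound by (intro mult_right_mono mult_left_mono) auto
  finally show ?thesis .
qed

text \<open>The pairing of \<open>\<psi>(A) x\<close> with \<open>y\<close>, without the factor
  \<open>1 / (2 * pi * \<i>)\<close>.\<close>

definition cpair :: "real \<Rightarrow> (complex \<Rightarrow> complex) \<Rightarrow> 'b \<Rightarrow> ('b \<Rightarrow>\<^sub>C\<^sub>L complex) \<Rightarrow> complex"
  where "cpair u \<psi> x y = cint u (\<lambda>z. \<psi> z * (y *\<^sub>V (resolvent z A *\<^sub>V x)))"

lemma bounded_linear_cpair:
  assumes u: "q < u" "u < s" and \<psi>: "admissible \<psi>"
  shows "bounded_linear (\<lambda>x. cpair u \<psi> x y)"
proof -
  obtain C where C: "0 \<le> C" "\<And>z. z \<in> polygonal E s \<Longrightarrow> norm (\<psi> z) \<le> C * dist_prod E z"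
    and h: "\<psi> holomorphic_on polygonal E s"
    using \<psi> by (auto simp: admissible_def)
  have le: "norm (\<psi> z * (y *\<^sub>V (resolvent z A *\<^sub>V x))) \<le> C * M0 * norm y * norm x" if "z \<in> annulus" for z x
    using norm_integrand_le[of C \<psi> z y x] C that annulus_subset by blast
  show ?thesis
  proof (rule bounded_linear_intro[where K = "C * M0 * norm y * (4 * pi / u)"])
    fix x x' r
    show "cpair u \<psi> (x + x') y = cpair u \<psi> x y + cpair u \<psi> x' y"
      unfolding cpair_def cblinfun_apply_add distrib_left
      by (rule cint_add[OF u integrand_holomorphic[OF h] le integrand_holomorphic[OF h] le])
    show "cpair u \<psi> (r *\<^sub>R x) y = r *\<^sub>R cpair u \<psi> x y"
      unfolding cpair_def cblinfun_apply_scaleR scaleR_conv_of_real mult.left_commute[of _ "of_real r"]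
      by (rule cint_cmult)
    have "norm (cpair u \<psi> x y) \<le> C * M0 * norm y * norm x * (4 * pi / u)"
      unfolding cpair_def using C(1) M0 by (intro norm_cint_le[OF u integrand_holomorphic[OF h] le]) auto
    then show "norm (cpair u \<psi> x y) \<le> norm x * (C * M0 * norm y * (4 * pi / u))" by (simp add: mult_ac)
  qed
qed

lemma cpair_add: "q < u \<Longrightarrow> u < s \<Longrightarrow> admissible \<psi> \<Longrightarrow> cpair u \<psi> (x + x') y = cpair u \<psi> x y + cpair u \<psi> x' y"
  by (rule linear_add[OF bounded_linear.linear[OF bounded_linear_cpair]])

lemma cpair_diff: "q < u \<Longrightarrow> u < s \<Longrightarrow> admissible \<psi> \<Longrightarrow> cpair u \<psi> (x - x') y = cpair u \<psi> x y - cpair u \<psi> x' y"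
  by (rule linear_diff[OF bounded_linear.linear[OF bounded_linear_cpair]])

lemma cpair_scaleC: "cpair u \<psi> (c *\<^sub>C x) y = c * cpair u \<psi> x y"
  unfolding cpair_def cblinfun_apply_scaleC scaleC_complex mult.left_commute[of _ c] by (rule cint_cmult)

lemma cpair_cmult: "cpair u (\<lambda>z. c * \<psi> z) x y = c * cpair u \<psi> x y"
  unfolding cpair_def mult.assoc by (rule cint_cmult)

lemma cpair_cong:
  "q < u \<Longrightarrow> u < s \<Longrightarrow> (\<And>z. z \<in> polygonal E s \<Longrightarrow> \<psi> z = \<psi>' z) \<Longrightarrow> cpair u \<psi> x y = cpair u \<psi>' x y"
  unfolding cpair_def using annulus_subset by (intro cint_cong) auto

lemma cpair_fun_add:
  assumes u: "q < u" "u < s" and "admissible \<psi>" "admissible \<psi>'"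
  shows "cpair u (\<lambda>z. \<psi> z + \<psi>' z) x y = cpair u \<psi> x y + cpair u \<psi>' x y"
proof -
  obtain C where C: "0 \<le> C" "\<And>z. z \<in> polygonal E s \<Longrightarrow> norm (\<psi> z) \<le> C * dist_prod E z"
    and h: "\<psi> holomorphic_on polygonal E s"
    using assms by (auto simp: admissible_def)
  obtain C' where C': "0 \<le> C'" "\<And>z. z \<in> polygonal E s \<Longrightarrow> norm (\<psi>' z) \<le> C' * dist_prod E z"
    and h': "\<psi>' holomorphic_on polygonal E s"
    using assms by (auto simp: admissible_def)
  have "norm (\<psi> z * (y *\<^sub>V (resolvent z A *\<^sub>V x))) \<le> C * M0 * norm y * norm x"
    "norm (\<psi>' z * (y *\<^sub>V (resolvent z A *\<^sub>V x))) \<le> C' * M0 * norm y * norm x" if "z \<in> annulus" for z x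
    using norm_integrand_le[of C \<psi> z y x] C norm_integrand_le[of C' \<psi>' z y x] C' that annulus_subset by blast+
  then show ?thesis
    unfolding cpair_def distrib_right
    by (rule cint_add[OF u integrand_holomorphic[OF h] _ integrand_holomorphic[OF h']])
qed

text \<open>Since \<open>z R(z) x = x + R(z) A x\<close>, the two sides differ by a multiple of the
  contour integral of \<open>\<psi>\<close>, which vanishes by Cauchy's theorem.\<close>

lemma cpair_z:
  assumes u: "q < u" "u < s" and \<psi>: "admissible \<psi>"
  shows "cpair u (\<lambda>z. z * \<psi> z) x y = cpair u \<psi> (A *\<^sub>V x) y"
proof -
  obtain C where C: "0 \<le> C" "\<And>z. z \<in> polygonal E s \<Longrightarrow> norm (\<psi> z) \<le> C * dist_prod E z"
    and h: "\<psi> holomorphic_on polygonal E s"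
    using \<psi> by (auto simp: admissible_def)
  obtain B where B: "\<And>z. z \<in> polygonal E s \<Longrightarrow> norm (\<psi> z) \<le> B" by (rule admissible_bounded[OF \<psi>]) blast
  have "cpair u (\<lambda>z. z * \<psi> z) x y
    = cint u (\<lambda>z. (y *\<^sub>V x) * \<psi> z + \<psi> z * (y *\<^sub>V (resolvent z A *\<^sub>V (A *\<^sub>V x))))"
    unfolding cpair_def
  proof (rule cint_cong[OF u])
    fix z assume "z \<in> annulus"
    then have eq: "z * (y *\<^sub>V (resolvent z A *\<^sub>V x)) = y *\<^sub>V x + y *\<^sub>V (resolvent z A *\<^sub>V (A *\<^sub>V x))"
      using resolvent_apply(1)[OF not_spectrum, of z x]
      by (metis cblinfun_apply_add cblinfun_apply_scaleC scaleC_complex)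
    have "z * \<psi> z * (y *\<^sub>V (resolvent z A *\<^sub>V x)) = \<psi> z * (z * (y *\<^sub>V (resolvent z A *\<^sub>V x)))"
      by (simp only: mult_ac)
    then show "z * \<psi> z * (y *\<^sub>V (resolvent z A *\<^sub>V x))
      = (y *\<^sub>V x) * \<psi> z + \<psi> z * (y *\<^sub>V (resolvent z A *\<^sub>V (A *\<^sub>V x)))"
      unfolding eq by (simp only: distrib_left mult.commute)
  qed
  also have "\<dots> = cint u (\<lambda>z. (y *\<^sub>V x) * \<psi> z) + cpair u \<psi> (A *\<^sub>V x) y"
    unfolding cpair_def
  proof (rule cint_add[OF u _ _ integrand_holomorphic[OF h]])
    show "(\<lambda>z. (y *\<^sub>V x) * \<psi> z) holomorphic_on annulus"
      using holomorphic_on_subset[OF h annulus_subset] by (intro holomorphic_intros)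
    show "norm ((y *\<^sub>V x) * \<psi> z) \<le> norm (y *\<^sub>V x) * B" if "z \<in> annulus" for z
      unfolding norm_mult using that annulus_subset by (intro mult_left_mono B) auto
    show "norm (\<psi> z * (y *\<^sub>V (resolvent z A *\<^sub>V (A *\<^sub>V x)))) \<le> C * M0 * norm y * norm (A *\<^sub>V x)"
      if "z \<in> annulus" for z
      using norm_integrand_le[of C \<psi> z y "A *\<^sub>V x"] C that annulus_subset by blast
  qed
  also have "cint u (\<lambda>z. (y *\<^sub>V x) * \<psi> z) = 0"
    unfolding cint_cmult using cint_holomorphic[OF u h B] by simp
  finally show ?thesis by simp
qed

text \<open>The operator \<open>W\<close> acts on the calculus as multiplication by the function \<open>g\<close>.\<close>

definition represents :: "real \<Rightarrow> (complex \<Rightarrow> complex) \<Rightarrow> ('b \<Rightarrow>\<^sub>C\<^sub>L 'b) \<Rightarrow> bool"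
  where "represents u g W \<longleftrightarrow> (\<forall>\<psi>. admissible \<psi> \<longrightarrow>
    admissible (\<lambda>z. g z * \<psi> z) \<and> (\<forall>x y. cpair u (\<lambda>z. g z * \<psi> z) x y = cpair u \<psi> (W *\<^sub>V x) y))"

lemma representsD:
  "represents u g W \<Longrightarrow> admissible \<psi> \<Longrightarrow> admissible (\<lambda>z. g z * \<psi> z)"
  "represents u g W \<Longrightarrow> admissible \<psi> \<Longrightarrow> cpair u (\<lambda>z. g z * \<psi> z) x y = cpair u \<psi> (W *\<^sub>V x) y"
  by (simp_all add: represents_def)

lemma represents_one: "represents u (\<lambda>_. 1) id_cblinfun"
  by (simp add: represents_def)

lemma represents_compose:
  assumes "represents u g W" "represents u g' W'"
  shows "represents u (\<lambda>z. g z * g' z) (W o\<^sub>C\<^sub>L W')"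
  unfolding represents_def
proof (intro allI impI conjI)
  fix \<psi> x y assume \<psi>: "admissible \<psi>"
  have eq: "(\<lambda>z. g z * g' z * \<psi> z) = (\<lambda>z. g' z * (g z * \<psi> z))" by (simp add: mult_ac)
  show "admissible (\<lambda>z. g z * g' z * \<psi> z)"
    unfolding eq by (intro representsD(1)[OF assms(2)] representsD(1)[OF assms(1)] \<psi>)
  show "cpair u (\<lambda>z. g z * g' z * \<psi> z) x y = cpair u \<psi> ((W o\<^sub>C\<^sub>L W') *\<^sub>V x) y"
    unfolding eq
    by (simp add: representsD(2)[OF assms(2) representsD(1)[OF assms(1) \<psi>]] representsD(2)[OF assms(1) \<psi>])
qed

lemma represents_power: "represents u g W \<Longrightarrow> represents u (\<lambda>z. g z ^ n) (op_power W n)"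
  by (induction n) (simp_all add: represents_one represents_compose)

lemma represents_z:
  assumes u: "q < u" "u < s"
  shows "represents u (\<lambda>z. z) A"
  unfolding represents_def
proof (intro allI impI conjI)
  fix \<psi> x y assume \<psi>: "admissible \<psi>"
  show "admissible (\<lambda>z. z * \<psi> z)"
    by (rule admissible_mult[OF \<psi>, where B = 1]) (auto intro: holomorphic_intros less_imp_le norm_polygonal)
  show "cpair u (\<lambda>z. z * \<psi> z) x y = cpair u \<psi> (A *\<^sub>V x) y" by (rule cpair_z[OF u \<psi>])
qed

lemma represents_one_minus:
  assumes u: "q < u" "u < s"
  shows "represents u (\<lambda>z. 1 - c * z) (id_cblinfun - c *\<^sub>C A)"
  unfolding represents_def
proof (intro allI impI conjI)
  fix \<psi> x y assume \<psi>: "admissible \<psi>"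
  note z = representsD[OF represents_z[OF u] \<psi>]
  show "admissible (\<lambda>z. (1 - c * z) * \<psi> z)"
  proof (rule admissible_mult[OF \<psi>, where B = "1 + norm c"])
    fix z assume "z \<in> polygonal E s"
    then have "norm (c * z) \<le> norm c" using norm_polygonal[of z] by (simp add: norm_mult mult_left_le)
    then show "norm (1 - c * z) \<le> 1 + norm c" using norm_triangle_ineq4[of 1 "c * z"] by simp
  qed (intro holomorphic_intros)
  have cz: "admissible (\<lambda>z. (- c) * (z * \<psi> z))"
    by (rule admissible_mult[OF z(1), where B = "norm c"]) (auto intro: holomorphic_intros)
  have "cpair u (\<lambda>z. (1 - c * z) * \<psi> z) x y = cpair u (\<lambda>z. \<psi> z + (- c) * (z * \<psi> z)) x y"
    by (simp add: algebra_simps)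
  also have "\<dots> = cpair u \<psi> x y + (- c) * cpair u \<psi> (A *\<^sub>V x) y"
    unfolding cpair_fun_add[OF u \<psi> cz] cpair_cmult z(2) ..
  also have "\<dots> = cpair u \<psi> ((id_cblinfun - c *\<^sub>C A) *\<^sub>V x) y"
    by (simp add: cblinfun_simps cpair_diff[OF u \<psi>] cpair_scaleC)
  finally show "cpair u (\<lambda>z. (1 - c * z) * \<psi> z) x y = cpair u \<psi> ((id_cblinfun - c *\<^sub>C A) *\<^sub>V x) y" .
qed

text \<open>Write \<open>x = \<tau> V x + A' V x\<close> with \<open>A' = 1 - cnj \<zeta> A\<close>,
  and apply the rule for \<open>1 - cnj \<zeta> * z\<close> to the quotient of \<open>\<psi>\<close>
  by \<open>\<tau> + (1 - cnj \<zeta> * z)\<close>; the denominator then cancels.\<close>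

lemma represents_inverse:
  assumes u: "q < u" "u < s" and \<zeta>: "\<zeta> \<in> E" and \<tau>: "0 < \<tau>"
    and V: "op_is_inverse (\<tau> *\<^sub>R id_cblinfun + (id_cblinfun - cnj \<zeta> *\<^sub>C A)) V"
  shows "represents u (\<lambda>z. 1 / (of_real \<tau> + (1 - cnj \<zeta> * z))) V"
  unfolding represents_def
proof (intro allI impI conjI)
  fix \<psi> x y assume \<psi>: "admissible \<psi>"
  let ?d = "\<lambda>z. of_real \<tau> + (1 - cnj \<zeta> * z)"
  have nz: "?d z \<noteq> 0" if "z \<in> polygonal E s" for z
    using of_real_add_nonzero[OF _ \<tau>] Re_one_minus_pos(1)[OF \<zeta> that] less_imp_le by blast
  show adm: "admissible (\<lambda>z. 1 / ?d z * \<psi> z)"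
  proof (rule admissible_mult[OF \<psi>, where B = "1 / \<tau>"])
    fix z assume z: "z \<in> polygonal E s"
    have "\<tau> \<le> norm (?d z)"
      using norm_add_ge_Re(2)[of "1 - cnj \<zeta> * z" \<tau>] Re_one_minus_pos(1)[OF \<zeta> z] \<tau> less_imp_le by blast
    then show "norm (1 / ?d z) \<le> 1 / \<tau>" using \<tau> by (simp add: norm_divide frac_le)
  qed (use nz in \<open>intro holomorphic_intros\<close>)
  note a = representsD[OF represents_one_minus[OF u, of "cnj \<zeta>"] adm]
  have \<tau>adm: "admissible (\<lambda>z. of_real \<tau> * (1 / ?d z * \<psi> z))"
    by (rule admissible_mult[OF adm, where B = \<tau>]) (use \<tau> in \<open>auto intro: holomorphic_intros\<close>)
  have "cpair u (\<lambda>z. 1 / ?d z * \<psi> z) x y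
    = cpair u (\<lambda>z. 1 / ?d z * \<psi> z) (\<tau> *\<^sub>R (V *\<^sub>V x) + (id_cblinfun - cnj \<zeta> *\<^sub>C A) *\<^sub>V (V *\<^sub>V x)) y"
    using op_inverse_apply(2)[OF V, of x] by simp
  also have "\<dots> = of_real \<tau> * cpair u (\<lambda>z. 1 / ?d z * \<psi> z) (V *\<^sub>V x) y
    + cpair u (\<lambda>z. (1 - cnj \<zeta> * z) * (1 / ?d z * \<psi> z)) (V *\<^sub>V x) y"
    unfolding cpair_add[OF u adm] a(2) scaleR_scaleC cpair_scaleC ..
  also have "\<dots> = cpair u (\<lambda>z. of_real \<tau> * (1 / ?d z * \<psi> z) + (1 - cnj \<zeta> * z) * (1 / ?d z * \<psi> z)) (V *\<^sub>V x) y"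
    unfolding cpair_fun_add[OF u \<tau>adm a(1)] cpair_cmult ..
  also have "\<dots> = cpair u \<psi> (V *\<^sub>V x) y"
  proof (rule cpair_cong[OF u])
    fix z assume "z \<in> polygonal E s"
    from nz[OF this] have "?d z * (1 / ?d z * \<psi> z) = \<psi> z" by simp
    then show "of_real \<tau> * (1 / ?d z * \<psi> z) + (1 - cnj \<zeta> * z) * (1 / ?d z * \<psi> z) = \<psi> z"
      by (simp only: distrib_right)
  qed
  finally show "cpair u (\<lambda>z. 1 / ?d z * \<psi> z) x y = cpair u \<psi> (V *\<^sub>V x) y" .
qed

lemma bal_int_bounded: "0 < \<theta> \<Longrightarrow> \<theta> < 1 \<Longrightarrow> \<zeta> \<in> E \<Longrightarrow> z \<in> polygonal E s \<Longrightarrow>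
  norm (bal_int \<theta> (1 - cnj \<zeta> * z)) \<le> (1 / \<theta> + 1 / (1 - \<theta>)) * 2 powr \<theta>"
  using Re_one_minus_pos
  by (intro order.trans[OF norm_bal_int_le] mult_left_mono powr_mono2) auto

lemma bal_int_comp_holomorphic:
  "0 < \<theta> \<Longrightarrow> \<theta> < 1 \<Longrightarrow> \<zeta> \<in> E \<Longrightarrow> (\<lambda>z. bal_int \<theta> (1 - cnj \<zeta> * z)) holomorphic_on polygonal E s"
  by (rule holomorphic_on_compose_gen[OF _ bal_int_holomorphic, unfolded o_def])
    (auto intro!: holomorphic_intros simp: Re_one_minus_pos(1) simp del: times_complex.sel minus_complex.sel)

text \<open>For each \<open>\<tau>\<close> the operator integrand acts as multiplication by
  \<open>bal_kernel\<close>. A bounded linear functional passes through the operator integral, and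
  \<open>bal_fubini\<close> exchanges the remaining scalar integrals.\<close>

lemma represents_balakrishnan:
  assumes u: "q < u" "u < s" and \<zeta>: "\<zeta> \<in> E" and \<theta>: "0 < \<theta>" "\<theta> < 1"
    and A': "A' = id_cblinfun - cnj \<zeta> *\<^sub>C A" and sec: "sectorial_bound A' Ms"
  shows "represents u (\<lambda>z. bal_int \<theta> (1 - cnj \<zeta> * z))
    (integral {0<..} (\<lambda>\<tau>. \<tau> powr (\<theta> - 1) *\<^sub>R (op_inverse (\<tau> *\<^sub>R id_cblinfun + A') o\<^sub>C\<^sub>L A')))"
  unfolding represents_def
proof (intro allI impI conjI)
  interpret U: polygonal_boundary E u by (rule polygonal_boundary) (use u in auto)
  fix \<psi> and x :: 'b and y assume \<psi>: "admissible \<psi>"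
  then have \<psi>h: "\<psi> holomorphic_on polygonal E s" by (simp add: admissible_def)
  obtain C where C: "0 \<le> C" "\<And>z. z \<in> polygonal E s \<Longrightarrow> norm (\<psi> z) \<le> C * dist_prod E z"
    using \<psi> by (auto simp: admissible_def)
  show "admissible (\<lambda>z. bal_int \<theta> (1 - cnj \<zeta> * z) * \<psi> z)"
    by (rule admissible_mult[OF \<psi> bal_int_comp_holomorphic[OF \<theta> \<zeta>] bal_int_bounded[OF \<theta> \<zeta>]])
  define f where "f = (\<lambda>\<tau>. \<tau> powr (\<theta> - 1) *\<^sub>R (op_inverse (\<tau> *\<^sub>R id_cblinfun + A') o\<^sub>C\<^sub>L A'))"
  have fI: "f integrable_on {0<..}" unfolding f_def by (rule balakrishnan_integrable[OF sec \<theta>])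
  define ev where "ev W = cpair u \<psi> (W *\<^sub>V x) y" for W
  have ev: "bounded_linear ev"
    unfolding ev_def
    using bounded_linear_compose[OF bounded_linear_cpair[OF u \<psi>] bounded_linear_cblinfun_apply_left] .
  define h where "h t = \<psi> (\<gamma> u t) * (y *\<^sub>V (resolvent (\<gamma> u t) A *\<^sub>V x)) * \<gamma>' u t" for t
  define m where "m t = 1 - cnj \<zeta> * \<gamma> u t" for t
  have fev: "ev (f \<tau>) = integral {0..1} (\<lambda>t. h t * bal_kernel \<theta> (m t) \<tau>)" if "\<tau> \<in> {0<..}" for \<tau>
  proof -
    have \<tau>: "0 < \<tau>" using that by simp
    have V: "op_is_inverse (\<tau> *\<^sub>R id_cblinfun + A') (op_inverse (\<tau> *\<^sub>R id_cblinfun + A'))"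
      using sec \<tau> by (auto simp: sectorial_bound_def)
    note r = represents_compose[OF represents_inverse[OF u \<zeta> \<tau> V[unfolded A']] represents_one_minus[OF u, of "cnj \<zeta>"]]
    have "ev (f \<tau>) = of_real (\<tau> powr (\<theta> - 1)) * cpair u \<psi> ((op_inverse (\<tau> *\<^sub>R id_cblinfun + A') o\<^sub>C\<^sub>L A') *\<^sub>V x) y"
      unfolding ev_def f_def scaleR_cblinfun_apply unfolding scaleR_scaleC[of "\<tau> powr (\<theta> - 1)"] cpair_scaleC ..
    also have "\<dots> = of_real (\<tau> powr (\<theta> - 1)) *
        cpair u (\<lambda>z. 1 / (of_real \<tau> + (1 - cnj \<zeta> * z)) * (1 - cnj \<zeta> * z) * \<psi> z) x y"
      unfolding A' by (simp only: representsD(2)[OF r \<psi>])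
    also have "\<dots> = integral {0..1} (\<lambda>t. h t * bal_kernel \<theta> (m t) \<tau>)"
      unfolding cpair_def cint_def integral_mult_right[symmetric]
      by (rule Henstock_Kurzweil_Integration.integral_cong) (simp add: h_def m_def bal_kernel_def mult_ac)
    finally show ?thesis .
  qed
  have "cpair u \<psi> (integral {0<..} f *\<^sub>V x) y = ev (integral {0<..} f)" by (simp add: ev_def)
  also have "\<dots> = integral {0<..} (ev \<circ> f)" using integral_linear[OF fI ev] by simp
  also have "\<dots> = integral {0<..} (\<lambda>\<tau>. integral {0..1} (\<lambda>t. h t * bal_kernel \<theta> (m t) \<tau>))"
    by (rule Henstock_Kurzweil_Integration.integral_cong) (simp add: fev)
  also have "\<dots> = integral {0..1} (\<lambda>t. h t * bal_int \<theta> (m t))"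
  proof (rule bal_fubini[OF \<theta>])
    let ?S = "{0<..<1} - breaks u"
    have in_ann: "\<gamma> u t \<in> annulus" if "t \<in> ?S" for t
      by (rule path_in_annulus[OF u that])
    have h0: "h t = 0" if "t \<notin> ?S" for t
    proof -
      have "\<gamma>' u t = 0" by (rule path_deriv_outside[OF _ _ that]) (use u in auto)
      then show ?thesis by (simp add: h_def)
    qed
    have "continuous_on ?S h"
      unfolding h_def
      by (intro continuous_on_mult[OF continuous_on_compose2[OF holomorphic_on_imp_continuous_on[OF
          integrand_holomorphic[OF \<psi>h]] U.continuous_boundary_path] U.continuous_path_deriv])
        (use in_ann in auto)
    then have "(\<lambda>t. indicator ?S t *\<^sub>R h t) \<in> borel_measurable borel"
      by (intro borel_measurable_continuous_on_indicator borel_open U.open_minus_breaks)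
    moreover have "(\<lambda>t. indicator ?S t *\<^sub>R h t) = h"
      using h0 by (auto simp: indicator_def fun_eq_iff)
    ultimately show "h \<in> borel_measurable borel" by simp
    show "norm (h t) \<le> C * M0 * norm y * norm x * (4 * pi / u)" for t
    proof (cases "t \<in> ?S")
      case True
      have "norm (\<psi> (\<gamma> u t) * (y *\<^sub>V (resolvent (\<gamma> u t) A *\<^sub>V x))) \<le> C * M0 * norm y * norm x"
        using in_ann[OF True] annulus_subset by (intro norm_integrand_le C) auto
      then show ?thesis
        unfolding h_def norm_mult[of _ "\<gamma>' u t"] by (intro mult_mono U.norm_path_deriv) (use C M0 in auto)
    next
      case False
      then show ?thesis using h0 C(1) M0 u q by simp
    qed
    show "h t = 0" if "t \<notin> {0..1}" for t using h0[of t] that by auto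
    show "continuous_on UNIV m" unfolding m_def by (intro continuous_intros U.continuous_boundary_path)
    have n: "norm (cnj \<zeta> * \<gamma> u t) \<le> 1" for t
      using U.norm_boundary_path_le[of t] U.norm_E[OF \<zeta>] by (simp add: norm_mult)
    show "0 \<le> Re (m t)" for t
      using complex_Re_le_cmod[of "cnj \<zeta> * \<gamma> u t"] n[of t] by (simp add: m_def del: times_complex.sel)
    show "norm (m t) \<le> 2" for t
      using norm_triangle_ineq4[of 1 "cnj \<zeta> * \<gamma> u t"] n[of t] by (simp add: m_def)
  qed
  also have "\<dots> = cpair u (\<lambda>z. bal_int \<theta> (1 - cnj \<zeta> * z) * \<psi> z) x y"
    unfolding cpair_def cint_def
    by (rule Henstock_Kurzweil_Integration.integral_cong) (simp add: h_def m_def mult_ac)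
  finally show "cpair u (\<lambda>z. bal_int \<theta> (1 - cnj \<zeta> * z) * \<psi> z) x y
      = cpair u \<psi> (integral {0<..} (\<lambda>\<tau>. \<tau> powr (\<theta> - 1) *\<^sub>R (op_inverse (\<tau> *\<^sub>R id_cblinfun + A') o\<^sub>C\<^sub>L A')) *\<^sub>V x) y"
    unfolding f_def by (rule sym)
qed

lemma represents_cmult:
  assumes "represents u g W"
  shows "represents u (\<lambda>z. c * g z) (c *\<^sub>C W)"
  unfolding represents_def
proof (intro allI impI conjI)
  fix \<psi> x y assume \<psi>: "admissible \<psi>"
  note r = representsD[OF assms \<psi>]
  show "admissible (\<lambda>z. c * g z * \<psi> z)"
    unfolding mult.assoc by (rule admissible_mult[OF r(1), where B = "norm c"]) (auto intro: holomorphic_intros)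
  show "cpair u (\<lambda>z. c * g z * \<psi> z) x y = cpair u \<psi> ((c *\<^sub>C W) *\<^sub>V x) y"
    unfolding mult.assoc cpair_cmult r(2) scaleC_cblinfun_apply cpair_scaleC ..
qed

lemma represents_frac_power:
  assumes u: "q < u" "u < s" and \<zeta>: "\<zeta> \<in> E" and \<alpha>: "0 < \<alpha>"
    and sec: "sectorial_bound (id_cblinfun - cnj \<zeta> *\<^sub>C A) Ms"
  shows "represents u (\<lambda>z. scalar_pow \<alpha> (1 - cnj \<zeta> * z)) (frac_power (id_cblinfun - cnj \<zeta> *\<^sub>C A) \<alpha>)"
proof -
  define n \<theta> where "n = nat \<lfloor>\<alpha>\<rfloor>" and "\<theta> = \<alpha> - real n"
  let ?A = "id_cblinfun - cnj \<zeta> *\<^sub>C A"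
  have p: "represents u (\<lambda>z. (1 - cnj \<zeta> * z) ^ n) (op_power ?A n)"
    by (rule represents_power[OF represents_one_minus[OF u]])
  show ?thesis
  proof (cases "\<theta> = 0")
    case True
    then have e: "\<alpha> - real (nat \<lfloor>\<alpha>\<rfloor>) = 0" by (simp add: \<theta>_def n_def)
    show ?thesis
      unfolding frac_power_def scalar_pow_def Let_def if_P[OF e] mult_1_right cblinfun_compose_id
      using p unfolding n_def .
  next
    case False
    have \<theta>: "0 < \<theta>" "\<theta> < 1" using frac_part_bounds[OF \<alpha>] False by (simp_all add: \<theta>_def n_def)
    have e: "\<alpha> - real (nat \<lfloor>\<alpha>\<rfloor>) \<noteq> 0" using False by (simp add: \<theta>_def n_def)
    show ?thesis
      unfolding frac_power_def scalar_pow_def Let_def if_not_P[OF e]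
      unfolding n_def[symmetric] \<theta>_def[symmetric] scaleR_scaleC[of "sin (pi * \<theta>) / pi"]
      by (rule represents_compose[OF p represents_cmult[OF represents_balakrishnan[OF u \<zeta> \<theta> refl sec]]])
  qed
qed

lemma represents_frac_product:
  assumes u: "q < u" "u < s" and \<xi>: "set \<xi> \<subseteq> E" and \<alpha>: "0 < \<alpha>"
    and sec: "\<And>\<zeta>. \<zeta> \<in> E \<Longrightarrow> \<exists>Ms. sectorial_bound (id_cblinfun - cnj \<zeta> *\<^sub>C A) Ms"
  shows "represents u (\<lambda>z. \<Prod>\<zeta>\<leftarrow>\<xi>. scalar_pow \<alpha> (1 - cnj \<zeta> * z)) (frac_product \<xi> \<alpha> A)"
  using \<xi>
proof (induction \<xi>)
  case (Cons \<zeta> \<xi>)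
  then obtain Ms where "sectorial_bound (id_cblinfun - cnj \<zeta> *\<^sub>C A) Ms" using sec by auto
  from represents_compose[OF represents_frac_power[OF u _ \<alpha> this] Cons.IH] Cons.prems
  show ?case by (simp add: frac_product_def)
qed (simp add: frac_product_def represents_one)

end

section \<open>Negative binomial series and a partition of unity\<close>

text \<open>The coefficients of the power series of \<open>(1 - w)^(-m)\<close>; the natural
  subtraction in \<open>m + k - 1\<close> is harmless for \<open>m \<ge> 1\<close>.\<close>

definition negbin :: "nat \<Rightarrow> nat \<Rightarrow> real"
  where "negbin m k = real ((m + k - 1) choose k)"

lemma negbin_sums:
  fixes w :: complex
  assumes "norm w < 1" "1 \<le> m"
  shows "(\<lambda>k. of_real (negbin m k) * w ^ k) sums (1 / (1 - w) ^ m)"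
proof -
  have "(\<lambda>k. ((- of_nat m) gchoose k) * (- w) ^ k) sums (1 + - w) powr (- of_nat m)"
    by (rule gen_binomial_complex) (use assms in simp)
  moreover have "((- of_nat m) gchoose k) * (- w) ^ k = of_real (negbin m k) * w ^ k" for k
  proof -
    have "((- of_nat m :: complex) gchoose k) = (- 1) ^ k * ((of_nat m + of_nat k - 1) gchoose k)"
      by (rule gbinomial_minus)
    also have "(of_nat m + of_nat k - 1 :: complex) = of_nat (m + k - 1)"
      using assms(2) by (simp add: of_nat_diff)
    also have "of_nat (m + k - 1) gchoose k = (of_real (negbin m k) :: complex)"
      by (simp add: negbin_def binomial_gbinomial[symmetric])
    finally show ?thesis by (simp add: power_minus[of w])
  qed
  moreover have "(1 + - w) powr (- of_nat m) = 1 / (1 - w) ^ m"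
  proof -
    have "1 - w \<noteq> 0" using assms by auto
    then show ?thesis by (simp add: powr_minus powr_nat inverse_eq_divide)
  qed
  ultimately show ?thesis by simp
qed

lemma negbin_nonneg: "0 \<le> negbin m k"
  by (simp add: negbin_def)

text \<open>Symmetry turns the coefficient into \<open>(m + k - 1) choose (m - 1)\<close>, which
  grows like the power \<open>m - 1\<close> of \<open>k\<close>.\<close>

lemma negbin_le:
  assumes "1 \<le> m"
  shows "negbin m k \<le> real m ^ (m - 1) * (real k + 1) ^ (m - 1)"
proof -
  have "(m + k - 1) choose k = (m + k - 1) choose (m - 1)"
    using assms binomial_symmetric[of k "m + k - 1"] by simp
  also have "\<dots> \<le> (m + k - 1) ^ (m - 1)" using assms by (intro binomial_le_pow) auto
  also have "\<dots> \<le> (m * (k + 1)) ^ (m - 1)"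
  proof (rule power_mono)
    have "1 * k \<le> m * k" using assms by (rule mult_le_mono1)
    moreover have "m * (k + 1) = m * k + m" by simp
    ultimately show "m + k - 1 \<le> m * (k + 1)" by linarith
  qed simp
  finally have "real ((m + k - 1) choose k) \<le> real ((m * (k + 1)) ^ (m - 1))" by (rule of_nat_mono)
  also have "real ((m * (k + 1)) ^ (m - 1)) = real m ^ (m - 1) * (real k + 1) ^ (m - 1)"
    by (simp only: of_nat_power of_nat_mult of_nat_add of_nat_1 power_mult_distrib)
  finally show ?thesis by (simp only: negbin_def)
qed

lemma negbin_partial_sum_le:
  assumes "0 \<le> r" "r < 1" "1 \<le> m"
  shows "(\<Sum>k<n. negbin m k * r ^ k) \<le> 1 / (1 - r) ^ m"
proof -
  have "(\<lambda>k. complex_of_real (negbin m k * r ^ k)) sums of_real (1 / (1 - r) ^ m)"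
    using negbin_sums[of "of_real r" m] assms by simp
  then have s: "(\<lambda>k. negbin m k * r ^ k) sums (1 / (1 - r) ^ m)" by (simp only: sums_of_real_iff)
  have "(\<Sum>k<n. negbin m k * r ^ k) \<le> (\<Sum>k. negbin m k * r ^ k)"
    by (rule sum_le_suminf[OF sums_summable[OF s]]) (use assms(1) negbin_nonneg in auto)
  then show ?thesis unfolding sums_unique[OF s, symmetric] .
qed

text \<open>Powers of linear factors with distinct roots are coprime, and the identity is built by
  adding one point of \<open>E\<close> at a time.\<close>

lemma bezout_partition:
  fixes E :: "complex set"
  assumes "finite E" "E \<noteq> {}"
  obtains h :: "complex \<Rightarrow> complex poly"
  where "(\<Sum>\<zeta>\<in>E. h \<zeta> * (\<Prod>\<eta>\<in>E - {\<zeta>}. [:1, - cnj \<eta>:] ^ m)) = 1"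
proof -
  let ?l = "\<lambda>\<eta>. [:1, - cnj \<eta>:]"
  have cop: "coprime (?l \<zeta>) (?l \<eta>)" if "\<zeta> \<noteq> \<eta>" for \<zeta> \<eta>
  proof (rule coprimeI)
    fix c assume c: "c dvd ?l \<zeta>" "c dvd ?l \<eta>"
    then have "c dvd smult (cnj \<eta>) (?l \<zeta>) - smult (cnj \<zeta>) (?l \<eta>)"
      by (intro dvd_diff dvd_smult)
    also have "smult (cnj \<eta>) (?l \<zeta>) - smult (cnj \<zeta>) (?l \<eta>) = [:cnj \<eta> - cnj \<zeta>:]" by simp
    finally have "c dvd [:cnj \<eta> - cnj \<zeta>:]" .
    moreover have "is_unit [:cnj \<eta> - cnj \<zeta>:]"
      using that by (simp add: is_unit_const_poly_iff dvd_field_iff)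
    ultimately show "is_unit c" by (rule dvd_unit_imp_unit)
  qed
  have "\<exists>h. (\<Sum>\<zeta>\<in>E. h \<zeta> * (\<Prod>\<eta>\<in>E - {\<zeta>}. ?l \<eta> ^ m)) = 1"
    using assms
  proof (induction E rule: finite_ne_induct)
    case (singleton e)
    show ?case by (rule exI[of _ "\<lambda>_. 1"]) simp
  next
    case (insert e E)
    then obtain h where h: "(\<Sum>\<zeta>\<in>E. h \<zeta> * (\<Prod>\<eta>\<in>E - {\<zeta>}. ?l \<eta> ^ m)) = 1" by blast
    define P where "P = (\<Prod>\<eta>\<in>E. ?l \<eta> ^ m)"
    have "coprime (?l e ^ m) P"
      unfolding P_def using insert by (intro prod_coprime_right) (auto intro!: cop simp: coprime_power_left_iff coprime_power_right_iff)
    then have g: "gcd (?l e ^ m) P = 1" by simp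
    obtain a b where ab: "a * (?l e ^ m) + b * P = 1"
      using bezout_coefficients_fst_snd[of "?l e ^ m" P] g by metis
    \<comment> \<open>Every old term acquires the factor of the new point \<open>e\<close>, so the
      old coefficients are multiplied by \<open>a\<close>; the term of \<open>e\<close> is the
      product \<open>P\<close> of the old factors and receives \<open>b\<close>.\<close>
    define h' where "h' \<zeta> = (if \<zeta> = e then b else a * h \<zeta>)" for \<zeta>
    have "(\<Sum>\<zeta>\<in>insert e E. h' \<zeta> * (\<Prod>\<eta>\<in>insert e E - {\<zeta>}. ?l \<eta> ^ m))
      = b * P + (\<Sum>\<zeta>\<in>E. h' \<zeta> * (\<Prod>\<eta>\<in>insert e E - {\<zeta>}. ?l \<eta> ^ m))"
      using insert by (simp add: h'_def P_def)
    also have "(\<Sum>\<zeta>\<in>E. h' \<zeta> * (\<Prod>\<eta>\<in>insert e E - {\<zeta>}. ?l \<eta> ^ m))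
      = (\<Sum>\<zeta>\<in>E. (a * ?l e ^ m) * (h \<zeta> * (\<Prod>\<eta>\<in>E - {\<zeta>}. ?l \<eta> ^ m)))"
    proof (rule sum.cong[OF refl])
      fix \<zeta> assume z: "\<zeta> \<in> E"
      then have "insert e E - {\<zeta>} = insert e (E - {\<zeta>})" "\<zeta> \<noteq> e" using insert by auto
      then show "h' \<zeta> * (\<Prod>\<eta>\<in>insert e E - {\<zeta>}. ?l \<eta> ^ m) = (a * ?l e ^ m) * (h \<zeta> * (\<Prod>\<eta>\<in>E - {\<zeta>}. ?l \<eta> ^ m))"
        using insert by (simp add: h'_def mult_ac)
    qed
    also have "\<dots> = a * ?l e ^ m" unfolding sum_distrib_left[symmetric] h by simp
    finally show ?case using ab by (intro exI[of _ h']) (simp add: add.commute)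
  qed
  then show thesis using that by blast
qed

text \<open>Truncated expansion of \<open>1\<close>. With the full series the summand of
  \<open>\<zeta>\<close> is \<open>h \<zeta>\<close> times the \<open>m\<close>-th powers of the
  factors of the other points, which is the Bezout identity. The factor \<open>z ^ k\<close> is kept
  apart because it is later split.\<close>

definition approx_one :: "complex set \<Rightarrow> nat \<Rightarrow> (complex \<Rightarrow> complex poly) \<Rightarrow> nat \<Rightarrow> complex \<Rightarrow> complex"
  where "approx_one E m h n z = (\<Sum>\<zeta>\<in>E. \<Sum>k<n. (of_real (negbin m k) * cnj \<zeta> ^ k) *
    (z ^ k * (poly (h \<zeta>) z * (\<Prod>\<eta>\<in>E. 1 - cnj \<eta> * z) ^ m)))"

lemma approx_one_eq:
  "approx_one E m h n z = (\<Sum>\<zeta>\<in>E. poly (h \<zeta>) z * (\<Prod>\<eta>\<in>E. 1 - cnj \<eta> * z) ^ m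
    * (\<Sum>k<n. of_real (negbin m k) * (cnj \<zeta> * z) ^ k))"
  by (simp add: approx_one_def sum_distrib_left power_mult_distrib mult_ac)

lemma approx_one_tendsto:
  assumes E: "finite E" "E \<subseteq> sphere 0 1" and m: "1 \<le> m" and z: "norm z < 1"
    and h: "(\<Sum>\<zeta>\<in>E. h \<zeta> * (\<Prod>\<eta>\<in>E - {\<zeta>}. [:1, - cnj \<eta>:] ^ m)) = 1"
  shows "(\<lambda>n. approx_one E m h n z) \<longlonglongrightarrow> 1"
proof -
  let ?P = "\<Prod>\<eta>\<in>E. 1 - cnj \<eta> * z"
  have n: "norm (cnj \<zeta> * z) < 1" if "\<zeta> \<in> E" for \<zeta> using E that z by (auto simp: norm_mult)
  have "(\<lambda>n. approx_one E m h n z) \<longlonglongrightarrow> (\<Sum>\<zeta>\<in>E. poly (h \<zeta>) z * ?P ^ m * (1 / (1 - cnj \<zeta> * z) ^ m))"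
    unfolding approx_one_eq
    using negbin_sums[OF n m] by (intro tendsto_sum tendsto_mult tendsto_const) (simp add: sums_def)
  also have "(\<Sum>\<zeta>\<in>E. poly (h \<zeta>) z * ?P ^ m * (1 / (1 - cnj \<zeta> * z) ^ m))
    = (\<Sum>\<zeta>\<in>E. poly (h \<zeta> * (\<Prod>\<eta>\<in>E - {\<zeta>}. [:1, - cnj \<eta>:] ^ m)) z)"
  proof (rule sum.cong[OF refl])
    fix \<zeta> assume \<zeta>: "\<zeta> \<in> E"
    have nz: "1 - cnj \<zeta> * z \<noteq> 0" using n[OF \<zeta>] by auto
    have "?P = (1 - cnj \<zeta> * z) * (\<Prod>\<eta>\<in>E - {\<zeta>}. 1 - cnj \<eta> * z)" using \<zeta> E(1) by (simp add: prod.remove)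
    then show "poly (h \<zeta>) z * ?P ^ m * (1 / (1 - cnj \<zeta> * z) ^ m)
      = poly (h \<zeta> * (\<Prod>\<eta>\<in>E - {\<zeta>}. [:1, - cnj \<eta>:] ^ m)) z"
      using nz by (simp add: power_mult_distrib poly_prod prod_power_distrib mult.commute)
  qed
  also have "\<dots> = 1" unfolding poly_sum[symmetric] h by simp
  finally show ?thesis .
qed

text \<open>The hypothesis on the product holds along contours that approach \<open>E\<close>
  nontangentially. Its \<open>m\<close>-th power absorbs \<open>(1 - norm z)^(-m)\<close>, which
  dominates all partial sums of the series, so the bound is uniform in \<open>n\<close>.\<close>

lemma norm_approx_one_le:
  fixes H C :: real
  assumes E: "finite E" "E \<subseteq> sphere 0 1" and m: "1 \<le> m" and z: "norm z < 1"
    and H: "\<And>\<zeta>. \<zeta> \<in> E \<Longrightarrow> norm (poly (h \<zeta>) z) \<le> H"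
    and P: "norm (\<Prod>\<eta>\<in>E. 1 - cnj \<eta> * z) \<le> C * (1 - norm z)"
  shows "norm (approx_one E m h n z) \<le> card E * (H * C ^ m)"
proof -
  let ?P = "\<Prod>\<eta>\<in>E. 1 - cnj \<eta> * z"
  have "norm (poly (h \<zeta>) z * ?P ^ m * (\<Sum>k<n. of_real (negbin m k) * (cnj \<zeta> * z) ^ k)) \<le> H * C ^ m"
    if \<zeta>: "\<zeta> \<in> E" for \<zeta>
  proof -
    have "norm \<zeta> = 1" using E \<zeta> by auto
    then have "norm (\<Sum>k<n. of_real (negbin m k) * (cnj \<zeta> * z) ^ k) \<le> (\<Sum>k<n. negbin m k * norm z ^ k)"
      by (intro sum_norm_le) (simp add: norm_mult norm_power negbin_nonneg)
    also have "\<dots> \<le> 1 / (1 - norm z) ^ m" by (rule negbin_partial_sum_le) (use z m in auto)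
    finally have 1: "norm (\<Sum>k<n. of_real (negbin m k) * (cnj \<zeta> * z) ^ k) \<le> 1 / (1 - norm z) ^ m" .
    have H0: "0 \<le> H" using H[OF \<zeta>] norm_ge_zero order.trans by blast
    have 2: "norm ?P ^ m \<le> (C * (1 - norm z)) ^ m" by (rule power_mono[OF P]) simp
    have "norm (poly (h \<zeta>) z) * norm ?P ^ m * norm (\<Sum>k<n. of_real (negbin m k) * (cnj \<zeta> * z) ^ k)
      \<le> H * (C * (1 - norm z)) ^ m * (1 / (1 - norm z) ^ m)"
      using H0 order.trans[OF norm_ge_zero P] by (intro mult_mono 1 2 H \<zeta>) auto
    also have "\<dots> = H * C ^ m" using z by (simp add: power_mult_distrib)
    finally show ?thesis by (simp only: norm_mult norm_power)
  qed
  then have "norm (approx_one E m h n z) \<le> (\<Sum>\<zeta>\<in>E. H * C ^ m)"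
    unfolding approx_one_eq by (rule sum_norm_le)
  then show ?thesis by simp
qed

section \<open>Products over \<open>E\<close> and sectoriality of Ritt operators\<close>

lemma norm_one_minus_cnj: "norm \<zeta> = 1 \<Longrightarrow> norm (1 - cnj \<zeta> * z) = norm (\<zeta> - z)"
proof -
  assume n: "norm \<zeta> = 1"
  then have "\<zeta> * (1 - cnj \<zeta> * z) = \<zeta> - z"
    using complex_norm_square[of \<zeta>] by (simp add: algebra_simps)
  then show ?thesis using n by (metis mult_1 norm_mult)
qed

lemma norm_prod_one_minus_cnj:
  "E \<subseteq> sphere 0 1 \<Longrightarrow> norm (\<Prod>\<zeta>\<in>E. 1 - cnj \<zeta> * z) = dist_prod E z"
  unfolding dist_prod_def prod_norm[symmetric] by (intro prod.cong refl norm_one_minus_cnj) auto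

lemma norm_prod_diff: "norm (\<Prod>\<zeta>\<in>E. \<zeta> - z) = dist_prod E z"
  by (simp add: dist_prod_def prod_norm)

text \<open>Up to the unimodular factor \<open>\<zeta>\<close>, the operator
  \<open>\<tau> + (1 - cnj \<zeta> S)\<close> is \<open>z - S\<close> at
  \<open>z = (1 + \<tau>) \<zeta>\<close>. Since \<open>\<zeta>\<close> is the point of
  \<open>E\<close> nearest to \<open>z\<close>, the product in the Ritt condition is at least a
  multiple of \<open>\<tau>\<close>. Large \<open>\<tau>\<close> are handled by a Neumann type
  estimate.\<close>

lemma R_Ritt_sectorial:
  fixes S :: "'b::complex_banach \<Rightarrow>\<^sub>C\<^sub>L 'b"
  assumes rad: "rademacher_seq M \<epsilon>" and RS: "R_Ritt M \<epsilon> E S"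
    and E: "finite E" "E \<subseteq> sphere 0 1" and \<zeta>: "\<zeta> \<in> E"
  shows "\<exists>Ms. sectorial_bound (id_cblinfun - cnj \<zeta> *\<^sub>C S) Ms"
proof -
  define A where "A = id_cblinfun - cnj \<zeta> *\<^sub>C S"
  \<comment> \<open>For \<open>\<tau> \<ge> T0\<close> the norm of \<open>A\<close> is at most
    \<open>\<tau> / 2\<close>, so \<open>\<tau> * norm V' \<le> 1 + \<tau> / 2 * norm V'\<close>;
    this is the source of the constant \<open>2\<close>.\<close>
  define T0 where "T0 = 2 * norm A + 1"
  have \<zeta>1: "norm \<zeta> = 1" "\<zeta> * cnj \<zeta> = 1" "cnj \<zeta> * \<zeta> = 1"
    using E \<zeta> complex_norm_square[of \<zeta>] by (auto simp: mult.commute)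
  have "1 < T0 + 1" using norm_ge_zero[of A] unfolding T0_def by linarith
  then have "R_bounded M \<epsilon> {(\<Prod>\<zeta>\<in>E. 1 - cnj \<zeta> * z) *\<^sub>C resolvent z S | z. 1 < norm z \<and> norm z < T0 + 1}"
    using RS unfolding R_Ritt_def by blast
  from R_bounded_imp_bounded[OF rad this] obtain B where B: "0 < B"
    "\<And>z. 1 < norm z \<Longrightarrow> norm z < T0 + 1 \<Longrightarrow> norm ((\<Prod>\<zeta>\<in>E. 1 - cnj \<zeta> * z) *\<^sub>C resolvent z S) \<le> B"
    by blast
  obtain c where c: "0 < c" "\<And>z \<zeta>. \<zeta> \<in> E \<Longrightarrow> (\<And>\<eta>. \<eta> \<in> E \<Longrightarrow> norm (\<zeta> - z) \<le> norm (\<eta> - z))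
    \<Longrightarrow> c * norm (\<zeta> - z) \<le> dist_prod E z"
    by (rule dist_prod_ge_nearest[OF E(1)]) blast
  have "op_is_inverse (\<tau> *\<^sub>R id_cblinfun + A) (op_inverse (\<tau> *\<^sub>R id_cblinfun + A))
      \<and> \<tau> * norm (op_inverse (\<tau> *\<^sub>R id_cblinfun + A)) \<le> max 2 (B / c)" if \<tau>: "0 < \<tau>" for \<tau>
  proof -
    define z where "z = of_real (1 + \<tau>) * \<zeta>"
    have nz: "norm z = 1 + \<tau>" unfolding z_def norm_mult norm_of_real using \<tau> \<zeta>1 by simp
    then have "z \<notin> op_spectrum S" using RS \<tau> by (auto simp: R_Ritt_def)
    then have inv: "op_is_inverse (z *\<^sub>C id_cblinfun - S) (resolvent z S)" by (rule op_is_inverse_resolvent)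
    have "cnj \<zeta> * z = of_real (1 + \<tau>)" using \<zeta>1 by (simp add: z_def mult.left_commute)
    then have eq: "\<tau> *\<^sub>R id_cblinfun + A = cnj \<zeta> *\<^sub>C (z *\<^sub>C id_cblinfun - S)"
      by (intro cblinfun_eqI)
        (simp add: A_def cblinfun_simps scaleC_algebra scaleR_scaleC)
    have V: "op_is_inverse (\<tau> *\<^sub>R id_cblinfun + A) (\<zeta> *\<^sub>C resolvent z S)"
    proof -
      have "(c *\<^sub>C B) o\<^sub>C\<^sub>L (d *\<^sub>C D) = (c * d) *\<^sub>C (B o\<^sub>C\<^sub>L D)" for c d and B D :: "'b \<Rightarrow>\<^sub>C\<^sub>L 'b"
        by (intro cblinfun_eqI) (simp add: cblinfun_simps scaleC_scaleC mult.commute)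
      then show ?thesis using inv unfolding eq by (simp only: op_is_inverse_def \<zeta>1 scaleC_one)
    qed
    have Veq: "op_inverse (\<tau> *\<^sub>R id_cblinfun + A) = \<zeta> *\<^sub>C resolvent z S" by (rule op_inverse_eq[OF V])
    have nV: "norm (\<zeta> *\<^sub>C resolvent z S) = norm (resolvent z S)" by (simp add: norm_scaleC \<zeta>1)
    have "\<tau> * norm (resolvent z S) \<le> max 2 (B / c)"
    proof (cases "\<tau> < T0")
      case True
      have zt: "norm (\<zeta> - z) = \<tau>"
      proof -
        have "\<zeta> - z = of_real (- \<tau>) * \<zeta>" by (simp add: z_def algebra_simps)
        then show ?thesis using \<tau> \<zeta>1 by (simp only: norm_mult norm_of_real)
      qed
      have "norm (\<zeta> - z) \<le> norm (\<eta> - z)" if "\<eta> \<in> E" for \<eta>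
        using norm_triangle_ineq2[of z \<eta>] that E(2) nz zt by (auto simp: norm_minus_commute)
      then have "c * \<tau> \<le> dist_prod E z" using c(2)[OF \<zeta>, of z] zt by simp
      then have "c * \<tau> * norm (resolvent z S) \<le> dist_prod E z * norm (resolvent z S)"
        by (rule mult_right_mono) simp
      also have "\<dots> \<le> B" using B(2)[of z] nz True \<tau> by (simp add: norm_scaleC norm_prod_one_minus_cnj[OF E(2)])
      finally have "\<tau> * norm (resolvent z S) \<le> B / c" using c(1) by (simp add: field_simps)
      then show ?thesis by simp
    next
      case False
      define V' where "V' = \<zeta> *\<^sub>C resolvent z S"
      have "\<tau> *\<^sub>R V' = id_cblinfun - A o\<^sub>C\<^sub>L V'"
        using op_inverse_apply(2)[OF V] by (intro cblinfun_eqI) (simp add: cblinfun_simps V'_def algebra_simps)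
      then have "norm (\<tau> *\<^sub>R V') \<le> norm (id_cblinfun :: 'b \<Rightarrow>\<^sub>C\<^sub>L 'b) + norm (A o\<^sub>C\<^sub>L V')"
        using norm_triangle_ineq4[of "id_cblinfun :: 'b \<Rightarrow>\<^sub>C\<^sub>L 'b" "A o\<^sub>C\<^sub>L V'"] by (simp only:)
      also have "\<dots> \<le> 1 + norm A * norm V'" by (intro add_mono norm_id_cblinfun_le norm_cblinfun_compose)
      also have "\<dots> \<le> 1 + \<tau> / 2 * norm V'"
        using False by (intro add_left_mono mult_right_mono) (auto simp: T0_def)
      finally have "\<tau> * norm V' \<le> 2" using \<tau> by simp
      then show ?thesis by (simp add: V'_def nV)
    qed
    then show ?thesis using V by (simp add: Veq nV)
  qed
  then show ?thesis unfolding sectorial_bound_def A_def by blast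
qed

section \<open>Estimates of the pairing and passage to the limit\<close>

context nested_polygonal
begin

lemma regular_parameter:
  assumes "q \<le> u" "u \<le> s"
  obtains t where "t \<in> {0<..<1} - breaks u"
proof -
  interpret U: polygonal_boundary E u by (rule polygonal_boundary[OF assms])
  have "\<not> {0<..<1::real} \<subseteq> breaks u"
  proof
    assume "{0<..<1::real} \<subseteq> breaks u"
    then have "finite {0<..<1::real}" by (rule finite_subset[OF _ U.finite_breaks])
    then show False by (simp add: infinite_Ioo)
  qed
  then show thesis using that by blast
qed

lemma annulus_nonempty: "annulus \<noteq> {}"
proof -
  define u where "u = (q + s) / 2"
  have u: "q < u" "u < s" using q by (auto simp: u_def)
  have us: "q \<le> u" "u \<le> s" using u by auto
  obtain t where t: "t \<in> {0<..<1} - breaks u" by (rule regular_parameter[OF us])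
  show ?thesis using path_in_annulus[OF u t] by blast
qed

lemma admissible_dist_powr_le:
  assumes f: "f holomorphic_on polygonal E s" and B: "0 \<le> B" and g: "1 \<le> g"
    and le: "\<And>z. z \<in> polygonal E s \<Longrightarrow> norm (f z) \<le> B * dist_prod E z powr g"
  shows "admissible f"
proof -
  define b where "b = (2 ^ card E * 2 :: real) powr (g - 1)"
  have "norm (f z) \<le> B * b * dist_prod E z" if z: "z \<in> polygonal E s" for z
  proof -
    have dp: "0 < dist_prod E z" using dist_prod_pos[OF finite_E polygonal_not_E[OF z]] .
    have "dist_prod E z powr (g - 1) \<le> b"
      unfolding b_def using g dp dist_prod_le_2[OF z] by (intro powr_mono2) auto
    then have "dist_prod E z powr (g - 1) * dist_prod E z \<le> b * dist_prod E z"
      using dp by (intro mult_right_mono) auto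
    moreover have "dist_prod E z powr (g - 1) * dist_prod E z = dist_prod E z powr g"
      using dp by (simp add: powr_diff)
    ultimately have "dist_prod E z powr g \<le> b * dist_prod E z" by simp
    from mult_left_mono[OF this B] show ?thesis using le[OF z] by (simp add: mult.assoc)
  qed
  moreover have "0 \<le> B * b" using B by (simp add: b_def)
  ultimately show ?thesis using f unfolding admissible_def by blast
qed

end

lemma polys_bounded:
  assumes "finite E"
  obtains H where "0 \<le> H" "\<And>\<zeta> z. \<zeta> \<in> E \<Longrightarrow> norm z \<le> 1 \<Longrightarrow> norm (poly (h \<zeta>) z :: complex) \<le> (H::real)"
proof -
  have "compact (\<Union>\<zeta>\<in>E. poly (h \<zeta>) ` cball 0 1)"
    using assms by (intro compact_UN compact_continuous_image continuous_intros) auto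
  then obtain H where H: "\<And>w. w \<in> (\<Union>\<zeta>\<in>E. poly (h \<zeta>) ` cball 0 1) \<Longrightarrow> norm w \<le> H"
    using compact_imp_bounded bounded_iff by metis
  show thesis
  proof (rule that[of "max 0 H"])
    fix \<zeta> z assume "\<zeta> \<in> E" "norm (z::complex) \<le> 1"
    then have "poly (h \<zeta>) z \<in> (\<Union>\<zeta>\<in>E. poly (h \<zeta>) ` cball 0 1)" by (intro UN_I[of \<zeta>]) auto
    then show "norm (poly (h \<zeta>) z) \<le> max 0 H" using H by fastforce
  qed simp
qed

context op_calculus
begin

lemma admissible_zero: "admissible (\<lambda>_. 0)"
  unfolding admissible_def by (auto intro!: exI[of _ 0])

lemma admissible_add:
  assumes "admissible f" "admissible g"
  shows "admissible (\<lambda>z. f z + g z)"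
proof -
  obtain C where C: "0 \<le> C" "\<And>z. z \<in> polygonal E s \<Longrightarrow> norm (f z) \<le> C * dist_prod E z"
    using assms by (auto simp: admissible_def)
  obtain C' where C': "0 \<le> C'" "\<And>z. z \<in> polygonal E s \<Longrightarrow> norm (g z) \<le> C' * dist_prod E z"
    using assms by (auto simp: admissible_def)
  have "norm (f z + g z) \<le> (C + C') * dist_prod E z" if "z \<in> polygonal E s" for z
    using norm_triangle_ineq[of "f z" "g z"] C(2)[OF that] C'(2)[OF that] by (simp add: distrib_right)
  then show ?thesis
    using assms C(1) C'(1) unfolding admissible_def by (auto intro!: holomorphic_intros exI[of _ "C + C'"])
qed

lemma cpair_fun_sum:
  assumes u: "q < u" "u < s" and "finite I" "\<And>i. i \<in> I \<Longrightarrow> admissible (f i)"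
  shows "admissible (\<lambda>z. \<Sum>i\<in>I. f i z)"
    "cpair u (\<lambda>z. \<Sum>i\<in>I. f i z) x y = (\<Sum>i\<in>I. cpair u (f i) x y)"
proof -
  have "admissible (\<lambda>z. \<Sum>i\<in>I. f i z) \<and> cpair u (\<lambda>z. \<Sum>i\<in>I. f i z) x y = (\<Sum>i\<in>I. cpair u (f i) x y)"
    using assms(3,4)
  proof (induction I)
    case empty
    have "cpair u (\<lambda>_. 0) x y = 0" using cpair_cmult[of u 0 "\<lambda>_. 0"] by simp
    then show ?case by (simp add: admissible_zero)
  next
    case (insert i I)
    then show ?case by (simp add: admissible_add cpair_fun_add[OF u])
  qed
  then show "admissible (\<lambda>z. \<Sum>i\<in>I. f i z)"
    "cpair u (\<lambda>z. \<Sum>i\<in>I. f i z) x y = (\<Sum>i\<in>I. cpair u (f i) x y)" by auto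
qed

text \<open>One factor \<open>dist_prod\<close> of \<open>\<psi>\<close> is spent on the pairing
  with the resolvent, which is then at most \<open>S\<close>. The remaining power
  \<open>g - 1\<close> is integrated against \<open>norm z ^ n\<close> by
  \<open>boundary_power_bound\<close>. The constant \<open>K\<close> precedes \<open>x\<close> and
  \<open>y\<close>, so that \<open>S\<close> can later be taken along the orbits.\<close>

lemma cpair_weight_le:
  assumes u: "q < u" "u < s" and g: "1 \<le> (g::real)"
  obtains K where "0 < K"
    "\<And>n \<psi> B S x y. \<psi> holomorphic_on polygonal E s \<Longrightarrow> 0 \<le> B \<Longrightarrow> 0 \<le> S
      \<Longrightarrow> (\<And>z. z \<in> polygonal E s \<Longrightarrow> norm (\<psi> z) \<le> B * (norm z ^ n * dist_prod E z powr g))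
      \<Longrightarrow> (\<And>z. z \<in> annulus \<Longrightarrow> dist_prod E z * norm (y *\<^sub>V (resolvent z A *\<^sub>V x)) \<le> S)
      \<Longrightarrow> norm (cpair u \<psi> x y) \<le> K * (B * S * (real n + 1) powr - g)"
proof -
  interpret U: polygonal_boundary E u by (rule polygonal_boundary) (use u in auto)
  obtain C where C: "0 < C"
    "\<And>n::nat. \<exists>f. f integrable_on {0..1} \<and> integral {0..1} f \<le> C * (real n + 1) powr - g \<and>
      (\<forall>t\<in>{0..1}. norm (\<gamma> u t) ^ n * dist_prod E (\<gamma> u t) powr (g - 1) \<le> f t)"
    by (rule U.boundary_power_bound[OF g]) blast
  define L where "L = 4 * pi / u"
  have L: "0 < L" using u q by (simp add: L_def)
  show thesis
  proof (rule that[of "C * L"])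
    show "0 < C * L" using C L by simp
    fix n \<psi> B S and x :: 'b and y :: "'b \<Rightarrow>\<^sub>C\<^sub>L complex"
    assume \<psi>: "\<psi> holomorphic_on polygonal E s" and B: "0 \<le> B" and S: "0 \<le> S"
      and le: "\<And>z. z \<in> polygonal E s \<Longrightarrow> norm (\<psi> z) \<le> B * (norm z ^ n * dist_prod E z powr g)"
      and Sle: "\<And>z. z \<in> annulus \<Longrightarrow> dist_prod E z * norm (y *\<^sub>V (resolvent z A *\<^sub>V x)) \<le> S"
    obtain f where f: "f integrable_on {0..1}" "integral {0..1} f \<le> C * (real n + 1) powr - g"
      "\<And>t. t \<in> {0..1} \<Longrightarrow> norm (\<gamma> u t) ^ n * dist_prod E (\<gamma> u t) powr (g - 1) \<le> f t"
      using C(2)[of n] by blast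
    have f0: "0 \<le> f t" if "t \<in> {0..1}" for t
      by (rule order.trans[OF _ f(3)[OF that]]) simp
    let ?F = "\<lambda>z. \<psi> z * (y *\<^sub>V (resolvent z A *\<^sub>V x))"
    have Fle: "norm (?F z) \<le> B * S * (norm z ^ n * dist_prod E z powr (g - 1))" if z: "z \<in> annulus" for z
    proof -
      have zp: "z \<in> polygonal E s" using z annulus_subset by blast
      have d: "0 < dist_prod E z" using dist_prod_pos[OF finite_E polygonal_not_E[OF zp]] .
      have "norm (y *\<^sub>V (resolvent z A *\<^sub>V x)) \<le> S / dist_prod E z"
        using Sle[OF z] d by (simp add: pos_le_divide_eq mult.commute)
      then have "norm (?F z) \<le> (B * (norm z ^ n * dist_prod E z powr g)) * (S / dist_prod E z)"
        unfolding norm_mult using le[OF zp] B by (intro mult_mono) auto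
      also have "\<dots> = B * S * (norm z ^ n * (dist_prod E z powr g / dist_prod E z))" by simp
      also have "dist_prod E z powr g / dist_prod E z = dist_prod E z powr (g - 1)"
        using d by (simp add: powr_diff)
      finally show ?thesis .
    qed
    have Ft: "norm (?F (\<gamma> u t)) \<le> B * S * f t" if t: "t \<in> {0..1}" "cis (2 * pi * t) \<notin> E" for t
      using order.trans[OF Fle[OF boundary_in_annulus[OF u t(2)]] mult_left_mono[OF f(3)[OF t(1)], of "B * S"]] B S
      by simp
    have fI: "(\<lambda>t. B * S * f t) integrable_on {0..1}" using f(1) by (rule integrable_on_mult_right)
    have "(\<lambda>t. ?F (\<gamma> u t) * \<gamma>' u t) absolutely_integrable_on {0..1}"
      by (rule integrand_integrable[OF u holomorphic_on_imp_continuous_on[OF integrand_holomorphic[OF \<psi>]] fI Ft])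
    then have I: "(\<lambda>t. ?F (\<gamma> u t) * \<gamma>' u t) integrable_on {0..1}" by (rule set_lebesgue_integral_eq_integral(1))
    have "norm (cpair u \<psi> x y) \<le> integral {0..1} (\<lambda>t. (B * S * L) * f t)"
      unfolding cpair_def cint_def
    proof (rule Henstock_Kurzweil_Integration.integral_norm_bound_integral[OF I])
      show "(\<lambda>t. (B * S * L) * f t) integrable_on {0..1}" using f(1) by (rule integrable_on_mult_right)
      fix t :: real assume t: "t \<in> {0..1}"
      show "norm (?F (\<gamma> u t) * \<gamma>' u t) \<le> (B * S * L) * f t"
      proof (cases "t \<in> {0<..<1} - breaks u")
        case True
        have "cis (2 * pi * t) \<notin> E" by (rule breaks_cis[OF _ _ True]) (use u in auto)
        from Ft[OF t this] U.norm_path_deriv[of t]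
        have "norm (?F (\<gamma> u t)) * norm (\<gamma>' u t) \<le> (B * S * f t) * L"
          using B S f0[OF t] unfolding L_def by (intro mult_mono) auto
        then show ?thesis by (simp add: norm_mult mult_ac)
      next
        case False
        have "\<gamma>' u t = 0" by (rule path_deriv_outside[OF _ _ False]) (use u in auto)
        then show ?thesis using B S L f0[OF t] by simp
      qed
    qed
    also have "\<dots> = (B * S * L) * integral {0..1} f" by (rule integral_mult_right)
    also have "\<dots> \<le> (B * S * L) * (C * (real n + 1) powr - g)"
      using B S L by (intro mult_left_mono f(2)) auto
    finally show "norm (cpair u \<psi> x y) \<le> C * L * (B * S * (real n + 1) powr - g)" by (simp add: mult_ac)
  qed
qed

text \<open>If the operator-valued integrand is not integrable, the integral is \<open>0\<close> by convention.\<close>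

lemma fun_calc_pairing:
  assumes u: "q < u" "u < s"
  shows "fun_calc E u \<phi> A = 0 \<or>
    (\<forall>x y. y *\<^sub>V (fun_calc E u \<phi> A *\<^sub>V x) = 1 / (2 * pi * \<i>) * cpair u \<phi> x y)"
proof -
  have us: "q \<le> u" "u \<le> s" using u by auto
  interpret U: polygonal_boundary E u by (rule polygonal_boundary[OF us])
  let ?f = "\<lambda>t. vector_derivative (\<gamma> u) (at t within {0..1}) *\<^sub>C (\<phi> (\<gamma> u t) *\<^sub>C resolvent (\<gamma> u t) A)"
  have fc: "fun_calc E u \<phi> A = (1 / (2 * pi * \<i>)) *\<^sub>C integral {0..1} ?f"
    by (simp add: fun_calc_def op_contour_integral_def)
  show ?thesis
  proof (cases "?f integrable_on {0..1}")
    case False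
    then show ?thesis by (simp add: fc not_integrable_integral scaleC_zero_right)
  next
    case True
    have "y *\<^sub>V (integral {0..1} ?f *\<^sub>V x) = cpair u \<phi> x y" for x and y :: "'b \<Rightarrow>\<^sub>C\<^sub>L complex"
    proof -
      have bl: "bounded_linear (\<lambda>W::'b \<Rightarrow>\<^sub>C\<^sub>L 'b. y *\<^sub>V (W *\<^sub>V x))"
        by (rule bounded_linear_compose[OF bounded_linear_cblinfun_apply bounded_linear_cblinfun_apply_left])
      have "y *\<^sub>V (integral {0..1} ?f *\<^sub>V x) = integral {0..1} ((\<lambda>W. y *\<^sub>V (W *\<^sub>V x)) \<circ> ?f)"
        using integral_linear[OF True bl] by simp
      also have "\<dots> = integral {0..1} (\<lambda>t. \<phi> (\<gamma> u t) * (y *\<^sub>V (resolvent (\<gamma> u t) A *\<^sub>V x)) * \<gamma>' u t)"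
      proof (rule integral_spike[of "insert 0 (insert 1 (breaks u))"])
        show "negligible (insert 0 (insert 1 (breaks u)))"
          using U.finite_breaks by (intro negligible_finite) simp
        fix t :: real assume t: "t \<in> {0..1} - insert 0 (insert 1 (breaks u))"
        then have t': "t \<in> {0<..<1} - breaks u" by auto
        have "vector_derivative (\<gamma> u) (at t within {0..1}) = vector_derivative (\<gamma> u) (at t)"
          using t' by (simp add: at_within_Icc_at)
        also have "\<dots> = \<gamma>' u t" unfolding U.path_deriv_def using t' by (rule if_P[symmetric])
        finally have vd: "vector_derivative (\<gamma> u) (at t within {0..1}) = \<gamma>' u t" .
        show "\<phi> (\<gamma> u t) * (y *\<^sub>V (resolvent (\<gamma> u t) A *\<^sub>V x)) * \<gamma>' u t = ((\<lambda>W. y *\<^sub>V (W *\<^sub>V x)) \<circ> ?f) t"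
          unfolding o_def vd by (simp add: cblinfun_simps mult_ac)
      qed
      finally show ?thesis by (simp add: cpair_def cint_def)
    qed
    then show ?thesis unfolding fc by (simp add: cblinfun_simps)
  qed
qed

text \<open>At distance \<open>\<delta>\<close> from the nearest point of \<open>E\<close>,
  \<open>\<phi>\<close> is of order \<open>\<delta>^d\<close> for some \<open>d > 0\<close> and the
  resolvent of order \<open>1 / \<delta>\<close>. The integrand thus has the integrable majorant
  \<open>\<delta>^(d - 1)\<close>, even when \<open>\<phi>\<close> is not admissible.\<close>

lemma cpair_approx_tendsto:
  assumes u: "q < u" "u < s" and \<phi>: "\<phi> \<in> H0_inf E s"
    and p: "\<And>n. p n holomorphic_on polygonal E s"
    and p1: "\<And>z. z \<in> polygonal E s \<Longrightarrow> (\<lambda>n. p n z) \<longlonglongrightarrow> 1"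
    and pB: "\<And>n t. cis (2 * pi * t) \<notin> E \<Longrightarrow> norm (p n (\<gamma> u t)) \<le> B"
  shows "(\<lambda>n. cpair u (\<lambda>z. p n z * \<phi> z) x y) \<longlonglongrightarrow> cpair u \<phi> x y"
proof -
  have us: "q \<le> u" "u \<le> s" using u by auto
  interpret U: polygonal_boundary E u by (rule polygonal_boundary[OF us])
  obtain C e where \<phi>h: "\<phi> holomorphic_on polygonal E s" and C: "0 < C" and e: "\<And>\<zeta>. \<zeta> \<in> E \<Longrightarrow> 0 < e \<zeta>"
    and \<phi>le: "\<And>z. z \<in> polygonal E s \<Longrightarrow> norm (\<phi> z) \<le> C * (\<Prod>\<zeta>\<in>E. norm (\<zeta> - z) powr e \<zeta>)"
    using \<phi> unfolding H0_inf_def by blast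
  \<comment> \<open>A common order of vanishing at all points of \<open>E\<close>, capped by
    \<open>1\<close> because \<open>boundary_weight_bound\<close> is stated for exponents up to
    \<open>1\<close>.\<close>
  define d where "d = Min (insert 1 (e ` E))"
  have d: "0 < d" "d \<le> 1" "\<And>\<zeta>. \<zeta> \<in> E \<Longrightarrow> d \<le> e \<zeta>"
    using finite_E e by (auto simp: d_def)
  obtain c where c: "0 < c" "\<And>z \<zeta>. \<zeta> \<in> E \<Longrightarrow> (\<And>\<eta>. \<eta> \<in> E \<Longrightarrow> norm (\<zeta> - z) \<le> norm (\<eta> - z))
    \<Longrightarrow> c * norm (\<zeta> - z) \<le> dist_prod E z"
    by (rule dist_prod_ge_nearest[OF finite_E]) blast
  obtain f where f: "f integrable_on {0..1}" "\<And>t. 0 \<le> f t"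
    "\<And>t \<zeta>. t \<in> {0..1} \<Longrightarrow> \<zeta> \<in> E \<Longrightarrow> cis (2 * pi * t) \<noteq> \<zeta> \<Longrightarrow> norm (\<zeta> - \<gamma> u t) powr (d - 1) \<le> f t"
    by (rule U.boundary_weight_bound[OF d(1,2)]) blast
  define K where "K = C * (\<Prod>\<eta>\<in>E. 2 powr e \<eta>) * (M0 * norm x * norm y) / c"
  have K: "0 \<le> K" using C c M0 by (auto simp: K_def intro!: divide_nonneg_pos mult_nonneg_nonneg prod_nonneg)
  let ?F = "\<lambda>z. \<phi> z * (y *\<^sub>V (resolvent z A *\<^sub>V x))"
  have Ft: "norm (?F (\<gamma> u t)) \<le> K * f t" if t: "t \<in> {0..1}" "cis (2 * pi * t) \<notin> E" for t
  proof -
    let ?z = "\<gamma> u t"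
    have za: "?z \<in> annulus" by (rule boundary_in_annulus[OF u t(2)])
    then have zp: "?z \<in> polygonal E s" using annulus_subset by blast
    obtain \<zeta> where \<zeta>: "\<zeta> \<in> E" "\<And>\<eta>. \<eta> \<in> E \<Longrightarrow> norm (\<zeta> - ?z) \<le> norm (\<eta> - ?z)"
      by (rule U.nearest_point[of ?z]) blast
    define \<delta> where "\<delta> = norm (\<zeta> - ?z)"
    have "\<zeta> \<noteq> ?z" using polygonal_not_E[OF zp] \<zeta>(1) by auto
    then have \<delta>: "0 < \<delta>" by (simp add: \<delta>_def)
    have le2: "norm (\<eta> - ?z) \<le> 2" if "\<eta> \<in> E" for \<eta>
      using norm_triangle_ineq4[of \<eta> ?z] norm_polygonal[OF zp] U.norm_E[OF that] by simp
    have "(\<Prod>\<eta>\<in>E. norm (\<eta> - ?z) powr e \<eta>) \<le> (\<Prod>\<eta>\<in>E. 2 powr e \<eta>) * \<delta> powr d"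
    proof -
      have "(\<Prod>\<eta>\<in>E. norm (\<eta> - ?z) powr e \<eta>) = \<delta> powr e \<zeta> * (\<Prod>\<eta>\<in>E - {\<zeta>}. norm (\<eta> - ?z) powr e \<eta>)"
        unfolding \<delta>_def by (rule prod.remove[OF finite_E \<zeta>(1)])
      also have "\<dots> \<le> (2 powr e \<zeta> * \<delta> powr d) * (\<Prod>\<eta>\<in>E - {\<zeta>}. 2 powr e \<eta>)"
      proof (rule mult_mono)
        have "\<delta> powr e \<zeta> = \<delta> powr (e \<zeta> - d) * \<delta> powr d" by (simp flip: powr_add)
        also have "\<dots> \<le> 2 powr (e \<zeta> - d) * \<delta> powr d"
          using le2[OF \<zeta>(1)] d(3)[OF \<zeta>(1)] by (intro mult_right_mono powr_mono2) (auto simp: \<delta>_def)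
        also have "\<dots> \<le> 2 powr e \<zeta> * \<delta> powr d" using d by (intro mult_right_mono powr_mono) auto
        finally show "\<delta> powr e \<zeta> \<le> 2 powr e \<zeta> * \<delta> powr d" .
        show "(\<Prod>\<eta>\<in>E - {\<zeta>}. norm (\<eta> - ?z) powr e \<eta>) \<le> (\<Prod>\<eta>\<in>E - {\<zeta>}. 2 powr e \<eta>)"
          using le2 e less_imp_le by (intro prod_mono conjI powr_mono2) auto
      qed (auto intro!: prod_nonneg)
      also have "\<dots> = (2 powr e \<zeta> * (\<Prod>\<eta>\<in>E - {\<zeta>}. 2 powr e \<eta>)) * \<delta> powr d" by (simp only: mult_ac)
      also have "2 powr e \<zeta> * (\<Prod>\<eta>\<in>E - {\<zeta>}. 2 powr e \<eta>) = (\<Prod>\<eta>\<in>E. 2 powr e \<eta>)"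
        by (rule prod.remove[OF finite_E \<zeta>(1), symmetric])
      finally show ?thesis .
    qed
    then have 1: "norm (\<phi> ?z) \<le> C * ((\<Prod>\<eta>\<in>E. 2 powr e \<eta>) * \<delta> powr d)"
      using \<phi>le[OF zp] C by (meson less_imp_le mult_left_mono order.trans)
    have dp: "c * \<delta> \<le> dist_prod E ?z" unfolding \<delta>_def using c(2)[OF \<zeta>] .
    have dp0: "0 < dist_prod E ?z" using c(1) \<delta> dp by (meson less_le_trans mult_pos_pos)
    have "norm (y *\<^sub>V (resolvent ?z A *\<^sub>V x)) \<le> norm y * (norm (resolvent ?z A) * norm x)"
      by (intro order.trans[OF norm_cblinfun] mult_left_mono norm_cblinfun) auto
    also have "\<dots> \<le> norm y * (M0 / dist_prod E ?z * norm x)"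
      using resolvent_bound[OF za] dp0
      by (intro mult_left_mono mult_right_mono) (auto simp: pos_le_divide_eq mult.commute)
    also have "\<dots> \<le> norm y * (M0 / (c * \<delta>) * norm x)"
      using dp dp0 c(1) \<delta> M0 by (intro mult_left_mono mult_right_mono divide_left_mono mult_pos_pos) auto
    finally have 2: "norm (y *\<^sub>V (resolvent ?z A *\<^sub>V x)) \<le> norm y * (M0 / (c * \<delta>) * norm x)" .
    have "norm (?F ?z) \<le> (C * ((\<Prod>\<eta>\<in>E. 2 powr e \<eta>) * \<delta> powr d)) * (norm y * (M0 / (c * \<delta>) * norm x))"
      unfolding norm_mult using 1 2 C by (intro mult_mono) (auto intro!: mult_nonneg_nonneg prod_nonneg)
    also have "\<dots> = K * (\<delta> powr d / \<delta>)" using c(1) \<delta> by (simp add: K_def field_simps)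
    also have "\<delta> powr d / \<delta> = \<delta> powr (d - 1)" using \<delta> by (simp add: powr_diff)
    also have "K * \<delta> powr (d - 1) \<le> K * f t"
      using f(3)[OF t(1) \<zeta>(1)] t(2) \<zeta>(1) K unfolding \<delta>_def by (intro mult_left_mono) auto
    finally show ?thesis .
  qed
  have "0 \<le> B"
  proof -
    obtain t where "t \<in> {0<..<1} - breaks u" by (rule regular_parameter[OF us])
    from pB[OF breaks_cis[OF us this]] show ?thesis using norm_ge_zero order.trans by blast
  qed
  note B0 = this
  have pFt: "norm (p n (\<gamma> u t) * ?F (\<gamma> u t)) \<le> B * (K * f t)" if "t \<in> {0..1}" "cis (2 * pi * t) \<notin> E" for t n
    unfolding norm_mult[of "p n _"] by (intro mult_mono pB Ft that B0) simp
  have hI: "(\<lambda>t. B * (K * f t)) integrable_on {0..1}" by (intro integrable_on_mult_right f(1))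
  have Fh: "?F holomorphic_on annulus" by (rule integrand_holomorphic[OF \<phi>h])
  have "(\<lambda>n. integral {0..1} (\<lambda>t. p n (\<gamma> u t) * ?F (\<gamma> u t) * \<gamma>' u t))
    \<longlonglongrightarrow> integral {0..1} (\<lambda>t. ?F (\<gamma> u t) * \<gamma>' u t)"
  proof (rule dominated_convergence(2)[where h = "\<lambda>t. B * (K * f t) * (4 * pi / u)"])
    fix n
    have "continuous_on annulus (\<lambda>z. p n z * ?F z)"
      by (intro continuous_on_mult[OF _ holomorphic_on_imp_continuous_on[OF Fh]]
          continuous_on_subset[OF holomorphic_on_imp_continuous_on[OF p] annulus_subset])
    from integrand_integrable[OF u this hI pFt]
    show "(\<lambda>t. p n (\<gamma> u t) * ?F (\<gamma> u t) * \<gamma>' u t) integrable_on {0..1}"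
      by (rule set_lebesgue_integral_eq_integral(1))
  next
    show "(\<lambda>t. B * (K * f t) * (4 * pi / u)) integrable_on {0..1}"
      using hI by (rule integrable_on_mult_left)
  next
    fix n t assume t: "t \<in> {0..1::real}"
    show "norm (p n (\<gamma> u t) * ?F (\<gamma> u t) * \<gamma>' u t) \<le> B * (K * f t) * (4 * pi / u)"
    proof (cases "t \<in> {0<..<1} - breaks u")
      case True
      show ?thesis
        unfolding norm_mult[of "p n _ * _"]
        using B0 K f(2) by (intro mult_mono pFt[OF t breaks_cis[OF us True]] U.norm_path_deriv) auto
    next
      case False
      have "\<gamma>' u t = 0" by (rule path_deriv_outside[OF us False])
      then show ?thesis using B0 K f(2)[of t] u q by simp
    qed
  next
    fix t assume t: "t \<in> {0..1::real}"
    show "(\<lambda>n. p n (\<gamma> u t) * ?F (\<gamma> u t) * \<gamma>' u t) \<longlonglongrightarrow> ?F (\<gamma> u t) * \<gamma>' u t"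
    proof (cases "t \<in> {0<..<1} - breaks u")
      case True
      have "\<gamma> u t \<in> polygonal E s" using path_in_annulus[OF u True] annulus_subset by blast
      then have "(\<lambda>n. p n (\<gamma> u t) * ?F (\<gamma> u t) * \<gamma>' u t) \<longlonglongrightarrow> 1 * ?F (\<gamma> u t) * \<gamma>' u t"
        by (intro tendsto_mult tendsto_const p1)
      then show ?thesis by simp
    next
      case False
      have "\<gamma>' u t = 0" by (rule path_deriv_outside[OF us False])
      then show ?thesis by (simp only: mult_zero_right tendsto_const)
    qed
  qed
  then show ?thesis by (simp only: cpair_def cint_def mult.assoc)
qed

lemma cpair_independent:
  assumes u: "q < u" "u < s" and v: "q < v" "v < s" and \<psi>: "admissible \<psi>"
  shows "cpair u \<psi> x y = cpair v \<psi> x y"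
proof -
  obtain C where h: "\<psi> holomorphic_on polygonal E s"
    and C: "0 \<le> C" "\<And>z. z \<in> polygonal E s \<Longrightarrow> norm (\<psi> z) \<le> C * dist_prod E z"
    using \<psi> by (auto simp: admissible_def)
  have le: "norm (\<psi> z * (y *\<^sub>V (resolvent z A *\<^sub>V x))) \<le> C * M0 * norm y * norm x" if "z \<in> annulus" for z
    by (rule norm_integrand_le[OF C(1) C(2)]) (use annulus_subset that in auto)
  show ?thesis unfolding cpair_def by (rule cint_independent[OF u v integrand_holomorphic[OF h] le])
qed

text \<open>The factor \<open>P ^ m\<close> makes every term admissible for bounded
  \<open>\<phi>\<close>, so the finite sums can be taken out of the pairing.\<close>

lemma cpair_approx_expand:
  fixes h :: "complex \<Rightarrow> complex poly"
  assumes u: "q < u" "u < s" and m: "1 \<le> m" and \<phi>: "\<phi> holomorphic_on polygonal E s"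
    and \<Phi>: "\<And>z. z \<in> polygonal E s \<Longrightarrow> norm (\<phi> z) \<le> \<Phi>"
  shows "admissible (\<lambda>z. approx_one E m h n z * \<phi> z)"
    "cpair u (\<lambda>z. approx_one E m h n z * \<phi> z) x y = (\<Sum>\<zeta>\<in>E. \<Sum>k<n. (of_real (negbin m k) * cnj \<zeta> ^ k)
      * cpair u (\<lambda>z. z ^ k * (poly (h \<zeta>) z * (\<Prod>\<eta>\<in>E. 1 - cnj \<eta> * z) ^ m) * \<phi> z) x y)"
proof -
  let ?P = "\<lambda>z. \<Prod>\<eta>\<in>E. 1 - cnj \<eta> * z"
  let ?\<psi> = "\<lambda>\<zeta> k z. z ^ k * (poly (h \<zeta>) z * ?P z ^ m) * \<phi> z"
  let ?c = "\<lambda>\<zeta> k. of_real (negbin m k) * cnj \<zeta> ^ k"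
  obtain H where H: "0 \<le> H" "\<And>\<zeta> z. \<zeta> \<in> E \<Longrightarrow> norm z \<le> 1 \<Longrightarrow> norm (poly (h \<zeta>) z) \<le> H"
    by (rule polys_bounded[OF finite_E, of h]) blast
  have "0 \<in> polygonal E s" using ball_subset_polygonal[of s E] q by auto
  then have \<Phi>0: "0 \<le> \<Phi>" using \<Phi> norm_ge_zero order.trans by blast
  have a: "admissible (?\<psi> \<zeta> k)" if \<zeta>: "\<zeta> \<in> E" for \<zeta> k
  proof (rule admissible_dist_powr_le[where B = "H * \<Phi>" and g = "real m"])
    show "?\<psi> \<zeta> k holomorphic_on polygonal E s" by (intro holomorphic_intros \<phi>)
    fix z assume z: "z \<in> polygonal E s"
    have dp: "0 < dist_prod E z" using dist_prod_pos[OF finite_E polygonal_not_E[OF z]] .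
    have "norm (?\<psi> \<zeta> k z) = norm z ^ k * (norm (poly (h \<zeta>) z) * dist_prod E z ^ m) * norm (\<phi> z)"
      by (simp only: norm_mult norm_power norm_prod_one_minus_cnj[OF E_sphere])
    also have "\<dots> \<le> 1 * (H * dist_prod E z ^ m) * \<Phi>"
      using norm_polygonal[OF z] H \<zeta> \<Phi>0 dp
      by (intro mult_mono \<Phi>[OF z] power_le_one) (auto intro!: mult_nonneg_nonneg)
    also have "\<dots> = H * \<Phi> * dist_prod E z powr real m" using dp by (simp add: powr_realpow)
    finally show "norm (?\<psi> \<zeta> k z) \<le> H * \<Phi> * dist_prod E z powr real m" .
  qed (use H \<Phi>0 m in auto)
  have ac: "admissible (\<lambda>z. ?c \<zeta> k * ?\<psi> \<zeta> k z)" if "\<zeta> \<in> E" for \<zeta> k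
    by (rule admissible_mult[OF a[OF that], where B = "norm (?c \<zeta> k)"]) (auto intro!: holomorphic_intros)
  have eq: "(\<lambda>z. approx_one E m h n z * \<phi> z) = (\<lambda>z. \<Sum>\<zeta>\<in>E. \<Sum>k<n. ?c \<zeta> k * ?\<psi> \<zeta> k z)"
    by (rule ext) (simp only: approx_one_def sum_distrib_right mult.assoc)
  note i = cpair_fun_sum[OF u finite_lessThan ac]
  note o' = cpair_fun_sum[OF u finite_E i(1)]
  show "admissible (\<lambda>z. approx_one E m h n z * \<phi> z)" unfolding eq by (rule o'(1))
  show "cpair u (\<lambda>z. approx_one E m h n z * \<phi> z) x y = (\<Sum>\<zeta>\<in>E. \<Sum>k<n. ?c \<zeta> k * cpair u (?\<psi> \<zeta> k) x y)"
    unfolding eq by (simp only: o'(2) i(2) cpair_cmult cong: sum.cong)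
qed

text \<open>The truncated functions are admissible, so their pairings do not depend on the contour
  and a bound on the contour \<open>v\<close> holds on \<open>u\<close> as well; the limit is then
  taken on \<open>u\<close>. The number \<open>N\<close> allows for a bound along a subsequence of
  truncations.\<close>

lemma norm_fun_calc_le:
  fixes h :: "complex \<Rightarrow> complex poly"
  assumes u: "q < u" "u < s" and v: "q < v" "v < s" and \<phi>: "\<phi> \<in> H0_inf E s" and m: "1 \<le> m"
    and h: "(\<Sum>\<zeta>\<in>E. h \<zeta> * (\<Prod>\<eta>\<in>E - {\<zeta>}. [:1, - cnj \<eta>:] ^ m)) = 1"
    and N: "0 < (N::nat)" and B: "0 \<le> B"
    and le: "\<And>n x y. norm (cpair v (\<lambda>z. approx_one E m h (N * n) z * \<phi> z) x y) \<le> B * norm x * norm y"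
  shows "norm (fun_calc E u \<phi> A) \<le> B"
proof -
  interpret U: polygonal_boundary E u by (rule polygonal_boundary) (use u in auto)
  have \<phi>h: "\<phi> holomorphic_on polygonal E s" and "bounded (\<phi> ` polygonal E s)"
    using \<phi> by (auto simp: H0_inf_def)
  then obtain \<Phi> where \<Phi>: "\<And>z. z \<in> polygonal E s \<Longrightarrow> norm (\<phi> z) \<le> \<Phi>" by (auto simp: bounded_iff)
  obtain H where H: "0 \<le> H" "\<And>\<zeta> z. \<zeta> \<in> E \<Longrightarrow> norm z \<le> 1 \<Longrightarrow> norm (poly (h \<zeta>) z) \<le> H"
    by (rule polys_bounded[OF finite_E, of h]) blast
  obtain k where k: "0 < k" "\<And>w. norm w = 1 \<Longrightarrow> k * infdist w E \<le> 1 - radial E u w"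
    using U.one_minus_radial_ge by blast
  \<comment> \<open>The nontangential constant: \<open>dist_prod\<close> is at most
    \<open>2 ^ card E\<close> times the distance to the point of \<open>E\<close> nearest to the
    direction of \<open>\<gamma> u t\<close>, and that distance is at most
    \<open>(1 + 1 / u) / k\<close> times \<open>1 - norm (\<gamma> u t)\<close>.\<close>
  define D where "D = 2 ^ card E * ((1 + 1 / u) / k)"
  have pB: "norm (approx_one E m h (N * n) (\<gamma> u t)) \<le> card E * (H * D ^ m)"
    if t: "cis (2 * pi * t) \<notin> E" for n t
  proof (rule norm_approx_one_le[OF finite_E E_sphere m])
    have z: "\<gamma> u t \<in> polygonal E s" using boundary_in_annulus[OF u t] annulus_subset by blast
    then show "norm (\<gamma> u t) < 1" by (rule norm_polygonal)
    then show "norm (poly (h \<zeta>) (\<gamma> u t)) \<le> H" if "\<zeta> \<in> E" for \<zeta> using H(2)[OF that] by simp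
    obtain \<zeta> where \<zeta>: "\<zeta> \<in> E" "infdist (cis (2 * pi * t)) E = norm (\<zeta> - cis (2 * pi * t))"
      by (rule U.nearest_point) blast
    have "dist_prod E (\<gamma> u t) \<le> 2 ^ card E * norm (\<zeta> - \<gamma> u t)"
      by (rule dist_prod_le[OF finite_E E_sphere _ \<zeta>(1)]) (use norm_polygonal[OF z] in auto)
    also have "\<dots> \<le> 2 ^ card E * ((1 + 1 / u) * norm (\<zeta> - cis (2 * pi * t)))"
      by (intro mult_left_mono U.dist_boundary_path_le \<zeta>) auto
    also have "norm (\<zeta> - cis (2 * pi * t)) \<le> (1 - norm (\<gamma> u t)) / k"
      using k(2)[of "cis (2 * pi * t)"] k(1) \<zeta>(2) by (simp add: U.norm_boundary_path field_simps)
    finally show "norm (\<Prod>\<eta>\<in>E. 1 - cnj \<eta> * \<gamma> u t) \<le> D * (1 - norm (\<gamma> u t))"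
      using u q by (simp add: norm_prod_one_minus_cnj[OF E_sphere] D_def mult_left_mono)
  qed
  have p1: "(\<lambda>n. approx_one E m h (N * n) z) \<longlonglongrightarrow> 1" if "z \<in> polygonal E s" for z
  proof -
    have "strict_mono (\<lambda>n. N * n)" using N by (simp add: strict_mono_def)
    from LIMSEQ_subseq_LIMSEQ[OF approx_one_tendsto[OF finite_E E_sphere m norm_polygonal[OF that] h] this]
    show ?thesis by (simp add: o_def)
  qed
  have ph: "approx_one E m h (N * n) holomorphic_on polygonal E s" for n
    unfolding approx_one_def[abs_def] by (intro holomorphic_intros)
  have le': "norm (cpair u \<phi> x y) \<le> B * norm x * norm y" for x y
  proof (rule Lim_bounded[OF tendsto_norm])
    show "(\<lambda>n. cpair u (\<lambda>z. approx_one E m h (N * n) z * \<phi> z) x y) \<longlonglongrightarrow> cpair u \<phi> x y"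
      by (rule cpair_approx_tendsto[OF u \<phi> ph p1 pB])
    show "\<forall>n\<ge>0. norm (cpair u (\<lambda>z. approx_one E m h (N * n) z * \<phi> z) x y) \<le> B * norm x * norm y"
      using le cpair_independent[OF u v cpair_approx_expand(1)[OF u m \<phi>h \<Phi>]] by simp
  qed
  show ?thesis
  proof (cases "fun_calc E u \<phi> A = 0")
    case True
    then show ?thesis using B by simp
  next
    case False
    show ?thesis
    proof (rule norm_cblinfun_le_pairing[OF B])
      fix x :: 'b and y :: "'b \<Rightarrow>\<^sub>C\<^sub>L complex"
      have "norm (y *\<^sub>V (fun_calc E u \<phi> A *\<^sub>V x)) = norm (cpair u \<phi> x y) / (2 * pi)"
        using fun_calc_pairing[OF u, of \<phi>] False by (simp add: norm_mult norm_divide)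
      also have "\<dots> \<le> norm (cpair u \<phi> x y)"
        using pi_gt3 by (simp add: divide_le_eq mult_le_cancel_left1)
      also have "\<dots> \<le> B * norm x * norm y" by (rule le')
      finally show "norm (y *\<^sub>V (fun_calc E u \<phi> A *\<^sub>V x)) \<le> B * norm x * norm y" .
    qed
  qed
qed

end

section \<open>From square functions to the functional calculus\<close>

lemma sum_by_three:
  fixes n :: nat
  shows "(\<Sum>k<3 * n. f k) = (\<Sum>a<n. f (3 * a) + f (3 * a + 1) + (f (3 * a + 2) :: real))"
  by (induction n) (simp_all add: numeral_3_eq_3 eval_nat_numeral)

text \<open>The square function hypotheses enter as bounds on all partial sums, and R-boundedness
  enters with a separate point of the annulus for each index. The contour \<open>u\<close> is fixed
  for the whole estimate.\<close>

locale square_setup =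
  T: op_calculus E q s T M0 + D: op_calculus E q s "banach_adjoint T" M0
  for E q s and T :: "'a::complex_banach \<Rightarrow>\<^sub>C\<^sub>L 'a" and M0 +
  fixes M :: "'w measure" and \<epsilon> :: "nat \<Rightarrow> 'w \<Rightarrow> real" and \<xi> :: "complex list"
    and \<alpha> \<beta> C CR u :: real
  assumes rad: "rademacher_seq M \<epsilon>" and set_\<xi>: "set \<xi> = E" and dist_\<xi>: "distinct \<xi>"
    and \<alpha>: "0 < \<alpha>" and \<beta>: "0 < \<beta>" and C: "0 \<le> C" and CR: "0 \<le> CR" and u: "q < u" "u < s"
    and sec_T: "\<zeta> \<in> E \<Longrightarrow> \<exists>Ms. sectorial_bound (id_cblinfun - cnj \<zeta> *\<^sub>C T) Ms"
    and sec_D: "\<zeta> \<in> E \<Longrightarrow> \<exists>Ms. sectorial_bound (id_cblinfun - cnj \<zeta> *\<^sub>C banach_adjoint T) Ms"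
    and square_T: "rad_norm M \<epsilon> n (\<lambda>k. real k powr (\<alpha> - 1/2) *\<^sub>R
      ((op_power T (k - 1) o\<^sub>C\<^sub>L frac_product \<xi> \<alpha> T) *\<^sub>V x)) \<le> C * norm x"
    and square_D: "rad_norm M \<epsilon> n (\<lambda>k. real k powr (\<beta> - 1/2) *\<^sub>R
      ((op_power (banach_adjoint T) (k - 1) o\<^sub>C\<^sub>L frac_product \<xi> \<beta> (banach_adjoint T)) *\<^sub>V y)) \<le> C * norm y"
    and R_bound: "(\<And>k. k \<in> {1..n} \<Longrightarrow> z k \<in> T.annulus) \<Longrightarrow>
      rad_norm M \<epsilon> n (\<lambda>k. ((\<Prod>\<zeta>\<in>E. \<zeta> - z k) *\<^sub>C resolvent (z k) T) *\<^sub>V x' k) \<le> CR * rad_norm M \<epsilon> n x'"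
begin

text \<open>The transpose involves no conjugation, so the resolvent of the adjoint at the same
  \<open>z\<close> is the transpose of the resolvent. Multipliers can therefore be moved to
  \<open>y\<close> by the calculus of the adjoint.\<close>

lemma cpair_adjoint: "T.cpair u \<psi> x y = D.cpair u \<psi> y (eval_functional x)"
  unfolding T.cpair_def D.cpair_def
  by (rule T.cint_cong[OF u]) (simp add: resolvent_adjoint(2)[OF T.not_spectrum])

lemma cpair_represents_both:
  assumes g: "T.represents u g W" and g': "D.represents u g' V" and \<psi>: "T.admissible \<psi>"
  shows "T.cpair u (\<lambda>z. g z * (g' z * \<psi> z)) x y = T.cpair u \<psi> (W *\<^sub>V x) (V *\<^sub>V y)"
proof -
  have "T.cpair u (\<lambda>z. g z * (g' z * \<psi> z)) x y = T.cpair u (\<lambda>z. g' z * \<psi> z) (W *\<^sub>V x) y"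
    by (rule T.representsD(2)[OF g D.representsD(1)[OF g' \<psi>]])
  also have "\<dots> = T.cpair u \<psi> (W *\<^sub>V x) (V *\<^sub>V y)"
    unfolding cpair_adjoint by (rule D.representsD(2)[OF g' \<psi>])
  finally show ?thesis .
qed

text \<open>A term of the square function with the index shifted to \<open>a = k - 1\<close>, which
  turns the weight \<open>k powr (\<alpha> - 1/2)\<close> into one in \<open>a + 1\<close>.\<close>

definition orbit_T :: "nat \<Rightarrow> 'a \<Rightarrow> 'a"
  where "orbit_T a x = (real a + 1) powr (\<alpha> - 1/2) *\<^sub>R ((op_power T a o\<^sub>C\<^sub>L frac_product \<xi> \<alpha> T) *\<^sub>V x)"

definition orbit_D :: "nat \<Rightarrow> ('a \<Rightarrow>\<^sub>C\<^sub>L complex) \<Rightarrow> 'a \<Rightarrow>\<^sub>C\<^sub>L complex"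
  where "orbit_D a y = (real a + 1) powr (\<beta> - 1/2) *\<^sub>R
    ((op_power (banach_adjoint T) a o\<^sub>C\<^sub>L frac_product \<xi> \<beta> (banach_adjoint T)) *\<^sub>V y)"

definition weight :: "nat \<Rightarrow> 'a \<Rightarrow> ('a \<Rightarrow>\<^sub>C\<^sub>L complex) \<Rightarrow> complex \<Rightarrow> real"
  where "weight a x y z = dist_prod E z * norm (orbit_D a y *\<^sub>V (resolvent z T *\<^sub>V orbit_T a x))"

lemma weight_le: "z \<in> T.annulus \<Longrightarrow> weight a x y z \<le> norm (orbit_D a y) * (M0 * norm (orbit_T a x))"
proof -
  assume z: "z \<in> T.annulus"
  have "weight a x y z \<le> dist_prod E z * (norm (orbit_D a y) * (norm (resolvent z T) * norm (orbit_T a x)))"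
    unfolding weight_def by (intro mult_left_mono order.trans[OF norm_cblinfun] norm_cblinfun dist_prod_nonneg) auto
  also have "\<dots> = norm (orbit_D a y) * ((dist_prod E z * norm (resolvent z T)) * norm (orbit_T a x))"
    by (simp only: mult_ac)
  also have "\<dots> \<le> norm (orbit_D a y) * (M0 * norm (orbit_T a x))"
    by (intro mult_left_mono mult_right_mono T.resolvent_bound z) auto
  finally show ?thesis .
qed

lemma bdd_above_weight: "bdd_above (weight a x y ` T.annulus)"
  by (rule bdd_aboveI2[OF weight_le])

lemma weight_SUP_nonneg: "0 \<le> (SUP z\<in>T.annulus. weight a x y z)"
proof -
  obtain z where z: "z \<in> T.annulus" using T.annulus_nonempty by blast
  have "0 \<le> weight a x y z" by (simp add: weight_def dist_prod_nonneg)
  also have "\<dots> \<le> (SUP z\<in>T.annulus. weight a x y z)" by (rule cSUP_upper[OF z bdd_above_weight])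
  finally show ?thesis .
qed

text \<open>For arbitrary points in place of the suprema, Rademacher duality bounds the sum,
  R-boundedness removes the weighted resolvents, and the two square functions remain.\<close>

lemma sum_weight_SUP_le:
  "(\<Sum>a<n. SUP z\<in>T.annulus. weight a x y z) \<le> 2 * (CR * (C * norm x) * (C * norm y))"
proof (rule sum_SUP_le[OF finite_lessThan T.annulus_nonempty bdd_above_weight])
  fix z assume z: "\<And>i. i \<in> {..<n} \<Longrightarrow> z i \<in> T.annulus"
  define S where "S k = (\<Prod>\<zeta>\<in>E. \<zeta> - z (k - 1)) *\<^sub>C resolvent (z (k - 1)) T" for k
  have rT: "rad_norm M \<epsilon> n (\<lambda>k. orbit_T (k - 1) x) \<le> C * norm x"
  proof -
    have "rad_norm M \<epsilon> n (\<lambda>k. orbit_T (k - 1) x) = rad_norm M \<epsilon> n (\<lambda>k. real k powr (\<alpha> - 1/2) *\<^sub>R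
      ((op_power T (k - 1) o\<^sub>C\<^sub>L frac_product \<xi> \<alpha> T) *\<^sub>V x))"
      by (rule rad_norm_cong[OF rad]) (auto simp: orbit_T_def)
    then show ?thesis using square_T by simp
  qed
  have rD: "rad_norm M \<epsilon> n (\<lambda>k. orbit_D (k - 1) y) \<le> C * norm y"
  proof -
    have "rad_norm M \<epsilon> n (\<lambda>k. orbit_D (k - 1) y) = rad_norm M \<epsilon> n (\<lambda>k. real k powr (\<beta> - 1/2) *\<^sub>R
      ((op_power (banach_adjoint T) (k - 1) o\<^sub>C\<^sub>L frac_product \<xi> \<beta> (banach_adjoint T)) *\<^sub>V y))"
      by (rule rad_norm_cong[OF rad]) (auto simp: orbit_D_def)
    then show ?thesis using square_D by simp
  qed
  have "(\<Sum>a<n. weight a x y (z a))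
    = (\<Sum>k=1..n. norm (orbit_D (k - 1) y *\<^sub>V (S k *\<^sub>V orbit_T (k - 1) x)))"
    unfolding One_nat_def sum.atLeast1_atMost_eq
    by (intro sum.cong refl)
      (simp add: weight_def S_def cblinfun_simps norm_mult norm_prod_diff)
  also have "\<dots> \<le> 2 * (rad_norm M \<epsilon> n (\<lambda>k. S k *\<^sub>V orbit_T (k - 1) x) * rad_norm M \<epsilon> n (\<lambda>k. orbit_D (k - 1) y))"
    by (rule sum_norm_pairing_le[OF rad])
  also have "\<dots> \<le> 2 * (CR * (C * norm x) * (C * norm y))"
  proof (intro mult_left_mono mult_mono rD)
    have "rad_norm M \<epsilon> n (\<lambda>k. S k *\<^sub>V orbit_T (k - 1) x) \<le> CR * rad_norm M \<epsilon> n (\<lambda>k. orbit_T (k - 1) x)"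
      unfolding S_def by (rule R_bound) (use z in auto)
    also have "\<dots> \<le> CR * (C * norm x)" by (rule mult_left_mono[OF rT CR])
    finally show "rad_norm M \<epsilon> n (\<lambda>k. S k *\<^sub>V orbit_T (k - 1) x) \<le> CR * (C * norm x)" .
  qed (use C CR rad_norm_nonneg[OF rad] in auto)
  finally show "(\<Sum>a<n. weight a x y (z a)) \<le> 2 * (CR * (C * norm x) * (C * norm y))" .
qed

definition frac_weight :: "real \<Rightarrow> complex \<Rightarrow> complex"
  where "frac_weight \<gamma> z = (\<Prod>\<zeta>\<leftarrow>\<xi>. scalar_pow \<gamma> (1 - cnj \<zeta> * z))"

lemma frac_weight_eq: "frac_weight \<gamma> z = (\<Prod>\<zeta>\<in>E. scalar_pow \<gamma> (1 - cnj \<zeta> * z))"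
  by (simp add: frac_weight_def prod.distinct_set_conv_list[OF dist_\<xi>, symmetric] set_\<xi>)

lemma frac_weight_holomorphic:
  assumes "0 < \<gamma>"
  shows "frac_weight \<gamma> holomorphic_on polygonal E s"
proof -
  have "(\<lambda>z. scalar_pow \<gamma> (1 - cnj \<zeta> * z)) holomorphic_on polygonal E s" if "\<zeta> \<in> E" for \<zeta>
  proof -
    have "(\<lambda>z. 1 - cnj \<zeta> * z) ` polygonal E s \<subseteq> {a. 0 < Re a}"
      using T.Re_one_minus_pos(1)[OF that] by blast
    then have "(scalar_pow \<gamma> \<circ> (\<lambda>z. 1 - cnj \<zeta> * z)) holomorphic_on polygonal E s"
      by (intro holomorphic_on_compose_gen[OF _ scalar_pow_holomorphic[OF assms]] holomorphic_intros)
    then show ?thesis by (simp only: o_def)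
  qed
  then show ?thesis unfolding frac_weight_eq[abs_def] by (intro holomorphic_on_prod) auto
qed

lemma frac_weight_ge:
  assumes \<gamma>: "0 < \<gamma>"
  obtains k where "0 < k" "\<And>z. z \<in> polygonal E s \<Longrightarrow> k * dist_prod E z powr \<gamma> \<le> norm (frac_weight \<gamma> z)"
proof -
  obtain k where k: "0 < k" "\<And>a. 0 < Re a \<Longrightarrow> k * norm a powr \<gamma> \<le> norm (scalar_pow \<gamma> a)"
    by (rule scalar_pow_bounds[OF \<gamma>]) blast
  show thesis
  proof (rule that[of "k ^ card E"])
    fix z assume z: "z \<in> polygonal E s"
    have "k ^ card E * dist_prod E z powr \<gamma> = (\<Prod>\<zeta>\<in>E. k * norm (\<zeta> - z) powr \<gamma>)"
      by (simp add: dist_prod_def prod_powr_distrib prod.distrib)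
    also have "\<dots> \<le> (\<Prod>\<zeta>\<in>E. norm (scalar_pow \<gamma> (1 - cnj \<zeta> * z)))"
    proof (rule prod_mono)
      fix \<zeta> assume \<zeta>: "\<zeta> \<in> E"
      show "0 \<le> k * norm (\<zeta> - z) powr \<gamma> \<and> k * norm (\<zeta> - z) powr \<gamma> \<le> norm (scalar_pow \<gamma> (1 - cnj \<zeta> * z))"
        using k(1) k(2)[OF T.Re_one_minus_pos(1)[OF \<zeta> z]] norm_one_minus_cnj[of \<zeta> z] T.S.norm_E[OF \<zeta>] by simp
    qed
    finally show "k ^ card E * dist_prod E z powr \<gamma> \<le> norm (frac_weight \<gamma> z)"
      by (simp add: frac_weight_eq prod_norm)
  qed (use k in simp)
qed

text \<open>Truncating at multiples of \<open>3\<close> lets the powers be grouped into the blocks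
  \<open>3 a\<close>, \<open>3 a + 1\<close>, \<open>3 a + 2\<close>, which share the orbit index
  \<open>a\<close>. The quantities \<open>m\<close>, \<open>h\<close> and \<open>K\<close> are fixed
  before \<open>\<phi>\<close> and \<open>n\<close>.\<close>

lemma cpair_approx_bound:
  obtains m h K where "1 \<le> m" "(\<Sum>\<zeta>\<in>E. h \<zeta> * (\<Prod>\<eta>\<in>E - {\<zeta>}. [:1, - cnj \<eta>:] ^ m)) = 1" "0 \<le> K"
    "\<And>\<phi> \<Phi> x y n. \<phi> holomorphic_on polygonal E s \<Longrightarrow> (\<And>z. z \<in> polygonal E s \<Longrightarrow> norm (\<phi> z) \<le> \<Phi>)
      \<Longrightarrow> norm (T.cpair u (\<lambda>z. approx_one E m h (3 * n) z * \<phi> z) x y) \<le> K * \<Phi> * norm x * norm y"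
proof -
  \<comment> \<open>This choice gives \<open>g \<ge> 1\<close>: after removal of both fractional
    products a full factor of order \<open>P\<close> is left for the resolvent.\<close>
  define m where "m = nat \<lceil>\<alpha> + \<beta>\<rceil> + 1"
  define g where "g = real m - (\<alpha> + \<beta>)"
  have m: "1 \<le> m" and g: "1 \<le> g"
    using real_nat_ceiling_ge[of "\<alpha> + \<beta>"] by (auto simp: m_def g_def)
  obtain h where h: "(\<Sum>\<zeta>\<in>E. h \<zeta> * (\<Prod>\<eta>\<in>E - {\<zeta>}. [:1, - cnj \<eta>:] ^ m)) = 1"
    by (rule bezout_partition[OF T.finite_E T.E_nonempty])
  obtain H where H: "0 \<le> H" "\<And>\<zeta> z. \<zeta> \<in> E \<Longrightarrow> norm z \<le> 1 \<Longrightarrow> norm (poly (h \<zeta>) z) \<le> H"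
    by (rule polys_bounded[OF T.finite_E, of h]) blast
  obtain ka where ka: "0 < ka" "\<And>z. z \<in> polygonal E s \<Longrightarrow> ka * dist_prod E z powr \<alpha> \<le> norm (frac_weight \<alpha> z)"
    by (rule frac_weight_ge[OF \<alpha>]) blast
  obtain kb where kb: "0 < kb" "\<And>z. z \<in> polygonal E s \<Longrightarrow> kb * dist_prod E z powr \<beta> \<le> norm (frac_weight \<beta> z)"
    by (rule frac_weight_ge[OF \<beta>]) blast
  obtain K0 where K0: "0 < K0"
    "\<And>n \<psi> B S x y. \<psi> holomorphic_on polygonal E s \<Longrightarrow> 0 \<le> B \<Longrightarrow> 0 \<le> S
      \<Longrightarrow> (\<And>z. z \<in> polygonal E s \<Longrightarrow> norm (\<psi> z) \<le> B * (norm z ^ n * dist_prod E z powr g))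
      \<Longrightarrow> (\<And>z. z \<in> T.annulus \<Longrightarrow> dist_prod E z * norm (y *\<^sub>V (resolvent z T *\<^sub>V x)) \<le> S)
      \<Longrightarrow> norm (T.cpair u \<psi> x y) \<le> K0 * (B * S * (real n + 1) powr - g)"
    by (rule T.cpair_weight_le[OF u g]) blast
  define P where "P z = (\<Prod>\<eta>\<in>E. 1 - cnj \<eta> * z)" for z
  \<comment> \<open>The lower bounds of \<open>frac_weight\<close> make the quotient holomorphic and
    of order \<open>dist_prod powr g\<close>.\<close>
  define G where "G z = P z ^ m / (frac_weight \<alpha> z * frac_weight \<beta> z)" for z
  have dp: "0 < dist_prod E z" if "z \<in> polygonal E s" for z
    using dist_prod_pos[OF T.finite_E T.polygonal_not_E[OF that]] .
  have nz: "frac_weight \<alpha> z \<noteq> 0" "frac_weight \<beta> z \<noteq> 0" if z: "z \<in> polygonal E s" for z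
    using ka(1) ka(2)[OF z] kb(1) kb(2)[OF z] dp[OF z]
    by (auto simp: mult_le_0_iff powr_nonneg_iff)
  have Gh: "G holomorphic_on polygonal E s"
    unfolding G_def[abs_def] P_def by (intro holomorphic_intros frac_weight_holomorphic \<alpha> \<beta>) (use nz in auto)
  have Gle: "norm (G z) \<le> 1 / (ka * kb) * dist_prod E z powr g" if z: "z \<in> polygonal E s" for z
  proof -
    have "norm (G z) = dist_prod E z powr real m / (norm (frac_weight \<alpha> z) * norm (frac_weight \<beta> z))"
      unfolding G_def P_def norm_divide norm_mult norm_power norm_prod_one_minus_cnj[OF T.E_sphere]
      using dp[OF z] by (simp add: powr_realpow)
    also have "\<dots> \<le> dist_prod E z powr real m / ((ka * dist_prod E z powr \<alpha>) * (kb * dist_prod E z powr \<beta>))"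
      using ka(1) ka(2)[OF z] kb(1) kb(2)[OF z] dp[OF z] nz[OF z]
      by (intro divide_left_mono mult_mono mult_pos_pos) auto
    also have "\<dots> = 1 / (ka * kb) * dist_prod E z powr g"
      by (simp add: g_def powr_diff powr_add mult_ac)
    finally show ?thesis .
  qed
  define L where "L = (3 * real m) ^ (m - 1) * (K0 * (H / (ka * kb)))"
  have L: "0 \<le> L" using H(1) K0(1) ka(1) kb(1) by (simp add: L_def)
  have block: "negbin m (3 * a + i) * norm (T.cpair u (\<lambda>z. z ^ (3 * a + i) * (poly (h \<zeta>) z * P z ^ m) * \<phi> z) x y)
      \<le> L * \<Phi> * (SUP z\<in>T.annulus. weight a x y z)"
    if \<phi>: "\<phi> holomorphic_on polygonal E s" and \<Phi>: "\<And>z. z \<in> polygonal E s \<Longrightarrow> norm (\<phi> z) \<le> \<Phi>" and \<Phi>0: "0 \<le> \<Phi>"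
      and \<zeta>: "\<zeta> \<in> E" and i: "i < 3"
    for \<phi> \<Phi> \<zeta> a i x y
  proof -
    define W where "W = op_power T a o\<^sub>C\<^sub>L frac_product \<xi> \<alpha> T"
    define V where "V = op_power (banach_adjoint T) a o\<^sub>C\<^sub>L frac_product \<xi> \<beta> (banach_adjoint T)"
    define R where "R = real a + 1"
    define F where "F = (SUP z\<in>T.annulus. weight a x y z)"
    have R: "0 < R" by (simp add: R_def)
    define B where "B = H * \<Phi> / (ka * kb)"
    have B: "0 \<le> B" using H(1) \<Phi>0 ka(1) kb(1) by (simp add: B_def)
    \<comment> \<open>The power \<open>3 * a + i\<close> is split as \<open>a + a + (a + i)\<close>:
      two parts go to \<open>x\<close> and \<open>y\<close>, and the one kept here supplies the
      decay in \<open>a\<close>.\<close>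
    define \<psi> where "\<psi> z = z ^ (a + i) * (poly (h \<zeta>) z * (\<phi> z * G z))" for z
    have \<psi>h: "\<psi> holomorphic_on polygonal E s" unfolding \<psi>_def[abs_def] by (intro holomorphic_intros \<phi> Gh)
    have \<psi>le: "norm (\<psi> z) \<le> B * (norm z ^ a * dist_prod E z powr g)" if z: "z \<in> polygonal E s" for z
    proof -
      have n1: "norm z \<le> 1" using T.norm_polygonal[OF z] by simp
      have "norm (\<psi> z) \<le> norm z ^ a * (H * (\<Phi> * (1 / (ka * kb) * dist_prod E z powr g)))"
        unfolding \<psi>_def norm_mult norm_power
        using n1 H \<zeta> \<Phi>0 by (intro mult_mono power_decreasing \<Phi> Gle z) (auto intro!: mult_nonneg_nonneg)
      then show ?thesis by (simp add: B_def mult_ac)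
    qed
    have adm: "T.admissible \<psi>"
    proof (rule T.admissible_dist_powr_le[OF \<psi>h B g])
      fix z assume z: "z \<in> polygonal E s"
      have "norm z ^ a \<le> 1" using T.norm_polygonal[OF z] by (intro power_le_one) auto
      then have "B * (norm z ^ a * dist_prod E z powr g) \<le> B * (1 * dist_prod E z powr g)"
        using B by (intro mult_left_mono mult_right_mono) auto
      then show "norm (\<psi> z) \<le> B * dist_prod E z powr g" using \<psi>le[OF z] by simp
    qed
    have rT: "T.represents u (\<lambda>z. z ^ a * frac_weight \<alpha> z) W"
      unfolding W_def frac_weight_def
      by (intro T.represents_compose T.represents_power T.represents_z T.represents_frac_product sec_T u \<alpha>)
        (simp_all add: set_\<xi>)
    have rD: "D.represents u (\<lambda>z. z ^ a * frac_weight \<beta> z) V"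
      unfolding V_def frac_weight_def
      by (intro D.represents_compose D.represents_power D.represents_z D.represents_frac_product sec_D u \<beta>)
        (simp_all add: set_\<xi>)
    have "T.cpair u (\<lambda>z. z ^ (3 * a + i) * (poly (h \<zeta>) z * P z ^ m) * \<phi> z) x y
      = T.cpair u (\<lambda>z. (z ^ a * frac_weight \<alpha> z) * ((z ^ a * frac_weight \<beta> z) * \<psi> z)) x y"
    proof (rule T.cpair_cong[OF u])
      fix z assume z: "z \<in> polygonal E s"
      have "z ^ (3 * a + i) = z ^ a * z ^ a * z ^ (a + i)"
        by (simp add: power_add[symmetric]) (rule arg_cong[where f = "(^) z"], simp)
      moreover have "P z ^ m = frac_weight \<alpha> z * frac_weight \<beta> z * G z" using nz[OF z] by (simp add: G_def)
      ultimately show "z ^ (3 * a + i) * (poly (h \<zeta>) z * P z ^ m) * \<phi> z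
        = (z ^ a * frac_weight \<alpha> z) * ((z ^ a * frac_weight \<beta> z) * \<psi> z)"
        by (simp only: \<psi>_def mult_ac)
    qed
    also have "\<dots> = T.cpair u \<psi> (W *\<^sub>V x) (V *\<^sub>V y)" by (rule cpair_represents_both[OF rT rD adm])
    finally have eq: "T.cpair u (\<lambda>z. z ^ (3 * a + i) * (poly (h \<zeta>) z * P z ^ m) * \<phi> z) x y
      = T.cpair u \<psi> (W *\<^sub>V x) (V *\<^sub>V y)" .
    have F0: "0 \<le> F" unfolding F_def by (rule weight_SUP_nonneg)
    have le: "norm (T.cpair u \<psi> (W *\<^sub>V x) (V *\<^sub>V y)) \<le> K0 * (B * (R powr (1 - (\<alpha> + \<beta>)) * F) * (real a + 1) powr - g)"
    proof (rule K0(2)[OF \<psi>h B _ \<psi>le])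
      show "0 \<le> R powr (1 - (\<alpha> + \<beta>)) * F" using F0 by simp
      fix z assume z: "z \<in> T.annulus"
      have "R powr (1 - (\<alpha> + \<beta>)) * (R powr (\<beta> - 1/2) * R powr (\<alpha> - 1/2)) = R powr 0"
        unfolding powr_add[symmetric] by (rule arg_cong[where f = "(powr) R"]) simp
      then have one: "R powr (1 - (\<alpha> + \<beta>)) * (R powr (\<beta> - 1/2) * R powr (\<alpha> - 1/2)) = 1" using R by simp
      have "weight a x y z = (R powr (\<beta> - 1/2) * R powr (\<alpha> - 1/2)) * (dist_prod E z * norm ((V *\<^sub>V y) *\<^sub>V (resolvent z T *\<^sub>V (W *\<^sub>V x))))"
        unfolding weight_def orbit_T_def orbit_D_def W_def[symmetric] V_def[symmetric] R_def[symmetric]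
        by (simp add: cblinfun_simps mult_ac)
      then have "R powr (1 - (\<alpha> + \<beta>)) * weight a x y z
        = (R powr (1 - (\<alpha> + \<beta>)) * (R powr (\<beta> - 1/2) * R powr (\<alpha> - 1/2))) * (dist_prod E z * norm ((V *\<^sub>V y) *\<^sub>V (resolvent z T *\<^sub>V (W *\<^sub>V x))))"
        by (simp only: mult.assoc)
      then have "dist_prod E z * norm ((V *\<^sub>V y) *\<^sub>V (resolvent z T *\<^sub>V (W *\<^sub>V x))) = R powr (1 - (\<alpha> + \<beta>)) * weight a x y z"
        unfolding one by simp
      also have "\<dots> \<le> R powr (1 - (\<alpha> + \<beta>)) * F"
        unfolding F_def by (intro mult_left_mono cSUP_upper[OF z bdd_above_weight]) simp
      finally show "dist_prod E z * norm ((V *\<^sub>V y) *\<^sub>V (resolvent z T *\<^sub>V (W *\<^sub>V x))) \<le> R powr (1 - (\<alpha> + \<beta>)) * F" .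
    qed
    \<comment> \<open>The exponents are \<open>m - 1\<close> from the coefficients,
      \<open>1 - (\<alpha> + \<beta>)\<close> from removing the two orbit weights, and
      \<open>- g\<close> from the contour integral; their sum is \<open>0\<close>.\<close>
    have "R ^ (m - 1) * (R powr (1 - (\<alpha> + \<beta>)) * R powr - g) = R powr (real (m - 1) + ((1 - (\<alpha> + \<beta>)) + - g))"
      unfolding powr_add using R by (simp add: powr_realpow)
    also have "real (m - 1) + ((1 - (\<alpha> + \<beta>)) + - g) = 0" using m by (simp add: g_def of_nat_diff)
    finally have one: "R ^ (m - 1) * (R powr (1 - (\<alpha> + \<beta>)) * R powr - g) = 1" using R by simp
    have "negbin m (3 * a + i) \<le> real m ^ (m - 1) * (real (3 * a + i) + 1) ^ (m - 1)" by (rule negbin_le[OF m])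
    also have "\<dots> \<le> real m ^ (m - 1) * (3 * R) ^ (m - 1)"
      using i by (intro mult_left_mono power_mono) (auto simp: R_def)
    also have "\<dots> = (3 * real m) ^ (m - 1) * R ^ (m - 1)" by (simp add: power_mult_distrib mult_ac)
    finally have nb: "negbin m (3 * a + i) \<le> (3 * real m) ^ (m - 1) * R ^ (m - 1)" .
    have "negbin m (3 * a + i) * norm (T.cpair u \<psi> (W *\<^sub>V x) (V *\<^sub>V y))
      \<le> ((3 * real m) ^ (m - 1) * R ^ (m - 1)) * (K0 * (B * (R powr (1 - (\<alpha> + \<beta>)) * F) * R powr - g))"
      using nb le R unfolding R_def by (intro mult_mono negbin_nonneg) auto
    also have "\<dots> = (3 * real m) ^ (m - 1) * (K0 * B) * F * (R ^ (m - 1) * (R powr (1 - (\<alpha> + \<beta>)) * R powr - g))"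
      by (simp only: mult_ac)
    also have "\<dots> = L * \<Phi> * F" unfolding one by (simp add: L_def B_def mult_ac)
    finally show ?thesis unfolding eq F_def .
  qed
  define K where "K = card E * (3 * L * (2 * (CR * C * C)))"
  show thesis
  proof (rule that[OF m h])
    show "0 \<le> K" using L CR C by (simp add: K_def)
    fix \<phi> \<Phi> and x :: 'a and y :: "'a \<Rightarrow>\<^sub>C\<^sub>L complex" and n
    assume \<phi>: "\<phi> holomorphic_on polygonal E s" and \<Phi>: "\<And>z. z \<in> polygonal E s \<Longrightarrow> norm (\<phi> z) \<le> \<Phi>"
    have "0 \<in> polygonal E s" using ball_subset_polygonal[of s E] T.q by auto
    then have \<Phi>0: "0 \<le> \<Phi>" using \<Phi> norm_ge_zero order.trans by blast
    let ?J = "\<lambda>\<zeta> k. T.cpair u (\<lambda>z. z ^ k * (poly (h \<zeta>) z * P z ^ m) * \<phi> z) x y"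
    let ?F = "\<lambda>a. SUP z\<in>T.annulus. weight a x y z"
    have ex: "T.cpair u (\<lambda>z. approx_one E m h (3 * n) z * \<phi> z) x y
      = (\<Sum>\<zeta>\<in>E. \<Sum>k<3 * n. (of_real (negbin m k) * cnj \<zeta> ^ k) * ?J \<zeta> k)"
      unfolding P_def by (rule T.cpair_approx_expand(2)[OF u m \<phi> \<Phi>])
    have "norm (T.cpair u (\<lambda>z. approx_one E m h (3 * n) z * \<phi> z) x y)
      \<le> (\<Sum>\<zeta>\<in>E. \<Sum>k<3 * n. norm ((of_real (negbin m k) * cnj \<zeta> ^ k) * ?J \<zeta> k))"
      unfolding ex by (rule order.trans[OF norm_sum sum_mono[OF norm_sum]])
    also have "\<dots> = (\<Sum>\<zeta>\<in>E. \<Sum>k<3 * n. negbin m k * norm (?J \<zeta> k))"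
      by (intro sum.cong refl)
        (simp add: norm_mult norm_power T.S.norm_E abs_of_nonneg[OF negbin_nonneg])
    also have "\<dots> \<le> (\<Sum>\<zeta>\<in>E. \<Sum>a<n. 3 * (L * \<Phi> * ?F a))"
      unfolding sum_by_three
    proof (intro sum_mono)
      fix \<zeta> a assume \<zeta>: "\<zeta> \<in> E"
      show "negbin m (3 * a) * norm (?J \<zeta> (3 * a)) + negbin m (3 * a + 1) * norm (?J \<zeta> (3 * a + 1))
        + negbin m (3 * a + 2) * norm (?J \<zeta> (3 * a + 2)) \<le> 3 * (L * \<Phi> * ?F a)"
        using block[OF \<phi> \<Phi> \<Phi>0 \<zeta>, of 0 a x y] block[OF \<phi> \<Phi> \<Phi>0 \<zeta>, of 1 a x y] block[OF \<phi> \<Phi> \<Phi>0 \<zeta>, of 2 a x y]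
        unfolding add_0_right by linarith
    qed
    also have "\<dots> = card E * (3 * L * \<Phi> * (\<Sum>a<n. ?F a))"
      by (simp add: sum_distrib_left mult_ac)
    also have "\<dots> \<le> card E * (3 * L * \<Phi> * (2 * (CR * (C * norm x) * (C * norm y))))"
      using L \<Phi>0 by (intro mult_left_mono sum_weight_SUP_le) auto
    also have "\<dots> = K * \<Phi> * norm x * norm y" by (simp add: K_def mult_ac)
    finally show "norm (T.cpair u (\<lambda>z. approx_one E m h (3 * n) z * \<phi> z) x y) \<le> K * \<Phi> * norm x * norm y" .
  qed
qed

end

text \<open>The resolvent of the adjoint is the transpose of the resolvent and has no larger norm,
  so one constant serves both operators.\<close>

lemma R_type_op_calculus:
  fixes T :: "'a::complex_banach \<Rightarrow>\<^sub>C\<^sub>L 'a"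
  assumes rad: "rademacher_seq M \<epsilon>" and E: "finite E" "E \<noteq> {}" "E \<subseteq> sphere 0 1"
    and r: "0 < r" "R_type M \<epsilon> E r T" and q: "r < q" "q < s" "s < 1"
  obtains M0 where "op_calculus E q s T M0" "op_calculus E q s (banach_adjoint T) M0"
proof -
  interpret N: nested_polygonal E q s
  proof
    show "large_enough E q"
      using r(2) subset_ball[of r q "0::complex"] q unfolding R_type_def large_enough_def by fastforce
  qed (use E r q in auto)
  have sub: "closure (polygonal E r) \<subseteq> closure (polygonal E q)"
    using q by (intro closure_mono polygonal_mono) auto
  have sp: "z \<notin> op_spectrum T" if "z \<in> N.annulus" for z
    using that r(2) sub by (auto simp: R_type_def N.annulus_def)
  have "R_bounded M \<epsilon> {(\<Prod>\<zeta>\<in>E. \<zeta> - z) *\<^sub>C resolvent z T | z. z \<in> ball 0 2 - closure (polygonal E q)}"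
    using r(2) q by (auto simp: R_type_def)
  from R_bounded_imp_bounded[OF rad this] obtain B where B: "0 < B"
    "\<And>z. z \<in> ball 0 2 - closure (polygonal E q) \<Longrightarrow> norm ((\<Prod>\<zeta>\<in>E. \<zeta> - z) *\<^sub>C resolvent z T) \<le> B"
    by blast
  have le: "dist_prod E z * norm (resolvent z T) \<le> B" if "z \<in> N.annulus" for z
    using B(2)[of z] that N.norm_polygonal[of z] by (auto simp: norm_scaleC norm_prod_diff N.annulus_def)
  have le': "dist_prod E z * norm (resolvent z (banach_adjoint T)) \<le> B" if "z \<in> N.annulus" for z
  proof -
    have "dist_prod E z * norm (resolvent z (banach_adjoint T)) \<le> dist_prod E z * norm (resolvent z T)"
      unfolding resolvent_adjoint(2)[OF sp[OF that]]
      by (intro mult_left_mono norm_banach_adjoint_le dist_prod_nonneg)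
    then show ?thesis using le[OF that] by simp
  qed
  show thesis
  proof (rule that)
    show "op_calculus E q s T B" by unfold_locales (use sp le B in auto)
    show "op_calculus E q s (banach_adjoint T) B"
      by unfold_locales (use resolvent_adjoint(1)[OF sp] le' B in auto)
  qed
qed

lemma square_fun_le_imp_rad_norm_le:
  fixes S :: "'b::complex_banach \<Rightarrow>\<^sub>C\<^sub>L 'b"
  assumes "rademacher_seq M \<epsilon>" "0 \<le> C" "square_fun M \<epsilon> \<xi> S \<gamma> x \<le> ennreal (C * norm x)"
  shows "rad_norm M \<epsilon> n
    (\<lambda>k. real k powr (\<gamma> - 1/2) *\<^sub>R ((op_power S (k - 1) o\<^sub>C\<^sub>L frac_product \<xi> \<gamma> S) *\<^sub>V x)) \<le> C * norm x"
proof -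
  have "0 \<le> C * norm x" using assms(2) by simp
  from order.trans[OF rad_norm_le_square_fun[OF assms(1)] assms(3)] show ?thesis
    unfolding ennreal_le_iff[OF \<open>0 \<le> C * norm x\<close>] .
qed

theorem corollary7p3:
  fixes M :: "'w measure" and \<epsilon> :: "nat \<Rightarrow> 'w \<Rightarrow> real"
    and \<xi> :: "complex list"
    and T :: "'a::complex_banach \<Rightarrow>\<^sub>C\<^sub>L 'a"
    and r \<alpha> \<beta> C :: real
  assumes "rademacher_seq M \<epsilon>"
    and "\<xi> \<noteq> []" and "distinct \<xi>" and "set \<xi> \<subseteq> sphere 0 1"
    and "reflexive_space TYPE('a)"
    and "finite_cotype M \<epsilon> TYPE('a)"
    and "finite_cotype M \<epsilon> TYPE('a \<Rightarrow>\<^sub>C\<^sub>L complex)"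
    and "0 < r" and "r < 1"
    and "R_Ritt M \<epsilon> (set \<xi>) T"
    and "R_type M \<epsilon> (set \<xi>) r T"
    and "R_Ritt M \<epsilon> (set \<xi>) (banach_adjoint T)"
    and "\<alpha> > 0" and "\<beta> > 0" and "C > 0"
    and "\<And>x. square_fun M \<epsilon> \<xi> T \<alpha> x \<le> ennreal (C * norm x)"
    and "\<And>y. square_fun M \<epsilon> \<xi> (banach_adjoint T) \<beta> y \<le> ennreal (C * norm y)"
  shows "\<forall>s\<in>{r<..<1}. bounded_Hinf_calculus (set \<xi>) r s T"
proof
  fix s assume s: "s \<in> {r<..<1}"
  note rad = assms(1)
  define E where "E = set \<xi>"
  have E: "finite E" "E \<noteq> {}" "E \<subseteq> sphere 0 1" using assms(2,4) by (auto simp: E_def)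
  \<comment> \<open>The square function estimate is made on the contour \<open>u\<^sub>0\<close>,
    and \<open>q\<close> leaves room between \<open>r\<close> and it. Both are chosen before
    \<open>\<phi>\<close> and \<open>u\<close>, so the resulting \<open>K\<close> does not depend on
    these.\<close>
  define u\<^sub>0 where "u\<^sub>0 = (r + s) / 2"
  define q where "q = (r + u\<^sub>0) / 2"
  have "r < s" "s < 1" using s by auto
  then have u0: "r < q" "q < u\<^sub>0" "u\<^sub>0 < s" "q < s" "s < 1" unfolding q_def u\<^sub>0_def by argo+
  have RT: "R_type M \<epsilon> E r T" using assms(11) by (simp add: E_def)
  obtain M0 where M0: "op_calculus E q s T M0" "op_calculus E q s (banach_adjoint T) M0"
    by (rule R_type_op_calculus[OF rad E assms(8) RT u0(1,4,5)])
  interpret T: op_calculus E q s T M0 by (rule M0)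
  have "R_bounded M \<epsilon> {(\<Prod>\<zeta>\<in>E. \<zeta> - z) *\<^sub>C resolvent z T | z. z \<in> ball 0 2 - closure (polygonal E q)}"
    using RT u0 by (auto simp: R_type_def)
  then obtain CR where CR: "0 < CR" "\<And>n (S :: nat \<Rightarrow> 'a \<Rightarrow>\<^sub>C\<^sub>L 'a) x.
      (\<And>k. k \<in> {1..n} \<Longrightarrow> S k \<in> {(\<Prod>\<zeta>\<in>E. \<zeta> - z) *\<^sub>C resolvent z T | z. z \<in> ball 0 2 - closure (polygonal E q)})
      \<Longrightarrow> rad_norm M \<epsilon> n (\<lambda>k. S k *\<^sub>V x k) \<le> CR * rad_norm M \<epsilon> n x"
    unfolding R_bounded_def by blast
  note square = square_fun_le_imp_rad_norm_le[OF rad less_imp_le[OF assms(15)]]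
  interpret square_setup E q s T M0 M \<epsilon> \<xi> \<alpha> \<beta> C CR u\<^sub>0
  proof (intro square_setup.intro M0 square_setup_axioms.intro)
    fix \<zeta> assume "\<zeta> \<in> E"
    then show "\<exists>Ms. sectorial_bound (id_cblinfun - cnj \<zeta> *\<^sub>C T) Ms"
      "\<exists>Ms. sectorial_bound (id_cblinfun - cnj \<zeta> *\<^sub>C banach_adjoint T) Ms"
      using R_Ritt_sectorial[OF rad assms(10)] R_Ritt_sectorial[OF rad assms(12)] E by (auto simp: E_def)
  next
    fix n :: nat and z :: "nat \<Rightarrow> complex" and x' :: "nat \<Rightarrow> 'a" assume z: "\<And>k. k \<in> {1..n} \<Longrightarrow> z k \<in> T.annulus"
    show "rad_norm M \<epsilon> n (\<lambda>k. ((\<Prod>\<zeta>\<in>E. \<zeta> - z k) *\<^sub>C resolvent (z k) T) *\<^sub>V x' k) \<le> CR * rad_norm M \<epsilon> n x'"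
    proof (rule CR(2))
      fix k assume "k \<in> {1..n}"
      then have "z k \<in> ball 0 2 - closure (polygonal E q)"
        using z[of k] T.norm_polygonal[of "z k"] by (auto simp: T.annulus_def)
      then show "(\<Prod>\<zeta>\<in>E. \<zeta> - z k) *\<^sub>C resolvent (z k) T
        \<in> {(\<Prod>\<zeta>\<in>E. \<zeta> - z) *\<^sub>C resolvent z T | z. z \<in> ball 0 2 - closure (polygonal E q)}"
        by blast
    qed
  qed ((rule square[OF assms(16)] square[OF assms(17)] rad assms(3,13,14) u0(2,3) less_imp_le[OF assms(15)]
      less_imp_le[OF CR(1)] E_def[symmetric])+)
  obtain m h K where m: "1 \<le> m" and h: "(\<Sum>\<zeta>\<in>E. h \<zeta> * (\<Prod>\<eta>\<in>E - {\<zeta>}. [:1, - cnj \<eta>:] ^ m)) = 1"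
    and K: "0 \<le> K" "\<And>\<phi> \<Phi> x y n. \<phi> holomorphic_on polygonal E s \<Longrightarrow> (\<And>z. z \<in> polygonal E s \<Longrightarrow> norm (\<phi> z) \<le> \<Phi>)
      \<Longrightarrow> norm (T.cpair u\<^sub>0 (\<lambda>z. approx_one E m h (3 * n) z * \<phi> z) x y) \<le> K * \<Phi> * norm x * norm y"
    by (rule cpair_approx_bound) blast
  have "norm (fun_calc E u \<phi> T) \<le> max 1 K * sup_norm_on (polygonal E s) \<phi>"
    if \<phi>: "\<phi> \<in> H0_inf E s" and u: "u \<in> {r<..<s}" for \<phi> u
  proof -
    let ?\<Phi> = "sup_norm_on (polygonal E s) \<phi>"
    \<comment> \<open>The contour \<open>u\<close> may lie below \<open>q\<close>; the smaller inner
      parameter \<open>q'\<close> gives one annulus for both \<open>u\<close> and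
      \<open>u\<^sub>0\<close>.\<close>
    define q' where "q' = (r + min u u\<^sub>0) / 2"
    have q': "r < q'" "q' < s" "q' < u" "u < s" "q' < u\<^sub>0" using u u0 by (auto simp: q'_def)
    obtain M0' where "op_calculus E q' s T M0'"
      by (rule R_type_op_calculus[OF rad E assms(8) RT q'(1,2) u0(5)])
    then interpret O: op_calculus E q' s T M0' .
    have \<phi>h: "\<phi> holomorphic_on polygonal E s" and bd: "bounded (\<phi> ` polygonal E s)"
      using \<phi> by (auto simp: H0_inf_def)
    from bd have "bdd_above ((\<lambda>z. norm (\<phi> z)) ` polygonal E s)"
      by (auto simp: bounded_iff bdd_above_def)
    then have \<Phi>: "norm (\<phi> z) \<le> ?\<Phi>" if "z \<in> polygonal E s" for z
      unfolding sup_norm_on_def by (intro cSUP_upper that)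
    have "0 \<in> polygonal E s" using ball_subset_polygonal[of s E] T.q by auto
    then have \<Phi>0: "0 \<le> ?\<Phi>" using \<Phi> norm_ge_zero order.trans by blast
    have "norm (fun_calc E u \<phi> T) \<le> K * ?\<Phi>"
      by (rule O.norm_fun_calc_le[OF q'(3,4,5) u0(3) \<phi> m h _ _ K(2)[OF \<phi>h \<Phi>]])
        (use K(1) \<Phi>0 in auto)
    also have "\<dots> \<le> max 1 K * ?\<Phi>" using \<Phi>0 by (intro mult_right_mono) auto
    finally show ?thesis .
  qed
  then show "bounded_Hinf_calculus (set \<xi>) r s T"
    unfolding bounded_Hinf_calculus_def E_def[symmetric] by (intro exI[of _ "max 1 K"]) auto
qed

end
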